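(* Let $\pi$ be a group, $\Bbbk$ a field and $H$ a T-coalgebra over $\pi$ and $\Bbbk$. The category $\mathcal{YD}(H)$ of Yetter-Drinfeld modules over $H$ is isomorphic to the category $\mathcal{Z}(\mathrm{Rep}(H))$, the center of the T-category of representations of $H$. This isomorphism induces on $\mathcal{YD}(H)$ (by transport of the braided T-category structure of $\mathcal{Z}(\mathrm{Rep}(H))$) the following structure of braided T-category: (1) the $\alpha$-th component is $\mathcal{YD}_\alpha(H)$; (2) for $(V,\Delta_V)\in\mathcal{YD}_\alpha(H)$ and $(W,\Delta_W)\in\mathcal{YD}_\beta(H)$, the tensor product is $(V\otimes W,\Delta_{V\otimes W})$ with $V\otimes W$ the tensor product in $\mathrm{Rep}(H)$ and $\Delta_{V\otimes W,\lambda}(v\otimes w)=v_{(V)}\otimes w_{(W)}\otimes w_{(\lambda)}\varphi_{\beta^{-1}}(v_{(\beta\lambda\beta^{-1})})$ for all $\lambda\in\pi$; the unit is $\Bbbk$ with $\Delta_{\Bbbk,\lambda}(k)=k\otimes1_\lambda$; the tensor product of arrows is that of linear maps; (3) for $\beta\in\pi$, the conjugation is ${}^\beta(V,\Delta_V)=({}^\beta V,\Delta_{{}^\beta V})$ with $\Delta_{{}^\beta V,\lambda}({}^\beta v)={}^\beta(v_{(V)})\otimes\varphi_\beta(v_{(\beta^{-1}\lambda\beta)})$, and $({}^\beta f)({}^\beta v)={}^\beta(f(v))$ on morphisms; (4) for $(V,\Delta_V)\in\mathcal{YD}_\alpha(H)$ and $(W,\Delta_W)\in\mathcal{YD}_\beta(H)$,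 the braiding is $c(v\otimes w)={}^\alpha\bigl(s_{\beta^{-1}}(v_{(\beta^{-1})})w\bigr)\otimes v_{(V)}$.
   Context: Associativity and unit constraints are suppressed from the notation; an object also denotes its identity arrow. **T-categories.** A T-category over $\pi$ is a tensor category $\mathcal{T}$ that is the disjoint union of subcategories $\{\mathcal{T}_\alpha\}_{\alpha\in\pi}$ (no arrows between different components) with $U\otimes V\in\mathcal{T}_{\alpha\beta}$ for $U\in\mathcal{T}_\alpha,V\in\mathcal{T}_\beta$, together with a group homomorphism $\varphi:\pi\to\mathrm{aut}(\mathcal{T})$ (invertible strict tensor endofunctors) such that $\varphi_\beta(\mathcal{T}_\alpha)=\mathcal{T}_{\beta\alpha\beta^{-1}}$. For $V\in\mathcal{T}_\beta$ write ${}^V(\cdot)={}^\beta(\cdot)=\varphi_\beta$. A braiding is a family of isomorphisms $c_{U,V}:U\otimes V\to{}^UV\otimes U$ with $({}^\alpha g\otimes f)\circ c_{U,V}=c_{U',V'}\circ(f\otimes g)$ for $f\in\mathcal{T}_\alpha(U,U')$, $g\in\mathcal{T}(V,V')$; $c_{U\otimes V,W}=(c_{U,{}^VW}\otimes V)\circ(U\otimes c_{V,W})$; $c_{U,V\otimes W}=({}^UV\otimes c_{U,W})\circ(c_{U,V}\otimes W)$; $\varphi_\beta(c_{U,V})=c_{\varphi_\beta(U),\varphi_\beta(V)}$. **Center.** $\mathcal{Z}(\mathcal{T})$: objects are pairs $(U,\mathfrak{c})$, $U\in\mathcal{T}$, $\mathfrak{c}$ a natural isomorphism $\mathfrak{c}_X:U\otimes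 X\to{}^UX\otimes U$ with $\mathfrak{c}_{X\otimes Y}=({}^UX\otimes\mathfrak{c}_Y)\circ(\mathfrak{c}_X\otimes Y)$. Arrows $(U,\mathfrak{c})\to(V,\mathfrak{d})$ are $f\in\mathcal{T}(U,V)$ with $({}^UX\otimes f)\circ\mathfrak{c}_X=\mathfrak{d}_X\circ(f\otimes X)$ for all $X$. Tensor product: $(U,\mathfrak{c})\otimes(U',\mathfrak{c}')=(U\otimes U',\mathfrak{c}'')$, $\mathfrak{c}''_X=(\mathfrak{c}_{{}^{U'}X}\otimes U')\circ(U\otimes\mathfrak{c}'_X)$; unit $(\mathbb{I},\mathrm{Id})$; $\alpha$-th component: pairs with $U\in\mathcal{T}_\alpha$; conjugation $\varphi_\beta(U,\mathfrak{c})=(\varphi_\beta(U),X\mapsto\varphi_\beta(\mathfrak{c}_{\varphi_\beta^{-1}(X)}))$, and $\varphi_\beta$ on arrows; braiding $c_{(U,\mathfrak{c}),(U',\mathfrak{c}')}=\mathfrak{c}_{U'}$. **T-coalgebras.** A T-coalgebra $H$ consists of associative unital $\Bbbk$-algebras $H_\alpha$ ($\alpha\in\pi$, unit $1_\alpha$, multiplication $\mu_\alpha$, unit map $\eta_\alpha$), algebra morphisms $\Delta_{\alpha,\beta}:H_{\alpha\beta}\to H_\alpha\otimes H_\beta$ with $(H_\alpha\otimes\Delta_{\beta,\gamma})\Delta_{\alpha,\beta\gamma}=(\Delta_{\alpha,\beta}\otimes H_\gamma)\Delta_{\alpha\beta,\gamma}$, an algebra morphism $\varepsilon:H_1\to\Bbbk$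 with $(\varepsilon\otimes H_\alpha)\Delta_{1,\alpha}=\mathrm{Id}=(H_\alpha\otimes\varepsilon)\Delta_{\alpha,1}$, algebra isomorphisms $\varphi_\beta:H_\alpha\to H_{\beta\alpha\beta^{-1}}$ with $\varphi_\beta\varphi_\gamma=\varphi_{\beta\gamma}$, $(\varphi_\gamma\otimes\varphi_\gamma)\Delta_{\alpha,\beta}=\Delta_{\gamma\alpha\gamma^{-1},\gamma\beta\gamma^{-1}}\varphi_\gamma$, $\varepsilon\varphi_\gamma=\varepsilon$, and linear maps $s_\alpha:H_\alpha\to H_{\alpha^{-1}}$ with $\mu_\alpha(H_\alpha\otimes s_{\alpha^{-1}})\Delta_{\alpha,\alpha^{-1}}=\eta_\alpha\varepsilon=\mu_\alpha(s_{\alpha^{-1}}\otimes H_\alpha)\Delta_{\alpha^{-1},\alpha}$. Notation: $\Delta_{\alpha,\beta}(h)=h'_{(\alpha)}\otimes h''_{(\beta)}$. **Rep(H).** $\mathrm{Rep}_\alpha(H)$ is the category of left $H_\alpha$-modules; $U\otimes V$ has underlying space $U\otimes_\Bbbk V$ with $h(u\otimes v)=h'_{(\alpha)}u\otimes h''_{(\beta)}v$; unit $\Bbbk$ via $\varepsilon$; ${}^\beta U$ has the same underlying space as $U$ (elements written ${}^\beta u$) with $h\,{}^\beta u={}^\beta(\varphi_{\beta^{-1}}(h)u)$. **Yetter-Drinfeld modules.** An object of $\mathcal{YD}_\alpha(H)$ is a left $H_\alpha$-module $V$ with linear maps $\Delta_{V,\lambda}:V\to V\otimes H_\lambda$ ($\lambda\in\pi$),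 $\Delta_{V,\lambda}(v)=v_{(V)}\otimes v_{(\lambda)}$, such that $(V\otimes\Delta_{\lambda_1,\lambda_2})\Delta_{V,\lambda_1\lambda_2}=(\Delta_{V,\lambda_1}\otimes H_{\lambda_2})\Delta_{V,\lambda_2}$; $(V\otimes\varepsilon)\Delta_{V,1}=\mathrm{Id}$; and for $h\in H_{\alpha\lambda}$, $v\in V$: $h'_{(\alpha)}v_{(V)}\otimes h''_{(\lambda)}v_{(\lambda)}=(h''_{(\alpha)}v)_{(V)}\otimes(h''_{(\alpha)}v)_{(\lambda)}\varphi_{\alpha^{-1}}(h'_{(\alpha\lambda\alpha^{-1})})$. Morphisms: $H_\alpha$-linear $f:V\to W$ with $\Delta_{W,\lambda}f=(f\otimes H_\lambda)\Delta_{V,\lambda}$ for all $\lambda$. $\mathcal{YD}(H)$ is the disjoint union of the $\mathcal{YD}_\alpha(H)$, $\alpha\in\pi$. *)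

theory Defs
  imports "HOL-Algebra.Module"
begin

section \<open>Tensor products of vector spaces\<close>

text \<open>
  Vector spaces over a field \<^term>\<open>K\<close> are given by \<^term>\<open>module K V\<close>; the ring multiplication and
  unit contained in the record type of modules are irrelevant, unless the space is an algebra.

  A list of pairs \<open>[(v\<^sub>1, w\<^sub>1), \<dots>, (v\<^sub>n, w\<^sub>n)]\<close> stands for the formal sum of the symbols
  \<open>v\<^sub>i \<otimes> w\<^sub>i\<close>. The tensor product is the quotient of the formal sums by the bilinearity relations,
  and every class is represented by a fixed list chosen from it. So the elements of \<open>V \<otimes> W\<close> are
  again elements of a type, and this type depends only on the types of elements of \<open>V\<close> and \<open>W\<close>.
\<close>

inductive tensor_cong ::
    "'k ring \<Rightarrow> ('k, 'x) module \<Rightarrow> ('k, 'y) module \<Rightarrow> ('x \<times> 'y) list \<Rightarrow> ('x \<times> 'y) list \<Rightarrow> bool"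
  for K V W where
  refl: "xs \<in> lists (carrier V \<times> carrier W) \<Longrightarrow> tensor_cong K V W xs xs"
| sym: "tensor_cong K V W xs ys \<Longrightarrow> tensor_cong K V W ys xs"
| trans: "tensor_cong K V W xs ys \<Longrightarrow> tensor_cong K V W ys zs \<Longrightarrow> tensor_cong K V W xs zs"
| append: "tensor_cong K V W xs xs' \<Longrightarrow> tensor_cong K V W ys ys' \<Longrightarrow>
    tensor_cong K V W (xs @ ys) (xs' @ ys')"
| commute: "xs \<in> lists (carrier V \<times> carrier W) \<Longrightarrow> ys \<in> lists (carrier V \<times> carrier W) \<Longrightarrow>
    tensor_cong K V W (xs @ ys) (ys @ xs)"
| add_left: "v \<in> carrier V \<Longrightarrow> v' \<in> carrier V \<Longrightarrow> w \<in> carrier W \<Longrightarrow>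
    tensor_cong K V W [(v \<oplus>\<^bsub>V\<^esub> v', w)] [(v, w), (v', w)]"
| add_right: "v \<in> carrier V \<Longrightarrow> w \<in> carrier W \<Longrightarrow> w' \<in> carrier W \<Longrightarrow>
    tensor_cong K V W [(v, w \<oplus>\<^bsub>W\<^esub> w')] [(v, w), (v, w')]"
| balanced: "a \<in> carrier K \<Longrightarrow> v \<in> carrier V \<Longrightarrow> w \<in> carrier W \<Longrightarrow>
    tensor_cong K V W [(a \<odot>\<^bsub>V\<^esub> v, w)] [(v, a \<odot>\<^bsub>W\<^esub> w)]"
| zero: "w \<in> carrier W \<Longrightarrow> tensor_cong K V W [(\<zero>\<^bsub>V\<^esub>, w)] []"

definition tensor_class ::
    "'k ring \<Rightarrow> ('k, 'x) module \<Rightarrow> ('k, 'y) module \<Rightarrow> ('x \<times> 'y) list \<Rightarrow> ('x \<times> 'y) list" where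
  "tensor_class K V W xs = (SOME ys. tensor_cong K V W xs ys)"

definition pure ::
    "'k ring \<Rightarrow> ('k, 'x) module \<Rightarrow> ('k, 'y) module \<Rightarrow> 'x \<Rightarrow> 'y \<Rightarrow> ('x \<times> 'y) list" where
  "pure K V W v w = tensor_class K V W [(v, w)]"

text \<open>
  \<open>sweedler M B x\<close> is the sum of the \<open>B v w\<close> in \<^term>\<open>M\<close> for \<open>x = \<Sum> v \<otimes> w\<close>. It is the linear map
  on the tensor product induced by \<^term>\<open>B\<close>, and is used only for bilinear \<^term>\<open>B\<close>, for which it
  does not depend on the chosen representatives.
\<close>

definition sweedler :: "('k, 'z) module \<Rightarrow> ('x \<Rightarrow> 'y \<Rightarrow> 'z) \<Rightarrow> ('x \<times> 'y) list \<Rightarrow> 'z" where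
  "sweedler M B x = foldr (\<lambda>(v, w) s. B v w \<oplus>\<^bsub>M\<^esub> s) x \<zero>\<^bsub>M\<^esub>"

text \<open>The fields \<^term>\<open>mult\<close> and \<^term>\<open>one\<close> are those of the tensor product of two algebras.\<close>

definition tensor :: "'k ring \<Rightarrow> ('k, 'x) module \<Rightarrow> ('k, 'y) module \<Rightarrow> ('k, ('x \<times> 'y) list) module" where
  "tensor K V W =
    (let S = \<lparr>carrier = tensor_class K V W ` lists (carrier V \<times> carrier W),
              mult = (\<lambda>x y. undefined),
              one = pure K V W \<one>\<^bsub>V\<^esub> \<one>\<^bsub>W\<^esub>,
              zero = tensor_class K V W [],
              add = (\<lambda>x y. tensor_class K V W (x @ y)),
              smult = (\<lambda>a x. tensor_class K V W (map (\<lambda>(v, w). (a \<odot>\<^bsub>V\<^esub> v, w)) x))\<rparr>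
     in S\<lparr>mult := \<lambda>x y. sweedler S (\<lambda>v w. sweedler S (\<lambda>v' w'.
            pure K V W (v \<otimes>\<^bsub>V\<^esub> v') (w \<otimes>\<^bsub>W\<^esub> w')) y) x\<rparr>)"

definition linear_map :: "'k ring \<Rightarrow> ('k, 'x) module \<Rightarrow> ('k, 'y) module \<Rightarrow> ('x \<Rightarrow> 'y) \<Rightarrow> bool" where
  "linear_map K V W f \<longleftrightarrow>
     f \<in> carrier V \<rightarrow> carrier W \<and>
     (\<forall>v\<in>carrier V. \<forall>v'\<in>carrier V. f (v \<oplus>\<^bsub>V\<^esub> v') = f v \<oplus>\<^bsub>W\<^esub> f v') \<and>
     (\<forall>a\<in>carrier K. \<forall>v\<in>carrier V. f (a \<odot>\<^bsub>V\<^esub> v) = a \<odot>\<^bsub>W\<^esub> f v)"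

definition ground_module :: "'k ring \<Rightarrow> ('k, 'k) module" where
  "ground_module K =
    \<lparr>carrier = carrier K, mult = mult K, one = one K, zero = zero K, add = add K, smult = mult K\<rparr>"

text \<open>The library locale \<^locale>\<open>algebra\<close> covers commutative algebras only.\<close>

locale unital_algebra = module K A + A: ring A for K and A (structure) +
  assumes smult_mult_left: "\<lbrakk>a \<in> carrier K; x \<in> carrier A; y \<in> carrier A\<rbrakk> \<Longrightarrow>
      (a \<odot> x) \<otimes> y = a \<odot> (x \<otimes> y)"
    and smult_mult_right: "\<lbrakk>a \<in> carrier K; x \<in> carrier A; y \<in> carrier A\<rbrakk> \<Longrightarrow>
      x \<otimes> (a \<odot> y) = a \<odot> (x \<otimes> y)"

definition algebra_morphism ::
    "'k ring \<Rightarrow> ('k, 'x) module \<Rightarrow> ('k, 'y) module \<Rightarrow> ('x \<Rightarrow> 'y) \<Rightarrow> bool" where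
  "algebra_morphism K A B f \<longleftrightarrow> linear_map K A B f \<and> f \<in> ring_hom A B"


section \<open>Tensor categories\<close>

record ('o, 'a) category =
  Obj :: "'o set"
  Arr :: "'a set"
  Dom :: "'a \<Rightarrow> 'o"
  Cod :: "'a \<Rightarrow> 'o"
  Ident :: "'o \<Rightarrow> 'a"  (\<open>\<iota>\<index>\<close>)
  Comp :: "'a \<Rightarrow> 'a \<Rightarrow> 'a"  (infixl \<open>\<cdot>\<index>\<close> 55)

definition arrows :: "('o, 'a, 'm) category_scheme \<Rightarrow> 'o \<Rightarrow> 'o \<Rightarrow> 'a set" where
  "arrows C U V = {f \<in> Arr C. Dom C f = U \<and> Cod C f = V}"

locale category =
  fixes C (structure)
  assumes Dom_closed: "f \<in> Arr C \<Longrightarrow> Dom C f \<in> Obj C"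
    and Cod_closed: "f \<in> Arr C \<Longrightarrow> Cod C f \<in> Obj C"
    and Ident_closed: "U \<in> Obj C \<Longrightarrow> \<iota> U \<in> arrows C U U"
    and Comp_closed: "\<lbrakk>f \<in> arrows C U V; g \<in> arrows C V W\<rbrakk> \<Longrightarrow> g \<cdot> f \<in> arrows C U W"
    and Comp_Ident_right: "f \<in> arrows C U V \<Longrightarrow> f \<cdot> \<iota> U = f"
    and Comp_Ident_left: "f \<in> arrows C U V \<Longrightarrow> \<iota> V \<cdot> f = f"
    and Comp_assoc: "\<lbrakk>f \<in> arrows C U V; g \<in> arrows C V W; h \<in> arrows C W X\<rbrakk> \<Longrightarrow>
      (h \<cdot> g) \<cdot> f = h \<cdot> (g \<cdot> f)"

definition inverse_arrows :: "('o, 'a, 'm) category_scheme \<Rightarrow> 'a \<Rightarrow> 'a \<Rightarrow> bool" where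
  "inverse_arrows C f g \<longleftrightarrow>
     f \<in> Arr C \<and> g \<in> arrows C (Cod C f) (Dom C f) \<and>
     g \<cdot>\<^bsub>C\<^esub> f = \<iota>\<^bsub>C\<^esub> (Dom C f) \<and> f \<cdot>\<^bsub>C\<^esub> g = \<iota>\<^bsub>C\<^esub> (Cod C f)"

definition isos :: "('o, 'a, 'm) category_scheme \<Rightarrow> 'o \<Rightarrow> 'o \<Rightarrow> 'a set" where
  "isos C U V = {f \<in> arrows C U V. \<exists>g. inverse_arrows C f g}"

definition inv_arrow :: "('o, 'a, 'm) category_scheme \<Rightarrow> 'a \<Rightarrow> 'a" where
  "inv_arrow C f = (THE g. inverse_arrows C f g)"

definition is_functor ::
    "('o, 'a, 'm) category_scheme \<Rightarrow> ('o', 'a', 'm') category_scheme \<Rightarrow>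
     ('o \<Rightarrow> 'o') \<Rightarrow> ('a \<Rightarrow> 'a') \<Rightarrow> bool" where
  "is_functor C D Fo Fa \<longleftrightarrow>
     (\<forall>U\<in>Obj C. Fo U \<in> Obj D) \<and>
     (\<forall>U\<in>Obj C. \<forall>V\<in>Obj C. \<forall>f\<in>arrows C U V. Fa f \<in> arrows D (Fo U) (Fo V)) \<and>
     (\<forall>U\<in>Obj C. Fa (\<iota>\<^bsub>C\<^esub> U) = \<iota>\<^bsub>D\<^esub> (Fo U)) \<and>
     (\<forall>U\<in>Obj C. \<forall>V\<in>Obj C. \<forall>W\<in>Obj C. \<forall>f\<in>arrows C U V. \<forall>g\<in>arrows C V W.
        Fa (g \<cdot>\<^bsub>C\<^esub> f) = Fa g \<cdot>\<^bsub>D\<^esub> Fa f)"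

record ('o, 'a) tensor_category = "('o, 'a) category" +
  TenO :: "'o \<Rightarrow> 'o \<Rightarrow> 'o"  (infixl \<open>\<boxtimes>\<index>\<close> 60)
  TenA :: "'a \<Rightarrow> 'a \<Rightarrow> 'a"  (infixl \<open>\<star>\<index>\<close> 60)
  Unit :: "'o"  (\<open>\<I>\<index>\<close>)
  Assoc :: "'o \<Rightarrow> 'o \<Rightarrow> 'o \<Rightarrow> 'a"
  LUnit :: "'o \<Rightarrow> 'a"
  RUnit :: "'o \<Rightarrow> 'a"

locale tensor_category = category C for C (structure) +
  assumes TenO_closed: "\<lbrakk>U \<in> Obj C; V \<in> Obj C\<rbrakk> \<Longrightarrow> U \<boxtimes> V \<in> Obj C"
    and TenA_closed: "\<lbrakk>f \<in> arrows C U U'; g \<in> arrows C V V'\<rbrakk> \<Longrightarrow>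
      f \<star> g \<in> arrows C (U \<boxtimes> V) (U' \<boxtimes> V')"
    and TenA_Ident: "\<lbrakk>U \<in> Obj C; V \<in> Obj C\<rbrakk> \<Longrightarrow> \<iota> U \<star> \<iota> V = \<iota> (U \<boxtimes> V)"
    and TenA_Comp: "\<lbrakk>f \<in> arrows C U U'; f' \<in> arrows C U' U''; g \<in> arrows C V V'; g' \<in> arrows C V' V''\<rbrakk> \<Longrightarrow>
      (f' \<cdot> f) \<star> (g' \<cdot> g) = (f' \<star> g') \<cdot> (f \<star> g)"
    and Unit_closed: "\<I> \<in> Obj C"
    and Assoc_iso: "\<lbrakk>U \<in> Obj C; V \<in> Obj C; W \<in> Obj C\<rbrakk> \<Longrightarrow>
      Assoc C U V W \<in> isos C ((U \<boxtimes> V) \<boxtimes> W) (U \<boxtimes> (V \<boxtimes> W))"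
    and Assoc_natural: "\<lbrakk>f \<in> arrows C U U'; g \<in> arrows C V V'; h \<in> arrows C W W'\<rbrakk> \<Longrightarrow>
      (f \<star> (g \<star> h)) \<cdot> Assoc C U V W = Assoc C U' V' W' \<cdot> ((f \<star> g) \<star> h)"
    and LUnit_iso: "U \<in> Obj C \<Longrightarrow> LUnit C U \<in> isos C (\<I> \<boxtimes> U) U"
    and LUnit_natural: "f \<in> arrows C U V \<Longrightarrow> f \<cdot> LUnit C U = LUnit C V \<cdot> (\<iota> \<I> \<star> f)"
    and RUnit_iso: "U \<in> Obj C \<Longrightarrow> RUnit C U \<in> isos C (U \<boxtimes> \<I>) U"
    and RUnit_natural: "f \<in> arrows C U V \<Longrightarrow> f \<cdot> RUnit C U = RUnit C V \<cdot> (f \<star> \<iota> \<I>)"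
    and pentagon: "\<lbrakk>U \<in> Obj C; V \<in> Obj C; W \<in> Obj C; X \<in> Obj C\<rbrakk> \<Longrightarrow>
      Assoc C U V (W \<boxtimes> X) \<cdot> Assoc C (U \<boxtimes> V) W X =
      (\<iota> U \<star> Assoc C V W X) \<cdot> Assoc C U (V \<boxtimes> W) X \<cdot> (Assoc C U V W \<star> \<iota> X)"
    and triangle: "\<lbrakk>U \<in> Obj C; V \<in> Obj C\<rbrakk> \<Longrightarrow>
      (\<iota> U \<star> LUnit C V) \<cdot> Assoc C U \<I> V = RUnit C U \<star> \<iota> V"


section \<open>T-categories\<close>

text \<open>
  The decomposition of the category into components is given by the map \<^term>\<open>Grade\<close> that sends
  an object to the index of its component.
\<close>

record ('p, 'o, 'a) T_category = "('o, 'a) tensor_category" +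
  Grade :: "'o \<Rightarrow> 'p"
  ConjO :: "'p \<Rightarrow> 'o \<Rightarrow> 'o"
  ConjA :: "'p \<Rightarrow> 'a \<Rightarrow> 'a"

definition component :: "('p, 'o, 'a, 'm) T_category_scheme \<Rightarrow> 'p \<Rightarrow> 'o set" where
  "component T \<alpha> = {U \<in> Obj T. Grade T U = \<alpha>}"

definition conjg :: "'p monoid \<Rightarrow> 'p \<Rightarrow> 'p \<Rightarrow> 'p" where
  "conjg \<pi> \<beta> \<alpha> = \<beta> \<otimes>\<^bsub>\<pi>\<^esub> \<alpha> \<otimes>\<^bsub>\<pi>\<^esub> inv\<^bsub>\<pi>\<^esub> \<beta>"

locale T_category = P: group \<pi> + tensor_category T
  for \<pi> :: "'p monoid" and T :: "('p, 'o, 'a, 'm) T_category_scheme" (structure) +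
  assumes Grade_closed: "U \<in> Obj T \<Longrightarrow> Grade T U \<in> carrier \<pi>"
    and Grade_arrow: "f \<in> Arr T \<Longrightarrow> Grade T (Dom T f) = Grade T (Cod T f)"
    and Grade_TenO: "\<lbrakk>U \<in> Obj T; V \<in> Obj T\<rbrakk> \<Longrightarrow> Grade T (U \<boxtimes> V) = Grade T U \<otimes>\<^bsub>\<pi>\<^esub> Grade T V"
    and Conj_functor: "\<beta> \<in> carrier \<pi> \<Longrightarrow> is_functor T T (ConjO T \<beta>) (ConjA T \<beta>)"
    and Conj_TenO: "\<lbrakk>\<beta> \<in> carrier \<pi>; U \<in> Obj T; V \<in> Obj T\<rbrakk> \<Longrightarrow>
      ConjO T \<beta> (U \<boxtimes> V) = ConjO T \<beta> U \<boxtimes> ConjO T \<beta> V"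
    and Conj_TenA: "\<lbrakk>\<beta> \<in> carrier \<pi>; f \<in> Arr T; g \<in> Arr T\<rbrakk> \<Longrightarrow>
      ConjA T \<beta> (f \<star> g) = ConjA T \<beta> f \<star> ConjA T \<beta> g"
    and Conj_Unit: "\<beta> \<in> carrier \<pi> \<Longrightarrow> ConjO T \<beta> \<I> = \<I>"
    and Conj_Assoc: "\<lbrakk>\<beta> \<in> carrier \<pi>; U \<in> Obj T; V \<in> Obj T; W \<in> Obj T\<rbrakk> \<Longrightarrow>
      ConjA T \<beta> (Assoc T U V W) = Assoc T (ConjO T \<beta> U) (ConjO T \<beta> V) (ConjO T \<beta> W)"
    and Conj_LUnit: "\<lbrakk>\<beta> \<in> carrier \<pi>; U \<in> Obj T\<rbrakk> \<Longrightarrow> ConjA T \<beta> (LUnit T U) = LUnit T (ConjO T \<beta> U)"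
    and Conj_RUnit: "\<lbrakk>\<beta> \<in> carrier \<pi>; U \<in> Obj T\<rbrakk> \<Longrightarrow> ConjA T \<beta> (RUnit T U) = RUnit T (ConjO T \<beta> U)"
    and ConjO_one: "U \<in> Obj T \<Longrightarrow> ConjO T \<one>\<^bsub>\<pi>\<^esub> U = U"
    and ConjA_one: "f \<in> Arr T \<Longrightarrow> ConjA T \<one>\<^bsub>\<pi>\<^esub> f = f"
    and ConjO_mult: "\<lbrakk>\<beta> \<in> carrier \<pi>; \<gamma> \<in> carrier \<pi>; U \<in> Obj T\<rbrakk> \<Longrightarrow>
      ConjO T (\<beta> \<otimes>\<^bsub>\<pi>\<^esub> \<gamma>) U = ConjO T \<beta> (ConjO T \<gamma> U)"
    and ConjA_mult: "\<lbrakk>\<beta> \<in> carrier \<pi>; \<gamma> \<in> carrier \<pi>; f \<in> Arr T\<rbrakk> \<Longrightarrow>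
      ConjA T (\<beta> \<otimes>\<^bsub>\<pi>\<^esub> \<gamma>) f = ConjA T \<beta> (ConjA T \<gamma> f)"
    and Conj_component: "\<lbrakk>\<beta> \<in> carrier \<pi>; \<alpha> \<in> carrier \<pi>\<rbrakk> \<Longrightarrow>
      ConjO T \<beta> ` component T \<alpha> = component T (conjg \<pi> \<beta> \<alpha>)"

text \<open>For \<open>V\<close> in the component of index \<open>\<beta>\<close>, these are the functor \<open>X \<mapsto> \<^sup>VX = \<phi>\<^sub>\<beta>(X)\<close>.\<close>

definition actO :: "('p, 'o, 'a, 'm) T_category_scheme \<Rightarrow> 'o \<Rightarrow> 'o \<Rightarrow> 'o" where
  "actO T V X = ConjO T (Grade T V) X"

definition actA :: "('p, 'o, 'a, 'm) T_category_scheme \<Rightarrow> 'o \<Rightarrow> 'a \<Rightarrow> 'a" where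
  "actA T V f = ConjA T (Grade T V) f"

record ('p, 'o, 'a) braided_T_category = "('p, 'o, 'a) T_category" +
  Braid :: "'o \<Rightarrow> 'o \<Rightarrow> 'a"

locale braided_T_category = T_category \<pi> T
  for \<pi> :: "'p monoid" and T :: "('p, 'o, 'a, 'm) braided_T_category_scheme" (structure) +
  assumes Braid_iso: "\<lbrakk>U \<in> Obj T; V \<in> Obj T\<rbrakk> \<Longrightarrow>
      Braid T U V \<in> isos T (U \<boxtimes> V) (actO T U V \<boxtimes> U)"
    and Braid_natural: "\<lbrakk>f \<in> arrows T U U'; g \<in> arrows T V V'\<rbrakk> \<Longrightarrow>
      (actA T U g \<star> f) \<cdot> Braid T U V = Braid T U' V' \<cdot> (f \<star> g)"
    and Braid_TenO_left: "\<lbrakk>U \<in> Obj T; V \<in> Obj T; W \<in> Obj T\<rbrakk> \<Longrightarrow>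
      Braid T (U \<boxtimes> V) W =
        Assoc T (actO T U (actO T V W)) U V
        \<cdot> (Braid T U (actO T V W) \<star> \<iota> V)
        \<cdot> inv_arrow T (Assoc T U (actO T V W) V)
        \<cdot> (\<iota> U \<star> Braid T V W)
        \<cdot> Assoc T U V W"
    and Braid_TenO_right: "\<lbrakk>U \<in> Obj T; V \<in> Obj T; W \<in> Obj T\<rbrakk> \<Longrightarrow>
      Braid T U (V \<boxtimes> W) =
        inv_arrow T (Assoc T (actO T U V) (actO T U W) U)
        \<cdot> (\<iota> (actO T U V) \<star> Braid T U W)
        \<cdot> Assoc T (actO T U V) U W
        \<cdot> (Braid T U V \<star> \<iota> W)
        \<cdot> inv_arrow T (Assoc T U V W)"
    and Conj_Braid: "\<lbrakk>\<beta> \<in> carrier \<pi>; U \<in> Obj T; V \<in> Obj T\<rbrakk> \<Longrightarrow>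
      ConjA T \<beta> (Braid T U V) = Braid T (ConjO T \<beta> U) (ConjO T \<beta> V)"

definition category_isomorphism ::
    "('o, 'a, 'm) category_scheme \<Rightarrow> ('o', 'a', 'm') category_scheme \<Rightarrow>
     ('o \<Rightarrow> 'o') \<Rightarrow> ('a \<Rightarrow> 'a') \<Rightarrow> bool" where
  "category_isomorphism C D Fo Fa \<longleftrightarrow>
     is_functor C D Fo Fa \<and> bij_betw Fo (Obj C) (Obj D) \<and> bij_betw Fa (Arr C) (Arr D)"

text \<open>
  Given an isomorphism of categories \<open>(Fo, Fa)\<close> from \<open>C\<close> to \<open>D\<close>, the following says that the
  structure of braided T-category on \<open>C\<close> is the one obtained by transport of that on \<open>D\<close>. As
  \<open>Fo\<close> and \<open>Fa\<close> are injective, the equations determine the structure on \<open>C\<close>.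
\<close>

definition transported_structure ::
    "'p monoid \<Rightarrow> ('p, 'o, 'a, 'm) braided_T_category_scheme \<Rightarrow>
     ('p, 'o', 'a', 'm') braided_T_category_scheme \<Rightarrow> ('o \<Rightarrow> 'o') \<Rightarrow> ('a \<Rightarrow> 'a') \<Rightarrow> bool" where
  "transported_structure \<pi> C D Fo Fa \<longleftrightarrow>
     (\<forall>\<alpha>\<in>carrier \<pi>. \<forall>U\<in>Obj C. U \<in> component C \<alpha> \<longleftrightarrow> Fo U \<in> component D \<alpha>) \<and>
     (\<forall>U\<in>Obj C. \<forall>V\<in>Obj C. U \<boxtimes>\<^bsub>C\<^esub> V \<in> Obj C \<and> Fo (U \<boxtimes>\<^bsub>C\<^esub> V) = Fo U \<boxtimes>\<^bsub>D\<^esub> Fo V) \<and>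
     (\<forall>f\<in>Arr C. \<forall>g\<in>Arr C. f \<star>\<^bsub>C\<^esub> g \<in> Arr C \<and> Fa (f \<star>\<^bsub>C\<^esub> g) = Fa f \<star>\<^bsub>D\<^esub> Fa g) \<and>
     \<I>\<^bsub>C\<^esub> \<in> Obj C \<and> Fo \<I>\<^bsub>C\<^esub> = \<I>\<^bsub>D\<^esub> \<and>
     (\<forall>U\<in>Obj C. \<forall>V\<in>Obj C. \<forall>W\<in>Obj C.
        Assoc C U V W \<in> Arr C \<and> Fa (Assoc C U V W) = Assoc D (Fo U) (Fo V) (Fo W)) \<and>
     (\<forall>U\<in>Obj C. LUnit C U \<in> Arr C \<and> Fa (LUnit C U) = LUnit D (Fo U)) \<and>
     (\<forall>U\<in>Obj C. RUnit C U \<in> Arr C \<and> Fa (RUnit C U) = RUnit D (Fo U)) \<and>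
     (\<forall>\<beta>\<in>carrier \<pi>. \<forall>U\<in>Obj C.
        ConjO C \<beta> U \<in> Obj C \<and> Fo (ConjO C \<beta> U) = ConjO D \<beta> (Fo U)) \<and>
     (\<forall>\<beta>\<in>carrier \<pi>. \<forall>f\<in>Arr C.
        ConjA C \<beta> f \<in> Arr C \<and> Fa (ConjA C \<beta> f) = ConjA D \<beta> (Fa f)) \<and>
     (\<forall>U\<in>Obj C. \<forall>V\<in>Obj C.
        Braid C U V \<in> Arr C \<and> Fa (Braid C U V) = Braid D (Fo U) (Fo V))"


section \<open>The center of a T-category\<close>

datatype ('o, 'm) arrow = Arrow (source: 'o) (target: 'o) (body: 'm)

context T_category
begin

text \<open>
  Half braidings are families indexed by the objects, so they are required to take the value
  \<^term>\<open>undefined\<close> elsewhere; otherwise equality of objects of the center would be too fine.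
\<close>

definition half_braiding :: "'o \<Rightarrow> ('o \<Rightarrow> 'a) \<Rightarrow> bool" where
  "half_braiding U c \<longleftrightarrow>
     c \<in> extensional (Obj T) \<and>
     (\<forall>X\<in>Obj T. c X \<in> isos T (U \<boxtimes> X) (actO T U X \<boxtimes> U)) \<and>
     (\<forall>X\<in>Obj T. \<forall>Y\<in>Obj T. \<forall>f\<in>arrows T X Y.
        (actA T U f \<star> \<iota> U) \<cdot> c X = c Y \<cdot> (\<iota> U \<star> f)) \<and>
     (\<forall>X\<in>Obj T. \<forall>Y\<in>Obj T.
        c (X \<boxtimes> Y) =
          inv_arrow T (Assoc T (actO T U X) (actO T U Y) U)
          \<cdot> (\<iota> (actO T U X) \<star> c Y)
          \<cdot> Assoc T (actO T U X) U Y
          \<cdot> (c X \<star> \<iota> Y)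
          \<cdot> inv_arrow T (Assoc T U X Y))"

definition center_obj :: "('o \<times> ('o \<Rightarrow> 'a)) set" where
  "center_obj = {(U, c). U \<in> Obj T \<and> half_braiding U c}"

definition center_arr :: "('o \<times> ('o \<Rightarrow> 'a), 'a) arrow set" where
  "center_arr = {Arrow (U, c) (V, d) f | U c V d f.
     (U, c) \<in> center_obj \<and> (V, d) \<in> center_obj \<and> f \<in> arrows T U V \<and>
     (\<forall>X\<in>Obj T. (\<iota> (actO T U X) \<star> f) \<cdot> c X = d X \<cdot> (f \<star> \<iota> X))}"

definition center_TenO :: "'o \<times> ('o \<Rightarrow> 'a) \<Rightarrow> 'o \<times> ('o \<Rightarrow> 'a) \<Rightarrow> 'o \<times> ('o \<Rightarrow> 'a)" where
  "center_TenO = (\<lambda>(U, c) (U', c').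
     (U \<boxtimes> U',
      \<lambda>X\<in>Obj T. Assoc T (actO T U (actO T U' X)) U U'
        \<cdot> (c (actO T U' X) \<star> \<iota> U')
        \<cdot> inv_arrow T (Assoc T U (actO T U' X) U')
        \<cdot> (\<iota> U \<star> c' X)
        \<cdot> Assoc T U U' X))"

text \<open>The half braiding of the unit is the identity only up to the unit constraints.\<close>

definition center_Unit :: "'o \<times> ('o \<Rightarrow> 'a)" where
  "center_Unit = (\<I>, \<lambda>X\<in>Obj T. inv_arrow T (RUnit T X) \<cdot> LUnit T X)"

definition center_ConjO :: "'p \<Rightarrow> 'o \<times> ('o \<Rightarrow> 'a) \<Rightarrow> 'o \<times> ('o \<Rightarrow> 'a)" where
  "center_ConjO \<beta> = (\<lambda>(U, c).
     (ConjO T \<beta> U, \<lambda>X\<in>Obj T. ConjA T \<beta> (c (ConjO T (inv\<^bsub>\<pi>\<^esub> \<beta>) X))))"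

definition center ::
    "('p, 'o \<times> ('o \<Rightarrow> 'a), ('o \<times> ('o \<Rightarrow> 'a), 'a) arrow) braided_T_category" where
  "center =
    \<lparr>Obj = center_obj,
     Arr = center_arr,
     Dom = source,
     Cod = target,
     Ident = (\<lambda>Z. Arrow Z Z (\<iota> (fst Z))),
     Comp = (\<lambda>g f. Arrow (source f) (target g) (body g \<cdot> body f)),
     TenO = center_TenO,
     TenA = (\<lambda>f g. Arrow (center_TenO (source f) (source g)) (center_TenO (target f) (target g))
               (body f \<star> body g)),
     Unit = center_Unit,
     Assoc = (\<lambda>Z Z' Z''. Arrow (center_TenO (center_TenO Z Z') Z'') (center_TenO Z (center_TenO Z' Z''))
               (Assoc T (fst Z) (fst Z') (fst Z''))),
     LUnit = (\<lambda>Z. Arrow (center_TenO center_Unit Z) Z (LUnit T (fst Z))),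
     RUnit = (\<lambda>Z. Arrow (center_TenO Z center_Unit) Z (RUnit T (fst Z))),
     Grade = (\<lambda>Z. Grade T (fst Z)),
     ConjO = center_ConjO,
     ConjA = (\<lambda>\<beta> f. Arrow (center_ConjO \<beta> (source f)) (center_ConjO \<beta> (target f))
               (ConjA T \<beta> (body f))),
     Braid = (\<lambda>Z Z'. Arrow (center_TenO Z Z')
               (center_TenO (center_ConjO (Grade T (fst Z)) Z') Z)
               (snd Z (fst Z')))\<rparr>"

end


section \<open>T-coalgebras\<close>

text \<open>
  \<open>twist H \<beta> \<alpha>\<close> is the map \<open>\<phi>\<^sub>\<beta>\<close> on the algebra with index \<open>\<alpha>\<close>. The carriers of the algebras
  need not be disjoint, so \<open>\<alpha>\<close> has to be given.
\<close>

record ('p, 'k, 'h) T_coalgebra =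
  alg :: "'p \<Rightarrow> ('k, 'h) module"
  comult :: "'p \<Rightarrow> 'p \<Rightarrow> 'h \<Rightarrow> ('h \<times> 'h) list"
  counit :: "'h \<Rightarrow> 'k"
  twist :: "'p \<Rightarrow> 'p \<Rightarrow> 'h \<Rightarrow> 'h"
  antipode :: "'p \<Rightarrow> 'h \<Rightarrow> 'h"

locale T_coalgebra = P: group \<pi> + K: field K
  for \<pi> :: "'p monoid" (structure) and K :: "'k ring" and H :: "('p, 'k, 'h) T_coalgebra" +
  assumes alg: "\<alpha> \<in> carrier \<pi> \<Longrightarrow> unital_algebra K (alg H \<alpha>)"
    and comult: "\<lbrakk>\<alpha> \<in> carrier \<pi>; \<beta> \<in> carrier \<pi>\<rbrakk> \<Longrightarrow>
      algebra_morphism K (alg H (\<alpha> \<otimes> \<beta>)) (tensor K (alg H \<alpha>) (alg H \<beta>)) (comult H \<alpha> \<beta>)"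
    and coassoc: "\<lbrakk>\<alpha> \<in> carrier \<pi>; \<beta> \<in> carrier \<pi>; \<gamma> \<in> carrier \<pi>; h \<in> carrier (alg H (\<alpha> \<otimes> \<beta> \<otimes> \<gamma>))\<rbrakk> \<Longrightarrow>
      (let H\<beta>\<gamma> = tensor K (alg H \<beta>) (alg H \<gamma>); T = tensor K (alg H \<alpha>) H\<beta>\<gamma> in
        sweedler T (\<lambda>x y. pure K (alg H \<alpha>) H\<beta>\<gamma> x (comult H \<beta> \<gamma> y)) (comult H \<alpha> (\<beta> \<otimes> \<gamma>) h) =
        sweedler T (\<lambda>u z. sweedler T (\<lambda>x y.
            pure K (alg H \<alpha>) H\<beta>\<gamma> x (pure K (alg H \<beta>) (alg H \<gamma>) y z)) (comult H \<alpha> \<beta> u))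
          (comult H (\<alpha> \<otimes> \<beta>) \<gamma> h))"
    and counit: "algebra_morphism K (alg H \<one>) (ground_module K) (counit H)"
    and counit_left: "\<lbrakk>\<alpha> \<in> carrier \<pi>; h \<in> carrier (alg H \<alpha>)\<rbrakk> \<Longrightarrow>
      sweedler (alg H \<alpha>) (\<lambda>x y. counit H x \<odot>\<^bsub>alg H \<alpha>\<^esub> y) (comult H \<one> \<alpha> h) = h"
    and counit_right: "\<lbrakk>\<alpha> \<in> carrier \<pi>; h \<in> carrier (alg H \<alpha>)\<rbrakk> \<Longrightarrow>
      sweedler (alg H \<alpha>) (\<lambda>x y. counit H y \<odot>\<^bsub>alg H \<alpha>\<^esub> x) (comult H \<alpha> \<one> h) = h"
    and twist: "\<lbrakk>\<alpha> \<in> carrier \<pi>; \<beta> \<in> carrier \<pi>\<rbrakk> \<Longrightarrow>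
      algebra_morphism K (alg H \<alpha>) (alg H (conjg \<pi> \<beta> \<alpha>)) (twist H \<beta> \<alpha>)"
    and twist_bij: "\<lbrakk>\<alpha> \<in> carrier \<pi>; \<beta> \<in> carrier \<pi>\<rbrakk> \<Longrightarrow>
      bij_betw (twist H \<beta> \<alpha>) (carrier (alg H \<alpha>)) (carrier (alg H (conjg \<pi> \<beta> \<alpha>)))"
    and twist_mult: "\<lbrakk>\<alpha> \<in> carrier \<pi>; \<beta> \<in> carrier \<pi>; \<gamma> \<in> carrier \<pi>; h \<in> carrier (alg H \<alpha>)\<rbrakk> \<Longrightarrow>
      twist H \<beta> (conjg \<pi> \<gamma> \<alpha>) (twist H \<gamma> \<alpha> h) = twist H (\<beta> \<otimes> \<gamma>) \<alpha> h"
    and twist_comult: "\<lbrakk>\<alpha> \<in> carrier \<pi>; \<beta> \<in> carrier \<pi>; \<gamma> \<in> carrier \<pi>; h \<in> carrier (alg H (\<alpha> \<otimes> \<beta>))\<rbrakk> \<Longrightarrow>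
      (let H\<alpha> = alg H (conjg \<pi> \<gamma> \<alpha>); H\<beta> = alg H (conjg \<pi> \<gamma> \<beta>) in
        sweedler (tensor K H\<alpha> H\<beta>) (\<lambda>x y. pure K H\<alpha> H\<beta> (twist H \<gamma> \<alpha> x) (twist H \<gamma> \<beta> y)) (comult H \<alpha> \<beta> h) =
        comult H (conjg \<pi> \<gamma> \<alpha>) (conjg \<pi> \<gamma> \<beta>) (twist H \<gamma> (\<alpha> \<otimes> \<beta>) h))"
    and twist_counit: "\<lbrakk>\<gamma> \<in> carrier \<pi>; h \<in> carrier (alg H \<one>)\<rbrakk> \<Longrightarrow> counit H (twist H \<gamma> \<one> h) = counit H h"
    and antipode: "\<alpha> \<in> carrier \<pi> \<Longrightarrow> linear_map K (alg H \<alpha>) (alg H (inv \<alpha>)) (antipode H \<alpha>)"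
    and antipode_right: "\<lbrakk>\<alpha> \<in> carrier \<pi>; h \<in> carrier (alg H \<one>)\<rbrakk> \<Longrightarrow>
      sweedler (alg H \<alpha>) (\<lambda>x y. x \<otimes>\<^bsub>alg H \<alpha>\<^esub> antipode H (inv \<alpha>) y) (comult H \<alpha> (inv \<alpha>) h) =
      counit H h \<odot>\<^bsub>alg H \<alpha>\<^esub> \<one>\<^bsub>alg H \<alpha>\<^esub>"
    and antipode_left: "\<lbrakk>\<alpha> \<in> carrier \<pi>; h \<in> carrier (alg H \<one>)\<rbrakk> \<Longrightarrow>
      sweedler (alg H \<alpha>) (\<lambda>x y. antipode H (inv \<alpha>) x \<otimes>\<^bsub>alg H \<alpha>\<^esub> y) (comult H (inv \<alpha>) \<alpha> h) =
      counit H h \<odot>\<^bsub>alg H \<alpha>\<^esub> \<one>\<^bsub>alg H \<alpha>\<^esub>"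


section \<open>Representations\<close>

text \<open>
  The modules of the category of representations have their elements in the following type. It
  plays the role of a universe: it contains the ground field, the algebras of the T-coalgebra and
  an arbitrary type \<^typ>\<open>'b\<close>, and is closed under tensor products via the constructor \<open>Tens\<close>.
\<close>

datatype ('k, 'h, 'b) univ =
    Scal (unScal: 'k)
  | Coef 'h
  | Atom 'b
  | Tens (unTens: "(('k, 'h, 'b) univ \<times> ('k, 'h, 'b) univ) list")

text \<open>Transport of the structure of a module along an injection \<^term>\<open>i\<close>.\<close>

definition copy_module :: "('x \<Rightarrow> 'y) \<Rightarrow> ('k, 'x) module \<Rightarrow> ('k, 'y) module" where
  "copy_module i M =
    \<lparr>carrier = i ` carrier M,
     mult = (\<lambda>x y. i (inv_into UNIV i x \<otimes>\<^bsub>M\<^esub> inv_into UNIV i y)),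
     one = i \<one>\<^bsub>M\<^esub>,
     zero = i \<zero>\<^bsub>M\<^esub>,
     add = (\<lambda>x y. i (inv_into UNIV i x \<oplus>\<^bsub>M\<^esub> inv_into UNIV i y)),
     smult = (\<lambda>a x. i (a \<odot>\<^bsub>M\<^esub> inv_into UNIV i x))\<rparr>"

text \<open>\<open>tensor\<^sub>u\<close>, \<open>pure\<^sub>u\<close> and \<open>sweedler\<^sub>u\<close> are the notions for tensor products formed in the universe.\<close>

type_synonym ('k, 'h, 'b) uspace = "('k, ('k, 'h, 'b) univ) module"

definition tensor\<^sub>u :: "'k ring \<Rightarrow> ('k, 'h, 'b) uspace \<Rightarrow> ('k, 'h, 'b) uspace \<Rightarrow> ('k, 'h, 'b) uspace" where
  "tensor\<^sub>u K V W = copy_module Tens (tensor K V W)"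

definition pure\<^sub>u :: "'k ring \<Rightarrow> ('k, 'h, 'b) uspace \<Rightarrow> ('k, 'h, 'b) uspace \<Rightarrow>
    ('k, 'h, 'b) univ \<Rightarrow> ('k, 'h, 'b) univ \<Rightarrow> ('k, 'h, 'b) univ" where
  "pure\<^sub>u K V W v w = Tens (pure K V W v w)"

definition sweedler\<^sub>u :: "('k, 'z) module \<Rightarrow> (('k, 'h, 'b) univ \<Rightarrow> ('k, 'h, 'b) univ \<Rightarrow> 'z) \<Rightarrow>
    ('k, 'h, 'b) univ \<Rightarrow> 'z" where
  "sweedler\<^sub>u M B x = sweedler M B (unTens x)"

record ('p, 'k, 'h, 'u) representation =
  deg :: 'p
  space :: "('k, 'u) module"
  act :: "'h \<Rightarrow> 'u \<Rightarrow> 'u"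

type_synonym ('p, 'k, 'h, 'b) rep = "('p, 'k, 'h, ('k, 'h, 'b) univ) representation"

type_synonym ('p, 'k, 'h, 'b) rep_arrow =
  "(('p, 'k, 'h, 'b) rep, ('k, 'h, 'b) univ \<Rightarrow> ('k, 'h, 'b) univ) arrow"

text \<open>
  As for half braidings, actions, coactions and morphisms are extensional functions, so that
  equality is equality on the relevant carriers.
\<close>

context T_coalgebra
begin

definition is_rep :: "('p, 'k, 'h, 'b) rep \<Rightarrow> bool" where
  "is_rep U \<longleftrightarrow>
     deg U \<in> carrier \<pi> \<and>
     module K (space U) \<and>
     act U \<in> extensional (carrier (alg H (deg U))) \<and>
     (\<forall>h\<in>carrier (alg H (deg U)).
        act U h \<in> extensional (carrier (space U)) \<and> linear_map K (space U) (space U) (act U h)) \<and>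
     (\<forall>u\<in>carrier (space U).
        act U \<one>\<^bsub>alg H (deg U)\<^esub> u = u \<and>
        (\<forall>h\<in>carrier (alg H (deg U)). \<forall>h'\<in>carrier (alg H (deg U)).
           act U (h \<oplus>\<^bsub>alg H (deg U)\<^esub> h') u = act U h u \<oplus>\<^bsub>space U\<^esub> act U h' u \<and>
           act U (h \<otimes>\<^bsub>alg H (deg U)\<^esub> h') u = act U h (act U h' u)) \<and>
        (\<forall>a\<in>carrier K. \<forall>h\<in>carrier (alg H (deg U)).
           act U (a \<odot>\<^bsub>alg H (deg U)\<^esub> h) u = a \<odot>\<^bsub>space U\<^esub> act U h u))"

definition is_rep_map ::
    "('p, 'k, 'h, 'b) rep \<Rightarrow> ('p, 'k, 'h, 'b) rep \<Rightarrow> (('k, 'h, 'b) univ \<Rightarrow> ('k, 'h, 'b) univ) \<Rightarrow> bool" where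
  "is_rep_map U V f \<longleftrightarrow>
     deg U = deg V \<and>
     f \<in> extensional (carrier (space U)) \<and>
     linear_map K (space U) (space V) f \<and>
     (\<forall>h\<in>carrier (alg H (deg U)). \<forall>u\<in>carrier (space U). f (act U h u) = act V h (f u))"

definition rep_tensor :: "('p, 'k, 'h, 'b) rep \<Rightarrow> ('p, 'k, 'h, 'b) rep \<Rightarrow> ('p, 'k, 'h, 'b) rep" where
  "rep_tensor U V =
    (let S = tensor\<^sub>u K (space U) (space V) in
     \<lparr>deg = deg U \<otimes> deg V,
      space = S,
      act = (\<lambda>h\<in>carrier (alg H (deg U \<otimes> deg V)). \<lambda>x\<in>carrier S.
               sweedler S (\<lambda>h' h''. sweedler\<^sub>u S (\<lambda>u v.
                   pure\<^sub>u K (space U) (space V) (act U h' u) (act V h'' v)) x)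
                 (comult H (deg U) (deg V) h))\<rparr>)"

definition map_tensor :: "('k, 'h, 'b) uspace \<Rightarrow> ('k, 'h, 'b) uspace \<Rightarrow>
    ('k, 'h, 'b) uspace \<Rightarrow> ('k, 'h, 'b) uspace \<Rightarrow>
    (('k, 'h, 'b) univ \<Rightarrow> ('k, 'h, 'b) univ) \<Rightarrow> (('k, 'h, 'b) univ \<Rightarrow> ('k, 'h, 'b) univ) \<Rightarrow>
    ('k, 'h, 'b) univ \<Rightarrow> ('k, 'h, 'b) univ" where
  "map_tensor U V U' V' f g =
    (\<lambda>x\<in>carrier (tensor\<^sub>u K U V).
       sweedler\<^sub>u (tensor\<^sub>u K U' V') (\<lambda>u v. pure\<^sub>u K U' V' (f u) (g v)) x)"

definition rep_unit :: "('p, 'k, 'h, 'b) rep" where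
  "rep_unit =
    \<lparr>deg = \<one>,
     space = copy_module Scal (ground_module K),
     act = (\<lambda>h\<in>carrier (alg H \<one>). \<lambda>x\<in>Scal ` carrier K. Scal (counit H h \<otimes>\<^bsub>K\<^esub> unScal x))\<rparr>"

definition assoc_map :: "('k, 'h, 'b) uspace \<Rightarrow> ('k, 'h, 'b) uspace \<Rightarrow> ('k, 'h, 'b) uspace \<Rightarrow>
    ('k, 'h, 'b) univ \<Rightarrow> ('k, 'h, 'b) univ" where
  "assoc_map U V W =
    (let VW = tensor\<^sub>u K V W; S = tensor\<^sub>u K U VW in
     (\<lambda>x\<in>carrier (tensor\<^sub>u K (tensor\<^sub>u K U V) W).
       sweedler\<^sub>u S (\<lambda>y w. sweedler\<^sub>u S (\<lambda>u v. pure\<^sub>u K U VW u (pure\<^sub>u K V W v w)) y) x))"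

definition lunit_map :: "('k, 'h, 'b) uspace \<Rightarrow> ('k, 'h, 'b) univ \<Rightarrow> ('k, 'h, 'b) univ" where
  "lunit_map U =
    (\<lambda>x\<in>carrier (tensor\<^sub>u K (copy_module Scal (ground_module K)) U).
       sweedler\<^sub>u U (\<lambda>a u. unScal a \<odot>\<^bsub>U\<^esub> u) x)"

definition runit_map :: "('k, 'h, 'b) uspace \<Rightarrow> ('k, 'h, 'b) univ \<Rightarrow> ('k, 'h, 'b) univ" where
  "runit_map U =
    (\<lambda>x\<in>carrier (tensor\<^sub>u K U (copy_module Scal (ground_module K))).
       sweedler\<^sub>u U (\<lambda>u a. unScal a \<odot>\<^bsub>U\<^esub> u) x)"

text \<open>\<open>\<^sup>\<beta>U\<close> has the same underlying space as \<open>U\<close>, that is, \<open>\<^sup>\<beta>u\<close> is represented by \<open>u\<close> itself.\<close>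

definition rep_conj :: "'p \<Rightarrow> ('p, 'k, 'h, 'b) rep \<Rightarrow> ('p, 'k, 'h, 'b) rep" where
  "rep_conj \<beta> U =
    \<lparr>deg = conjg \<pi> \<beta> (deg U),
     space = space U,
     act = (\<lambda>h\<in>carrier (alg H (conjg \<pi> \<beta> (deg U))).
              act U (twist H (inv \<beta>) (conjg \<pi> \<beta> (deg U)) h))\<rparr>"

definition Rep :: "('p, ('p, 'k, 'h, 'b) rep, ('p, 'k, 'h, 'b) rep_arrow) T_category" where
  "Rep =
    \<lparr>Obj = {U. is_rep U},
     Arr = {Arrow U V f | U V f. is_rep U \<and> is_rep V \<and> is_rep_map U V f},
     Dom = source,
     Cod = target,
     Ident = (\<lambda>U. Arrow U U (\<lambda>u\<in>carrier (space U). u)),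
     Comp = (\<lambda>g f. Arrow (source f) (target g)
               (compose (carrier (space (source f))) (body g) (body f))),
     TenO = rep_tensor,
     TenA = (\<lambda>f g. Arrow (rep_tensor (source f) (source g)) (rep_tensor (target f) (target g))
               (map_tensor (space (source f)) (space (source g)) (space (target f)) (space (target g))
                  (body f) (body g))),
     Unit = rep_unit,
     Assoc = (\<lambda>U V W. Arrow (rep_tensor (rep_tensor U V) W) (rep_tensor U (rep_tensor V W))
               (assoc_map (space U) (space V) (space W))),
     LUnit = (\<lambda>U. Arrow (rep_tensor rep_unit U) U (lunit_map (space U))),
     RUnit = (\<lambda>U. Arrow (rep_tensor U rep_unit) U (runit_map (space U))),
     Grade = deg,
     ConjO = rep_conj,
     ConjA = (\<lambda>\<beta> f. Arrow (rep_conj \<beta> (source f)) (rep_conj \<beta> (target f)) (body f))\<rparr>"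

end


section \<open>Yetter-Drinfeld modules\<close>

type_synonym ('p, 'k, 'h, 'b) coaction =
  "'p \<Rightarrow> ('k, 'h, 'b) univ \<Rightarrow> (('k, 'h, 'b) univ \<times> 'h) list"

type_synonym ('p, 'k, 'h, 'b) yd = "('p, 'k, 'h, 'b) rep \<times> ('p, 'k, 'h, 'b) coaction"

type_synonym ('p, 'k, 'h, 'b) yd_arrow =
  "(('p, 'k, 'h, 'b) yd, ('k, 'h, 'b) univ \<Rightarrow> ('k, 'h, 'b) univ) arrow"

context T_coalgebra
begin

definition is_yd :: "('p, 'k, 'h, 'b) yd \<Rightarrow> bool" where
  "is_yd = (\<lambda>(V, \<Delta>).
     is_rep V \<and>
     \<Delta> \<in> extensional (carrier \<pi>) \<and>
     (\<forall>\<mu>\<in>carrier \<pi>.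
        \<Delta> \<mu> \<in> extensional (carrier (space V)) \<and>
        linear_map K (space V) (tensor K (space V) (alg H \<mu>)) (\<Delta> \<mu>)) \<and>
     (\<forall>\<mu>\<in>carrier \<pi>. \<forall>\<nu>\<in>carrier \<pi>. \<forall>v\<in>carrier (space V).
        let H\<mu>\<nu> = tensor K (alg H \<mu>) (alg H \<nu>); T = tensor K (space V) H\<mu>\<nu> in
        sweedler T (\<lambda>u z. pure K (space V) H\<mu>\<nu> u (comult H \<mu> \<nu> z)) (\<Delta> (\<mu> \<otimes> \<nu>) v) =
        sweedler T (\<lambda>w y. sweedler T (\<lambda>u x.
            pure K (space V) H\<mu>\<nu> u (pure K (alg H \<mu>) (alg H \<nu>) x y)) (\<Delta> \<mu> w)) (\<Delta> \<nu> v)) \<and>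
     (\<forall>v\<in>carrier (space V).
        sweedler (space V) (\<lambda>u x. counit H x \<odot>\<^bsub>space V\<^esub> u) (\<Delta> \<one> v) = v) \<and>
     (\<forall>\<mu>\<in>carrier \<pi>. \<forall>h\<in>carrier (alg H (deg V \<otimes> \<mu>)). \<forall>v\<in>carrier (space V).
        let T = tensor K (space V) (alg H \<mu>) in
        sweedler T (\<lambda>h' h''. sweedler T (\<lambda>u x.
            pure K (space V) (alg H \<mu>) (act V h' u) (h'' \<otimes>\<^bsub>alg H \<mu>\<^esub> x)) (\<Delta> \<mu> v))
          (comult H (deg V) \<mu> h) =
        sweedler T (\<lambda>h' h''. sweedler T (\<lambda>u x.
            pure K (space V) (alg H \<mu>) u
              (x \<otimes>\<^bsub>alg H \<mu>\<^esub> twist H (inv (deg V)) (conjg \<pi> (deg V) \<mu>) h')) (\<Delta> \<mu> (act V h'' v)))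
          (comult H (conjg \<pi> (deg V) \<mu>) (deg V) h)))"

definition is_yd_map ::
    "('p, 'k, 'h, 'b) yd \<Rightarrow> ('p, 'k, 'h, 'b) yd \<Rightarrow> (('k, 'h, 'b) univ \<Rightarrow> ('k, 'h, 'b) univ) \<Rightarrow> bool" where
  "is_yd_map = (\<lambda>(V, \<Delta>) (W, \<Delta>') f.
     is_rep_map V W f \<and>
     (\<forall>\<mu>\<in>carrier \<pi>. \<forall>v\<in>carrier (space V).
        \<Delta>' \<mu> (f v) =
        sweedler (tensor K (space W) (alg H \<mu>)) (\<lambda>u x. pure K (space W) (alg H \<mu>) (f u) x) (\<Delta> \<mu> v)))"

definition yd_tensor :: "('p, 'k, 'h, 'b) yd \<Rightarrow> ('p, 'k, 'h, 'b) yd \<Rightarrow> ('p, 'k, 'h, 'b) yd" where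
  "yd_tensor = (\<lambda>(V, \<Delta>) (W, \<Delta>').
     let VW = rep_tensor V W; \<beta> = deg W in
     (VW,
      \<lambda>\<mu>\<in>carrier \<pi>. \<lambda>x\<in>carrier (space VW).
        let T = tensor K (space VW) (alg H \<mu>) in
        sweedler\<^sub>u T (\<lambda>v w. sweedler T (\<lambda>v' a. sweedler T (\<lambda>w' b.
            pure K (space VW) (alg H \<mu>)
              (pure\<^sub>u K (space V) (space W) v' w')
              (b \<otimes>\<^bsub>alg H \<mu>\<^esub> twist H (inv \<beta>) (conjg \<pi> \<beta> \<mu>) a))
          (\<Delta>' \<mu> w)) (\<Delta> (conjg \<pi> \<beta> \<mu>) v)) x))"

definition yd_unit :: "('p, 'k, 'h, 'b) yd" where
  "yd_unit =
    (rep_unit,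
     \<lambda>\<mu>\<in>carrier \<pi>. \<lambda>x\<in>carrier (space rep_unit). pure K (space rep_unit) (alg H \<mu>) x \<one>\<^bsub>alg H \<mu>\<^esub>)"

definition yd_conj :: "'p \<Rightarrow> ('p, 'k, 'h, 'b) yd \<Rightarrow> ('p, 'k, 'h, 'b) yd" where
  "yd_conj \<beta> = (\<lambda>(V, \<Delta>).
     (rep_conj \<beta> V,
      \<lambda>\<mu>\<in>carrier \<pi>. \<lambda>v\<in>carrier (space V).
        sweedler (tensor K (space V) (alg H \<mu>))
          (\<lambda>u x. pure K (space V) (alg H \<mu>) u (twist H \<beta> (conjg \<pi> (inv \<beta>) \<mu>) x))
          (\<Delta> (conjg \<pi> (inv \<beta>) \<mu>) v)))"

definition yd_braid_map ::
    "('p, 'k, 'h, 'b) yd \<Rightarrow> ('p, 'k, 'h, 'b) yd \<Rightarrow> ('k, 'h, 'b) univ \<Rightarrow> ('k, 'h, 'b) univ" where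
  "yd_braid_map = (\<lambda>(V, \<Delta>) (W, \<Delta>').
     let \<beta> = deg W; S = tensor\<^sub>u K (space W) (space V) in
     (\<lambda>x\<in>carrier (tensor\<^sub>u K (space V) (space W)).
       sweedler\<^sub>u S (\<lambda>v w. sweedler S (\<lambda>v' a.
           pure\<^sub>u K (space W) (space V) (act W (antipode H (inv \<beta>) a) w) v')
         (\<Delta> (inv \<beta>) v)) x))"

text \<open>In \<open>Braid\<close>, the space of \<open>\<^sup>\<alpha>W\<close> is that of \<open>W\<close>, for \<open>\<alpha>\<close> the degree of \<open>V\<close>.\<close>

definition YD :: "('p, ('p, 'k, 'h, 'b) yd, ('p, 'k, 'h, 'b) yd_arrow) braided_T_category" where
  "YD =
    \<lparr>Obj = {V. is_yd V},
     Arr = {Arrow V W f | V W f. is_yd V \<and> is_yd W \<and> is_yd_map V W f},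
     Dom = source,
     Cod = target,
     Ident = (\<lambda>V. Arrow V V (\<lambda>v\<in>carrier (space (fst V)). v)),
     Comp = (\<lambda>g f. Arrow (source f) (target g)
               (compose (carrier (space (fst (source f)))) (body g) (body f))),
     TenO = yd_tensor,
     TenA = (\<lambda>f g. Arrow (yd_tensor (source f) (source g)) (yd_tensor (target f) (target g))
               (map_tensor (space (fst (source f))) (space (fst (source g)))
                  (space (fst (target f))) (space (fst (target g))) (body f) (body g))),
     Unit = yd_unit,
     Assoc = (\<lambda>U V W. Arrow (yd_tensor (yd_tensor U V) W) (yd_tensor U (yd_tensor V W))
               (assoc_map (space (fst U)) (space (fst V)) (space (fst W)))),
     LUnit = (\<lambda>V. Arrow (yd_tensor yd_unit V) V (lunit_map (space (fst V)))),
     RUnit = (\<lambda>V. Arrow (yd_tensor V yd_unit) V (runit_map (space (fst V)))),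
     Grade = (\<lambda>V. deg (fst V)),
     ConjO = yd_conj,
     ConjA = (\<lambda>\<beta> f. Arrow (yd_conj \<beta> (source f)) (yd_conj \<beta> (target f)) (body f)),
     Braid = (\<lambda>V W. Arrow (yd_tensor V W) (yd_tensor (yd_conj (deg (fst V)) W) V)
               (yd_braid_map V W))\<rparr>"

end

end

theory Submission
  imports Defs
begin

text \<open>
  For a Yetter-Drinfeld module \<open>V\<close> of degree \<open>\<alpha>\<close> and a representation \<open>X\<close> of degree \<open>\<lambda>\<close>, the map
  \<open>e\<^sub>X : \<^sup>\<alpha>X \<otimes> V \<rightarrow> V \<otimes> X\<close> given by \<open>e\<^sub>X(x \<otimes> v) = v\<^sub>(\<^sub>V\<^sub>) \<otimes> v\<^sub>(\<^sub>\<lambda>\<^sub>) x\<close> is invertible by the antipode axioms. Its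
  linearity is the compatibility of action and coaction, and the inverses form a half braiding by
  coassociativity. Conversely, a half braiding \<open>c\<close> gives the coaction sending \<open>v\<close> to the value of the inverse
  of \<open>c\<close> at the regular representation \<open>H\<^sub>\<lambda>\<close> on \<open>1 \<otimes> v\<close>; naturality with respect to the maps
  \<open>H\<^sub>\<lambda> \<rightarrow> X\<close>, \<open>a \<mapsto> ax\<close>, shows that \<open>c\<close> is determined by this coaction. The formulas for the structure of
  Yetter-Drinfeld modules are obtained by evaluating the half braidings of the center at regular
  representations, and all axioms are then reflected by the isomorphism.
\<close>

section \<open>Tensor categories\<close>

text \<open>The tensor product of the universe is associative and unital only up to isomorphism, so
  every axiom of the center carries constraints. Therefore the center is treated for an arbitrary
  T-category, where coherence is handled abstractly, and work with elements is confined to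
  \<open>Rep\<close> and to single half braidings. The second obstacle is that the elements of a
  tensor product are chosen representatives of classes of formal sums, and that a value of
  \<open>comult\<close> or of a coaction is in general not a pure tensor. The recurring device is to
  replace such a value by an arbitrary element \<open>t\<close> of the tensor product, to prove the
  identity for pure \<open>t\<close>, to extend it by linearity, and only then to specialize; the
  axioms of \<open>H\<close> enter as equations between the specialized elements. The counit axiom
  of a coaction has a separate origin, namely invertibility at the unit object. That tensor products
  and conjugates of Yetter-Drinfeld modules are again Yetter-Drinfeld modules is not verified on
  their coactions: it follows from closure of the center under its operations.\<close>

context category
begin

lemma arrowsD:
  "f \<in> arrows C U V \<Longrightarrow> f \<in> Arr C \<and> Dom C f = U \<and> Cod C f = V"
  by (simp add: arrows_def)

lemma arrowsI [intro]:
  "\<lbrakk>f \<in> Arr C; Dom C f = U; Cod C f = V\<rbrakk> \<Longrightarrow> f \<in> arrows C U V"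
  by (simp add: arrows_def)

lemma Ident_simps [simp]:
  assumes "U \<in> Obj C"
  shows "\<iota> U \<in> Arr C" "Dom C (\<iota> U) = U" "Cod C (\<iota> U) = U"
  using Ident_closed[OF assms] by (auto simp: arrows_def)

lemma Comp_simps [simp]:
  assumes "f \<in> Arr C" "g \<in> Arr C" "Cod C f = Dom C g"
  shows "g \<cdot> f \<in> Arr C" "Dom C (g \<cdot> f) = Dom C f" "Cod C (g \<cdot> f) = Cod C g"
  using Comp_closed[of f "Dom C f" "Cod C f" g "Cod C g"] assms by (auto simp: arrows_def)

lemma Comp_Ident_simps [simp]:
  "f \<in> Arr C \<Longrightarrow> Dom C f = U \<Longrightarrow> f \<cdot> \<iota> U = f"
  "f \<in> Arr C \<Longrightarrow> Cod C f = U \<Longrightarrow> \<iota> U \<cdot> f = f"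
  using Comp_Ident_left Comp_Ident_right by (auto simp: arrows_def)

lemma Dom_Cod_Obj [simp]:
  "f \<in> Arr C \<Longrightarrow> Dom C f \<in> Obj C" "f \<in> Arr C \<Longrightarrow> Cod C f \<in> Obj C"
  by (auto intro: Dom_closed Cod_closed)

lemma comp_assoc:
  "\<lbrakk>f \<in> Arr C; g \<in> Arr C; h \<in> Arr C; Cod C f = Dom C g; Cod C g = Dom C h\<rbrakk> \<Longrightarrow>
    (h \<cdot> g) \<cdot> f = h \<cdot> (g \<cdot> f)"
  using Comp_assoc[of f "Dom C f" "Dom C g" g "Dom C h" h "Cod C h"] by (auto simp: arrows_def)

text \<open>Composites are kept nested to the right, where \<open>g \<cdot> f\<close> is not a
  subterm of \<open>g \<cdot> (f \<cdot> r)\<close>; in this form an equation for two arrows can act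
  at the head of a longer composite.\<close>

lemma comp_left_rewrite:
  assumes "g \<cdot> f = k" "f \<in> Arr C" "g \<in> Arr C" "Cod C f = Dom C g" "r \<in> Arr C" "Cod C r = Dom C f"
  shows "g \<cdot> (f \<cdot> r) = k \<cdot> r"
  using comp_assoc[of r f g] assms by simp

text \<open>The same device for a commuting square. Many of the diagram chases below consist in
  moving one arrow through a composite by this rule.\<close>

lemma square_left_rewrite:
  assumes "g \<cdot> f = k \<cdot> l" "f \<in> Arr C" "g \<in> Arr C" "Cod C f = Dom C g"
    "l \<in> Arr C" "k \<in> Arr C" "Cod C l = Dom C k" "r \<in> Arr C" "Cod C r = Dom C f"
    "Dom C f = Dom C l"
  shows "g \<cdot> (f \<cdot> r) = k \<cdot> (l \<cdot> r)"
  using comp_assoc[of r f g] comp_assoc[of r l k] assms by simp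

text \<open>The usual computation \<open>g = g (f g') = (g f) g' = g'\<close>; it makes the definite
  description in \<open>inv_arrow\<close> meaningful.\<close>

lemma inverse_arrows_unique:
  assumes "inverse_arrows C f g" "inverse_arrows C f g'"
  shows "g = g'"
proof -
  have "g \<cdot> (f \<cdot> g') = g"
    using assms by (auto simp: inverse_arrows_def arrows_def)
  then have "g = g \<cdot> (f \<cdot> g')" by simp
  also have "\<dots> = (g \<cdot> f) \<cdot> g'"
    by (rule comp_assoc[symmetric]) (use assms in \<open>auto simp: inverse_arrows_def arrows_def\<close>)
  also have "\<dots> = g'"
    using assms by (auto simp: inverse_arrows_def arrows_def)
  finally show ?thesis .
qed

lemma inv_arrow_eq: "inverse_arrows C f g \<Longrightarrow> inv_arrow C f = g"
  unfolding inv_arrow_def using inverse_arrows_unique by blast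

lemma inverse_arrows_sym: "inverse_arrows C f g \<Longrightarrow> inverse_arrows C g f"
  by (auto simp: inverse_arrows_def arrows_def)

lemma isosD:
  assumes "f \<in> isos C U V"
  shows "inverse_arrows C f (inv_arrow C f)" "f \<in> Arr C" "Dom C f = U" "Cod C f = V"
    "inv_arrow C f \<in> Arr C" "Dom C (inv_arrow C f) = V" "Cod C (inv_arrow C f) = U"
    "inv_arrow C f \<cdot> f = \<iota> U" "f \<cdot> inv_arrow C f = \<iota> V"
proof -
  show i: "inverse_arrows C f (inv_arrow C f)"
    using assms inv_arrow_eq by (auto simp: isos_def)
  show "f \<in> Arr C" "Dom C f = U" "Cod C f = V"
    using assms by (auto simp: isos_def arrows_def)
  then show "inv_arrow C f \<in> Arr C" "Dom C (inv_arrow C f) = V" "Cod C (inv_arrow C f) = U"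
    "inv_arrow C f \<cdot> f = \<iota> U" "f \<cdot> inv_arrow C f = \<iota> V"
    using i by (auto simp: inverse_arrows_def arrows_def)
qed

lemma isosI: "\<lbrakk>f \<in> arrows C U V; inverse_arrows C f g\<rbrakk> \<Longrightarrow> f \<in> isos C U V"
  by (auto simp: isos_def)

lemma inverse_arrowsI:
  "\<lbrakk>f \<in> arrows C U V; g \<in> arrows C V U; g \<cdot> f = \<iota> U; f \<cdot> g = \<iota> V\<rbrakk> \<Longrightarrow> inverse_arrows C f g"
  by (auto simp: inverse_arrows_def arrows_def)

lemma isos_arrows: "f \<in> isos C U V \<Longrightarrow> f \<in> arrows C U V"
  by (simp add: isos_def)

lemma iso_cancel [simp]:
  assumes "f \<in> isos C U V" "r \<in> Arr C"
  shows "Cod C r = U \<Longrightarrow> inv_arrow C f \<cdot> (f \<cdot> r) = r"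
    "Cod C r = V \<Longrightarrow> f \<cdot> (inv_arrow C f \<cdot> r) = r"
  using comp_assoc[of r f "inv_arrow C f"] comp_assoc[of r "inv_arrow C f" f] isosD[OF assms(1)]
    assms(2) by auto

lemma iso_eq_iff_left:
  assumes "f \<in> isos C U V" "x \<in> Arr C" "y \<in> Arr C" "Cod C x = U" "Cod C y = V" "Dom C x = Dom C y"
  shows "f \<cdot> x = y \<longleftrightarrow> x = inv_arrow C f \<cdot> y"
  using assms iso_cancel[OF assms(1)] by metis

lemma inv_isos: "f \<in> isos C U V \<Longrightarrow> inv_arrow C f \<in> isos C V U"
  using isosD[of f U V] inverse_arrows_sym by (auto intro!: isosI)

lemma inv_inv_arrow: "f \<in> isos C U V \<Longrightarrow> inv_arrow C (inv_arrow C f) = f"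
  using isosD(1)[of f U V] inverse_arrows_sym inv_arrow_eq by blast

lemma comp_isos:
  assumes "f \<in> isos C U V" "g \<in> isos C V W"
  shows "g \<cdot> f \<in> isos C U W"
proof (rule isosI)
  note f = isosD[OF assms(1)] and g = isosD[OF assms(2)]
  show "g \<cdot> f \<in> arrows C U W" using f g by auto
  show "inverse_arrows C (g \<cdot> f) (inv_arrow C f \<cdot> inv_arrow C g)"
    by (rule inverse_arrowsI[where U = U and V = W])
      (use f g in \<open>auto simp: comp_assoc iso_cancel[OF assms(1)] iso_cancel[OF assms(2)]\<close>)
qed

lemma inv_comp:
  assumes "f \<in> isos C U V" "g \<in> isos C V W"
  shows "inv_arrow C (g \<cdot> f) = inv_arrow C f \<cdot> inv_arrow C g"
proof (rule inv_arrow_eq)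
  note f = isosD[OF assms(1)] and g = isosD[OF assms(2)]
  show "inverse_arrows C (g \<cdot> f) (inv_arrow C f \<cdot> inv_arrow C g)"
    by (rule inverse_arrowsI[where U = U and V = W])
      (use f g in \<open>auto simp: comp_assoc iso_cancel[OF assms(1)] iso_cancel[OF assms(2)]\<close>)
qed

text \<open>Compose the square with the inverses of its two parallel isomorphisms. The rule
  translates naturality and compatibility conditions for half braidings into conditions on their
  inverses and back.\<close>

lemma square_inv:
  assumes "c \<in> isos C A B" "d \<in> isos C A' B'" "p \<in> arrows C A A'" "q \<in> arrows C B B'"
  shows "q \<cdot> c = d \<cdot> p \<longleftrightarrow> inv_arrow C d \<cdot> q = p \<cdot> inv_arrow C c"
proof
  note c = isosD[OF assms(1)] and d = isosD[OF assms(2)] and pq = arrowsD[OF assms(3)] arrowsD[OF assms(4)]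
  have objs: "A \<in> Obj C" "B \<in> Obj C" "A' \<in> Obj C" "B' \<in> Obj C" using c d Dom_closed Cod_closed by metis+
  {
    assume e: "q \<cdot> c = d \<cdot> p"
    have "inv_arrow C d \<cdot> q = inv_arrow C d \<cdot> (q \<cdot> (c \<cdot> inv_arrow C c))"
      using c d pq objs by simp
    also have "\<dots> = inv_arrow C d \<cdot> ((q \<cdot> c) \<cdot> inv_arrow C c)"
      using c d pq objs by (simp add: comp_assoc)
    also have "\<dots> = p \<cdot> inv_arrow C c"
      unfolding e using c d pq objs by (simp add: comp_assoc iso_cancel[OF assms(2)])
    finally show "inv_arrow C d \<cdot> q = p \<cdot> inv_arrow C c" .
  }
  {
    assume e: "inv_arrow C d \<cdot> q = p \<cdot> inv_arrow C c"
    have "q \<cdot> c = d \<cdot> ((inv_arrow C d \<cdot> q) \<cdot> c)"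
      using c d pq objs by (simp add: comp_assoc iso_cancel[OF assms(2)])
    also have "\<dots> = d \<cdot> p"
      unfolding e using c d pq objs by (simp add: comp_assoc)
    finally show "q \<cdot> c = d \<cdot> p" .
  }
qed

end

context tensor_category
begin

section \<open>Tensor calculus: whiskering and associativity constraints\<close>

lemma TenA_simps [simp]:
  assumes "f \<in> Arr C" "g \<in> Arr C"
  shows "f \<star> g \<in> Arr C" "Dom C (f \<star> g) = Dom C f \<boxtimes> Dom C g" "Cod C (f \<star> g) = Cod C f \<boxtimes> Cod C g"
  using TenA_closed[of f "Dom C f" "Cod C f" g "Dom C g" "Cod C g"] assms by (auto simp: arrows_def)

lemma interchange:
  "\<lbrakk>f \<in> Arr C; f' \<in> Arr C; g \<in> Arr C; g' \<in> Arr C; Cod C f = Dom C f'; Cod C g = Dom C g'\<rbrakk> \<Longrightarrow>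
   (f' \<star> g') \<cdot> (f \<star> g) = (f' \<cdot> f) \<star> (g' \<cdot> g)"
  using TenA_Comp[of f "Dom C f" "Dom C f'" f' "Cod C f'" g "Dom C g" "Dom C g'" g' "Cod C g'"]
  by (auto simp: arrows_def)

lemma whisker_left_comp:
  "\<lbrakk>g \<in> Arr C; g' \<in> Arr C; Cod C g = Dom C g'; A \<in> Obj C\<rbrakk> \<Longrightarrow>
   \<iota> A \<star> (g' \<cdot> g) = (\<iota> A \<star> g') \<cdot> (\<iota> A \<star> g)"
  by (simp add: interchange)

lemma whisker_right_comp:
  "\<lbrakk>g \<in> Arr C; g' \<in> Arr C; Cod C g = Dom C g'; A \<in> Obj C\<rbrakk> \<Longrightarrow>
   (g' \<cdot> g) \<star> \<iota> A = (g' \<star> \<iota> A) \<cdot> (g \<star> \<iota> A)"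
  by (simp add: interchange)

declare TenO_closed [simp] Unit_closed [simp] TenA_Ident [simp]

abbreviation "aso \<equiv> Assoc C"
abbreviation "asi U V W \<equiv> inv_arrow C (Assoc C U V W)"

lemma aso_simps [simp]:
  assumes "U \<in> Obj C" "V \<in> Obj C" "W \<in> Obj C"
  shows "aso U V W \<in> Arr C" "Dom C (aso U V W) = U \<boxtimes> V \<boxtimes> W" "Cod C (aso U V W) = U \<boxtimes> (V \<boxtimes> W)"
    "asi U V W \<in> Arr C" "Cod C (asi U V W) = U \<boxtimes> V \<boxtimes> W" "Dom C (asi U V W) = U \<boxtimes> (V \<boxtimes> W)"
    "aso U V W \<cdot> asi U V W = \<iota> (U \<boxtimes> (V \<boxtimes> W))" "asi U V W \<cdot> aso U V W = \<iota> (U \<boxtimes> V \<boxtimes> W)"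
  using isosD[OF Assoc_iso[OF assms]] by auto

lemma aso_cancel [simp]:
  assumes "U \<in> Obj C" "V \<in> Obj C" "W \<in> Obj C" "r \<in> Arr C"
  shows "Cod C r = U \<boxtimes> (V \<boxtimes> W) \<Longrightarrow> aso U V W \<cdot> (asi U V W \<cdot> r) = r"
    "Cod C r = U \<boxtimes> V \<boxtimes> W \<Longrightarrow> asi U V W \<cdot> (aso U V W \<cdot> r) = r"
  using iso_cancel[OF Assoc_iso[OF assms(1-3)] assms(4)] by auto

lemma LUnit_simps [simp]:
  assumes "U \<in> Obj C"
  shows "LUnit C U \<in> Arr C" "Dom C (LUnit C U) = \<I> \<boxtimes> U" "Cod C (LUnit C U) = U"
    "inv_arrow C (LUnit C U) \<in> Arr C" "Cod C (inv_arrow C (LUnit C U)) = \<I> \<boxtimes> U"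
    "Dom C (inv_arrow C (LUnit C U)) = U"
    "LUnit C U \<cdot> inv_arrow C (LUnit C U) = \<iota> U" "inv_arrow C (LUnit C U) \<cdot> LUnit C U = \<iota> (\<I> \<boxtimes> U)"
  using isosD[OF LUnit_iso[OF assms]] by auto

lemma RUnit_simps [simp]:
  assumes "U \<in> Obj C"
  shows "RUnit C U \<in> Arr C" "Dom C (RUnit C U) = U \<boxtimes> \<I>" "Cod C (RUnit C U) = U"
    "inv_arrow C (RUnit C U) \<in> Arr C" "Cod C (inv_arrow C (RUnit C U)) = U \<boxtimes> \<I>"
    "Dom C (inv_arrow C (RUnit C U)) = U"
    "RUnit C U \<cdot> inv_arrow C (RUnit C U) = \<iota> U" "inv_arrow C (RUnit C U) \<cdot> RUnit C U = \<iota> (U \<boxtimes> \<I>)"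
  using isosD[OF RUnit_iso[OF assms]] by auto

lemma unit_cancel [simp]:
  assumes "U \<in> Obj C" "r \<in> Arr C"
  shows "Cod C r = U \<Longrightarrow> LUnit C U \<cdot> (inv_arrow C (LUnit C U) \<cdot> r) = r"
    "Cod C r = \<I> \<boxtimes> U \<Longrightarrow> inv_arrow C (LUnit C U) \<cdot> (LUnit C U \<cdot> r) = r"
    "Cod C r = U \<Longrightarrow> RUnit C U \<cdot> (inv_arrow C (RUnit C U) \<cdot> r) = r"
    "Cod C r = U \<boxtimes> \<I> \<Longrightarrow> inv_arrow C (RUnit C U) \<cdot> (RUnit C U \<cdot> r) = r"
  using iso_cancel[OF LUnit_iso[OF assms(1)] assms(2)] iso_cancel[OF RUnit_iso[OF assms(1)] assms(2)]
  by auto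

lemma whisker_isos:
  assumes "f \<in> isos C U V" "A \<in> Obj C"
  shows "\<iota> A \<star> f \<in> isos C (A \<boxtimes> U) (A \<boxtimes> V)" "f \<star> \<iota> A \<in> isos C (U \<boxtimes> A) (V \<boxtimes> A)"
    "inv_arrow C (\<iota> A \<star> f) = \<iota> A \<star> inv_arrow C f" "inv_arrow C (f \<star> \<iota> A) = inv_arrow C f \<star> \<iota> A"
proof -
  note f = isosD[OF assms(1)]
  have o: "U \<in> Obj C" "V \<in> Obj C" using f Dom_closed Cod_closed by metis+
  have 1: "inverse_arrows C (\<iota> A \<star> f) (\<iota> A \<star> inv_arrow C f)"
    by (rule inverse_arrowsI[of _ "A \<boxtimes> U" "A \<boxtimes> V"])
      (use f o assms(2) in \<open>auto simp: interchange\<close>)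
  have 2: "inverse_arrows C (f \<star> \<iota> A) (inv_arrow C f \<star> \<iota> A)"
    by (rule inverse_arrowsI[of _ "U \<boxtimes> A" "V \<boxtimes> A"])
      (use f o assms(2) in \<open>auto simp: interchange\<close>)
  show "\<iota> A \<star> f \<in> isos C (A \<boxtimes> U) (A \<boxtimes> V)" "f \<star> \<iota> A \<in> isos C (U \<boxtimes> A) (V \<boxtimes> A)"
    using 1 2 f assms(2) by (auto intro!: isosI)
  show "inv_arrow C (\<iota> A \<star> f) = \<iota> A \<star> inv_arrow C f" "inv_arrow C (f \<star> \<iota> A) = inv_arrow C f \<star> \<iota> A"
    using 1 2 inv_arrow_eq by auto
qed

lemma aso_natural:
  assumes "f \<in> Arr C" "g \<in> Arr C" "h \<in> Arr C"
  shows "aso (Cod C f) (Cod C g) (Cod C h) \<cdot> ((f \<star> g) \<star> h) = (f \<star> (g \<star> h)) \<cdot> aso (Dom C f) (Dom C g) (Dom C h)"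
  using Assoc_natural[of f "Dom C f" "Cod C f" g "Dom C g" "Cod C g" h "Dom C h" "Cod C h"] assms
  by (auto simp: arrows_def)

lemma asi_natural:
  assumes "f \<in> Arr C" "g \<in> Arr C" "h \<in> Arr C"
  shows "asi (Cod C f) (Cod C g) (Cod C h) \<cdot> (f \<star> (g \<star> h)) = ((f \<star> g) \<star> h) \<cdot> asi (Dom C f) (Dom C g) (Dom C h)"
  using square_inv[OF Assoc_iso[of "Dom C f" "Dom C g" "Dom C h"] Assoc_iso[of "Cod C f" "Cod C g" "Cod C h"],
      of "(f \<star> g) \<star> h" "f \<star> (g \<star> h)"] aso_natural[OF assms] assms by (auto simp: arrows_def)

lemma pentagon':
  assumes "U \<in> Obj C" "V \<in> Obj C" "W \<in> Obj C" "X \<in> Obj C"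
  shows "(\<iota> U \<star> aso V W X) \<cdot> (aso U (V \<boxtimes> W) X \<cdot> (aso U V W \<star> \<iota> X)) = aso U V (W \<boxtimes> X) \<cdot> aso (U \<boxtimes> V) W X"
  using pentagon[OF assms] assms by (simp add: comp_assoc)

lemma asi_whisker [simp]:
  assumes "U \<in> Obj C" "V \<in> Obj C" "W \<in> Obj C" "X \<in> Obj C"
  shows "(\<iota> X \<star> aso U V W) \<cdot> (\<iota> X \<star> asi U V W) = \<iota> (X \<boxtimes> (U \<boxtimes> (V \<boxtimes> W)))"
    "(\<iota> X \<star> asi U V W) \<cdot> (\<iota> X \<star> aso U V W) = \<iota> (X \<boxtimes> (U \<boxtimes> V \<boxtimes> W))"
    "(aso U V W \<star> \<iota> X) \<cdot> (asi U V W \<star> \<iota> X) = \<iota> (U \<boxtimes> (V \<boxtimes> W) \<boxtimes> X)"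
    "(asi U V W \<star> \<iota> X) \<cdot> (aso U V W \<star> \<iota> X) = \<iota> (U \<boxtimes> V \<boxtimes> W \<boxtimes> X)"
  using assms by (auto simp: interchange)

lemma asi_whisker_cancel [simp]:
  assumes "U \<in> Obj C" "V \<in> Obj C" "W \<in> Obj C" "X \<in> Obj C" "r \<in> Arr C"
  shows "Cod C r = X \<boxtimes> (U \<boxtimes> (V \<boxtimes> W)) \<Longrightarrow> (\<iota> X \<star> aso U V W) \<cdot> ((\<iota> X \<star> asi U V W) \<cdot> r) = r"
    "Cod C r = X \<boxtimes> (U \<boxtimes> V \<boxtimes> W) \<Longrightarrow> (\<iota> X \<star> asi U V W) \<cdot> ((\<iota> X \<star> aso U V W) \<cdot> r) = r"
    "Cod C r = U \<boxtimes> (V \<boxtimes> W) \<boxtimes> X \<Longrightarrow> (aso U V W \<star> \<iota> X) \<cdot> ((asi U V W \<star> \<iota> X) \<cdot> r) = r"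
    "Cod C r = U \<boxtimes> V \<boxtimes> W \<boxtimes> X \<Longrightarrow> (asi U V W \<star> \<iota> X) \<cdot> ((aso U V W \<star> \<iota> X) \<cdot> r) = r"
  using assms by (auto simp: comp_left_rewrite[OF asi_whisker(1)] comp_left_rewrite[OF asi_whisker(2)]
      comp_left_rewrite[OF asi_whisker(3)] comp_left_rewrite[OF asi_whisker(4)])

text \<open>The pentagon with some of its constraints inverted: this is how associators remain on
  the source side after whiskering twice.\<close>

lemma pentagon_right:
  assumes "U \<in> Obj C" "V \<in> Obj C" "W \<in> Obj C" "X \<in> Obj C"
  shows "aso (U \<boxtimes> V) W X \<cdot> ((asi U V W \<star> \<iota> X) \<cdot> asi U (V \<boxtimes> W) X) = asi U V (W \<boxtimes> X) \<cdot> (\<iota> U \<star> aso V W X)"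
proof -
  let ?r = "(asi U V W \<star> \<iota> X) \<cdot> asi U (V \<boxtimes> W) X"
  have "aso (U \<boxtimes> V) W X \<cdot> ?r = asi U V (W \<boxtimes> X) \<cdot> ((aso U V (W \<boxtimes> X) \<cdot> aso (U \<boxtimes> V) W X) \<cdot> ?r)"
    using assms by (simp add: comp_assoc)
  also have "\<dots> = asi U V (W \<boxtimes> X) \<cdot> (\<iota> U \<star> aso V W X)"
    unfolding pentagon'[OF assms, symmetric] using assms by (simp add: comp_assoc)
  finally show ?thesis .
qed

text \<open>
  Up to associativity, \<open>rwh A B D E f Y\<close> is \<open>f \<otimes> Y\<close> for \<open>f : A \<otimes> B \<rightarrow> D \<otimes> E\<close>. Expressed in terms of
  \<open>rwh\<close>, the axioms of half braidings contain almost no associativity constraints.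
\<close>

definition rwh :: "'a \<Rightarrow> 'a \<Rightarrow> 'a \<Rightarrow> 'a \<Rightarrow> 'b \<Rightarrow> 'a \<Rightarrow> 'b" where
  "rwh A B D E f Y = aso D E Y \<cdot> ((f \<star> \<iota> Y) \<cdot> asi A B Y)"

lemma rwh_simps [simp]:
  assumes "f \<in> Arr C" "Dom C f = A \<boxtimes> B" "Cod C f = D \<boxtimes> E" "A \<in> Obj C" "B \<in> Obj C" "D \<in> Obj C"
    "E \<in> Obj C" "Y \<in> Obj C"
  shows "rwh A B D E f Y \<in> Arr C" "Dom C (rwh A B D E f Y) = A \<boxtimes> (B \<boxtimes> Y)"
    "Cod C (rwh A B D E f Y) = D \<boxtimes> (E \<boxtimes> Y)"
  using assms by (auto simp: rwh_def)

text \<open>The pentagon is used once at the target of \<open>f\<close> and, as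
  \<open>pentagon_right\<close>, once at its source; in between \<open>f\<close> slides through an
  associator by naturality. Successive whiskerings can thereby be merged.\<close>

lemma rwh_rwh:
  assumes "f \<in> Arr C" "Dom C f = A \<boxtimes> B" "Cod C f = D \<boxtimes> E" "A \<in> Obj C" "B \<in> Obj C" "D \<in> Obj C"
    "E \<in> Obj C" "Y \<in> Obj C" "Z \<in> Obj C"
  shows "(\<iota> D \<star> aso E Y Z) \<cdot> rwh A (B \<boxtimes> Y) D (E \<boxtimes> Y) (rwh A B D E f Y) Z =
    rwh A B D E f (Y \<boxtimes> Z) \<cdot> (\<iota> A \<star> aso B Y Z)"
proof -
  have "(\<iota> D \<star> aso E Y Z) \<cdot> rwh A (B \<boxtimes> Y) D (E \<boxtimes> Y) (rwh A B D E f Y) Z =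
    ((\<iota> D \<star> aso E Y Z) \<cdot> (aso D (E \<boxtimes> Y) Z \<cdot> (aso D E Y \<star> \<iota> Z))) \<cdot> (((f \<star> \<iota> Y) \<star> \<iota> Z) \<cdot>
      ((asi A B Y \<star> \<iota> Z) \<cdot> asi A (B \<boxtimes> Y) Z))"
    using assms by (simp add: rwh_def whisker_right_comp comp_assoc)
  also have "\<dots> = aso D E (Y \<boxtimes> Z) \<cdot> ((aso (D \<boxtimes> E) Y Z \<cdot> ((f \<star> \<iota> Y) \<star> \<iota> Z)) \<cdot>
      ((asi A B Y \<star> \<iota> Z) \<cdot> asi A (B \<boxtimes> Y) Z))"
    using assms by (subst pentagon') (simp_all add: comp_assoc)
  also have "aso (D \<boxtimes> E) Y Z \<cdot> ((f \<star> \<iota> Y) \<star> \<iota> Z) = (f \<star> \<iota> (Y \<boxtimes> Z)) \<cdot> aso (A \<boxtimes> B) Y Z"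
    using aso_natural[of f "\<iota> Y" "\<iota> Z"] assms by simp
  also have "aso D E (Y \<boxtimes> Z) \<cdot> (((f \<star> \<iota> (Y \<boxtimes> Z)) \<cdot> aso (A \<boxtimes> B) Y Z) \<cdot> ((asi A B Y \<star> \<iota> Z) \<cdot> asi A (B \<boxtimes> Y) Z)) =
     aso D E (Y \<boxtimes> Z) \<cdot> ((f \<star> \<iota> (Y \<boxtimes> Z)) \<cdot> (aso (A \<boxtimes> B) Y Z \<cdot> ((asi A B Y \<star> \<iota> Z) \<cdot> asi A (B \<boxtimes> Y) Z)))"
    using assms by (simp add: comp_assoc)
  also have "\<dots> = rwh A B D E f (Y \<boxtimes> Z) \<cdot> (\<iota> A \<star> aso B Y Z)"
    using assms by (simp add: rwh_def comp_assoc pentagon_right)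
  finally show ?thesis .
qed

lemma rwh_comp:
  assumes "f \<in> Arr C" "Dom C f = A \<boxtimes> B" "Cod C f = D \<boxtimes> E" "A \<in> Obj C" "B \<in> Obj C" "D \<in> Obj C"
    "E \<in> Obj C" "Y \<in> Obj C"
    and "g \<in> Arr C" "Dom C g = D \<boxtimes> E" "Cod C g = F \<boxtimes> G" "F \<in> Obj C" "G \<in> Obj C"
  shows "rwh A B F G (g \<cdot> f) Y = rwh D E F G g Y \<cdot> rwh A B D E f Y"
  using assms by (simp add: rwh_def comp_assoc whisker_right_comp)

lemma rwh_whisker_left:
  assumes "g \<in> Arr C" "Dom C g = B" "Cod C g = E" "D \<in> Obj C" "Y \<in> Obj C"
  shows "rwh D B D E (\<iota> D \<star> g) Y = \<iota> D \<star> (g \<star> \<iota> Y)"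
proof -
  have o: "B \<in> Obj C" "E \<in> Obj C" using assms by auto
  have "aso D E Y \<cdot> (((\<iota> D \<star> g) \<star> \<iota> Y) \<cdot> asi D B Y) = (\<iota> D \<star> (g \<star> \<iota> Y)) \<cdot> (aso D B Y \<cdot> asi D B Y)"
    by (rule square_left_rewrite) (use assms o aso_natural[of "\<iota> D" g "\<iota> Y"] in simp_all)
  then show ?thesis using assms o by (simp add: rwh_def)
qed

text \<open>The pentagon at the target. It regroups a threefold target, as it arises when the
  multiplicativity of a half braiding is whiskered by a further object.\<close>

lemma rwh_aso:
  assumes "k \<in> Arr C" "Dom C k = A \<boxtimes> B" "Cod C k = D \<boxtimes> E \<boxtimes> F" "A \<in> Obj C" "B \<in> Obj C" "D \<in> Obj C"
    "E \<in> Obj C" "F \<in> Obj C" "Z \<in> Obj C"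
  shows "(\<iota> D \<star> aso E F Z) \<cdot> rwh A B D (E \<boxtimes> F) (aso D E F \<cdot> k) Z =
    aso D E (F \<boxtimes> Z) \<cdot> rwh A B (D \<boxtimes> E) F k Z"
proof -
  have "(\<iota> D \<star> aso E F Z) \<cdot> rwh A B D (E \<boxtimes> F) (aso D E F \<cdot> k) Z =
    ((\<iota> D \<star> aso E F Z) \<cdot> (aso D (E \<boxtimes> F) Z \<cdot> (aso D E F \<star> \<iota> Z))) \<cdot> ((k \<star> \<iota> Z) \<cdot> asi A B Z)"
    using assms by (simp add: rwh_def whisker_right_comp comp_assoc)
  also have "\<dots> = aso D E (F \<boxtimes> Z) \<cdot> rwh A B (D \<boxtimes> E) F k Z"
    using assms by (subst pentagon') (simp_all add: rwh_def comp_assoc)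
  finally show ?thesis .
qed

text \<open>The counterpart of \<open>rwh_aso\<close> at the source, needed because the half
  braiding of a tensor product starts with an associator.\<close>

lemma rwh_asi:
  assumes "k \<in> Arr C" "Dom C k = A \<boxtimes> (B \<boxtimes> F)" "Cod C k = D \<boxtimes> E" "A \<in> Obj C" "B \<in> Obj C" "D \<in> Obj C"
    "E \<in> Obj C" "F \<in> Obj C" "Z \<in> Obj C"
  shows "rwh (A \<boxtimes> B) F D E (k \<cdot> aso A B F) Z =
    rwh A (B \<boxtimes> F) D E k Z \<cdot> ((\<iota> A \<star> asi B F Z) \<cdot> aso A B (F \<boxtimes> Z))"
proof -
  have "(aso A B F \<star> \<iota> Z) \<cdot> asi (A \<boxtimes> B) F Z =
     asi A (B \<boxtimes> F) Z \<cdot> ((\<iota> A \<star> asi B F Z) \<cdot> (((\<iota> A \<star> aso B F Z) \<cdot> (aso A (B \<boxtimes> F) Z \<cdot> (aso A B F \<star> \<iota> Z))) \<cdot> asi (A \<boxtimes> B) F Z))"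
    using assms by (simp add: comp_assoc)
  also have "\<dots> = asi A (B \<boxtimes> F) Z \<cdot> ((\<iota> A \<star> asi B F Z) \<cdot> aso A B (F \<boxtimes> Z))"
    using assms by (subst pentagon') (simp_all add: comp_assoc)
  finally show ?thesis
    using assms by (simp add: rwh_def whisker_right_comp comp_assoc)
qed

text \<open>\<open>f\<close> and \<open>g\<close> act on different tensor factors, so the
  interchange law lets them commute; naturality of the associators carries this through the
  rebracketings inside \<open>rwh\<close>.\<close>

lemma rwh_natural:
  assumes "f \<in> Arr C" "Dom C f = A \<boxtimes> B" "Cod C f = D \<boxtimes> E" "A \<in> Obj C" "B \<in> Obj C" "D \<in> Obj C"
    "E \<in> Obj C" and "g \<in> Arr C"
  shows "rwh A B D E f (Cod C g) \<cdot> (\<iota> A \<star> (\<iota> B \<star> g)) = (\<iota> D \<star> (\<iota> E \<star> g)) \<cdot> rwh A B D E f (Dom C g)"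
proof -
  have "rwh A B D E f (Cod C g) \<cdot> (\<iota> A \<star> (\<iota> B \<star> g)) =
    aso D E (Cod C g) \<cdot> ((f \<star> \<iota> (Cod C g)) \<cdot> (asi A B (Cod C g) \<cdot> (\<iota> A \<star> (\<iota> B \<star> g))))"
    using assms by (simp add: rwh_def comp_assoc)
  also have "asi A B (Cod C g) \<cdot> (\<iota> A \<star> (\<iota> B \<star> g)) = (\<iota> (A \<boxtimes> B) \<star> g) \<cdot> asi A B (Dom C g)"
    using asi_natural[of "\<iota> A" "\<iota> B" g] assms by simp
  also have "(f \<star> \<iota> (Cod C g)) \<cdot> ((\<iota> (A \<boxtimes> B) \<star> g) \<cdot> asi A B (Dom C g)) =
     (\<iota> (D \<boxtimes> E) \<star> g) \<cdot> ((f \<star> \<iota> (Dom C g)) \<cdot> asi A B (Dom C g))"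
    by (rule square_left_rewrite) (use assms in \<open>simp_all add: interchange\<close>)
  also have "aso D E (Cod C g) \<cdot> ((\<iota> (D \<boxtimes> E) \<star> g) \<cdot> ((f \<star> \<iota> (Dom C g)) \<cdot> asi A B (Dom C g))) =
     (\<iota> D \<star> (\<iota> E \<star> g)) \<cdot> (aso D E (Dom C g) \<cdot> ((f \<star> \<iota> (Dom C g)) \<cdot> asi A B (Dom C g)))"
    by (rule square_left_rewrite) (use assms aso_natural[of "\<iota> D" "\<iota> E" g] in simp_all)
  finally show ?thesis by (simp add: rwh_def)
qed

section \<open>Coherence of the unit constraints\<close>

lemma LUnit_nat: "f \<in> Arr C \<Longrightarrow> LUnit C (Cod C f) \<cdot> (\<iota> \<I> \<star> f) = f \<cdot> LUnit C (Dom C f)"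
  using LUnit_natural[of f "Dom C f" "Cod C f"] by (simp add: arrowsI)

lemma RUnit_nat: "f \<in> Arr C \<Longrightarrow> RUnit C (Cod C f) \<cdot> (f \<star> \<iota> \<I>) = f \<cdot> RUnit C (Dom C f)"
  using RUnit_natural[of f "Dom C f" "Cod C f"] by (simp add: arrowsI)

text \<open>Naturality of the unit constraints recovers an arrow \<open>h\<close> from
  \<open>\<iota> \<I> \<star> h\<close>, and likewise from \<open>h \<star> \<iota> \<I>\<close>, so
  whiskering by the unit object is faithful.\<close>

lemma whisker_unit_cancel:
  assumes "f \<in> Arr C" "g \<in> Arr C" "Dom C f = Dom C g" "Cod C f = Cod C g"
  shows "\<iota> \<I> \<star> f = \<iota> \<I> \<star> g \<Longrightarrow> f = g" "f \<star> \<iota> \<I> = g \<star> \<iota> \<I> \<Longrightarrow> f = g"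
proof -
  have L: "h = LUnit C (Cod C h) \<cdot> ((\<iota> \<I> \<star> h) \<cdot> inv_arrow C (LUnit C (Dom C h)))"
    and R: "h = RUnit C (Cod C h) \<cdot> ((h \<star> \<iota> \<I>) \<cdot> inv_arrow C (RUnit C (Dom C h)))" if h: "h \<in> Arr C" for h
    using h comp_left_rewrite[OF LUnit_nat[of h]] comp_left_rewrite[OF RUnit_nat[of h]]
    by (simp_all add: comp_assoc)
  show "\<iota> \<I> \<star> f = \<iota> \<I> \<star> g \<Longrightarrow> f = g" using L[of f] L[of g] assms by simp
  show "f \<star> \<iota> \<I> = g \<star> \<iota> \<I> \<Longrightarrow> f = g" using R[of f] R[of g] assms by simp
qed

text \<open>Kelly's consequence of the pentagon and the triangle. The equation is first proved after
  tensoring with the unit object on the left, where the pentagon for \<open>\<I>, \<I>, X, Y\<close>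
  and two triangles apply; then \<open>whisker_unit_cancel\<close> removes the extra factor.\<close>

lemma LUnit_TenO:
  assumes X: "X \<in> Obj C" and Y: "Y \<in> Obj C"
  shows "LUnit C (X \<boxtimes> Y) \<cdot> aso \<I> X Y = LUnit C X \<star> \<iota> Y"
proof -
  let ?I = "\<I>"
  have "((\<iota> ?I \<star> LUnit C (X \<boxtimes> Y)) \<cdot> (\<iota> ?I \<star> aso ?I X Y)) \<cdot> (aso ?I (?I \<boxtimes> X) Y \<cdot> (aso ?I ?I X \<star> \<iota> Y)) =
      (\<iota> ?I \<star> LUnit C (X \<boxtimes> Y)) \<cdot> ((\<iota> ?I \<star> aso ?I X Y) \<cdot> (aso ?I (?I \<boxtimes> X) Y \<cdot> (aso ?I ?I X \<star> \<iota> Y)))"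
    using X Y by (simp add: comp_assoc)
  also have "\<dots> = ((\<iota> ?I \<star> LUnit C (X \<boxtimes> Y)) \<cdot> aso ?I ?I (X \<boxtimes> Y)) \<cdot> aso (?I \<boxtimes> ?I) X Y"
    using X Y by (simp add: pentagon' comp_assoc)
  also have "\<dots> = (RUnit C ?I \<star> \<iota> (X \<boxtimes> Y)) \<cdot> aso (?I \<boxtimes> ?I) X Y"
    using X Y by (simp add: triangle)
  also have "\<dots> = aso ?I X Y \<cdot> ((RUnit C ?I \<star> \<iota> X) \<star> \<iota> Y)"
    using aso_natural[of "RUnit C ?I" "\<iota> X" "\<iota> Y"] X Y by simp
  also have "\<dots> = aso ?I X Y \<cdot> (((\<iota> ?I \<star> LUnit C X) \<star> \<iota> Y) \<cdot> (aso ?I ?I X \<star> \<iota> Y))"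
    using X Y by (simp add: triangle[symmetric] whisker_right_comp)
  also have "\<dots> = (\<iota> ?I \<star> (LUnit C X \<star> \<iota> Y)) \<cdot> (aso ?I (?I \<boxtimes> X) Y \<cdot> (aso ?I ?I X \<star> \<iota> Y))"
    by (rule square_left_rewrite) (use X Y aso_natural[of "\<iota> ?I" "LUnit C X" "\<iota> Y"] in simp_all)
  finally have e: "((\<iota> ?I \<star> LUnit C (X \<boxtimes> Y)) \<cdot> (\<iota> ?I \<star> aso ?I X Y)) \<cdot> (aso ?I (?I \<boxtimes> X) Y \<cdot> (aso ?I ?I X \<star> \<iota> Y)) =
     (\<iota> ?I \<star> (LUnit C X \<star> \<iota> Y)) \<cdot> (aso ?I (?I \<boxtimes> X) Y \<cdot> (aso ?I ?I X \<star> \<iota> Y))" .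
  \<comment> \<open>The common right factor of the two sides of \<open>e\<close> is an isomorphism
    and is cancelled by composing with its inverse.\<close>
  have "(\<iota> ?I \<star> LUnit C (X \<boxtimes> Y)) \<cdot> (\<iota> ?I \<star> aso ?I X Y) =
     (((\<iota> ?I \<star> LUnit C (X \<boxtimes> Y)) \<cdot> (\<iota> ?I \<star> aso ?I X Y)) \<cdot> (aso ?I (?I \<boxtimes> X) Y \<cdot> (aso ?I ?I X \<star> \<iota> Y))) \<cdot>
       ((asi ?I ?I X \<star> \<iota> Y) \<cdot> asi ?I (?I \<boxtimes> X) Y)"
    using X Y by (simp add: comp_assoc)
  also have "\<dots> = \<iota> ?I \<star> (LUnit C X \<star> \<iota> Y)"
    unfolding e using X Y by (simp add: comp_assoc)
  finally have "\<iota> ?I \<star> (LUnit C (X \<boxtimes> Y) \<cdot> aso ?I X Y) = \<iota> ?I \<star> (LUnit C X \<star> \<iota> Y)"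
    using X Y by (simp add: whisker_left_comp)
  then show ?thesis
    by (rule whisker_unit_cancel(1)[rotated 4]) (use X Y in simp_all)
qed

text \<open>The mirror image of \<open>LUnit_TenO\<close>: tensoring with the unit object on the
  right brings in the pentagon for \<open>X, Y, \<I>, \<I>\<close>.\<close>

lemma RUnit_TenO:
  assumes X: "X \<in> Obj C" and Y: "Y \<in> Obj C"
  shows "(\<iota> X \<star> RUnit C Y) \<cdot> aso X Y \<I> = RUnit C (X \<boxtimes> Y)"
proof -
  let ?I = "\<I>"
  have "((\<iota> X \<star> RUnit C Y) \<cdot> aso X Y \<I>) \<star> \<iota> ?I = asi X Y ?I \<cdot> (aso X Y ?I \<cdot> (((\<iota> X \<star> RUnit C Y) \<star> \<iota> ?I) \<cdot> (aso X Y \<I> \<star> \<iota> ?I)))"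
    using X Y by (simp add: whisker_right_comp)
  also have "aso X Y ?I \<cdot> (((\<iota> X \<star> RUnit C Y) \<star> \<iota> ?I) \<cdot> (aso X Y \<I> \<star> \<iota> ?I)) =
      (\<iota> X \<star> (RUnit C Y \<star> \<iota> ?I)) \<cdot> (aso X (Y \<boxtimes> ?I) ?I \<cdot> (aso X Y \<I> \<star> \<iota> ?I))"
    by (rule square_left_rewrite) (use X Y aso_natural[of "\<iota> X" "RUnit C Y" "\<iota> ?I"] in simp_all)
  also have "\<dots> = (\<iota> X \<star> (\<iota> Y \<star> LUnit C ?I)) \<cdot> ((\<iota> X \<star> aso Y ?I ?I) \<cdot> (aso X (Y \<boxtimes> ?I) ?I \<cdot> (aso X Y \<I> \<star> \<iota> ?I)))"
    using X Y by (simp add: triangle[symmetric] whisker_left_comp comp_assoc)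
  also have "\<dots> = (\<iota> X \<star> (\<iota> Y \<star> LUnit C ?I)) \<cdot> (aso X Y (?I \<boxtimes> ?I) \<cdot> aso (X \<boxtimes> Y) ?I ?I)"
    using X Y by (simp add: pentagon')
  also have "\<dots> = aso X Y ?I \<cdot> ((\<iota> (X \<boxtimes> Y) \<star> LUnit C ?I) \<cdot> aso (X \<boxtimes> Y) ?I ?I)"
    by (rule square_left_rewrite) (use X Y aso_natural[of "\<iota> X" "\<iota> Y" "LUnit C ?I"] in simp_all)
  also have "asi X Y ?I \<cdot> (aso X Y ?I \<cdot> ((\<iota> (X \<boxtimes> Y) \<star> LUnit C ?I) \<cdot> aso (X \<boxtimes> Y) ?I ?I)) = RUnit C (X \<boxtimes> Y) \<star> \<iota> ?I"
    using X Y by (simp add: triangle)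
  finally show ?thesis
    by (rule whisker_unit_cancel(2)[rotated 4]) (use X Y in simp_all)
qed

end

section \<open>The center of a T-category\<close>

context T_category
begin

declare Grade_closed [simp]

section \<open>Conjugation functors and degrees\<close>

lemma ConjO_closed [simp]: "\<lbrakk>\<beta> \<in> carrier \<pi>; U \<in> Obj T\<rbrakk> \<Longrightarrow> ConjO T \<beta> U \<in> Obj T"
  using Conj_functor by (auto simp: is_functor_def)

lemma ConjA_simps [simp]:
  assumes "\<beta> \<in> carrier \<pi>" "f \<in> Arr T"
  shows "ConjA T \<beta> f \<in> Arr T" "Dom T (ConjA T \<beta> f) = ConjO T \<beta> (Dom T f)"
    "Cod T (ConjA T \<beta> f) = ConjO T \<beta> (Cod T f)"
proof -
  have "ConjA T \<beta> f \<in> arrows T (ConjO T \<beta> (Dom T f)) (ConjO T \<beta> (Cod T f))"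
    using Conj_functor[OF assms(1)] assms(2) Dom_Cod_Obj unfolding is_functor_def by (blast intro: arrowsI)
  then show "ConjA T \<beta> f \<in> Arr T" "Dom T (ConjA T \<beta> f) = ConjO T \<beta> (Dom T f)"
    "Cod T (ConjA T \<beta> f) = ConjO T \<beta> (Cod T f)"
    by (auto dest: arrowsD)
qed

lemma ConjA_Ident [simp]: "\<lbrakk>\<beta> \<in> carrier \<pi>; U \<in> Obj T\<rbrakk> \<Longrightarrow> ConjA T \<beta> (\<iota> U) = \<iota> (ConjO T \<beta> U)"
  using Conj_functor by (auto simp: is_functor_def)

lemma ConjA_Comp:
  assumes "\<beta> \<in> carrier \<pi>" "f \<in> Arr T" "g \<in> Arr T" "Cod T f = Dom T g"
  shows "ConjA T \<beta> (g \<cdot> f) = ConjA T \<beta> g \<cdot> ConjA T \<beta> f"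
proof -
  have "f \<in> arrows T (Dom T f) (Dom T g)" "g \<in> arrows T (Dom T g) (Cod T g)" using assms by auto
  then show ?thesis
    using Conj_functor[OF assms(1)] assms(2-) Dom_Cod_Obj unfolding is_functor_def by blast
qed

lemma ConjA_isos:
  assumes "\<beta> \<in> carrier \<pi>" "f \<in> isos T U V"
  shows "ConjA T \<beta> f \<in> isos T (ConjO T \<beta> U) (ConjO T \<beta> V)"
    "inv_arrow T (ConjA T \<beta> f) = ConjA T \<beta> (inv_arrow T f)"
proof -
  note f = isosD[OF assms(2)]
  have o: "U \<in> Obj T" "V \<in> Obj T" using f Dom_closed Cod_closed by metis+
  have i: "inverse_arrows T (ConjA T \<beta> f) (ConjA T \<beta> (inv_arrow T f))"
    by (rule inverse_arrowsI[where U = "ConjO T \<beta> U" and V = "ConjO T \<beta> V"])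
      (use f o assms(1) in \<open>auto simp: ConjA_Comp[symmetric]\<close>)
  then show "inv_arrow T (ConjA T \<beta> f) = ConjA T \<beta> (inv_arrow T f)"
    by (rule inv_arrow_eq)
  show "ConjA T \<beta> f \<in> isos T (ConjO T \<beta> U) (ConjO T \<beta> V)"
    using i f assms(1) by (auto intro!: isosI)
qed

lemma ConjO_inv [simp]:
  "\<lbrakk>\<beta> \<in> carrier \<pi>; U \<in> Obj T\<rbrakk> \<Longrightarrow> ConjO T (inv\<^bsub>\<pi>\<^esub> \<beta>) (ConjO T \<beta> U) = U"
  "\<lbrakk>\<beta> \<in> carrier \<pi>; U \<in> Obj T\<rbrakk> \<Longrightarrow> ConjO T \<beta> (ConjO T (inv\<^bsub>\<pi>\<^esub> \<beta>) U) = U"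
  by (simp_all add: ConjO_mult[symmetric] ConjO_one)

lemma ConjA_inv [simp]:
  "\<lbrakk>\<beta> \<in> carrier \<pi>; f \<in> Arr T\<rbrakk> \<Longrightarrow> ConjA T (inv\<^bsub>\<pi>\<^esub> \<beta>) (ConjA T \<beta> f) = f"
  "\<lbrakk>\<beta> \<in> carrier \<pi>; f \<in> Arr T\<rbrakk> \<Longrightarrow> ConjA T \<beta> (ConjA T (inv\<^bsub>\<pi>\<^esub> \<beta>) f) = f"
  by (simp_all add: ConjA_mult[symmetric] ConjA_one)

lemma Grade_ConjO:
  assumes "\<beta> \<in> carrier \<pi>" "U \<in> Obj T"
  shows "Grade T (ConjO T \<beta> U) = conjg \<pi> \<beta> (Grade T U)"
proof -
  have "ConjO T \<beta> U \<in> ConjO T \<beta> ` component T (Grade T U)"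
    using assms by (auto simp: component_def)
  then have "ConjO T \<beta> U \<in> component T (conjg \<pi> \<beta> (Grade T U))"
    using Conj_component[of \<beta> "Grade T U"] assms by simp
  then show ?thesis by (simp add: component_def)
qed

text \<open>The unit constraint at \<open>\<I>\<close> is an arrow from
  \<open>\<I> \<boxtimes> \<I>\<close> to \<open>\<I>\<close>, and arrows stay within one component;
  so the degree of \<open>\<I>\<close> is an idempotent element of a group.\<close>

lemma Grade_Unit: "Grade T \<I> = \<one>\<^bsub>\<pi>\<^esub>"
proof -
  have "Grade T \<I> \<otimes>\<^bsub>\<pi>\<^esub> Grade T \<I> = Grade T \<I>"
    using Grade_arrow[of "LUnit T \<I>"] Grade_TenO[of \<I> \<I>] by simp
  then show ?thesis using P.r_cancel_one[of "Grade T \<I>" "Grade T \<I>"] by simp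
qed

lemma actO_simps [simp]:
  assumes "U \<in> Obj T" "X \<in> Obj T"
  shows "actO T U X \<in> Obj T"
    "Y \<in> Obj T \<Longrightarrow> actO T U (X \<boxtimes> Y) = actO T U X \<boxtimes> actO T U Y"
    "actO T U \<I> = \<I>"
    "Y \<in> Obj T \<Longrightarrow> actO T (U \<boxtimes> Y) X = actO T U (actO T Y X)"
  using assms by (auto simp: actO_def Conj_TenO Grade_Unit ConjO_one Conj_Unit Grade_TenO ConjO_mult)

lemma actA_simps [simp]:
  assumes "U \<in> Obj T" "f \<in> Arr T"
  shows "actA T U f \<in> Arr T" "Dom T (actA T U f) = actO T U (Dom T f)"
    "Cod T (actA T U f) = actO T U (Cod T f)"
    "Y \<in> Obj T \<Longrightarrow> actA T (U \<boxtimes> Y) f = actA T U (actA T Y f)"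
  using assms by (auto simp: actA_def actO_def Grade_Unit ConjA_one Grade_TenO ConjA_mult)

lemma act_Unit [simp]: "X \<in> Obj T \<Longrightarrow> actO T \<I> X = X" "f \<in> Arr T \<Longrightarrow> actA T \<I> f = f"
  by (simp_all add: actO_def actA_def Grade_Unit ConjO_one ConjA_one)

lemma actO_arrow: "f \<in> Arr T \<Longrightarrow> actO T (Dom T f) X = actO T (Cod T f) X"
  using Grade_arrow by (simp add: actO_def)

text \<open>This is why the half braiding in \<open>center_ConjO\<close> is evaluated at the object
  conjugated by the inverse of \<open>\<beta>\<close> and conjugated back afterwards: only then do
  its targets have the required form.\<close>

lemma actO_ConjO:
  assumes "\<beta> \<in> carrier \<pi>" "U \<in> Obj T" "X \<in> Obj T"
  shows "actO T (ConjO T \<beta> U) X = ConjO T \<beta> (actO T U (ConjO T (inv\<^bsub>\<pi>\<^esub> \<beta>) X))"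
  using assms by (simp add: actO_def Grade_ConjO conjg_def ConjO_mult)

lemma actA_ConjO:
  assumes "\<beta> \<in> carrier \<pi>" "U \<in> Obj T" "f \<in> Arr T"
  shows "actA T (ConjO T \<beta> U) f = ConjA T \<beta> (actA T U (ConjA T (inv\<^bsub>\<pi>\<^esub> \<beta>) f))"
  using assms by (simp add: actA_def Grade_ConjO conjg_def ConjA_mult)

section \<open>Half braidings and their tensor products, unit and conjugates\<close>

lemma hb_simps:
  assumes "half_braiding U c" "U \<in> Obj T" "X \<in> Obj T"
  shows "c X \<in> isos T (U \<boxtimes> X) (actO T U X \<boxtimes> U)"
    "c X \<in> Arr T" "Dom T (c X) = U \<boxtimes> X" "Cod T (c X) = actO T U X \<boxtimes> U"
    "inv_arrow T (c X) \<in> Arr T" "Dom T (inv_arrow T (c X)) = actO T U X \<boxtimes> U" "Cod T (inv_arrow T (c X)) = U \<boxtimes> X"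
proof -
  show "c X \<in> isos T (U \<boxtimes> X) (actO T U X \<boxtimes> U)" using assms by (auto simp: half_braiding_def)
  from isosD[OF this] show "c X \<in> Arr T" "Dom T (c X) = U \<boxtimes> X" "Cod T (c X) = actO T U X \<boxtimes> U"
    "inv_arrow T (c X) \<in> Arr T" "Dom T (inv_arrow T (c X)) = actO T U X \<boxtimes> U" "Cod T (inv_arrow T (c X)) = U \<boxtimes> X"
    by auto
qed

lemma hb_natural:
  assumes "half_braiding U c" "f \<in> Arr T"
  shows "c (Cod T f) \<cdot> (\<iota> U \<star> f) = (actA T U f \<star> \<iota> U) \<cdot> c (Dom T f)"
proof -
  have "f \<in> arrows T (Dom T f) (Cod T f)" using assms by auto
  then show ?thesis using assms unfolding half_braiding_def by (metis Dom_Cod_Obj)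
qed

text \<open>Moving the leading inverse associator to the other side turns the rest of the right hand
  side into a whiskering \<open>rwh\<close>. This is the form of multiplicativity in which tensor
  products of half braidings are computed.\<close>

lemma hb_TenO_iff:
  assumes "U \<in> Obj T" "X \<in> Obj T" "Y \<in> Obj T"
    "c X \<in> isos T (U \<boxtimes> X) (actO T U X \<boxtimes> U)" "c Y \<in> isos T (U \<boxtimes> Y) (actO T U Y \<boxtimes> U)"
    "c (X \<boxtimes> Y) \<in> isos T (U \<boxtimes> (X \<boxtimes> Y)) (actO T U (X \<boxtimes> Y) \<boxtimes> U)"
  shows "c (X \<boxtimes> Y) =
          asi (actO T U X) (actO T U Y) U
          \<cdot> (\<iota> (actO T U X) \<star> c Y)
          \<cdot> aso (actO T U X) U Y
          \<cdot> (c X \<star> \<iota> Y)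
          \<cdot> asi U X Y \<longleftrightarrow>
     aso (actO T U X) (actO T U Y) U \<cdot> c (X \<boxtimes> Y) =
      (\<iota> (actO T U X) \<star> c Y) \<cdot> rwh U X (actO T U X) U (c X) Y" (is "_ = ?r \<longleftrightarrow> _")
proof -
  note c = isosD[OF assms(4)] isosD[OF assms(5)] isosD[OF assms(6)]
  have r: "?r = asi (actO T U X) (actO T U Y) U \<cdot> ((\<iota> (actO T U X) \<star> c Y) \<cdot> rwh U X (actO T U X) U (c X) Y)"
    using c assms(1-3) by (simp add: rwh_def comp_assoc)
  show ?thesis unfolding r
    using iso_eq_iff_left[OF Assoc_iso[of "actO T U X" "actO T U Y" U], of "c (X \<boxtimes> Y)"
        "(\<iota> (actO T U X) \<star> c Y) \<cdot> rwh U X (actO T U X) U (c X) Y"] c assms(1-3)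
    by simp
qed

lemma hb_TenO:
  assumes "half_braiding U c" "U \<in> Obj T" "X \<in> Obj T" "Y \<in> Obj T"
  shows "aso (actO T U X) (actO T U Y) U \<cdot> c (X \<boxtimes> Y) =
      (\<iota> (actO T U X) \<star> c Y) \<cdot> rwh U X (actO T U X) U (c X) Y"
proof -
  have "\<forall>X\<in>Obj T. \<forall>Y\<in>Obj T. c (X \<boxtimes> Y) = asi (actO T U X) (actO T U Y) U
      \<cdot> (\<iota> (actO T U X) \<star> c Y) \<cdot> aso (actO T U X) U Y \<cdot> (c X \<star> \<iota> Y) \<cdot> asi U X Y"
    using assms(1) unfolding half_braiding_def by (elim conjE)
  from this[rule_format, OF assms(3,4)] show ?thesis
    by (rule hb_TenO_iff[THEN iffD1, rotated 6]) (intro assms hb_simps(1)[OF assms(1)] TenO_closed)+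
qed

lemma half_braidingI:
  assumes "U \<in> Obj T" "c \<in> extensional (Obj T)"
    and "\<And>X. X \<in> Obj T \<Longrightarrow> c X \<in> isos T (U \<boxtimes> X) (actO T U X \<boxtimes> U)"
    and "\<And>f. f \<in> Arr T \<Longrightarrow> c (Cod T f) \<cdot> (\<iota> U \<star> f) = (actA T U f \<star> \<iota> U) \<cdot> c (Dom T f)"
    and "\<And>X Y. \<lbrakk>X \<in> Obj T; Y \<in> Obj T\<rbrakk> \<Longrightarrow> aso (actO T U X) (actO T U Y) U \<cdot> c (X \<boxtimes> Y) =
      (\<iota> (actO T U X) \<star> c Y) \<cdot> rwh U X (actO T U X) U (c X) Y"
  shows "half_braiding U c"
  unfolding half_braiding_def
proof (intro conjI ballI)
  fix X Y assume XY: "X \<in> Obj T" "Y \<in> Obj T"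
  show "c (X \<boxtimes> Y) =
          asi (actO T U X) (actO T U Y) U
          \<cdot> (\<iota> (actO T U X) \<star> c Y)
          \<cdot> aso (actO T U X) U Y
          \<cdot> (c X \<star> \<iota> Y)
          \<cdot> asi U X Y"
    by (rule hb_TenO_iff[THEN iffD2]) (intro assms XY TenO_closed)+
next
  fix X Y f assume "X \<in> Obj T" "Y \<in> Obj T" "f \<in> arrows T X Y"
  then show "(actA T U f \<star> \<iota> U) \<cdot> c X = c Y \<cdot> (\<iota> U \<star> f)"
    using assms(4)[of f] by (auto dest: arrowsD)
qed (use assms in auto)

text \<open>
  The inverses of the half braiding of a Yetter-Drinfeld module do not involve the antipode, so the axioms
  of half braidings are verified for the inverses.
\<close>

lemma half_braiding_inverse_iff:
  assumes U: "U \<in> Obj T" and c: "c \<in> extensional (Obj T)"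
    and iso: "\<And>X. X \<in> Obj T \<Longrightarrow> c X \<in> isos T (U \<boxtimes> X) (actO T U X \<boxtimes> U)"
  shows "half_braiding U c \<longleftrightarrow>
     (\<forall>f\<in>Arr T. inv_arrow T (c (Cod T f)) \<cdot> (actA T U f \<star> \<iota> U) = (\<iota> U \<star> f) \<cdot> inv_arrow T (c (Dom T f))) \<and>
     (\<forall>X\<in>Obj T. \<forall>Y\<in>Obj T. inv_arrow T (c (X \<boxtimes> Y)) =
        aso U X Y \<cdot> ((inv_arrow T (c X) \<star> \<iota> Y) \<cdot> (asi (actO T U X) U Y \<cdot>
          ((\<iota> (actO T U X) \<star> inv_arrow T (c Y)) \<cdot> aso (actO T U X) (actO T U Y) U))))" (is "_ = (?N \<and> ?M)")
proof -
  \<comment> \<open>For each \<open>f\<close> the naturality square has two values of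
    \<open>c\<close> as parallel isomorphisms, so \<open>square_inv\<close> applies.\<close>
  have N: "(\<forall>X\<in>Obj T. \<forall>Y\<in>Obj T. \<forall>f\<in>arrows T X Y.
        (actA T U f \<star> \<iota> U) \<cdot> c X = c Y \<cdot> (\<iota> U \<star> f)) \<longleftrightarrow> ?N" (is "?N' = _")
  proof -
    have "(actA T U f \<star> \<iota> U) \<cdot> c (Dom T f) = c (Cod T f) \<cdot> (\<iota> U \<star> f) \<longleftrightarrow>
       inv_arrow T (c (Cod T f)) \<cdot> (actA T U f \<star> \<iota> U) = (\<iota> U \<star> f) \<cdot> inv_arrow T (c (Dom T f))" if f: "f \<in> Arr T" for f
      by (rule square_inv) (use f U iso[of "Dom T f"] iso[of "Cod T f"] in auto)
    moreover have "?N' \<longleftrightarrow> (\<forall>f\<in>Arr T. (actA T U f \<star> \<iota> U) \<cdot> c (Dom T f) = c (Cod T f) \<cdot> (\<iota> U \<star> f))"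
      by (auto simp: arrows_def)
    ultimately show ?thesis by auto
  qed
  have M: "c (X \<boxtimes> Y) =
          asi (actO T U X) (actO T U Y) U
          \<cdot> (\<iota> (actO T U X) \<star> c Y)
          \<cdot> aso (actO T U X) U Y
          \<cdot> (c X \<star> \<iota> Y)
          \<cdot> asi U X Y \<longleftrightarrow> inv_arrow T (c (X \<boxtimes> Y)) =
        aso U X Y \<cdot> ((inv_arrow T (c X) \<star> \<iota> Y) \<cdot> (asi (actO T U X) U Y \<cdot>
          ((\<iota> (actO T U X) \<star> inv_arrow T (c Y)) \<cdot> aso (actO T U X) (actO T U Y) U)))" (is "_ = ?r \<longleftrightarrow> _ = ?s")
    if X: "X \<in> Obj T" and Y: "Y \<in> Obj T" for X Y
  proof -
    let ?X = "actO T U X" and ?Y = "actO T U Y"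
    have 1: "asi U X Y \<in> isos T (U \<boxtimes> (X \<boxtimes> Y)) (U \<boxtimes> X \<boxtimes> Y)"
      using X Y U by (auto intro!: inv_isos Assoc_iso)
    have 2: "c X \<star> \<iota> Y \<in> isos T (U \<boxtimes> X \<boxtimes> Y) (?X \<boxtimes> U \<boxtimes> Y)"
      using whisker_isos(2)[OF iso[OF X] Y] .
    have 3: "aso ?X U Y \<in> isos T (?X \<boxtimes> U \<boxtimes> Y) (?X \<boxtimes> (U \<boxtimes> Y))" using X Y U by (auto intro!: Assoc_iso)
    have 4: "\<iota> ?X \<star> c Y \<in> isos T (?X \<boxtimes> (U \<boxtimes> Y)) (?X \<boxtimes> (?Y \<boxtimes> U))"
      using whisker_isos(1)[OF iso[OF Y], of ?X] X U by auto
    have 5: "asi ?X ?Y U \<in> isos T (?X \<boxtimes> (?Y \<boxtimes> U)) (?X \<boxtimes> ?Y \<boxtimes> U)"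
      using X Y U by (auto intro!: inv_isos Assoc_iso)
    note c = isosD[OF iso[OF X]] isosD[OF iso[OF Y]]
    have e: "?r = asi ?X ?Y U \<cdot> ((\<iota> ?X \<star> c Y) \<cdot> (aso ?X U Y \<cdot> ((c X \<star> \<iota> Y) \<cdot> asi U X Y)))"
      using X Y U c by (simp add: comp_assoc)
    \<comment> \<open>The right hand side of multiplicativity is a composite of five isomorphisms.
      It equals \<open>c (X \<boxtimes> Y)\<close> exactly if the inverses agree, and its inverse is
      the composite of the five inverses in reverse order.\<close>
    have k: "?r \<in> isos T (U \<boxtimes> (X \<boxtimes> Y)) (?X \<boxtimes> ?Y \<boxtimes> U)"
      unfolding e by (rule comp_isos[OF comp_isos[OF comp_isos[OF comp_isos[OF 1 2] 3] 4] 5])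
    have "inv_arrow T ?r = ((((inv_arrow T (asi U X Y) \<cdot> (inv_arrow T (c X) \<star> \<iota> Y)) \<cdot> asi ?X U Y) \<cdot>
        (\<iota> ?X \<star> inv_arrow T (c Y))) \<cdot> inv_arrow T (asi ?X ?Y U))"
      unfolding e
      by (simp add: inv_comp[OF 1 2] inv_comp[OF comp_isos[OF 1 2] 3] inv_comp[OF comp_isos[OF comp_isos[OF 1 2] 3] 4]
          inv_comp[OF comp_isos[OF comp_isos[OF comp_isos[OF 1 2] 3] 4] 5]
          whisker_isos(4)[OF iso[OF X] Y] whisker_isos(3)[OF iso[OF Y], of ?X] X U)
    also have "\<dots> = ?s"
      using X Y U c by (simp add: inv_inv_arrow[OF Assoc_iso] comp_assoc)
    finally have s: "inv_arrow T ?r = ?s" .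
    show ?thesis unfolding s[symmetric]
      using inv_inv_arrow[OF k] inv_inv_arrow[OF iso[of "X \<boxtimes> Y"]] X Y by (metis TenO_closed)
  qed
  show ?thesis
    unfolding half_braiding_def N using M iso c by auto
qed

text \<open>The half braiding of a tensor product, evaluated at a tensor product, contains a
  whiskered value of \<open>c\<close> at a tensor product. Here the multiplicativity of
  \<open>c\<close> is whiskered by a third object, with the associators arranged so that each single
  value of \<open>c\<close> again sits inside a \<open>rwh\<close>.\<close>

lemma hb_TenO_whisker:
  assumes "half_braiding U c" "U \<in> Obj T" "X \<in> Obj T" "Y \<in> Obj T" "Z \<in> Obj T"
  shows "aso (actO T U X) (actO T U Y) (U \<boxtimes> Z) \<cdot> rwh U (X \<boxtimes> Y) (actO T U X \<boxtimes> actO T U Y) U (c (X \<boxtimes> Y)) Z =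
    (\<iota> (actO T U X) \<star> rwh U Y (actO T U Y) U (c Y) Z) \<cdot>
      (rwh U X (actO T U X) U (c X) (Y \<boxtimes> Z) \<cdot> (\<iota> U \<star> aso X Y Z))"
proof -
  let ?X = "actO T U X" and ?Y = "actO T U Y"
  note [simp] = assms(2-5) hb_simps(2-4)[OF assms(1)]
  have "aso ?X ?Y (U \<boxtimes> Z) \<cdot> rwh U (X \<boxtimes> Y) (?X \<boxtimes> ?Y) U (c (X \<boxtimes> Y)) Z =
    (\<iota> ?X \<star> aso ?Y U Z) \<cdot> rwh U (X \<boxtimes> Y) ?X (?Y \<boxtimes> U) (aso ?X ?Y U \<cdot> c (X \<boxtimes> Y)) Z"
    by (simp add: rwh_aso)
  also have "\<dots> = (\<iota> ?X \<star> aso ?Y U Z) \<cdot> (rwh ?X (U \<boxtimes> Y) ?X (?Y \<boxtimes> U) (\<iota> ?X \<star> c Y) Z \<cdot>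
     rwh U (X \<boxtimes> Y) ?X (U \<boxtimes> Y) (rwh U X ?X U (c X) Y) Z)"
    unfolding hb_TenO[OF assms(1-4)] by (subst rwh_comp[where D = ?X and E = "U \<boxtimes> Y"]) simp_all
  also have "\<dots> = (\<iota> ?X \<star> (aso ?Y U Z \<cdot> (c Y \<star> \<iota> Z))) \<cdot> rwh U (X \<boxtimes> Y) ?X (U \<boxtimes> Y) (rwh U X ?X U (c X) Y) Z"
    by (simp add: rwh_whisker_left whisker_left_comp comp_assoc)
  also have "aso ?Y U Z \<cdot> (c Y \<star> \<iota> Z) = rwh U Y ?Y U (c Y) Z \<cdot> aso U Y Z"
    by (simp add: rwh_def comp_assoc)
  also have "(\<iota> ?X \<star> (rwh U Y ?Y U (c Y) Z \<cdot> aso U Y Z)) \<cdot> rwh U (X \<boxtimes> Y) ?X (U \<boxtimes> Y) (rwh U X ?X U (c X) Y) Z =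
    (\<iota> ?X \<star> rwh U Y ?Y U (c Y) Z) \<cdot> ((\<iota> ?X \<star> aso U Y Z) \<cdot> rwh U (X \<boxtimes> Y) ?X (U \<boxtimes> Y) (rwh U X ?X U (c X) Y) Z)"
    by (simp add: whisker_left_comp comp_assoc)
  also have "\<dots> = (\<iota> ?X \<star> rwh U Y ?Y U (c Y) Z) \<cdot> (rwh U X ?X U (c X) (Y \<boxtimes> Z) \<cdot> (\<iota> U \<star> aso X Y Z))"
    by (simp add: rwh_rwh)
  finally show ?thesis .
qed

text \<open>The half braiding in \<open>center_TenO\<close>, nested to the right and with the
  whiskering of \<open>c\<close> gathered in \<open>rwh\<close>; the agreement is
  \<open>center_TenO_eq\<close>.\<close>

definition tensor_hb :: "'o \<Rightarrow> ('o \<Rightarrow> 'a) \<Rightarrow> 'o \<Rightarrow> ('o \<Rightarrow> 'a) \<Rightarrow> 'o \<Rightarrow> 'a" where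
  "tensor_hb U c U' c' X =
     rwh U (actO T U' X) (actO T U (actO T U' X)) U (c (actO T U' X)) U' \<cdot> ((\<iota> U \<star> c' X) \<cdot> aso U U' X)"

lemma center_TenO_eq:
  assumes "half_braiding U c" "half_braiding U' c'" "U \<in> Obj T" "U' \<in> Obj T"
  shows "center_TenO (U, c) (U', c') = (U \<boxtimes> U', \<lambda>X\<in>Obj T. tensor_hb U c U' c' X)"
  unfolding center_TenO_def tensor_hb_def rwh_def
  by (auto simp: comp_assoc assms(3,4) hb_simps(2-4)[OF assms(1)] hb_simps(2-4)[OF assms(2)] intro!: restrict_ext)

lemma tensor_hb_isos:
  assumes "half_braiding U c" "half_braiding U' c'" "U \<in> Obj T" "U' \<in> Obj T" "X \<in> Obj T"
  shows "tensor_hb U c U' c' X \<in> isos T (U \<boxtimes> U' \<boxtimes> X) (actO T U (actO T U' X) \<boxtimes> (U \<boxtimes> U'))"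
    "tensor_hb U c U' c' X \<in> Arr T" "Dom T (tensor_hb U c U' c' X) = U \<boxtimes> U' \<boxtimes> X"
    "Cod T (tensor_hb U c U' c' X) = actO T U (actO T U' X) \<boxtimes> (U \<boxtimes> U')"
proof -
  note [simp] = assms(3-5)
  show i: "tensor_hb U c U' c' X \<in> isos T (U \<boxtimes> U' \<boxtimes> X) (actO T U (actO T U' X) \<boxtimes> (U \<boxtimes> U'))"
    unfolding tensor_hb_def rwh_def
  proof (rule comp_isos[OF comp_isos comp_isos[OF comp_isos]])
    show "aso U U' X \<in> isos T (U \<boxtimes> U' \<boxtimes> X) (U \<boxtimes> (U' \<boxtimes> X))" by (simp add: Assoc_iso)
    show "\<iota> U \<star> c' X \<in> isos T (U \<boxtimes> (U' \<boxtimes> X)) (U \<boxtimes> (actO T U' X \<boxtimes> U'))"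
      by (rule whisker_isos) (simp_all add: hb_simps(1)[OF assms(2)])
    show "asi U (actO T U' X) U' \<in> isos T (U \<boxtimes> (actO T U' X \<boxtimes> U')) (U \<boxtimes> actO T U' X \<boxtimes> U')"
      by (simp add: inv_isos Assoc_iso)
    show "c (actO T U' X) \<star> \<iota> U' \<in> isos T (U \<boxtimes> actO T U' X \<boxtimes> U') (actO T U (actO T U' X) \<boxtimes> U \<boxtimes> U')"
      by (rule whisker_isos) (simp_all add: hb_simps(1)[OF assms(1)])
    show "aso (actO T U (actO T U' X)) U U' \<in> isos T (actO T U (actO T U' X) \<boxtimes> U \<boxtimes> U') (actO T U (actO T U' X) \<boxtimes> (U \<boxtimes> U'))"
      by (simp add: Assoc_iso)
  qed
  show "tensor_hb U c U' c' X \<in> Arr T" "Dom T (tensor_hb U c U' c' X) = U \<boxtimes> U' \<boxtimes> X"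
    "Cod T (tensor_hb U c U' c' X) = actO T U (actO T U' X) \<boxtimes> (U \<boxtimes> U')"
    using isosD[OF i] by auto
qed

text \<open>Whiskering passes to the two factors: \<open>rwh_asi\<close> takes out the initial
  associator, \<open>rwh_comp\<close> splits the composite, and \<open>rwh_rwh\<close> merges the
  two whiskerings of \<open>c\<close>. It serves both for the multiplicativity of
  \<open>tensor_hb\<close> and for the associators as arrows of the center.\<close>

lemma rwh_tensor_hb:
  assumes "half_braiding U c" "half_braiding U' c'" "U \<in> Obj T" "U' \<in> Obj T" "X \<in> Obj T" "Y \<in> Obj T"
  shows "(\<iota> (actO T U (actO T U' X)) \<star> aso U U' Y) \<cdot>
      rwh (U \<boxtimes> U') X (actO T U (actO T U' X)) (U \<boxtimes> U') (tensor_hb U c U' c' X) Y =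
    rwh U (actO T U' X) (actO T U (actO T U' X)) U (c (actO T U' X)) (U' \<boxtimes> Y) \<cdot>
      ((\<iota> U \<star> rwh U' X (actO T U' X) U' (c' X) Y) \<cdot> aso U U' (X \<boxtimes> Y))"
proof -
  let ?X = "actO T U' X" let ?Z = "actO T U ?X"
  note [simp] = assms(3-6) hb_simps(2-4)[OF assms(1)] hb_simps(2-4)[OF assms(2)]
  let ?r = "rwh U ?X ?Z U (c ?X) U'"
  have "rwh (U \<boxtimes> U') X ?Z (U \<boxtimes> U') (tensor_hb U c U' c' X) Y = rwh (U \<boxtimes> U') X ?Z (U \<boxtimes> U') ((?r \<cdot> (\<iota> U \<star> c' X)) \<cdot> aso U U' X) Y"
    by (simp add: tensor_hb_def comp_assoc)
  also have "\<dots> = rwh U (U' \<boxtimes> X) ?Z (U \<boxtimes> U') (?r \<cdot> (\<iota> U \<star> c' X)) Y \<cdot> ((\<iota> U \<star> asi U' X Y) \<cdot> aso U U' (X \<boxtimes> Y))"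
    by (rule rwh_asi) simp_all
  also have "rwh U (U' \<boxtimes> X) ?Z (U \<boxtimes> U') (?r \<cdot> (\<iota> U \<star> c' X)) Y =
    rwh U (?X \<boxtimes> U') ?Z (U \<boxtimes> U') ?r Y \<cdot> rwh U (U' \<boxtimes> X) U (?X \<boxtimes> U') (\<iota> U \<star> c' X) Y"
    by (rule rwh_comp) simp_all
  also have "rwh U (U' \<boxtimes> X) U (?X \<boxtimes> U') (\<iota> U \<star> c' X) Y = \<iota> U \<star> (c' X \<star> \<iota> Y)"
    by (rule rwh_whisker_left) simp_all
  finally have "(\<iota> ?Z \<star> aso U U' Y) \<cdot> rwh (U \<boxtimes> U') X ?Z (U \<boxtimes> U') (tensor_hb U c U' c' X) Y =
     ((\<iota> ?Z \<star> aso U U' Y) \<cdot> rwh U (?X \<boxtimes> U') ?Z (U \<boxtimes> U') ?r Y) \<cdot> ((\<iota> U \<star> (c' X \<star> \<iota> Y)) \<cdot> ((\<iota> U \<star> asi U' X Y) \<cdot> aso U U' (X \<boxtimes> Y)))"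
    by (simp add: comp_assoc)
  also have "(\<iota> ?Z \<star> aso U U' Y) \<cdot> rwh U (?X \<boxtimes> U') ?Z (U \<boxtimes> U') ?r Y = rwh U ?X ?Z U (c ?X) (U' \<boxtimes> Y) \<cdot> (\<iota> U \<star> aso ?X U' Y)"
    by (rule rwh_rwh) simp_all
  finally show ?thesis
    by (simp add: rwh_def whisker_left_comp comp_assoc)
qed

text \<open>For naturality an arrow \<open>f\<close> passes first through \<open>c'\<close>,
  becoming \<open>actA T U' f\<close>, and then through \<open>c\<close>. For multiplicativity both
  half braidings are expanded at the tensor product; the factors then come in the wrong order, and
  the two in the middle have to be exchanged.\<close>

lemma tensor_hb_half_braiding:
  assumes "half_braiding U c" "half_braiding U' c'" "U \<in> Obj T" "U' \<in> Obj T"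
  shows "half_braiding (U \<boxtimes> U') (\<lambda>X\<in>Obj T. tensor_hb U c U' c' X)"
proof (rule half_braidingI)
  note [simp] = assms(3,4) hb_simps(2-4)[OF assms(1)] hb_simps(2-4)[OF assms(2)]
    tensor_hb_isos(2-)[OF assms]
  show "U \<boxtimes> U' \<in> Obj T" "(\<lambda>X\<in>Obj T. tensor_hb U c U' c' X) \<in> extensional (Obj T)" by simp_all
  show "(\<lambda>X\<in>Obj T. tensor_hb U c U' c' X) X \<in> isos T (U \<boxtimes> U' \<boxtimes> X) (actO T (U \<boxtimes> U') X \<boxtimes> (U \<boxtimes> U'))"
    if "X \<in> Obj T" for X
    using tensor_hb_isos(1)[OF assms that] that by simp
  fix f assume f [simp]: "f \<in> Arr T"
  have n: "(\<iota> U \<star> c' (Cod T f)) \<cdot> (\<iota> U \<star> (\<iota> U' \<star> f)) = (\<iota> U \<star> (actA T U' f \<star> \<iota> U')) \<cdot> (\<iota> U \<star> c' (Dom T f))"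
    using hb_natural[OF assms(2) f] by (simp add: whisker_left_comp[symmetric])
  let ?X = "actO T U' (Dom T f)" and ?Y = "actO T U' (Cod T f)"
  have "tensor_hb U c U' c' (Cod T f) \<cdot> (\<iota> (U \<boxtimes> U') \<star> f) =
    rwh U ?Y (actO T U ?Y) U (c ?Y) U' \<cdot> ((\<iota> U \<star> c' (Cod T f)) \<cdot> (aso U U' (Cod T f) \<cdot> (\<iota> (U \<boxtimes> U') \<star> f)))"
    by (simp add: tensor_hb_def comp_assoc)
  also have "aso U U' (Cod T f) \<cdot> (\<iota> (U \<boxtimes> U') \<star> f) = (\<iota> U \<star> (\<iota> U' \<star> f)) \<cdot> aso U U' (Dom T f)"
    using aso_natural[of "\<iota> U" "\<iota> U'" f] by simp
  also have "(\<iota> U \<star> c' (Cod T f)) \<cdot> ((\<iota> U \<star> (\<iota> U' \<star> f)) \<cdot> aso U U' (Dom T f)) =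
     (\<iota> U \<star> (actA T U' f \<star> \<iota> U')) \<cdot> ((\<iota> U \<star> c' (Dom T f)) \<cdot> aso U U' (Dom T f))"
    by (rule square_left_rewrite[OF n]) simp_all
  also have "rwh U ?Y (actO T U ?Y) U (c ?Y) U' \<cdot> \<dots> =
    (actA T U (actA T U' f) \<star> \<iota> (U \<boxtimes> U')) \<cdot> (rwh U ?X (actO T U ?X) U (c ?X) U' \<cdot> ((\<iota> U \<star> c' (Dom T f)) \<cdot> aso U U' (Dom T f)))"
  \<comment> \<open>Naturality of \<open>c\<close> at the arrow \<open>actA T U' f\<close>, carried
    through the whiskering by \<open>U'\<close>.\<close>
  proof (rule square_left_rewrite)
    let ?g = "actA T U' f"
    have "rwh U ?Y (actO T U ?Y) U (c ?Y) U' \<cdot> (\<iota> U \<star> (?g \<star> \<iota> U')) =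
       aso (actO T U ?Y) U U' \<cdot> ((c ?Y \<star> \<iota> U') \<cdot> (asi U ?Y U' \<cdot> (\<iota> U \<star> (?g \<star> \<iota> U'))))"
      by (simp add: rwh_def comp_assoc)
    also have "asi U ?Y U' \<cdot> (\<iota> U \<star> (?g \<star> \<iota> U')) = ((\<iota> U \<star> ?g) \<star> \<iota> U') \<cdot> asi U ?X U'"
      using asi_natural[of "\<iota> U" ?g "\<iota> U'"] by simp
    also have "(c ?Y \<star> \<iota> U') \<cdot> (((\<iota> U \<star> ?g) \<star> \<iota> U') \<cdot> asi U ?X U') =
      ((actA T U ?g \<star> \<iota> U) \<star> \<iota> U') \<cdot> ((c ?X \<star> \<iota> U') \<cdot> asi U ?X U')"
      by (rule square_left_rewrite) (use hb_natural[OF assms(1), of ?g] in \<open>simp_all add: whisker_right_comp[symmetric]\<close>)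
    also have "aso (actO T U ?Y) U U' \<cdot> \<dots> = (actA T U ?g \<star> \<iota> (U \<boxtimes> U')) \<cdot> (aso (actO T U ?X) U U' \<cdot> ((c ?X \<star> \<iota> U') \<cdot> asi U ?X U'))"
      by (rule square_left_rewrite) (use aso_natural[of "actA T U ?g" "\<iota> U" "\<iota> U'"] in simp_all)
    finally show "rwh U ?Y (actO T U ?Y) U (c ?Y) U' \<cdot> (\<iota> U \<star> (?g \<star> \<iota> U')) =
       (actA T U ?g \<star> \<iota> (U \<boxtimes> U')) \<cdot> rwh U ?X (actO T U ?X) U (c ?X) U'" by (simp add: rwh_def)
  qed simp_all
  finally show "(\<lambda>X\<in>Obj T. tensor_hb U c U' c' X) (Cod T f) \<cdot> (\<iota> (U \<boxtimes> U') \<star> f) =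
     (actA T (U \<boxtimes> U') f \<star> \<iota> (U \<boxtimes> U')) \<cdot> (\<lambda>X\<in>Obj T. tensor_hb U c U' c' X) (Dom T f)"
    by (simp add: tensor_hb_def comp_assoc)
next
  note [simp] = assms(3,4) hb_simps(2-4)[OF assms(1)] hb_simps(2-4)[OF assms(2)]
    tensor_hb_isos(2-)[OF assms]
  fix X Y assume [simp]: "X \<in> Obj T" "Y \<in> Obj T"
  let ?X = "actO T U' X" and ?Y = "actO T U' Y" let ?Z = "actO T U ?X" and ?W = "actO T U ?Y"
  let ?h = "tensor_hb U c U' c'"
  have "aso ?Z ?W (U \<boxtimes> U') \<cdot> ?h (X \<boxtimes> Y) =
      (aso ?Z ?W (U \<boxtimes> U') \<cdot> rwh U (?X \<boxtimes> ?Y) (?Z \<boxtimes> ?W) U (c (?X \<boxtimes> ?Y)) U') \<cdot> ((\<iota> U \<star> c' (X \<boxtimes> Y)) \<cdot> aso U U' (X \<boxtimes> Y))"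
    by (simp add: tensor_hb_def comp_assoc)
  also have "\<dots> = (\<iota> ?Z \<star> rwh U ?Y ?W U (c ?Y) U') \<cdot> (rwh U ?X ?Z U (c ?X) (?Y \<boxtimes> U') \<cdot>
      ((\<iota> U \<star> (aso ?X ?Y U' \<cdot> c' (X \<boxtimes> Y))) \<cdot> aso U U' (X \<boxtimes> Y)))"
    unfolding hb_TenO_whisker[OF assms(1,3) actO_simps(1)[OF assms(4) \<open>X \<in> Obj T\<close>] actO_simps(1)[OF assms(4) \<open>Y \<in> Obj T\<close>] assms(4)]
    by (simp add: whisker_left_comp comp_assoc)
  also have "\<iota> U \<star> (aso ?X ?Y U' \<cdot> c' (X \<boxtimes> Y)) = (\<iota> U \<star> (\<iota> ?X \<star> c' Y)) \<cdot> (\<iota> U \<star> rwh U' X ?X U' (c' X) Y)"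
    by (simp add: hb_TenO[OF assms(2,4)] whisker_left_comp)
  also have "rwh U ?X ?Z U (c ?X) (?Y \<boxtimes> U') \<cdot> (((\<iota> U \<star> (\<iota> ?X \<star> c' Y)) \<cdot> (\<iota> U \<star> rwh U' X ?X U' (c' X) Y)) \<cdot> aso U U' (X \<boxtimes> Y)) =
     (rwh U ?X ?Z U (c ?X) (?Y \<boxtimes> U') \<cdot> (\<iota> U \<star> (\<iota> ?X \<star> c' Y))) \<cdot> ((\<iota> U \<star> rwh U' X ?X U' (c' X) Y) \<cdot> aso U U' (X \<boxtimes> Y))"
    by (simp add: comp_assoc)
  \<comment> \<open>The exchange: \<open>c\<close> at \<open>?X\<close> and \<open>c'\<close> at
    \<open>Y\<close> involve disjoint tensor factors.\<close>
  also have "rwh U ?X ?Z U (c ?X) (?Y \<boxtimes> U') \<cdot> (\<iota> U \<star> (\<iota> ?X \<star> c' Y)) = (\<iota> ?Z \<star> (\<iota> U \<star> c' Y)) \<cdot> rwh U ?X ?Z U (c ?X) (U' \<boxtimes> Y)"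
    using rwh_natural[of "c ?X" U ?X ?Z U "c' Y"] by simp
  also have "((\<iota> ?Z \<star> (\<iota> U \<star> c' Y)) \<cdot> rwh U ?X ?Z U (c ?X) (U' \<boxtimes> Y)) \<cdot> ((\<iota> U \<star> rwh U' X ?X U' (c' X) Y) \<cdot> aso U U' (X \<boxtimes> Y)) =
     (\<iota> ?Z \<star> (\<iota> U \<star> c' Y)) \<cdot> ((\<iota> ?Z \<star> aso U U' Y) \<cdot> rwh (U \<boxtimes> U') X ?Z (U \<boxtimes> U') (?h X) Y)"
    using rwh_tensor_hb[OF assms, of X Y] by (simp add: comp_assoc)
  finally show "aso (actO T (U \<boxtimes> U') X) (actO T (U \<boxtimes> U') Y) (U \<boxtimes> U') \<cdot> (\<lambda>X\<in>Obj T. ?h X) (X \<boxtimes> Y) =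
      (\<iota> (actO T (U \<boxtimes> U') X) \<star> (\<lambda>X\<in>Obj T. ?h X) Y) \<cdot> rwh (U \<boxtimes> U') X (actO T (U \<boxtimes> U') X) (U \<boxtimes> U') ((\<lambda>X\<in>Obj T. ?h X) X) Y"
    by (simp add: tensor_hb_def whisker_left_comp comp_assoc)
qed

text \<open>Multiplicativity is the coherence of the units: the triangle cancels the constraints
  that meet between the two factors, and \<open>LUnit_TenO\<close> and \<open>RUnit_TenO\<close>
  identify the remaining ones with those of \<open>X \<boxtimes> Y\<close>.\<close>

lemma unit_half_braiding: "half_braiding \<I> (\<lambda>X\<in>Obj T. inv_arrow T (RUnit T X) \<cdot> LUnit T X)"
proof (rule half_braidingI)
  let ?c = "\<lambda>X\<in>Obj T. inv_arrow T (RUnit T X) \<cdot> LUnit T X"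
  show "?c X \<in> isos T (\<I> \<boxtimes> X) (actO T \<I> X \<boxtimes> \<I>)" if "X \<in> Obj T" for X
    using that by (simp add: comp_isos[OF LUnit_iso inv_isos[OF RUnit_iso]])
  show "?c (Cod T f) \<cdot> (\<iota> \<I> \<star> f) = (actA T \<I> f \<star> \<iota> \<I>) \<cdot> ?c (Dom T f)" if f [simp]: "f \<in> Arr T" for f
  proof -
    have "inv_arrow T (RUnit T (Cod T f)) \<cdot> f = (f \<star> \<iota> \<I>) \<cdot> inv_arrow T (RUnit T (Dom T f))"
      using square_inv[OF RUnit_iso[of "Dom T f"] RUnit_iso[of "Cod T f"], of "f \<star> \<iota> \<I>" f] RUnit_nat[OF f]
      by (simp add: arrowsI)
    from square_left_rewrite[OF this, of "LUnit T (Dom T f)"] LUnit_nat[OF f] show ?thesis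
      by (simp add: comp_assoc)
  qed
  fix X Y assume [simp]: "X \<in> Obj T" "Y \<in> Obj T"
  have "(\<iota> X \<star> LUnit T Y) \<cdot> (aso X \<I> Y \<cdot> (inv_arrow T (RUnit T X) \<star> \<iota> Y)) = (RUnit T X \<cdot> inv_arrow T (RUnit T X)) \<star> \<iota> Y"
    by (subst comp_assoc[symmetric]) (simp_all add: triangle whisker_right_comp del: RUnit_simps(7))
  then have 1: "(\<iota> X \<star> LUnit T Y) \<cdot> (aso X \<I> Y \<cdot> (inv_arrow T (RUnit T X) \<star> \<iota> Y)) = \<iota> (X \<boxtimes> Y)"
    by simp
  have "(\<iota> X \<star> ?c Y) \<cdot> rwh \<I> X X \<I> (?c X) Y =
    (\<iota> X \<star> inv_arrow T (RUnit T Y)) \<cdot> (((\<iota> X \<star> LUnit T Y) \<cdot> (aso X \<I> Y \<cdot> (inv_arrow T (RUnit T X) \<star> \<iota> Y))) \<cdot>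
      ((LUnit T X \<star> \<iota> Y) \<cdot> asi \<I> X Y))"
    by (simp add: rwh_def whisker_left_comp whisker_right_comp comp_assoc)
  also have "\<dots> = (\<iota> X \<star> inv_arrow T (RUnit T Y)) \<cdot> LUnit T (X \<boxtimes> Y)"
    unfolding 1 by (simp add: LUnit_TenO[symmetric] comp_assoc)
  also have "\<iota> X \<star> inv_arrow T (RUnit T Y) = aso X Y \<I> \<cdot> inv_arrow T (RUnit T (X \<boxtimes> Y))"
  proof -
    have "(\<iota> X \<star> inv_arrow T (RUnit T Y)) \<cdot> ((\<iota> X \<star> RUnit T Y) \<cdot> (aso X Y \<I> \<cdot> inv_arrow T (RUnit T (X \<boxtimes> Y)))) =
       (\<iota> X \<star> inv_arrow T (RUnit T Y)) \<cdot> (((\<iota> X \<star> RUnit T Y) \<cdot> aso X Y \<I>) \<cdot> inv_arrow T (RUnit T (X \<boxtimes> Y)))"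
      by (simp add: comp_assoc)
    also have "\<dots> = \<iota> X \<star> inv_arrow T (RUnit T Y)"
      by (subst RUnit_TenO) simp_all
    finally show ?thesis
      by (subst (asm) comp_assoc[symmetric]) (simp_all add: whisker_left_comp[symmetric])
  qed
  finally show "aso (actO T \<I> X) (actO T \<I> Y) \<I> \<cdot> ?c (X \<boxtimes> Y) = (\<iota> (actO T \<I> X) \<star> ?c Y) \<cdot> rwh \<I> X (actO T \<I> X) \<I> (?c X) Y"
    by (simp add: comp_assoc)
qed simp_all

lemma ConjA_rwh:
  assumes "\<beta> \<in> carrier \<pi>" "f \<in> Arr T" "Dom T f = A \<boxtimes> B" "Cod T f = D \<boxtimes> E" "A \<in> Obj T" "B \<in> Obj T" "D \<in> Obj T"
    "E \<in> Obj T" "Y \<in> Obj T"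
  shows "ConjA T \<beta> (rwh A B D E f Y) =
    rwh (ConjO T \<beta> A) (ConjO T \<beta> B) (ConjO T \<beta> D) (ConjO T \<beta> E) (ConjA T \<beta> f) (ConjO T \<beta> Y)"
proof -
  have "ConjA T \<beta> (asi A B Y) = asi (ConjO T \<beta> A) (ConjO T \<beta> B) (ConjO T \<beta> Y)"
    using ConjA_isos(2)[OF assms(1) Assoc_iso] assms by (simp add: Conj_Assoc)
  then show ?thesis
    using assms by (simp add: rwh_def ConjA_Comp Conj_TenA Conj_Assoc)
qed

text \<open>Conjugation by \<open>\<beta>\<close> is a strict tensor functor, so it maps the axioms
  of \<open>c\<close> at objects and arrows conjugated by the inverse of \<open>\<beta>\<close> to
  the axioms wanted.\<close>

lemma conj_half_braiding:
  assumes "half_braiding U c" "U \<in> Obj T" "\<beta> \<in> carrier \<pi>"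
  shows "half_braiding (ConjO T \<beta> U) (\<lambda>X\<in>Obj T. ConjA T \<beta> (c (ConjO T (inv\<^bsub>\<pi>\<^esub> \<beta>) X)))"
proof (rule half_braidingI)
  note [simp] = assms(2,3) hb_simps(2-4)[OF assms(1)] Conj_TenO actO_ConjO actA_ConjO
  let ?c = "\<lambda>X\<in>Obj T. ConjA T \<beta> (c (ConjO T (inv\<^bsub>\<pi>\<^esub> \<beta>) X))"
  show "?c X \<in> isos T (ConjO T \<beta> U \<boxtimes> X) (actO T (ConjO T \<beta> U) X \<boxtimes> ConjO T \<beta> U)" if "X \<in> Obj T" for X
    using ConjA_isos(1)[OF assms(3) hb_simps(1)[OF assms(1,2), of "ConjO T (inv\<^bsub>\<pi>\<^esub> \<beta>) X"]] that
    by simp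
  show "?c (Cod T f) \<cdot> (\<iota> (ConjO T \<beta> U) \<star> f) = (actA T (ConjO T \<beta> U) f \<star> \<iota> (ConjO T \<beta> U)) \<cdot> ?c (Dom T f)"
    if f [simp]: "f \<in> Arr T" for f
    using arg_cong[OF hb_natural[OF assms(1), of "ConjA T (inv\<^bsub>\<pi>\<^esub> \<beta>) f"], of "ConjA T \<beta>"]
    by (simp add: ConjA_Comp Conj_TenA)
  fix X Y assume [simp]: "X \<in> Obj T" "Y \<in> Obj T"
  let ?X = "ConjO T (inv\<^bsub>\<pi>\<^esub> \<beta>) X" and ?Y = "ConjO T (inv\<^bsub>\<pi>\<^esub> \<beta>) Y"
  show "aso (actO T (ConjO T \<beta> U) X) (actO T (ConjO T \<beta> U) Y) (ConjO T \<beta> U) \<cdot> ?c (X \<boxtimes> Y) =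
     (\<iota> (actO T (ConjO T \<beta> U) X) \<star> ?c Y) \<cdot> rwh (ConjO T \<beta> U) X (actO T (ConjO T \<beta> U) X) (ConjO T \<beta> U) (?c X) Y"
    using arg_cong[OF hb_TenO[OF assms(1,2), of ?X ?Y], of "ConjA T \<beta>"]
    by (simp add: ConjA_Comp Conj_TenA Conj_Assoc ConjA_rwh)
qed (use assms in simp_all)

section \<open>The center as a category\<close>

lemma center_obj_iff: "Z \<in> center_obj \<longleftrightarrow> fst Z \<in> Obj T \<and> half_braiding (fst Z) (snd Z)"
  by (auto simp: center_obj_def)

lemma center_objD:
  "Z \<in> center_obj \<Longrightarrow> fst Z \<in> Obj T" "Z \<in> center_obj \<Longrightarrow> half_braiding (fst Z) (snd Z)"
  by (auto simp: center_obj_def)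

lemma center_simps [simp]:
  "Obj center = center_obj" "Arr center = center_arr" "Dom center = source" "Cod center = target"
  "Ident center Z = Arrow Z Z (\<iota> (fst Z))"
  "Comp center g f = Arrow (source f) (target g) (body g \<cdot> body f)"
  "TenO center = center_TenO"
  "TenA center f g = Arrow (center_TenO (source f) (source g)) (center_TenO (target f) (target g))
               (body f \<star> body g)"
  "Unit center = center_Unit"
  "Assoc center Z Z' Z'' = Arrow (center_TenO (center_TenO Z Z') Z'') (center_TenO Z (center_TenO Z' Z''))
               (Assoc T (fst Z) (fst Z') (fst Z''))"
  "LUnit center Z = Arrow (center_TenO center_Unit Z) Z (LUnit T (fst Z))"
  "RUnit center Z = Arrow (center_TenO Z center_Unit) Z (RUnit T (fst Z))"
  "Grade center Z = Grade T (fst Z)"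
  "ConjO center = center_ConjO"
  "ConjA center \<beta> f = Arrow (center_ConjO \<beta> (source f)) (center_ConjO \<beta> (target f)) (ConjA T \<beta> (body f))"
  "Braid center Z Z' = Arrow (center_TenO Z Z') (center_TenO (center_ConjO (Grade T (fst Z)) Z') Z)
               (snd Z (fst Z'))"
  by (simp_all add: center_def)

lemma fst_center [simp]:
  "fst (center_TenO Z Z') = fst Z \<boxtimes> fst Z'" "fst center_Unit = \<I>"
  "fst (center_ConjO \<beta> Z) = ConjO T \<beta> (fst Z)"
  by (simp_all add: center_TenO_def center_Unit_def center_ConjO_def split_beta)

lemma snd_center_ConjO: "X \<in> Obj T \<Longrightarrow> snd (center_ConjO \<beta> Z) X = ConjA T \<beta> (snd Z (ConjO T (inv\<^bsub>\<pi>\<^esub> \<beta>) X))"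
  by (simp add: center_ConjO_def split_beta)

lemma snd_center_Unit: "X \<in> Obj T \<Longrightarrow> snd center_Unit X = inv_arrow T (RUnit T X) \<cdot> LUnit T X"
  by (simp add: center_Unit_def)

lemma snd_center_TenO:
  assumes "Z \<in> center_obj" "Z' \<in> center_obj" "X \<in> Obj T"
  shows "snd (center_TenO Z Z') X = tensor_hb (fst Z) (snd Z) (fst Z') (snd Z') X"
  using center_TenO_eq[of "fst Z" "snd Z" "fst Z'" "snd Z'"] assms center_objD by simp

lemma snd_center_obj:
  assumes "Z \<in> center_obj" "X \<in> Obj T"
  shows "snd Z X \<in> Arr T" "Dom T (snd Z X) = fst Z \<boxtimes> X" "Cod T (snd Z X) = actO T (fst Z) X \<boxtimes> fst Z"
  using hb_simps(2-4)[OF center_objD(2)[OF assms(1)] center_objD(1)[OF assms(1)] assms(2)] by auto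

lemma center_TenO_closed [simp]:
  "\<lbrakk>Z \<in> center_obj; Z' \<in> center_obj\<rbrakk> \<Longrightarrow> center_TenO Z Z' \<in> center_obj"
  using center_TenO_eq[of "fst Z" "snd Z" "fst Z'" "snd Z'"]
    tensor_hb_half_braiding[of "fst Z" "snd Z" "fst Z'" "snd Z'"]
  by (simp add: center_obj_iff)

lemma center_Unit_closed [simp]: "center_Unit \<in> center_obj"
  using unit_half_braiding by (simp add: center_obj_iff center_Unit_def)

lemma center_ConjO_closed [simp]:
  "\<lbrakk>\<beta> \<in> carrier \<pi>; Z \<in> center_obj\<rbrakk> \<Longrightarrow> center_ConjO \<beta> Z \<in> center_obj"
  using conj_half_braiding[of "fst Z" "snd Z" \<beta>] by (simp add: center_obj_iff) (simp add: center_ConjO_def split_beta)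

lemma center_arr_iff:
  "Arrow Z Z' f \<in> center_arr \<longleftrightarrow> Z \<in> center_obj \<and> Z' \<in> center_obj \<and> f \<in> Arr T \<and> Dom T f = fst Z \<and> Cod T f = fst Z' \<and>
     (\<forall>X\<in>Obj T. (\<iota> (actO T (fst Z) X) \<star> f) \<cdot> snd Z X = snd Z' X \<cdot> (f \<star> \<iota> X))"
  by (cases Z; cases Z') (auto simp: center_arr_def arrows_def)

lemma center_arr_cases:
  assumes "f \<in> center_arr"
  shows "source f \<in> center_obj" "target f \<in> center_obj" "body f \<in> Arr T"
    "Dom T (body f) = fst (source f)" "Cod T (body f) = fst (target f)"
    "X \<in> Obj T \<Longrightarrow> (\<iota> (actO T (fst (source f)) X) \<star> body f) \<cdot> snd (source f) X = snd (target f) X \<cdot> (body f \<star> \<iota> X)"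
  using assms center_arr_iff[of "source f" "target f" "body f"] by auto

lemma arrows_center: "f \<in> arrows center Z Z' \<longleftrightarrow> (\<exists>g. f = Arrow Z Z' g \<and> Arrow Z Z' g \<in> center_arr)"
  by (cases f) (auto simp: arrows_def)

text \<open>Source and target of an arrow have the same degree, so the conjugates of
  \<open>X\<close> in the two compatibility squares agree and the squares can be pasted.\<close>

lemma center_Comp_closed:
  assumes "Arrow Z Z' f \<in> center_arr" "Arrow Z' Z'' g \<in> center_arr"
  shows "Arrow Z Z'' (g \<cdot> f) \<in> center_arr"
  unfolding center_arr_iff
proof (intro conjI ballI)
  note f = assms(1)[unfolded center_arr_iff] and g = assms(2)[unfolded center_arr_iff]
  fix X assume X [simp]: "X \<in> Obj T"
  note [simp] = center_objD snd_center_obj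
  have a: "actO T (fst Z) X = actO T (fst Z') X"
    using actO_arrow[of f X] f by auto
  have "(\<iota> (actO T (fst Z) X) \<star> (g \<cdot> f)) \<cdot> snd Z X = (\<iota> (actO T (fst Z') X) \<star> g) \<cdot> ((\<iota> (actO T (fst Z) X) \<star> f) \<cdot> snd Z X)"
    using f g a by (simp add: whisker_left_comp comp_assoc)
  also have "(\<iota> (actO T (fst Z) X) \<star> f) \<cdot> snd Z X = snd Z' X \<cdot> (f \<star> \<iota> X)" using f by simp
  also have "(\<iota> (actO T (fst Z') X) \<star> g) \<cdot> (snd Z' X \<cdot> (f \<star> \<iota> X)) = snd Z'' X \<cdot> ((g \<star> \<iota> X) \<cdot> (f \<star> \<iota> X))"
    by (rule square_left_rewrite) (use f g a in auto)
  finally show "(\<iota> (actO T (fst Z) X) \<star> (g \<cdot> f)) \<cdot> snd Z X = snd Z'' X \<cdot> ((g \<cdot> f) \<star> \<iota> X)"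
    using f g by (simp add: whisker_right_comp)
qed (use assms in \<open>auto simp: center_arr_iff\<close>)

sublocale center: category center
proof
  fix Z assume Z: "Z \<in> Obj center"
  then show "Ident center Z \<in> arrows center Z Z"
    using center_objD[of Z] hb_simps(2-4)[of "fst Z" "snd Z"] by (simp add: arrows_center center_arr_iff)
next
  fix f Z Z' g Z'' assume "f \<in> arrows center Z Z'" "g \<in> arrows center Z' Z''"
  then show "Comp center g f \<in> arrows center Z Z''"
    by (auto simp: arrows_center intro: center_Comp_closed)
next
  fix f Z Z' g Z'' h Z'''
  assume "f \<in> arrows center Z Z'" "g \<in> arrows center Z' Z''" "h \<in> arrows center Z'' Z'''"
  then show "Comp center (Comp center h g) f = Comp center h (Comp center g f)"
    by (auto simp: arrows_center center_arr_iff comp_assoc)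
qed (auto simp: arrows_center center_arr_iff dest: center_arr_cases)

text \<open>By \<open>square_inv\<close> the inverse of an arrow compatible with the half braidings
  is again compatible, so invertibility of an arrow of the center can be checked in
  \<open>T\<close>.\<close>

lemma center_isoI:
  assumes "Arrow Z Z' f \<in> center_arr" "f \<in> isos T (fst Z) (fst Z')"
  shows "Arrow Z Z' f \<in> isos center Z Z'" "inv_arrow center (Arrow Z Z' f) = Arrow Z' Z (inv_arrow T f)"
proof -
  note f = assms(1)[unfolded center_arr_iff] and i = isosD[OF assms(2)]
  note [simp] = center_objD snd_center_obj
  have "Arrow Z' Z (inv_arrow T f) \<in> center_arr"
    unfolding center_arr_iff
  proof (intro conjI ballI)
    fix X assume X [simp]: "X \<in> Obj T"
    have a: "actO T (fst Z') X = actO T (fst Z) X"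
      using actO_arrow[of f X] f by auto
    have 1: "\<iota> (actO T (fst Z) X) \<star> f \<in> isos T (actO T (fst Z) X \<boxtimes> fst Z) (actO T (fst Z) X \<boxtimes> fst Z')"
      and 2: "f \<star> \<iota> X \<in> isos T (fst Z \<boxtimes> X) (fst Z' \<boxtimes> X)"
      using whisker_isos(1,2)[OF assms(2)] f by simp_all
    have "snd Z' X \<cdot> (f \<star> \<iota> X) = (\<iota> (actO T (fst Z) X) \<star> f) \<cdot> snd Z X" using f by simp
    then have "inv_arrow T (\<iota> (actO T (fst Z) X) \<star> f) \<cdot> snd Z' X = snd Z X \<cdot> inv_arrow T (f \<star> \<iota> X)"
      by (subst (asm) square_inv[OF 2 1]) (use f a in \<open>auto intro!: arrowsI\<close>)
    then show "(\<iota> (actO T (fst Z') X) \<star> inv_arrow T f) \<cdot> snd Z' X = snd Z X \<cdot> (inv_arrow T f \<star> \<iota> X)"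
      using whisker_isos(3,4)[OF assms(2)] f a by simp
  qed (use f i in auto)
  then have "inverse_arrows center (Arrow Z Z' f) (Arrow Z' Z (inv_arrow T f))"
    using assms(1) i by (simp add: inverse_arrows_def arrows_def)
  then show "Arrow Z Z' f \<in> isos center Z Z'" "inv_arrow center (Arrow Z Z' f) = Arrow Z' Z (inv_arrow T f)"
    using assms(1) by (auto intro!: center.isosI center.inv_arrow_eq simp: arrows_def)
qed

section \<open>The braided T-category structure of the center\<close>

text \<open>\<open>f\<close> passes through the half braiding of \<open>Z\<close> and
  \<open>g\<close> through that of \<open>Z'\<close>, one factor at a time, with naturality of the
  associators in between.\<close>

lemma center_TenA_closed:
  assumes "Arrow Z W f \<in> center_arr" "Arrow Z' W' g \<in> center_arr"
  shows "Arrow (center_TenO Z Z') (center_TenO W W') (f \<star> g) \<in> center_arr"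
  unfolding center_arr_iff
proof (intro conjI ballI)
  note f = assms(1)[unfolded center_arr_iff] and g = assms(2)[unfolded center_arr_iff]
  fix X assume X [simp]: "X \<in> Obj T"
  have Z: "Z \<in> center_obj" "W \<in> center_obj" "Z' \<in> center_obj" "W' \<in> center_obj" using f g by auto
  note [simp] = f[THEN conjunct2, THEN conjunct2, THEN conjunct1] g[THEN conjunct2, THEN conjunct2, THEN conjunct1]
  have d [simp]: "Dom T f = fst Z" "Cod T f = fst W" "Dom T g = fst Z'" "Cod T g = fst W'" using f g by auto
  note [simp] = Z[THEN center_objD(1)] Z[THEN center_objD(2), THEN hb_simps(2)] Z[THEN center_objD(2), THEN hb_simps(3)]
    Z[THEN center_objD(2), THEN hb_simps(4)]
  have a: "actO T (fst W) Y = actO T (fst Z) Y" "actO T (fst W') Y = actO T (fst Z') Y" for Y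
    using actO_arrow[of f Y] actO_arrow[of g Y] by auto
  let ?X = "actO T (fst Z') X" let ?Y = "actO T (fst Z) ?X"
  let ?U = "fst Z" and ?U' = "fst Z'" and ?V = "fst W" and ?V' = "fst W'" and ?c = "snd Z" and ?c' = "snd Z'" and ?d = "snd W" and ?d' = "snd W'"
  have fX: "(\<iota> ?Y \<star> f) \<cdot> ?c ?X = ?d ?X \<cdot> (f \<star> \<iota> ?X)" and gX: "(\<iota> ?X \<star> g) \<cdot> ?c' X = ?d' X \<cdot> (g \<star> \<iota> X)"
    using f g by simp_all
  have "(\<iota> ?Y \<star> (f \<star> g)) \<cdot> tensor_hb ?U ?c ?U' ?c' X =
    (\<iota> ?Y \<star> (f \<star> g)) \<cdot> (aso ?Y ?U ?U' \<cdot> ((?c ?X \<star> \<iota> ?U') \<cdot> (asi ?U ?X ?U' \<cdot> ((\<iota> ?U \<star> ?c' X) \<cdot> aso ?U ?U' X))))"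
    by (simp add: tensor_hb_def rwh_def comp_assoc)
  also have "\<dots> = aso ?Y ?V ?V' \<cdot> (((\<iota> ?Y \<star> f) \<star> g) \<cdot> ((?c ?X \<star> \<iota> ?U') \<cdot> (asi ?U ?X ?U' \<cdot> ((\<iota> ?U \<star> ?c' X) \<cdot> aso ?U ?U' X))))"
    by (rule square_left_rewrite) (use aso_natural[of "\<iota> ?Y" f g] in simp_all)
  also have "((\<iota> ?Y \<star> f) \<star> g) \<cdot> ((?c ?X \<star> \<iota> ?U') \<cdot> (asi ?U ?X ?U' \<cdot> ((\<iota> ?U \<star> ?c' X) \<cdot> aso ?U ?U' X))) =
     (?d ?X \<star> \<iota> ?V') \<cdot> (((f \<star> \<iota> ?X) \<star> g) \<cdot> (asi ?U ?X ?U' \<cdot> ((\<iota> ?U \<star> ?c' X) \<cdot> aso ?U ?U' X)))"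
    by (rule square_left_rewrite) (simp_all add: interchange fX a)
  also have "((f \<star> \<iota> ?X) \<star> g) \<cdot> (asi ?U ?X ?U' \<cdot> ((\<iota> ?U \<star> ?c' X) \<cdot> aso ?U ?U' X)) =
     asi ?V ?X ?V' \<cdot> ((f \<star> (\<iota> ?X \<star> g)) \<cdot> ((\<iota> ?U \<star> ?c' X) \<cdot> aso ?U ?U' X))"
    by (rule square_left_rewrite) (use asi_natural[of f "\<iota> ?X" g] in simp_all)
  also have "(f \<star> (\<iota> ?X \<star> g)) \<cdot> ((\<iota> ?U \<star> ?c' X) \<cdot> aso ?U ?U' X) = (\<iota> ?V \<star> ?d' X) \<cdot> ((f \<star> (g \<star> \<iota> X)) \<cdot> aso ?U ?U' X)"
    by (rule square_left_rewrite) (simp_all add: interchange gX a)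
  also have "(f \<star> (g \<star> \<iota> X)) \<cdot> aso ?U ?U' X = aso ?V ?V' X \<cdot> ((f \<star> g) \<star> \<iota> X)"
    using aso_natural[of f g "\<iota> X"] by simp
  finally have "(\<iota> ?Y \<star> (f \<star> g)) \<cdot> tensor_hb ?U ?c ?U' ?c' X = tensor_hb ?V ?d ?V' ?d' X \<cdot> ((f \<star> g) \<star> \<iota> X)"
    by (simp add: tensor_hb_def rwh_def comp_assoc a)
  then show "(\<iota> (actO T (fst (center_TenO Z Z')) X) \<star> (f \<star> g)) \<cdot> snd (center_TenO Z Z') X = snd (center_TenO W W') X \<cdot> ((f \<star> g) \<star> \<iota> X)"
    by (simp add: snd_center_TenO Z)
qed (use assms in \<open>auto simp: center_arr_iff\<close>)

text \<open>\<open>rwh_tensor_hb\<close> expands the whiskered half braiding of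
  \<open>center_TenO Z Z'\<close>. Afterwards both sides contain the same three half braidings, and
  the associators left on the source side agree by the pentagon.\<close>

lemma center_Assoc_closed:
  assumes Z: "Z \<in> center_obj" "Z' \<in> center_obj" "Z'' \<in> center_obj"
  shows "Arrow (center_TenO (center_TenO Z Z') Z'') (center_TenO Z (center_TenO Z' Z'')) (aso (fst Z) (fst Z') (fst Z'')) \<in> center_arr"
  unfolding center_arr_iff
proof (intro conjI ballI)
  note [simp] = Z[THEN center_objD(1)] Z[THEN center_objD(2), THEN hb_simps(2)] Z[THEN center_objD(2), THEN hb_simps(3)]
    Z[THEN center_objD(2), THEN hb_simps(4)]
  fix X assume X [simp]: "X \<in> Obj T"
  let ?U = "fst Z" and ?V = "fst Z'" and ?W = "fst Z''" and ?c = "snd Z" and ?d = "snd Z'" and ?e = "snd Z''"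
  let ?X1 = "actO T ?W X" let ?X2 = "actO T ?V ?X1" let ?X3 = "actO T ?U ?X2"
  let ?f = "\<iota> ?X3 \<star> aso ?U ?V ?W"
  note [simp] = tensor_hb_isos(2-4)[OF Z(1)[THEN center_objD(2)] Z(2)[THEN center_objD(2)] Z(1,2)[THEN center_objD(1)]]
    tensor_hb_isos(2-4)[OF Z(2)[THEN center_objD(2)] Z(3)[THEN center_objD(2)] Z(2,3)[THEN center_objD(1)]]
  let ?k = "tensor_hb ?U ?c ?V ?d"
  have "?f \<cdot> snd (center_TenO (center_TenO Z Z') Z'') X =
     (?f \<cdot> rwh (?U \<boxtimes> ?V) ?X1 ?X3 (?U \<boxtimes> ?V) (?k ?X1) ?W) \<cdot> ((\<iota> (?U \<boxtimes> ?V) \<star> ?e X) \<cdot> aso (?U \<boxtimes> ?V) ?W X)"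
    by (simp add: snd_center_TenO Z tensor_hb_def[of "?U \<boxtimes> ?V"] comp_assoc)
  also have "?f \<cdot> rwh (?U \<boxtimes> ?V) ?X1 ?X3 (?U \<boxtimes> ?V) (?k ?X1) ?W =
     rwh ?U ?X2 ?X3 ?U (?c ?X2) (?V \<boxtimes> ?W) \<cdot> ((\<iota> ?U \<star> rwh ?V ?X1 ?X2 ?V (?d ?X1) ?W) \<cdot> aso ?U ?V (?X1 \<boxtimes> ?W))"
    by (rule rwh_tensor_hb) (simp_all add: center_objD Z)
  also have "(rwh ?U ?X2 ?X3 ?U (?c ?X2) (?V \<boxtimes> ?W) \<cdot> ((\<iota> ?U \<star> rwh ?V ?X1 ?X2 ?V (?d ?X1) ?W) \<cdot> aso ?U ?V (?X1 \<boxtimes> ?W))) \<cdot>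
      ((\<iota> (?U \<boxtimes> ?V) \<star> ?e X) \<cdot> aso (?U \<boxtimes> ?V) ?W X) =
     rwh ?U ?X2 ?X3 ?U (?c ?X2) (?V \<boxtimes> ?W) \<cdot> ((\<iota> ?U \<star> rwh ?V ?X1 ?X2 ?V (?d ?X1) ?W) \<cdot> (aso ?U ?V (?X1 \<boxtimes> ?W) \<cdot>
      ((\<iota> (?U \<boxtimes> ?V) \<star> ?e X) \<cdot> aso (?U \<boxtimes> ?V) ?W X)))"
    by (simp add: comp_assoc)
  also have "aso ?U ?V (?X1 \<boxtimes> ?W) \<cdot> ((\<iota> (?U \<boxtimes> ?V) \<star> ?e X) \<cdot> aso (?U \<boxtimes> ?V) ?W X) =
     (\<iota> ?U \<star> (\<iota> ?V \<star> ?e X)) \<cdot> (aso ?U ?V (?W \<boxtimes> X) \<cdot> aso (?U \<boxtimes> ?V) ?W X)"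
    by (rule square_left_rewrite) (use aso_natural[of "\<iota> ?U" "\<iota> ?V" "?e X"] in simp_all)
  also have "aso ?U ?V (?W \<boxtimes> X) \<cdot> aso (?U \<boxtimes> ?V) ?W X = (\<iota> ?U \<star> aso ?V ?W X) \<cdot> (aso ?U (?V \<boxtimes> ?W) X \<cdot> (aso ?U ?V ?W \<star> \<iota> X))"
    by (simp add: pentagon')
  finally show "(\<iota> (actO T (fst (center_TenO (center_TenO Z Z') Z'')) X) \<star> aso ?U ?V ?W) \<cdot> snd (center_TenO (center_TenO Z Z') Z'') X =
    snd (center_TenO Z (center_TenO Z' Z'')) X \<cdot> (aso ?U ?V ?W \<star> \<iota> X)"
    by (simp add: snd_center_TenO Z tensor_hb_def whisker_left_comp comp_assoc)
qed (use center_objD Z in auto)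

text \<open>The half braiding of the unit contributes an inverse right and a left unit constraint.
  The triangle cancels the former; by \<open>LUnit_TenO\<close> the latter becomes the constraint of
  a tensor product, which passes through the half braiding of \<open>Z\<close> by
  naturality.\<close>

lemma center_LUnit_closed:
  assumes Z: "Z \<in> center_obj"
  shows "Arrow (center_TenO center_Unit Z) Z (LUnit T (fst Z)) \<in> center_arr"
  unfolding center_arr_iff
proof (intro conjI ballI)
  note [simp] = Z[THEN center_objD(1)] Z[THEN center_objD(2), THEN hb_simps(2)] Z[THEN center_objD(2), THEN hb_simps(3)]
    Z[THEN center_objD(2), THEN hb_simps(4)]
  fix X assume X [simp]: "X \<in> Obj T"
  let ?U = "fst Z" and ?c = "snd Z" let ?X = "actO T ?U X"
  have "(\<iota> ?X \<star> LUnit T ?U) \<cdot> snd (center_TenO center_Unit Z) X =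
     (\<iota> ?X \<star> LUnit T ?U) \<cdot> (aso ?X \<I> ?U \<cdot> ((inv_arrow T (RUnit T ?X) \<star> \<iota> ?U) \<cdot> ((LUnit T ?X \<star> \<iota> ?U) \<cdot>
        (asi \<I> ?X ?U \<cdot> ((\<iota> \<I> \<star> ?c X) \<cdot> aso \<I> ?U X)))))"
    by (simp add: snd_center_TenO Z tensor_hb_def rwh_def snd_center_Unit whisker_right_comp comp_assoc)
  also have "\<dots> = (RUnit T ?X \<star> \<iota> ?U) \<cdot> ((inv_arrow T (RUnit T ?X) \<star> \<iota> ?U) \<cdot> ((LUnit T ?X \<star> \<iota> ?U) \<cdot>
        (asi \<I> ?X ?U \<cdot> ((\<iota> \<I> \<star> ?c X) \<cdot> aso \<I> ?U X))))"
    by (rule comp_left_rewrite[OF triangle]) simp_all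
  also have "\<dots> = (LUnit T ?X \<star> \<iota> ?U) \<cdot> (asi \<I> ?X ?U \<cdot> ((\<iota> \<I> \<star> ?c X) \<cdot> aso \<I> ?U X))"
    by (subst comp_assoc[symmetric]) (simp_all add: whisker_right_comp[symmetric])
  also have "\<dots> = LUnit T (?X \<boxtimes> ?U) \<cdot> ((\<iota> \<I> \<star> ?c X) \<cdot> aso \<I> ?U X)"
    by (simp add: LUnit_TenO[symmetric] comp_assoc)
  also have "\<dots> = ?c X \<cdot> (LUnit T (?U \<boxtimes> X) \<cdot> aso \<I> ?U X)"
    by (rule square_left_rewrite) (use LUnit_nat[of "?c X"] in simp_all)
  finally show "(\<iota> (actO T (fst (center_TenO center_Unit Z)) X) \<star> LUnit T ?U) \<cdot> snd (center_TenO center_Unit Z) X = ?c X \<cdot> (LUnit T ?U \<star> \<iota> X)"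
    by (simp add: LUnit_TenO)
qed (use center_objD Z in auto)

text \<open>As for the left unit with the order of the arguments changed: \<open>RUnit_TenO\<close>
  and naturality of the right unit come first, the triangle last.\<close>

lemma center_RUnit_closed:
  assumes Z: "Z \<in> center_obj"
  shows "Arrow (center_TenO Z center_Unit) Z (RUnit T (fst Z)) \<in> center_arr"
  unfolding center_arr_iff
proof (intro conjI ballI)
  note [simp] = Z[THEN center_objD(1)] Z[THEN center_objD(2), THEN hb_simps(2)] Z[THEN center_objD(2), THEN hb_simps(3)]
    Z[THEN center_objD(2), THEN hb_simps(4)]
  fix X assume X [simp]: "X \<in> Obj T"
  let ?U = "fst Z" and ?c = "snd Z" let ?X = "actO T ?U X"
  have "(\<iota> ?X \<star> RUnit T ?U) \<cdot> snd (center_TenO Z center_Unit) X =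
     (\<iota> ?X \<star> RUnit T ?U) \<cdot> (aso ?X ?U \<I> \<cdot> ((?c X \<star> \<iota> \<I>) \<cdot> (asi ?U X \<I> \<cdot>
       ((\<iota> ?U \<star> inv_arrow T (RUnit T X)) \<cdot> ((\<iota> ?U \<star> LUnit T X) \<cdot> aso ?U \<I> X)))))"
    by (simp add: snd_center_TenO Z tensor_hb_def rwh_def snd_center_Unit whisker_left_comp comp_assoc)
  also have "\<dots> = RUnit T (?X \<boxtimes> ?U) \<cdot> ((?c X \<star> \<iota> \<I>) \<cdot> (asi ?U X \<I> \<cdot>
       ((\<iota> ?U \<star> inv_arrow T (RUnit T X)) \<cdot> ((\<iota> ?U \<star> LUnit T X) \<cdot> aso ?U \<I> X))))"
    by (rule comp_left_rewrite[OF RUnit_TenO]) simp_all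
  also have "\<dots> = ?c X \<cdot> (RUnit T (?U \<boxtimes> X) \<cdot> (asi ?U X \<I> \<cdot>
       ((\<iota> ?U \<star> inv_arrow T (RUnit T X)) \<cdot> ((\<iota> ?U \<star> LUnit T X) \<cdot> aso ?U \<I> X))))"
    by (rule square_left_rewrite) (use RUnit_nat[of "?c X"] in simp_all)
  also have "RUnit T (?U \<boxtimes> X) \<cdot> (asi ?U X \<I> \<cdot> ((\<iota> ?U \<star> inv_arrow T (RUnit T X)) \<cdot> ((\<iota> ?U \<star> LUnit T X) \<cdot> aso ?U \<I> X))) =
     (\<iota> ?U \<star> RUnit T X) \<cdot> ((\<iota> ?U \<star> inv_arrow T (RUnit T X)) \<cdot> ((\<iota> ?U \<star> LUnit T X) \<cdot> aso ?U \<I> X))"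
    by (simp add: RUnit_TenO[symmetric] comp_assoc)
  also have "\<dots> = RUnit T ?U \<star> \<iota> X"
    by (subst comp_assoc[symmetric]) (simp_all add: triangle whisker_left_comp[symmetric])
  finally show "(\<iota> (actO T (fst (center_TenO Z center_Unit)) X) \<star> RUnit T ?U) \<cdot> snd (center_TenO Z center_Unit) X = ?c X \<cdot> (RUnit T ?U \<star> \<iota> X)"
    by simp
qed (use center_objD Z in auto)

text \<open>The point is naturality of \<open>snd Z\<close> at the arrow \<open>snd Z' X\<close>,
  combined with multiplicativity of \<open>snd Z\<close>, which splits its values at the source and
  at the target of that arrow.\<close>

lemma center_Braid_closed:
  assumes Z: "Z \<in> center_obj" "Z' \<in> center_obj"
  shows "Arrow (center_TenO Z Z') (center_TenO (center_ConjO (Grade T (fst Z)) Z') Z) (snd Z (fst Z')) \<in> center_arr"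
  unfolding center_arr_iff
proof (intro conjI ballI)
  note [simp] = Z[THEN center_objD(1)] Z[THEN center_objD(2), THEN hb_simps(2)] Z[THEN center_objD(2), THEN hb_simps(3)]
    Z[THEN center_objD(2), THEN hb_simps(4)]
  fix X assume X [simp]: "X \<in> Obj T"
  let ?U = "fst Z" and ?V = "fst Z'" and ?c = "snd Z" and ?d = "snd Z'"
  let ?X = "actO T ?V X" let ?Y = "actO T ?U ?X" and ?W = "actO T ?U ?V" and ?UX = "actO T ?U X"
  \<comment> \<open>Degree computations: the half braiding of the conjugate of \<open>Z'\<close> at
    the conjugate of \<open>X\<close> is the conjugate of \<open>?d X\<close>, which is what
    naturality of \<open>?c\<close> at \<open>?d X\<close> produces.\<close>
  have conj: "ConjO T (Grade T ?U) ?V = ?W" "actO T ?W ?UX = ?Y"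
    "snd (center_ConjO (Grade T ?U) Z') ?UX = actA T ?U (?d X)"
    by (simp_all add: actO_def actA_def snd_center_ConjO Grade_ConjO conjg_def ConjO_mult)
  have "(\<iota> ?Y \<star> ?c ?V) \<cdot> tensor_hb ?U ?c ?V ?d X =
    ((\<iota> ?Y \<star> ?c ?V) \<cdot> rwh ?U ?X ?Y ?U (?c ?X) ?V) \<cdot> ((\<iota> ?U \<star> ?d X) \<cdot> aso ?U ?V X)"
    by (simp add: tensor_hb_def comp_assoc)
  also have "(\<iota> ?Y \<star> ?c ?V) \<cdot> rwh ?U ?X ?Y ?U (?c ?X) ?V = aso ?Y ?W ?U \<cdot> ?c (?X \<boxtimes> ?V)"
    by (rule hb_TenO[symmetric]) (simp_all add: center_objD Z)
  also have "(aso ?Y ?W ?U \<cdot> ?c (?X \<boxtimes> ?V)) \<cdot> ((\<iota> ?U \<star> ?d X) \<cdot> aso ?U ?V X) =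
     aso ?Y ?W ?U \<cdot> (?c (?X \<boxtimes> ?V) \<cdot> ((\<iota> ?U \<star> ?d X) \<cdot> aso ?U ?V X))"
    by (simp add: comp_assoc)
  also have "?c (?X \<boxtimes> ?V) \<cdot> ((\<iota> ?U \<star> ?d X) \<cdot> aso ?U ?V X) = (actA T ?U (?d X) \<star> \<iota> ?U) \<cdot> (?c (?V \<boxtimes> X) \<cdot> aso ?U ?V X)"
    by (rule square_left_rewrite) (use hb_natural[OF center_objD(2)[OF Z(1)], of "?d X"] in simp_all)
  also have "?c (?V \<boxtimes> X) \<cdot> aso ?U ?V X = (asi ?W ?UX ?U \<cdot> (aso ?W ?UX ?U \<cdot> ?c (?V \<boxtimes> X))) \<cdot> aso ?U ?V X"
    by simp
  also have "\<dots> = asi ?W ?UX ?U \<cdot> ((\<iota> ?W \<star> ?c X) \<cdot> (aso ?W ?U X \<cdot> (?c ?V \<star> \<iota> X)))"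
    by (subst hb_TenO) (simp_all add: center_objD Z rwh_def comp_assoc)
  finally show "(\<iota> (actO T (fst (center_TenO Z Z')) X) \<star> ?c ?V) \<cdot> snd (center_TenO Z Z') X =
     snd (center_TenO (center_ConjO (Grade T ?U) Z') Z) X \<cdot> (?c ?V \<star> \<iota> X)"
    by (simp add: snd_center_TenO Z tensor_hb_def[of ?W] rwh_def conj comp_assoc)
qed (use center_objD Z in \<open>auto simp: snd_center_obj actO_def\<close>)

lemma center_ConjA_closed:
  assumes "Arrow Z Z' f \<in> center_arr" "\<beta> \<in> carrier \<pi>"
  shows "Arrow (center_ConjO \<beta> Z) (center_ConjO \<beta> Z') (ConjA T \<beta> f) \<in> center_arr"
  unfolding center_arr_iff
proof (intro conjI ballI)
  note f = assms(1)[unfolded center_arr_iff]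
  have Z: "Z \<in> center_obj" "Z' \<in> center_obj" using f by auto
  note [simp] = Z[THEN center_objD(1)] Z[THEN center_objD(2), THEN hb_simps(2)] Z[THEN center_objD(2), THEN hb_simps(3)]
    Z[THEN center_objD(2), THEN hb_simps(4)]
  fix X assume X [simp]: "X \<in> Obj T"
  have a: "actO T (fst Z') Y = actO T (fst Z) Y" for Y
    using actO_arrow[of f Y] f by auto
  have e: "(\<iota> (actO T (fst Z) (ConjO T (inv\<^bsub>\<pi>\<^esub> \<beta>) X)) \<star> f) \<cdot> snd Z (ConjO T (inv\<^bsub>\<pi>\<^esub> \<beta>) X) =
     snd Z' (ConjO T (inv\<^bsub>\<pi>\<^esub> \<beta>) X) \<cdot> (f \<star> \<iota> (ConjO T (inv\<^bsub>\<pi>\<^esub> \<beta>) X))"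
    using f assms(2) by simp
  have d: "Dom T f = fst Z" "Cod T f = fst Z'" using f by auto
  from arg_cong[OF e, of "ConjA T \<beta>"]
  show "(\<iota> (actO T (fst (center_ConjO \<beta> Z)) X) \<star> ConjA T \<beta> f) \<cdot> snd (center_ConjO \<beta> Z) X =
     snd (center_ConjO \<beta> Z') X \<cdot> (ConjA T \<beta> f \<star> \<iota> X)"
    using conjunct1[OF f[THEN conjunct2, THEN conjunct2]] d assms(2) a
    by (simp add: snd_center_ConjO ConjA_Comp Conj_TenA actO_ConjO)
qed (use assms in \<open>auto simp: center_arr_iff\<close>)

text \<open>Half braidings are extensional, hence determined by their values at objects.\<close>

lemma center_obj_eqI:
  assumes "Z \<in> center_obj" "Z' \<in> center_obj" "fst Z = fst Z'" "\<And>X. X \<in> Obj T \<Longrightarrow> snd Z X = snd Z' X"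
  shows "Z = Z'"
proof (rule prod_eqI)
  show "snd Z = snd Z'"
    by (rule extensionalityI[where A = "Obj T"])
      (use assms in \<open>auto simp: center_obj_iff half_braiding_def\<close>)
qed (fact assms(3))

lemma center_ConjO_TenO:
  assumes Z: "Z \<in> center_obj" "Z' \<in> center_obj" "\<beta> \<in> carrier \<pi>"
  shows "center_ConjO \<beta> (center_TenO Z Z') = center_TenO (center_ConjO \<beta> Z) (center_ConjO \<beta> Z')"
proof (rule center_obj_eqI)
  note [simp] = assms Z(1,2)[THEN center_objD(1)] Z(1,2)[THEN center_objD(2), THEN hb_simps(2)] Z(1,2)[THEN center_objD(2), THEN hb_simps(3)]
    Z(1,2)[THEN center_objD(2), THEN hb_simps(4)]
  fix X assume X [simp]: "X \<in> Obj T"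
  show "snd (center_ConjO \<beta> (center_TenO Z Z')) X = snd (center_TenO (center_ConjO \<beta> Z) (center_ConjO \<beta> Z')) X"
    by (simp add: snd_center_TenO snd_center_ConjO tensor_hb_def ConjA_Comp ConjA_rwh Conj_TenA Conj_Assoc actO_ConjO)
qed (use assms in \<open>auto simp: Conj_TenO center_objD\<close>)

lemma center_ConjO_Unit:
  assumes [simp]: "\<beta> \<in> carrier \<pi>"
  shows "center_ConjO \<beta> center_Unit = center_Unit"
proof (rule center_obj_eqI)
  fix X assume X [simp]: "X \<in> Obj T"
  show "snd (center_ConjO \<beta> center_Unit) X = snd center_Unit X"
    using ConjA_isos(2)[OF assms RUnit_iso, of "ConjO T (inv\<^bsub>\<pi>\<^esub> \<beta>) X"]
    by (simp add: snd_center_ConjO snd_center_Unit ConjA_Comp Conj_LUnit Conj_RUnit)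
qed (auto simp: Conj_Unit)

lemma center_ConjO_one: "Z \<in> center_obj \<Longrightarrow> center_ConjO \<one>\<^bsub>\<pi>\<^esub> Z = Z"
  by (rule center_obj_eqI) (auto simp: ConjO_one snd_center_ConjO ConjA_one center_objD snd_center_obj)

lemma center_ConjO_mult:
  "\<lbrakk>Z \<in> center_obj; \<beta> \<in> carrier \<pi>; \<gamma> \<in> carrier \<pi>\<rbrakk> \<Longrightarrow>
    center_ConjO (\<beta> \<otimes>\<^bsub>\<pi>\<^esub> \<gamma>) Z = center_ConjO \<beta> (center_ConjO \<gamma> Z)"
  by (rule center_obj_eqI)
    (auto simp: ConjO_mult snd_center_ConjO ConjA_mult center_objD snd_center_obj P.inv_mult_group)

text \<open>An arrow of the center is an arrow of \<open>T\<close> with prescribed source and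
  target, and composition and tensor product act on the bodies as in \<open>T\<close>. Once the
  constraints are known to be arrows of the center, each equation is the corresponding one in
  \<open>T\<close>.\<close>

lemma center_tensor_category: "tensor_category center"
proof
  fix f Z W g Z' W' assume "f \<in> arrows center Z W" "g \<in> arrows center Z' W'"
  then show "TenA center f g \<in> arrows center (TenO center Z Z') (TenO center W W')"
    by (auto simp: arrows_center intro: center_TenA_closed)
next
  fix f U U' f' U'' g V V' g' V''
  assume "f \<in> arrows center U U'" "f' \<in> arrows center U' U''" "g \<in> arrows center V V'" "g' \<in> arrows center V' V''"
  then show "TenA center (Comp center f' f) (Comp center g' g) = Comp center (TenA center f' g') (TenA center f g)"
    by (auto simp: arrows_center center_arr_iff interchange)
next
  fix U V W assume "U \<in> Obj center" "V \<in> Obj center" "W \<in> Obj center"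
  then show "Assoc center U V W \<in> isos center (TenO center (TenO center U V) W) (TenO center U (TenO center V W))"
    by (auto intro!: center_isoI(1) center_Assoc_closed Assoc_iso simp: center_objD)
next
  fix f U U' g V V' h W W'
  assume "f \<in> arrows center U U'" "g \<in> arrows center V V'" "h \<in> arrows center W W'"
  then show "Comp center (TenA center f (TenA center g h)) (Assoc center U V W) =
    Comp center (Assoc center U' V' W') (TenA center (TenA center f g) h)"
    using aso_natural[of "body f" "body g" "body h"] by (auto simp: arrows_center center_arr_iff)
next
  fix U assume "U \<in> Obj center"
  then show "LUnit center U \<in> isos center (TenO center (Unit center) U) U"
    "RUnit center U \<in> isos center (TenO center U (Unit center)) U"
    by (auto intro!: center_isoI(1) center_LUnit_closed center_RUnit_closed LUnit_iso RUnit_iso simp: center_objD)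
next
  fix f U V assume "f \<in> arrows center U V"
  then show "Comp center f (LUnit center U) = Comp center (LUnit center V) (TenA center (Ident center (Unit center)) f)"
    "Comp center f (RUnit center U) = Comp center (RUnit center V) (TenA center f (Ident center (Unit center)))"
    using LUnit_nat[of "body f"] RUnit_nat[of "body f"] by (auto simp: arrows_center center_arr_iff)
next
  fix U V W X assume "U \<in> Obj center" "V \<in> Obj center" "W \<in> Obj center" "X \<in> Obj center"
  then show "Comp center (Assoc center U V (TenO center W X)) (Assoc center (TenO center U V) W X) =
    Comp center (Comp center (TenA center (Ident center U) (Assoc center V W X)) (Assoc center U (TenO center V W) X))
      (TenA center (Assoc center U V W) (Ident center X))"
    using pentagon[of "fst U" "fst V" "fst W" "fst X"] by (auto simp: center_objD)
next
  fix U V assume "U \<in> Obj center" "V \<in> Obj center"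
  then show "Comp center (TenA center (Ident center U) (LUnit center V)) (Assoc center U (Unit center) V) =
    TenA center (RUnit center U) (Ident center V)"
    using triangle[of "fst U" "fst V"] by (auto simp: center_objD)
qed (auto simp: center_objD)

lemma center_T_category: "T_category \<pi> center"
proof -
  interpret CT: tensor_category center by (rule center_tensor_category)
  show ?thesis
  proof
    fix f assume "f \<in> Arr center"
    then show "Grade center (Dom center f) = Grade center (Cod center f)"
      using Grade_arrow[of "body f"] by (simp add: center_arr_cases)
  next
    fix \<beta> assume "\<beta> \<in> carrier \<pi>"
    then show "is_functor center center (ConjO center \<beta>) (ConjA center \<beta>)"
      unfolding is_functor_def
      by (auto simp: arrows_center center_objD ConjA_Comp intro!: center_ConjA_closed)
        (auto simp: center_arr_iff intro!: ConjA_Comp)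
  next
    fix \<beta> f g assume "\<beta> \<in> carrier \<pi>" "f \<in> Arr center" "g \<in> Arr center"
    then show "ConjA center \<beta> (TenA center f g) = TenA center (ConjA center \<beta> f) (ConjA center \<beta> g)"
      by (simp add: center_arr_cases center_ConjO_TenO Conj_TenA)
  next
    fix f assume "f \<in> Arr center"
    then show "ConjA center \<one>\<^bsub>\<pi>\<^esub> f = f"
      by (cases f) (simp add: center_ConjO_one center_arr_cases[of f, simplified] ConjA_one center_arr_iff)
  next
    fix \<beta> \<alpha> assume b: "\<beta> \<in> carrier \<pi>" "\<alpha> \<in> carrier \<pi>"
    show "ConjO center \<beta> ` component center \<alpha> = component center (conjg \<pi> \<beta> \<alpha>)"
    proof (intro subset_antisym subsetI)
      fix Z assume "Z \<in> ConjO center \<beta> ` component center \<alpha>"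
      then show "Z \<in> component center (conjg \<pi> \<beta> \<alpha>)"
        using b by (auto simp: component_def dest: center_objD(1) intro!: Grade_ConjO)
    next
      fix Z assume Z: "Z \<in> component center (conjg \<pi> \<beta> \<alpha>)"
      then have "Z = center_ConjO \<beta> (center_ConjO (inv\<^bsub>\<pi>\<^esub> \<beta>) Z)"
        using b by (simp add: component_def center_ConjO_mult[symmetric] center_ConjO_one)
      moreover have "center_ConjO (inv\<^bsub>\<pi>\<^esub> \<beta>) Z \<in> component center \<alpha>"
        using Z b by (auto simp: component_def Grade_ConjO center_objD conjg_def P.m_assoc) (simp add: P.m_assoc[symmetric])
      ultimately show "Z \<in> ConjO center \<beta> ` component center \<alpha>" by auto
    qed
  qed (auto simp: center_objD Grade_TenO center_ConjO_TenO center_ConjO_Unit Conj_Assoc Conj_LUnit Conj_RUnit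
      center_ConjO_one center_ConjO_mult ConjA_one ConjA_mult center_arr_cases)
qed

lemma center_actO: "actO center Z Z' = center_ConjO (Grade T (fst Z)) Z'"
  "actA center Z f = Arrow (center_ConjO (Grade T (fst Z)) (source f)) (center_ConjO (Grade T (fst Z)) (target f))
     (actA T (fst Z) (body f))"
  "fst (center_ConjO (Grade T (fst Z)) Z') = actO T (fst Z) (fst Z')"
  by (simp_all add: actO_def actA_def)

text \<open>Naturality of the braiding in the first variable is compatibility of arrows with half
  braidings, in the second it is naturality of a half braiding. The first hexagon is the definition
  of \<open>center_TenO\<close>, the second one is multiplicativity of half braidings.\<close>

theorem center_braided_T_category: "braided_T_category \<pi> center"
proof -
  interpret C: T_category \<pi> center by (rule center_T_category)
  have inv_Assoc: "inv_arrow center (Assoc center Z Z' Z'') =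
     Arrow (center_TenO Z (center_TenO Z' Z'')) (center_TenO (center_TenO Z Z') Z'') (asi (fst Z) (fst Z') (fst Z''))"
    if "Z \<in> center_obj" "Z' \<in> center_obj" "Z'' \<in> center_obj" for Z Z' Z''
    using center_isoI(2)[OF center_Assoc_closed[OF that]] Assoc_iso that center_objD by simp
  show ?thesis
  proof
    fix Z Z' assume Z: "Z \<in> Obj center" "Z' \<in> Obj center"
    show "Braid center Z Z' \<in> isos center (TenO center Z Z') (TenO center (actO center Z Z') Z)"
      using Z hb_simps(1)[OF center_objD(2)[of Z] center_objD(1)[of Z] center_objD(1)[of Z']]
      by (auto simp: center_actO(1) actO_def[of T, symmetric] intro!: center_isoI(1) center_Braid_closed)
  next
    fix f U U' g V V' assume f: "f \<in> arrows center U U'" and g: "g \<in> arrows center V V'"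
    then obtain f' g' where [simp]: "f = Arrow U U' f'" "g = Arrow V V' g'"
      and f': "Arrow U U' f' \<in> center_arr" and g': "Arrow V V' g' \<in> center_arr"
      by (auto simp: arrows_center)
    note f'' = f'[unfolded center_arr_iff] and g'' = g'[unfolded center_arr_iff]
    have a: "Grade T (fst U') = Grade T (fst U)" "actO T (fst U') X = actO T (fst U) X" for X
      using Grade_arrow[of f'] f'' actO_arrow[of f' X] by auto
    let ?g = "actA T (fst U) g'"
    note [simp] = center_objD snd_center_obj
    \<comment> \<open>The arrow is factored by the interchange law, so that the two variables can be
      treated one after the other.\<close>
    have "(?g \<star> f') \<cdot> snd U (fst V) = (\<iota> (actO T (fst U) (fst V')) \<star> f') \<cdot> ((?g \<star> \<iota> (fst U)) \<cdot> snd U (fst V))"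
      using f'' g'' by (subst comp_assoc[symmetric]) (simp_all add: interchange)
    also have "(?g \<star> \<iota> (fst U)) \<cdot> snd U (fst V) = snd U (fst V') \<cdot> (\<iota> (fst U) \<star> g')"
      using hb_natural[of "fst U" "snd U" g'] f'' g'' by simp
    also have "(\<iota> (actO T (fst U) (fst V')) \<star> f') \<cdot> (snd U (fst V') \<cdot> (\<iota> (fst U) \<star> g')) =
       snd U' (fst V') \<cdot> ((f' \<star> \<iota> (fst V')) \<cdot> (\<iota> (fst U) \<star> g'))"
      by (rule square_left_rewrite) (use f'' g'' a in simp_all)
    also have "(f' \<star> \<iota> (fst V')) \<cdot> (\<iota> (fst U) \<star> g') = f' \<star> g'"
      using f'' g'' by (simp add: interchange)
    finally show "Comp center (TenA center (actA center U g) f) (Braid center U V) =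
        Comp center (Braid center U' V') (TenA center f g)"
      using a by (simp add: center_actO)
  next
    fix U V W assume Z: "U \<in> Obj center" "V \<in> Obj center" "W \<in> Obj center"
    have "center_ConjO (Grade T (fst U \<boxtimes> fst V)) W = center_ConjO (Grade T (fst U)) (center_ConjO (Grade T (fst V)) W)"
      using Z by (simp add: Grade_TenO center_objD center_ConjO_mult)
    moreover have "snd (center_TenO U V) (fst W) = aso (actO T (fst U) (actO T (fst V) (fst W))) (fst U) (fst V)
        \<cdot> (snd U (actO T (fst V) (fst W)) \<star> \<iota> (fst V)) \<cdot> asi (fst U) (actO T (fst V) (fst W)) (fst V)
        \<cdot> (\<iota> (fst U) \<star> snd V (fst W)) \<cdot> aso (fst U) (fst V) (fst W)"
      using Z by (simp add: center_TenO_def split_beta center_objD)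
    ultimately show "Braid center (TenO center U V) W =
        Comp center (Comp center (Comp center (Comp center (Assoc center (actO center U (actO center V W)) U V)
        (TenA center (Braid center U (actO center V W)) (Ident center V)))
        (inv_arrow center (Assoc center U (actO center V W) V)))
        (TenA center (Ident center U) (Braid center V W))) (Assoc center U V W)"
      using Z inv_Assoc[of U "center_ConjO (Grade T (fst V)) W" V] by (simp add: center_actO(1) actO_def[of T, symmetric] center_objD)
    have "center_ConjO (Grade T (fst U)) (center_TenO V W) = center_TenO (center_ConjO (Grade T (fst U)) V) (center_ConjO (Grade T (fst U)) W)"
      using Z by (simp add: center_ConjO_TenO center_objD)
    moreover have "\<forall>X\<in>Obj T. \<forall>Y\<in>Obj T. snd U (X \<boxtimes> Y) =
          asi (actO T (fst U) X) (actO T (fst U) Y) (fst U) \<cdot> (\<iota> (actO T (fst U) X) \<star> snd U Y)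
          \<cdot> aso (actO T (fst U) X) (fst U) Y \<cdot> (snd U X \<star> \<iota> Y) \<cdot> asi (fst U) X Y"
      using Z(1) unfolding center_simps center_obj_iff half_braiding_def by (elim conjE)
    ultimately show "Braid center U (TenO center V W) =
        Comp center (Comp center (Comp center (Comp center
        (inv_arrow center (Assoc center (actO center U V) (actO center U W) U))
        (TenA center (Ident center (actO center U V)) (Braid center U W)))
        (Assoc center (actO center U V) U W))
        (TenA center (Braid center U V) (Ident center W)))
        (inv_arrow center (Assoc center U V W))"
      using Z inv_Assoc[of U V W] inv_Assoc[of "center_ConjO (Grade T (fst U)) V" "center_ConjO (Grade T (fst U)) W" U]
      by (simp add: center_actO(1) actO_def[of T, symmetric] center_objD)
  next
    fix \<beta> U V assume Z: "\<beta> \<in> carrier \<pi>" "U \<in> Obj center" "V \<in> Obj center"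
    have "center_ConjO (Grade T (ConjO T \<beta> (fst U))) (center_ConjO \<beta> V) = center_ConjO \<beta> (center_ConjO (Grade T (fst U)) V)"
      using Z by (simp add: center_ConjO_mult[symmetric] Grade_ConjO center_objD conjg_def P.m_assoc)
    then show "ConjA center \<beta> (Braid center U V) = Braid center (ConjO center \<beta> U) (ConjO center \<beta> V)"
      using Z by (simp add: center_ConjO_TenO snd_center_ConjO center_objD)
  qed
qed

text \<open>Half braidings are compared with coactions through their inverses, so the tensor product
  in the center is wanted in inverted form.\<close>

lemma center_TenO_inverse:
  assumes Z: "Z \<in> center_obj" and Z': "Z' \<in> center_obj" and X: "X \<in> Obj T"
  shows "inv_arrow T (snd (center_TenO Z Z') X) = asi (fst Z) (fst Z') X \<cdot> ((\<iota> (fst Z) \<star> inv_arrow T (snd Z' X)) \<cdot>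
    (aso (fst Z) (actO T (fst Z') X) (fst Z') \<cdot> ((inv_arrow T (snd Z (actO T (fst Z') X)) \<star> \<iota> (fst Z')) \<cdot>
      asi (actO T (fst Z) (actO T (fst Z') X)) (fst Z) (fst Z'))))"
proof -
  note U = center_objD(1)[OF Z] and U' = center_objD(1)[OF Z'] note X' = actO_simps(1)[OF U' X] note X'' = actO_simps(1)[OF U X']
  note h = hb_simps[OF center_objD(2)[OF Z] U X'] and h' = hb_simps[OF center_objD(2)[OF Z'] U' X]
  note w = whisker_isos[OF h'(1) U] and w' = whisker_isos[OF h(1) U']
  note a = Assoc_iso[OF U U' X] and b = Assoc_iso[OF U X' U'] and c = Assoc_iso[OF X'' U U']
  have 1: "inv_arrow T ((\<iota> (fst Z) \<star> snd Z' X) \<cdot> aso (fst Z) (fst Z') X) = asi (fst Z) (fst Z') X \<cdot> (\<iota> (fst Z) \<star> inv_arrow T (snd Z' X))"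
    by (simp only: inv_comp[OF a w(1)] w(3))
  have 2: "inv_arrow T (rwh (fst Z) (actO T (fst Z') X) (actO T (fst Z) (actO T (fst Z') X)) (fst Z) (snd Z (actO T (fst Z') X)) (fst Z')) =
    (aso (fst Z) (actO T (fst Z') X) (fst Z') \<cdot> (inv_arrow T (snd Z (actO T (fst Z') X)) \<star> \<iota> (fst Z'))) \<cdot>
      asi (actO T (fst Z) (actO T (fst Z') X)) (fst Z) (fst Z')"
    unfolding rwh_def by (simp only: inv_comp[OF comp_isos[OF inv_isos[OF b] w'(2)] c] inv_comp[OF inv_isos[OF b] w'(2)] w'(4) inv_inv_arrow[OF b])
  show ?thesis
    unfolding snd_center_TenO[OF Z Z' X] tensor_hb_def
    using inv_comp[OF comp_isos[OF a w(1)] comp_isos[OF comp_isos[OF inv_isos[OF b] w'(2)] c, folded rwh_def]] 1 2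
    by (simp add: comp_assoc U U' X X' h h')
qed

end

section \<open>Transport of structure\<close>

text \<open>The assumptions say that \<open>Fo\<close> and \<open>Fa\<close> are bijective and carry
  each operation of \<open>C\<close> to that of \<open>D\<close>, with the expected domains and
  codomains in \<open>C\<close>. \<open>Arr_iff\<close> makes an arrow of \<open>C\<close> out of
  every candidate between objects whose image is an arrow of \<open>D\<close>; so closure under the
  operations on arrows is inherited, and equations are reflected by injectivity.\<close>

locale structure_transport = D: braided_T_category \<pi> D
  for \<pi> :: "'p monoid" and D :: "('p, 'o2, 'a2, 'm2) braided_T_category_scheme"
    and C :: "('p, 'o, 'a, 'm) braided_T_category_scheme" (structure)
    and Fo :: "'o \<Rightarrow> 'o2" and Fa :: "'a \<Rightarrow> 'a2" +
  assumes bij_Fo: "bij_betw Fo (Obj C) (Obj D)" and bij_Fa: "bij_betw Fa (Arr C) (Arr D)"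
    and Arr_Obj [simp]: "f \<in> Arr C \<Longrightarrow> Dom C f \<in> Obj C" "f \<in> Arr C \<Longrightarrow> Cod C f \<in> Obj C"
    and Fa_Dom [simp]: "Dom D (Fa f) = Fo (Dom C f)" and Fa_Cod [simp]: "Cod D (Fa f) = Fo (Cod C f)"
    and Arr_iff: "\<lbrakk>Dom C f \<in> Obj C; Cod C f \<in> Obj C\<rbrakk> \<Longrightarrow> f \<in> Arr C \<longleftrightarrow> Fa f \<in> Arr D"
    and Ident' [simp]: "U \<in> Obj C \<Longrightarrow> Dom C (\<iota> U) = U" "U \<in> Obj C \<Longrightarrow> Cod C (\<iota> U) = U"
      "U \<in> Obj C \<Longrightarrow> Fa (\<iota> U) = \<iota>\<^bsub>D\<^esub> (Fo U)"
    and Comp' [simp]: "\<lbrakk>f \<in> Arr C; g \<in> Arr C; Cod C f = Dom C g\<rbrakk> \<Longrightarrow> Dom C (g \<cdot> f) = Dom C f"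
      "\<lbrakk>f \<in> Arr C; g \<in> Arr C; Cod C f = Dom C g\<rbrakk> \<Longrightarrow> Cod C (g \<cdot> f) = Cod C g"
      "\<lbrakk>f \<in> Arr C; g \<in> Arr C; Cod C f = Dom C g\<rbrakk> \<Longrightarrow> Fa (g \<cdot> f) = Fa g \<cdot>\<^bsub>D\<^esub> Fa f"
    and TenO' [simp]: "\<lbrakk>U \<in> Obj C; V \<in> Obj C\<rbrakk> \<Longrightarrow> U \<boxtimes> V \<in> Obj C"
      "\<lbrakk>U \<in> Obj C; V \<in> Obj C\<rbrakk> \<Longrightarrow> Fo (U \<boxtimes> V) = Fo U \<boxtimes>\<^bsub>D\<^esub> Fo V"
    and TenA' [simp]: "\<lbrakk>f \<in> Arr C; g \<in> Arr C\<rbrakk> \<Longrightarrow> Dom C (f \<star> g) = Dom C f \<boxtimes> Dom C g"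
      "\<lbrakk>f \<in> Arr C; g \<in> Arr C\<rbrakk> \<Longrightarrow> Cod C (f \<star> g) = Cod C f \<boxtimes> Cod C g"
      "\<lbrakk>f \<in> Arr C; g \<in> Arr C\<rbrakk> \<Longrightarrow> Fa (f \<star> g) = Fa f \<star>\<^bsub>D\<^esub> Fa g"
    and Unit' [simp]: "\<I> \<in> Obj C" "Fo \<I> = \<I>\<^bsub>D\<^esub>"
    and Assoc' [simp]: "\<lbrakk>U \<in> Obj C; V \<in> Obj C; W \<in> Obj C\<rbrakk> \<Longrightarrow> Dom C (Assoc C U V W) = (U \<boxtimes> V) \<boxtimes> W"
      "\<lbrakk>U \<in> Obj C; V \<in> Obj C; W \<in> Obj C\<rbrakk> \<Longrightarrow> Cod C (Assoc C U V W) = U \<boxtimes> (V \<boxtimes> W)"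
      "\<lbrakk>U \<in> Obj C; V \<in> Obj C; W \<in> Obj C\<rbrakk> \<Longrightarrow> Fa (Assoc C U V W) = Assoc D (Fo U) (Fo V) (Fo W)"
    and LUnit' [simp]: "U \<in> Obj C \<Longrightarrow> Dom C (LUnit C U) = \<I> \<boxtimes> U" "U \<in> Obj C \<Longrightarrow> Cod C (LUnit C U) = U"
      "U \<in> Obj C \<Longrightarrow> Fa (LUnit C U) = LUnit D (Fo U)"
    and RUnit' [simp]: "U \<in> Obj C \<Longrightarrow> Dom C (RUnit C U) = U \<boxtimes> \<I>" "U \<in> Obj C \<Longrightarrow> Cod C (RUnit C U) = U"
      "U \<in> Obj C \<Longrightarrow> Fa (RUnit C U) = RUnit D (Fo U)"
    and Grade' [simp]: "U \<in> Obj C \<Longrightarrow> Grade C U = Grade D (Fo U)"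
    and ConjO' [simp]: "\<lbrakk>\<beta> \<in> carrier \<pi>; U \<in> Obj C\<rbrakk> \<Longrightarrow> ConjO C \<beta> U \<in> Obj C"
      "\<lbrakk>\<beta> \<in> carrier \<pi>; U \<in> Obj C\<rbrakk> \<Longrightarrow> Fo (ConjO C \<beta> U) = ConjO D \<beta> (Fo U)"
    and ConjA' [simp]: "\<lbrakk>\<beta> \<in> carrier \<pi>; f \<in> Arr C\<rbrakk> \<Longrightarrow> Dom C (ConjA C \<beta> f) = ConjO C \<beta> (Dom C f)"
      "\<lbrakk>\<beta> \<in> carrier \<pi>; f \<in> Arr C\<rbrakk> \<Longrightarrow> Cod C (ConjA C \<beta> f) = ConjO C \<beta> (Cod C f)"
      "\<lbrakk>\<beta> \<in> carrier \<pi>; f \<in> Arr C\<rbrakk> \<Longrightarrow> Fa (ConjA C \<beta> f) = ConjA D \<beta> (Fa f)"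
    and Braid' [simp]: "\<lbrakk>U \<in> Obj C; V \<in> Obj C\<rbrakk> \<Longrightarrow> Dom C (Braid C U V) = U \<boxtimes> V"
      "\<lbrakk>U \<in> Obj C; V \<in> Obj C\<rbrakk> \<Longrightarrow> Cod C (Braid C U V) = actO C U V \<boxtimes> U"
      "\<lbrakk>U \<in> Obj C; V \<in> Obj C\<rbrakk> \<Longrightarrow> Fa (Braid C U V) = Braid D (Fo U) (Fo V)"
begin

lemma Fo_Obj [simp]: "U \<in> Obj C \<Longrightarrow> Fo U \<in> Obj D"
  using bij_Fo by (rule bij_betw_apply)

lemma Fo_eqI: "Fo U = Fo V \<Longrightarrow> U \<in> Obj C \<Longrightarrow> V \<in> Obj C \<Longrightarrow> U = V"
  using bij_Fo by (auto simp: bij_betw_def inj_on_def)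

lemma Fa_Arr [simp]: "f \<in> Arr C \<Longrightarrow> Fa f \<in> Arr D"
  using bij_Fa by (rule bij_betw_apply)

lemma Fa_eqI: "Fa f = Fa g \<Longrightarrow> f \<in> Arr C \<Longrightarrow> g \<in> Arr C \<Longrightarrow> f = g"
  using bij_Fa by (auto simp: bij_betw_def inj_on_def)

lemma Grade_Fo [simp]: "U \<in> Obj C \<Longrightarrow> Grade D (Fo U) \<in> carrier \<pi>"
  by (simp add: D.Grade_closed)

lemma act_simps [simp]:
  "\<lbrakk>U \<in> Obj C; V \<in> Obj C\<rbrakk> \<Longrightarrow> actO C U V \<in> Obj C"
  "\<lbrakk>U \<in> Obj C; V \<in> Obj C\<rbrakk> \<Longrightarrow> Fo (actO C U V) = actO D (Fo U) (Fo V)"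
  "\<lbrakk>U \<in> Obj C; f \<in> Arr C\<rbrakk> \<Longrightarrow> Dom C (actA C U f) = actO C U (Dom C f)"
  "\<lbrakk>U \<in> Obj C; f \<in> Arr C\<rbrakk> \<Longrightarrow> Cod C (actA C U f) = actO C U (Cod C f)"
  "\<lbrakk>U \<in> Obj C; f \<in> Arr C\<rbrakk> \<Longrightarrow> Fa (actA C U f) = actA D (Fo U) (Fa f)"
  by (simp_all add: actO_def actA_def)

lemma Braid_simps [simp]:
  assumes "U \<in> Obj D" "V \<in> Obj D"
  shows "Braid D U V \<in> Arr D" "Dom D (Braid D U V) = U \<boxtimes>\<^bsub>D\<^esub> V" "Cod D (Braid D U V) = actO D U V \<boxtimes>\<^bsub>D\<^esub> U"
  using D.isosD(2-4)[OF D.Braid_iso[OF assms]] by simp_all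

lemma Arr_closed [simp]:
  "U \<in> Obj C \<Longrightarrow> \<iota> U \<in> Arr C"
  "\<lbrakk>f \<in> Arr C; g \<in> Arr C; Cod C f = Dom C g\<rbrakk> \<Longrightarrow> g \<cdot> f \<in> Arr C"
  "\<lbrakk>f \<in> Arr C; g \<in> Arr C\<rbrakk> \<Longrightarrow> f \<star> g \<in> Arr C"
  "\<lbrakk>U \<in> Obj C; V \<in> Obj C; W \<in> Obj C\<rbrakk> \<Longrightarrow> Assoc C U V W \<in> Arr C"
  "U \<in> Obj C \<Longrightarrow> LUnit C U \<in> Arr C" "U \<in> Obj C \<Longrightarrow> RUnit C U \<in> Arr C"
  "\<lbrakk>\<beta> \<in> carrier \<pi>; f \<in> Arr C\<rbrakk> \<Longrightarrow> ConjA C \<beta> f \<in> Arr C"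
  "\<lbrakk>U \<in> Obj C; V \<in> Obj C\<rbrakk> \<Longrightarrow> Braid C U V \<in> Arr C"
  by (subst Arr_iff; simp)+

lemma actA_Arr [simp]: "\<lbrakk>U \<in> Obj C; f \<in> Arr C\<rbrakk> \<Longrightarrow> actA C U f \<in> Arr C"
  by (simp add: actA_def)

lemma category: "category C"
  by unfold_locales
    (auto simp: arrows_def intro!: Fa_eqI simp: D.comp_assoc)

interpretation C: category C by (rule category)

text \<open>The inverse in \<open>D\<close> of an image is itself an image, as \<open>Fa\<close> is
  surjective, and injectivity of \<open>Fa\<close> turns the two identities for it into identities
  in \<open>C\<close>.\<close>

lemma isos_iff: "f \<in> isos C U V \<longleftrightarrow> f \<in> arrows C U V \<and> Fa f \<in> isos D (Fo U) (Fo V)"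
  and Fa_inv: "f \<in> isos C U V \<Longrightarrow> Fa (inv_arrow C f) = inv_arrow D (Fa f)"
proof -
  have 1: "inverse_arrows D (Fa f) (Fa g)" if "inverse_arrows C f g" for f g
  proof -
    have fg: "f \<in> Arr C" "g \<in> Arr C" "Dom C g = Cod C f" "Cod C g = Dom C f" "g \<cdot> f = \<iota> (Dom C f)" "f \<cdot> g = \<iota> (Cod C f)"
      using that by (auto simp: inverse_arrows_def arrows_def)
    have "Fa (g \<cdot> f) = \<iota>\<^bsub>D\<^esub> (Fo (Dom C f))" "Fa (f \<cdot> g) = \<iota>\<^bsub>D\<^esub> (Fo (Cod C f))" unfolding fg(5,6) using fg(1) by simp_all
    then show ?thesis using fg(1-4) by (simp add: inverse_arrows_def arrows_def)
  qed
  have 2: "f \<in> isos C U V" if f: "f \<in> arrows C U V" and i: "Fa f \<in> isos D (Fo U) (Fo V)"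
  proof -
    note i = D.isosD[OF i]
    have fA: "f \<in> Arr C" "Dom C f = U" "Cod C f = V" using f by (auto simp: arrows_def)
    obtain g where g: "g \<in> Arr C" "Fa g = inv_arrow D (Fa f)"
      using bij_Fa i(5) by (metis bij_betw_imp_surj_on imageE)
    have "Fo (Dom C g) = Fo V" "Fo (Cod C g) = Fo U" using Fa_Dom[of g] Fa_Cod[of g] g(2) i(6,7) by simp_all
    then have dg: "Dom C g = V" "Cod C g = U" using g fA by (auto intro: Fo_eqI)
    have "g \<cdot> f = \<iota> U" "f \<cdot> g = \<iota> V" using g fA dg i(8,9) by (auto intro!: Fa_eqI)
    then show ?thesis using f g(1) dg fA by (auto simp: isos_def inverse_arrows_def arrows_def)
  qed
  show "f \<in> isos C U V \<longleftrightarrow> f \<in> arrows C U V \<and> Fa f \<in> isos D (Fo U) (Fo V)"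
  proof
    assume f: "f \<in> isos C U V"
    have a: "f \<in> arrows C U V" by (rule C.isos_arrows[OF f])
    then have "Fa f \<in> arrows D (Fo U) (Fo V)" by (auto simp: arrows_def)
    then show "f \<in> arrows C U V \<and> Fa f \<in> isos D (Fo U) (Fo V)" using a D.isosI[OF _ 1[OF C.isosD(1)[OF f]]] by blast
  qed (use 2 in blast)
  show "f \<in> isos C U V \<Longrightarrow> Fa (inv_arrow C f) = inv_arrow D (Fa f)"
    using D.inv_arrow_eq[OF 1[OF C.isosD(1)]] by simp
qed

lemma Assoc_isos: "\<lbrakk>U \<in> Obj C; V \<in> Obj C; W \<in> Obj C\<rbrakk> \<Longrightarrow> Assoc C U V W \<in> isos C ((U \<boxtimes> V) \<boxtimes> W) (U \<boxtimes> (V \<boxtimes> W))"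
  by (simp add: isos_iff D.Assoc_iso arrows_def)

lemma inv_Assoc [simp]:
  assumes "U \<in> Obj C" "V \<in> Obj C" "W \<in> Obj C"
  shows "inv_arrow C (Assoc C U V W) \<in> Arr C" "Dom C (inv_arrow C (Assoc C U V W)) = U \<boxtimes> (V \<boxtimes> W)"
    "Cod C (inv_arrow C (Assoc C U V W)) = (U \<boxtimes> V) \<boxtimes> W" "Fa (inv_arrow C (Assoc C U V W)) = inv_arrow D (Assoc D (Fo U) (Fo V) (Fo W))"
  using C.isosD(5-7)[OF Assoc_isos[OF assms]] Fa_inv[OF Assoc_isos[OF assms]] assms by simp_all

lemma tensor_category: "tensor_category C"
proof (rule tensor_category.intro[OF category], unfold_locales, goal_cases)
  case 6 then show ?case by (rule Assoc_isos)
next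
  case (7 f U U' g V V' h W W')
  then show ?case using D.aso_natural[of "Fa f" "Fa g" "Fa h"] by (auto simp: arrows_def intro!: Fa_eqI)
next
  case 8 then show ?case by (simp add: isos_iff D.LUnit_iso arrows_def)
next
  case (9 f U V)
  then show ?case using D.LUnit_nat[of "Fa f"] by (auto simp: arrows_def intro!: Fa_eqI)
next
  case 10 then show ?case by (simp add: isos_iff D.RUnit_iso arrows_def)
next
  case (11 f U V)
  then show ?case using D.RUnit_nat[of "Fa f"] by (auto simp: arrows_def intro!: Fa_eqI)
next
  case 12 then show ?case by (auto intro!: Fa_eqI simp: D.pentagon)
next
  case 13 then show ?case by (auto intro!: Fa_eqI simp: D.triangle)
qed (auto simp: arrows_def D.TenA_Ident D.interchange intro!: Fa_eqI)

interpretation C: tensor_category C by (rule tensor_category)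

lemma T_category: "T_category \<pi> C"
proof (rule T_category.intro[OF D.P.is_group tensor_category], unfold_locales, goal_cases)
  case (2 f) then show ?case using D.Grade_arrow[of "Fa f"] by simp
next
  case (4 \<beta>) then show ?case by (auto simp: is_functor_def arrows_def D.ConjA_Comp intro!: Fa_eqI)
next
  case (15 \<beta> \<alpha>)
  show ?case
  proof (intro equalityI subsetI)
    fix V assume "V \<in> ConjO C \<beta> ` component C \<alpha>"
    then show "V \<in> component C (conjg \<pi> \<beta> \<alpha>)" using 15 by (auto simp: component_def D.Grade_ConjO)
  next
    fix V assume "V \<in> component C (conjg \<pi> \<beta> \<alpha>)"
    then have V: "V \<in> Obj C" "Fo V \<in> component D (conjg \<pi> \<beta> \<alpha>)" by (auto simp: component_def)
    \<comment> \<open>The preimage under conjugation is found in \<open>D\<close> and brought back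
      along the bijection \<open>Fo\<close>.\<close>
    then obtain Z where Z: "Z \<in> component D \<alpha>" "Fo V = ConjO D \<beta> Z" using D.Conj_component[OF 15] by auto
    then obtain U where U: "U \<in> Obj C" "Z = Fo U" using bij_Fo by (auto simp: bij_betw_def component_def)
    have "V = ConjO C \<beta> U" using Z U V 15 by (auto intro!: Fo_eqI)
    then show "V \<in> ConjO C \<beta> ` component C \<alpha>" using Z U by (auto simp: component_def)
  qed
qed (auto simp: D.Grade_TenO D.Conj_TenO D.Conj_TenA D.Conj_Unit D.Conj_Assoc D.Conj_LUnit D.Conj_RUnit
  D.ConjO_one D.ConjA_one D.ConjO_mult D.ConjA_mult intro!: Fo_eqI Fa_eqI)

lemma braided_T_category: "braided_T_category \<pi> C"
proof (rule braided_T_category.intro[OF T_category], unfold_locales, goal_cases)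
  case 1 then show ?case by (simp add: isos_iff D.Braid_iso arrows_def)
next
  case (2 f U U' g V V')
  then show ?case using D.Braid_natural[of "Fa f" "Fo U" "Fo U'" "Fa g" "Fo V" "Fo V'"]
    by (auto simp: arrows_def intro!: Fa_eqI)
next
  case 3 then show ?case by (auto intro!: Fa_eqI simp: D.Braid_TenO_left)
next
  case 4 then show ?case by (auto intro!: Fa_eqI simp: D.Braid_TenO_right)
next
  case 5 then show ?case by (auto intro!: Fa_eqI simp: D.Conj_Braid)
qed

lemma category_isomorphism: "category_isomorphism C D Fo Fa"
  using bij_Fo bij_Fa by (auto simp: category_isomorphism_def is_functor_def arrows_def)

lemma transported_structure: "transported_structure \<pi> C D Fo Fa"
  by (auto simp: transported_structure_def component_def)

end

section \<open>Linear algebra\<close>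

lemma linear_mapI:
  assumes "\<And>v. v \<in> carrier V \<Longrightarrow> f v \<in> carrier W"
    and "\<And>v v'. \<lbrakk>v \<in> carrier V; v' \<in> carrier V\<rbrakk> \<Longrightarrow> f (v \<oplus>\<^bsub>V\<^esub> v') = f v \<oplus>\<^bsub>W\<^esub> f v'"
    and "\<And>a v. \<lbrakk>a \<in> carrier K; v \<in> carrier V\<rbrakk> \<Longrightarrow> f (a \<odot>\<^bsub>V\<^esub> v) = a \<odot>\<^bsub>W\<^esub> f v"
  shows "linear_map K V W f"
  using assms by (auto simp: linear_map_def)

lemma linear_mapD:
  assumes "linear_map K V W f"
  shows "v \<in> carrier V \<Longrightarrow> f v \<in> carrier W"
    "\<lbrakk>v \<in> carrier V; v' \<in> carrier V\<rbrakk> \<Longrightarrow> f (v \<oplus>\<^bsub>V\<^esub> v') = f v \<oplus>\<^bsub>W\<^esub> f v'"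
    "\<lbrakk>a \<in> carrier K; v \<in> carrier V\<rbrakk> \<Longrightarrow> f (a \<odot>\<^bsub>V\<^esub> v) = a \<odot>\<^bsub>W\<^esub> f v"
  using assms by (auto simp: linear_map_def)

lemma linear_map_zero:
  assumes "module K V" "module K W" "linear_map K V W f"
  shows "f \<zero>\<^bsub>V\<^esub> = \<zero>\<^bsub>W\<^esub>"
proof -
  interpret V: module K V by fact
  interpret W: module K W by fact
  have "f (\<zero>\<^bsub>K\<^esub> \<odot>\<^bsub>V\<^esub> \<zero>\<^bsub>V\<^esub>) = \<zero>\<^bsub>K\<^esub> \<odot>\<^bsub>W\<^esub> f \<zero>\<^bsub>V\<^esub>"
    by (rule linear_mapD(3)[OF assms(3)]) simp_all
  then show ?thesis using linear_mapD(1)[OF assms(3) V.zero_closed] by simp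
qed

lemma linear_map_comp:
  "linear_map K U V f \<Longrightarrow> linear_map K V W g \<Longrightarrow> linear_map K U W (\<lambda>u. g (f u))"
  by (auto simp: linear_map_def Pi_iff)

lemma linear_map_cong:
  assumes "linear_map K V W f" "module K V" "\<And>v. v \<in> carrier V \<Longrightarrow> g v = f v"
  shows "linear_map K V W g"
proof -
  interpret module K V by fact
  show ?thesis using assms(1,3) by (auto simp: linear_map_def Pi_iff)
qed

definition bilinear_map ::
    "'k ring \<Rightarrow> ('k, 'x) module \<Rightarrow> ('k, 'y) module \<Rightarrow> ('k, 'z) module \<Rightarrow> ('x \<Rightarrow> 'y \<Rightarrow> 'z) \<Rightarrow> bool" where
  "bilinear_map K V W M B \<longleftrightarrow>
     (\<forall>v\<in>carrier V. linear_map K W M (B v)) \<and> (\<forall>w\<in>carrier W. linear_map K V M (\<lambda>v. B v w))"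

lemma bilinear_mapI:
  assumes "\<And>v. v \<in> carrier V \<Longrightarrow> linear_map K W M (B v)"
    and "\<And>w. w \<in> carrier W \<Longrightarrow> linear_map K V M (\<lambda>v. B v w)"
  shows "bilinear_map K V W M B"
  using assms by (auto simp: bilinear_map_def)

lemma bilinear_mapD:
  assumes "bilinear_map K V W M B"
  shows "v \<in> carrier V \<Longrightarrow> linear_map K W M (B v)" "w \<in> carrier W \<Longrightarrow> linear_map K V M (\<lambda>v. B v w)"
    "\<lbrakk>v \<in> carrier V; w \<in> carrier W\<rbrakk> \<Longrightarrow> B v w \<in> carrier M"
  using assms by (auto simp: bilinear_map_def linear_map_def)

lemma linear_map_id: "linear_map K V V (\<lambda>v. v)"
  by (auto simp: linear_map_def)

lemma linear_map_sum:
  assumes "module K U" "module K M" "linear_map K U M f" "linear_map K U M g"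
  shows "linear_map K U M (\<lambda>u. f u \<oplus>\<^bsub>M\<^esub> g u)"
proof -
  interpret U: module K U by fact
  interpret M: module K M by fact
  show ?thesis
    using assms(3,4) by (intro linear_mapI) (auto simp: linear_mapD M.a_ac M.smult_r_distr)
qed

lemma linear_map_const_zero:
  assumes "module K M"
  shows "linear_map K U M (\<lambda>u. \<zero>\<^bsub>M\<^esub>)"
proof -
  interpret M: module K M by fact
  show ?thesis by (intro linear_mapI) auto
qed

lemma linear_map_smult_right:
  assumes "module K U" "module K M" "linear_map K U M f" "a \<in> carrier K"
  shows "linear_map K U M (\<lambda>u. a \<odot>\<^bsub>M\<^esub> f u)"
proof -
  interpret U: module K U by fact
  interpret M: module K M by fact
  show ?thesis
    using assms(3,4) by (intro linear_mapI) (auto simp: linear_mapD M.smult_r_distr M.smult_assoc1[symmetric] U.m_comm)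
qed

lemma linear_map_smult_left:
  assumes "module K M" "linear_map K U (ground_module K) f" "m \<in> carrier M"
  shows "linear_map K U M (\<lambda>u. f u \<odot>\<^bsub>M\<^esub> m)"
proof -
  interpret M: module K M by fact
  show ?thesis
    using assms(3) linear_mapD[OF assms(2), unfolded ground_module_def, simplified]
    by (intro linear_mapI) (simp_all add: M.smult_l_distr M.smult_assoc1)
qed

subsection \<open>Lifting bilinear maps\<close>

lemma sweedler_simps:
  "sweedler M B [] = \<zero>\<^bsub>M\<^esub>" "sweedler M B ((v, w) # x) = B v w \<oplus>\<^bsub>M\<^esub> sweedler M B x"
  by (simp_all add: sweedler_def)

lemma sweedler_list_closed:
  assumes "module K M" "x \<in> lists (carrier V \<times> carrier W)"
    "\<And>v w. \<lbrakk>v \<in> carrier V; w \<in> carrier W\<rbrakk> \<Longrightarrow> B v w \<in> carrier M"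
  shows "sweedler M B x \<in> carrier M"
proof -
  interpret M: module K M by fact
  show ?thesis using assms(2) by induction (auto simp: sweedler_simps assms(3))
qed

lemma sweedler_append:
  assumes "module K M" "x \<in> lists (carrier V \<times> carrier W)" "y \<in> lists (carrier V \<times> carrier W)"
    "\<And>v w. \<lbrakk>v \<in> carrier V; w \<in> carrier W\<rbrakk> \<Longrightarrow> B v w \<in> carrier M"
  shows "sweedler M B (x @ y) = sweedler M B x \<oplus>\<^bsub>M\<^esub> sweedler M B y"
proof -
  interpret M: module K M by fact
  note c = sweedler_list_closed[where B = B and V = V and W = W, OF assms(1) _ assms(4)]
  from assms(2) show ?thesis
  proof induction
    case (Cons z zs)
    then show ?case
      using c[OF assms(3)] c[OF Cons.hyps(2)] assms(4) by (auto simp: sweedler_simps M.a_assoc)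
  qed (use c[OF assms(3)] in \<open>simp add: sweedler_simps\<close>)
qed

lemma tensor_cong_lists:
  assumes "tensor_cong K V W xs ys" "module K V" "module K W"
  shows "xs \<in> lists (carrier V \<times> carrier W) \<and> ys \<in> lists (carrier V \<times> carrier W)"
proof -
  interpret V: module K V by fact
  interpret W: module K W by fact
  show ?thesis using assms(1) by induction auto
qed

text \<open>Rule induction: each generating relation is an identity satisfied by every bilinear map,
  and the structural rules hold because \<open>sweedler\<close> turns concatenation into addition.
  Hence a bilinear map may be evaluated on any representative.\<close>

lemma sweedler_tensor_cong:
  assumes "tensor_cong K V W xs ys" "module K V" "module K W" "module K M" "bilinear_map K V W M B"
  shows "sweedler M B xs = sweedler M B ys"
proof -
  interpret V: module K V by fact
  interpret W: module K W by fact
  interpret M: module K M by fact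
  note B = bilinear_mapD[OF assms(5)]
  note Bl = linear_mapD[OF B(1)] linear_mapD[OF B(2)]
  note c = sweedler_list_closed[where B = B and V = V and W = W, OF assms(4) _ B(3)]
  note ap = sweedler_append[where B = B and V = V and W = W, OF assms(4) _ _ B(3)]
  show ?thesis using assms(1)
  proof induction
    case (append xs xs' ys ys')
    then show ?case
      using tensor_cong_lists[OF append.hyps(1) assms(2,3)] tensor_cong_lists[OF append.hyps(2) assms(2,3)]
        ap[of xs ys]
        ap[of xs' ys']
      by simp
  next
    case (commute xs ys)
    then show ?case
      using c[of xs] c[of ys] ap[of xs ys]
        ap[of ys xs] by (simp add: M.a_comm del: in_lists_conv_set)
  next
    case (zero w)
    then show ?case
      using linear_map_zero[OF assms(2,4) B(2)] by (simp add: sweedler_simps)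
  qed (simp_all add: sweedler_simps Bl B(3) M.a_ac)
qed

section \<open>The tensor product as a module and its universal property\<close>

context
  fixes K :: "'k ring" and V :: "('k, 'x) module" and W :: "('k, 'y) module"
  assumes V: "module K V" and W: "module K W"
begin

interpretation K: cring K using V by (rule module.axioms)
interpretation V: module K V by (rule V)
interpretation W: module K W by (rule W)

text \<open>Makes scalar multiplication on representatives well defined; the relation
  \<open>balanced\<close> survives because scalars commute.\<close>

lemma tensor_cong_smult:
  assumes "tensor_cong K V W xs ys" "a \<in> carrier K"
  shows "tensor_cong K V W (map (\<lambda>(v, w). (a \<odot>\<^bsub>V\<^esub> v, w)) xs) (map (\<lambda>(v, w). (a \<odot>\<^bsub>V\<^esub> v, w)) ys)"
proof -
  have l: "map (\<lambda>(v, w). (a \<odot>\<^bsub>V\<^esub> v, w)) xs \<in> lists (carrier V \<times> carrier W)"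
    if "xs \<in> lists (carrier V \<times> carrier W)" for xs
    using that by induction (auto simp: assms(2))
  show ?thesis using assms(1)
  proof induction
    case (balanced b v w)
    have "a \<odot>\<^bsub>V\<^esub> (b \<odot>\<^bsub>V\<^esub> v) = b \<odot>\<^bsub>V\<^esub> (a \<odot>\<^bsub>V\<^esub> v)"
      using balanced assms(2) by (simp add: V.smult_assoc1[symmetric] K.m_comm)
    then show ?case using balanced assms(2) by (auto intro: tensor_cong.balanced)
  qed (use assms(2) l in \<open>auto intro: tensor_cong.intros simp: V.smult_r_distr\<close>)
qed

lemma tensor_class_cong:
  assumes "xs \<in> lists (carrier V \<times> carrier W)"
  shows "tensor_cong K V W xs (tensor_class K V W xs)"
  unfolding tensor_class_def by (rule someI) (rule tensor_cong.refl[OF assms])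

text \<open>Congruent lists have the same predicate of lists congruent to them, so the choice
  operator picks the same representative.\<close>

lemma tensor_class_eq:
  assumes "tensor_cong K V W xs ys"
  shows "tensor_class K V W xs = tensor_class K V W ys"
proof -
  have "tensor_cong K V W xs = tensor_cong K V W ys"
    using assms by (auto simp: fun_eq_iff intro: tensor_cong.sym tensor_cong.trans)
  then show ?thesis by (simp add: tensor_class_def)
qed

lemma tensor_class_lists:
  "xs \<in> lists (carrier V \<times> carrier W) \<Longrightarrow> tensor_class K V W xs \<in> lists (carrier V \<times> carrier W)"
  using tensor_cong_lists[OF tensor_class_cong V W] by blast

lemma carrier_tensor: "carrier (tensor K V W) = tensor_class K V W ` lists (carrier V \<times> carrier W)"
  and zero_tensor: "\<zero>\<^bsub>tensor K V W\<^esub> = tensor_class K V W []"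
  and one_tensor: "\<one>\<^bsub>tensor K V W\<^esub> = pure K V W \<one>\<^bsub>V\<^esub> \<one>\<^bsub>W\<^esub>"
  and add_tensor: "x \<oplus>\<^bsub>tensor K V W\<^esub> y = tensor_class K V W (x @ y)"
  and smult_tensor: "a \<odot>\<^bsub>tensor K V W\<^esub> x = tensor_class K V W (map (\<lambda>(v, w). (a \<odot>\<^bsub>V\<^esub> v, w)) x)"
  by (simp_all add: tensor_def Let_def)

lemma mult_tensor:
  "x \<otimes>\<^bsub>tensor K V W\<^esub> y = sweedler (tensor K V W) (\<lambda>v w. sweedler (tensor K V W) (\<lambda>v' w'.
      pure K V W (v \<otimes>\<^bsub>V\<^esub> v') (w \<otimes>\<^bsub>W\<^esub> w')) y) x"
  by (simp add: tensor_def Let_def sweedler_def)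

lemma add_tensor_class:
  assumes "xs \<in> lists (carrier V \<times> carrier W)" "ys \<in> lists (carrier V \<times> carrier W)"
  shows "tensor_class K V W xs \<oplus>\<^bsub>tensor K V W\<^esub> tensor_class K V W ys = tensor_class K V W (xs @ ys)"
  unfolding add_tensor
  by (rule tensor_class_eq[OF tensor_cong.sym]) (intro tensor_cong.append tensor_class_cong assms)

lemma smult_tensor_class:
  assumes "xs \<in> lists (carrier V \<times> carrier W)" "a \<in> carrier K"
  shows "a \<odot>\<^bsub>tensor K V W\<^esub> tensor_class K V W xs = tensor_class K V W (map (\<lambda>(v, w). (a \<odot>\<^bsub>V\<^esub> v, w)) xs)"
  unfolding smult_tensor
  by (rule tensor_class_eq[OF tensor_cong.sym]) (intro tensor_cong_smult tensor_class_cong assms)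

lemma tensor_cong_Cons_append:
  assumes "x \<in> carrier V \<times> carrier W" "ys \<in> lists (carrier V \<times> carrier W)" "zs \<in> lists (carrier V \<times> carrier W)"
  shows "tensor_cong K V W (ys @ x # zs) (x # ys @ zs)"
  using tensor_cong.append[OF tensor_cong.commute[of ys V W "[x]"] tensor_cong.refl[OF assms(3)], of K] assms
  by simp

text \<open>Addition is concatenation of representatives. The real content lies in
  \<open>ldistr\<close> and \<open>zero\<close>, where lists of different length are shown congruent
  by induction; the other laws come from congruence rules or hold entry by entry.\<close>

lemma tensor_module: "module K (tensor K V W)"
proof (rule moduleI)
  let ?c = "tensor_class K V W" and ?L = "lists (carrier V \<times> carrier W)"
  have ap: "xs @ ys \<in> ?L" if "xs \<in> ?L" "ys \<in> ?L" for xs ys using that by auto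
  have sm: "map (\<lambda>(v, w). (a \<odot>\<^bsub>V\<^esub> v, w)) xs \<in> ?L" if "xs \<in> ?L" "a \<in> carrier K" for a xs
    using that by induction auto
  show "cring K" by (rule K.is_cring)
  have ldistr: "?c (map (\<lambda>(v, w). ((a \<oplus>\<^bsub>K\<^esub> b) \<odot>\<^bsub>V\<^esub> v, w)) xs) =
       ?c (map (\<lambda>(v, w). (a \<odot>\<^bsub>V\<^esub> v, w)) xs @ map (\<lambda>(v, w). (b \<odot>\<^bsub>V\<^esub> v, w)) xs)"
    if xs: "xs \<in> ?L" and ab: "a \<in> carrier K" "b \<in> carrier K" for xs a b
  proof (rule tensor_class_eq)
    show "tensor_cong K V W (map (\<lambda>(v, w). ((a \<oplus>\<^bsub>K\<^esub> b) \<odot>\<^bsub>V\<^esub> v, w)) xs)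
       (map (\<lambda>(v, w). (a \<odot>\<^bsub>V\<^esub> v, w)) xs @ map (\<lambda>(v, w). (b \<odot>\<^bsub>V\<^esub> v, w)) xs)"
      using xs
    proof induction
      case Nil
      then show ?case by (auto intro: tensor_cong.refl)
    next
      case (Cons x xs)
      obtain v w where x: "x = (v, w)" "v \<in> carrier V" "w \<in> carrier W" using Cons by auto
      let ?f = "\<lambda>a. map (\<lambda>(v, w). (a \<odot>\<^bsub>V\<^esub> v, w)) xs"
      have "tensor_cong K V W ([((a \<oplus>\<^bsub>K\<^esub> b) \<odot>\<^bsub>V\<^esub> v, w)] @ ?f (a \<oplus>\<^bsub>K\<^esub> b))
         ([(a \<odot>\<^bsub>V\<^esub> v, w), (b \<odot>\<^bsub>V\<^esub> v, w)] @ (?f a @ ?f b))"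
        by (rule tensor_cong.append[OF _ Cons.IH])
          (use x ab in \<open>auto intro!: tensor_cong.add_left simp: V.smult_l_distr\<close>)
      \<comment> \<open>The two terms obtained from \<open>x\<close> arrive next to each other; the
        second one is moved past the terms scaled by \<open>a\<close>.\<close>
      moreover have "tensor_cong K V W ([(a \<odot>\<^bsub>V\<^esub> v, w)] @ ((b \<odot>\<^bsub>V\<^esub> v, w) # ?f a @ ?f b))
         ([(a \<odot>\<^bsub>V\<^esub> v, w)] @ (?f a @ (b \<odot>\<^bsub>V\<^esub> v, w) # ?f b))"
        by (intro tensor_cong.append tensor_cong.refl tensor_cong.sym[OF tensor_cong_Cons_append])
          (use x ab sm[OF Cons.hyps(2)] in auto)
      ultimately show ?case using x by (auto intro: tensor_cong.trans)
    qed
  qed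
  have zero: "?c (map (\<lambda>(v, w). (\<zero>\<^bsub>K\<^esub> \<odot>\<^bsub>V\<^esub> v, w)) xs) = ?c []" if xs: "xs \<in> ?L" for xs
  proof (rule tensor_class_eq)
    show "tensor_cong K V W (map (\<lambda>(v, w). (\<zero>\<^bsub>K\<^esub> \<odot>\<^bsub>V\<^esub> v, w)) xs) []"
      using xs
    proof induction
      case (Cons x xs)
      obtain v w where x: "x = (v, w)" "v \<in> carrier V" "w \<in> carrier W" using Cons by auto
      have "tensor_cong K V W ([(\<zero>\<^bsub>V\<^esub>, w)] @ map (\<lambda>(v, w). (\<zero>\<^bsub>K\<^esub> \<odot>\<^bsub>V\<^esub> v, w)) xs) ([] @ [])"
        by (intro tensor_cong.append tensor_cong.zero x Cons.IH)
      then show ?case using x by simp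
    qed (auto intro: tensor_cong.refl)
  qed
  note in_listsD [rule del] in_listsI [rule del]
  show "abelian_group (tensor K V W)"
  proof (rule abelian_groupI)
    fix x assume "x \<in> carrier (tensor K V W)"
    then obtain xs where x: "x = ?c xs" "xs \<in> ?L" by (auto simp: carrier_tensor)
    \<comment> \<open>The negative of \<open>x\<close> is \<open>x\<close> scaled by minus one. To
      apply \<open>ldistr\<close> and \<open>zero\<close>, the other summand is written as
      \<open>x\<close> scaled by one.\<close>
    let ?y = "?c (map (\<lambda>(v, w). ((\<ominus>\<^bsub>K\<^esub> \<one>\<^bsub>K\<^esub>) \<odot>\<^bsub>V\<^esub> v, w)) xs)"
    have id: "map (\<lambda>(v, w). (\<one>\<^bsub>K\<^esub> \<odot>\<^bsub>V\<^esub> v, w)) xs = xs" using x(2) by induction auto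
    have "?y \<oplus>\<^bsub>tensor K V W\<^esub> x = ?c (map (\<lambda>(v, w). ((\<ominus>\<^bsub>K\<^esub> \<one>\<^bsub>K\<^esub>) \<odot>\<^bsub>V\<^esub> v, w)) xs @ map (\<lambda>(v, w). (\<one>\<^bsub>K\<^esub> \<odot>\<^bsub>V\<^esub> v, w)) xs)"
      unfolding id x(1) by (rule add_tensor_class[OF sm x(2)]) (use x(2) in auto)
    also have "\<dots> = \<zero>\<^bsub>tensor K V W\<^esub>"
      using ldistr[OF x(2), of "\<ominus>\<^bsub>K\<^esub> \<one>\<^bsub>K\<^esub>" "\<one>\<^bsub>K\<^esub>"] zero[OF x(2)] by (simp add: zero_tensor K.l_neg)
    finally show "\<exists>y\<in>carrier (tensor K V W). y \<oplus>\<^bsub>tensor K V W\<^esub> x = \<zero>\<^bsub>tensor K V W\<^esub>"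
      using sm[OF x(2), of "\<ominus>\<^bsub>K\<^esub> \<one>\<^bsub>K\<^esub>"] by (auto simp: carrier_tensor simp del: in_lists_conv_set)
  next
    fix x y assume "x \<in> carrier (tensor K V W)" "y \<in> carrier (tensor K V W)"
    then obtain xs ys where "x = ?c xs" "xs \<in> ?L" "y = ?c ys" "ys \<in> ?L" by (auto simp: carrier_tensor)
    then show "x \<oplus>\<^bsub>tensor K V W\<^esub> y = y \<oplus>\<^bsub>tensor K V W\<^esub> x"
      by (simp only: add_tensor_class) (rule tensor_class_eq[OF tensor_cong.commute])
  qed (auto simp: carrier_tensor add_tensor_class zero_tensor simp del: in_lists_conv_set
        intro!: imageI ap add_tensor_class[of "[]", simplified])
  fix a x assume a: "a \<in> carrier K" and "x \<in> carrier (tensor K V W)"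
  then obtain xs where x: "x = ?c xs" "xs \<in> ?L" by (auto simp: carrier_tensor)
  show "a \<odot>\<^bsub>tensor K V W\<^esub> x \<in> carrier (tensor K V W)"
    using x sm[OF x(2) a] a by (auto simp: smult_tensor_class carrier_tensor simp del: in_lists_conv_set)
  {
    fix b assume b: "b \<in> carrier K"
    show "(a \<oplus>\<^bsub>K\<^esub> b) \<odot>\<^bsub>tensor K V W\<^esub> x = a \<odot>\<^bsub>tensor K V W\<^esub> x \<oplus>\<^bsub>tensor K V W\<^esub> b \<odot>\<^bsub>tensor K V W\<^esub> x"
      using a b x(2) sm[OF x(2)] ldistr[OF x(2) a b]
      by (simp add: x(1) smult_tensor_class add_tensor_class del: in_lists_conv_set)
    have "map (\<lambda>(v, w). ((a \<otimes>\<^bsub>K\<^esub> b) \<odot>\<^bsub>V\<^esub> v, w)) xs = map (\<lambda>(v, w). (a \<odot>\<^bsub>V\<^esub> v, w)) (map (\<lambda>(v, w). (b \<odot>\<^bsub>V\<^esub> v, w)) xs)"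
      using x(2) by induction (auto simp: a b V.smult_assoc1)
    then show "a \<otimes>\<^bsub>K\<^esub> b \<odot>\<^bsub>tensor K V W\<^esub> x = a \<odot>\<^bsub>tensor K V W\<^esub> (b \<odot>\<^bsub>tensor K V W\<^esub> x)"
      using a b x(2) sm[OF x(2) b]
      by (simp add: x(1) smult_tensor_class del: in_lists_conv_set map_map map_eq_conv)
  }
  fix y assume "y \<in> carrier (tensor K V W)"
  then obtain ys where y: "y = ?c ys" "ys \<in> ?L" by (auto simp: carrier_tensor)
  show "a \<odot>\<^bsub>tensor K V W\<^esub> (x \<oplus>\<^bsub>tensor K V W\<^esub> y) = a \<odot>\<^bsub>tensor K V W\<^esub> x \<oplus>\<^bsub>tensor K V W\<^esub> a \<odot>\<^bsub>tensor K V W\<^esub> y"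
    using a x y ap[OF x(2) y(2)] sm[OF x(2) a] sm[OF y(2) a]
    by (simp add: smult_tensor_class add_tensor_class del: in_lists_conv_set append_in_lists_conv)
next
  fix x assume "x \<in> carrier (tensor K V W)"
  then obtain xs where x: "x = tensor_class K V W xs" "xs \<in> lists (carrier V \<times> carrier W)" by (auto simp: carrier_tensor)
  have "map (\<lambda>(v, w). (\<one>\<^bsub>K\<^esub> \<odot>\<^bsub>V\<^esub> v, w)) xs = xs" using x(2) by induction auto
  then show "\<one>\<^bsub>K\<^esub> \<odot>\<^bsub>tensor K V W\<^esub> x = x"
    using x by (simp add: smult_tensor_class del: in_lists_conv_set)
qed

lemma pure_closed: "\<lbrakk>v \<in> carrier V; w \<in> carrier W\<rbrakk> \<Longrightarrow> pure K V W v w \<in> carrier (tensor K V W)"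
  by (auto simp: pure_def carrier_tensor)

lemma pure_bilinear: "bilinear_map K V W (tensor K V W) (pure K V W)"
proof (intro bilinear_mapI linear_mapI)
  fix v w w' assume "v \<in> carrier V" "w \<in> carrier W" "w' \<in> carrier W"
  then show "pure K V W v (w \<oplus>\<^bsub>W\<^esub> w') = pure K V W v w \<oplus>\<^bsub>tensor K V W\<^esub> pure K V W v w'"
    unfolding pure_def by (subst add_tensor_class) (auto intro!: tensor_class_eq tensor_cong.add_right)
next
  fix v w w' assume "w \<in> carrier V" "v \<in> carrier W" "w' \<in> carrier V"
  then show "pure K V W (w \<oplus>\<^bsub>V\<^esub> w') v = pure K V W w v \<oplus>\<^bsub>tensor K V W\<^esub> pure K V W w' v"
    unfolding pure_def by (subst add_tensor_class) (auto intro!: tensor_class_eq tensor_cong.add_left)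
next
  fix a v w assume "a \<in> carrier K" "v \<in> carrier V" "w \<in> carrier W"
  then show "pure K V W v (a \<odot>\<^bsub>W\<^esub> w) = a \<odot>\<^bsub>tensor K V W\<^esub> pure K V W v w"
    unfolding pure_def by (subst smult_tensor_class) (auto intro!: tensor_class_eq tensor_cong.sym[OF tensor_cong.balanced])
next
  fix a v w assume "a \<in> carrier K" "v \<in> carrier V" "w \<in> carrier W"
  then show "pure K V W (a \<odot>\<^bsub>V\<^esub> v) w = a \<odot>\<^bsub>tensor K V W\<^esub> pure K V W v w"
    unfolding pure_def by (subst smult_tensor_class) auto
qed (auto intro: pure_closed)

lemma tensor_lists: "x \<in> carrier (tensor K V W) \<Longrightarrow> x \<in> lists (carrier V \<times> carrier W)"
  using tensor_class_lists by (auto simp: carrier_tensor simp del: in_lists_conv_set)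

text \<open>The class of a list is the sum of the pure tensors of its entries, so this is induction
  over a representative.\<close>

lemma tensor_induct [consumes 1, case_names zero add]:
  assumes "x \<in> carrier (tensor K V W)" and "P \<zero>\<^bsub>tensor K V W\<^esub>"
    and "\<And>v w y. \<lbrakk>v \<in> carrier V; w \<in> carrier W; y \<in> carrier (tensor K V W); P y\<rbrakk> \<Longrightarrow>
      P (pure K V W v w \<oplus>\<^bsub>tensor K V W\<^esub> y)"
  shows "P x"
proof -
  have "P (tensor_class K V W xs)" if "xs \<in> lists (carrier V \<times> carrier W)" for xs
    using that
  proof induction
    case Nil
    then show ?case using assms(2) by (simp add: zero_tensor)
  next
    case (Cons x xs)
    obtain v w where x: "x = (v, w)" "v \<in> carrier V" "w \<in> carrier W" using Cons by auto
    have "tensor_class K V W (x # xs) = pure K V W v w \<oplus>\<^bsub>tensor K V W\<^esub> tensor_class K V W xs"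
      unfolding pure_def x(1) by (subst add_tensor_class) (use x Cons in auto)
    then show ?case using assms(3) x Cons by (auto simp: carrier_tensor simp del: in_lists_conv_set)
  qed
  then show ?thesis using assms(1) by (auto simp: carrier_tensor simp del: in_lists_conv_set)
qed

context
  fixes M :: "('k, 'z) module"
  assumes M: "module K M"
begin

interpretation M: module K M by (rule M)

lemma sweedler_class:
  assumes "bilinear_map K V W M B" "xs \<in> lists (carrier V \<times> carrier W)"
  shows "sweedler M B (tensor_class K V W xs) = sweedler M B xs"
  using sweedler_tensor_cong[OF tensor_class_cong[OF assms(2)] V W M assms(1)] by simp

lemma sweedler_linear:
  assumes "bilinear_map K V W M B"
  shows "linear_map K (tensor K V W) M (sweedler M B)"
proof (rule linear_mapI)
  note B = bilinear_mapD[OF assms]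
  fix x assume x: "x \<in> carrier (tensor K V W)"
  show "sweedler M B x \<in> carrier M" by (rule sweedler_list_closed[OF M tensor_lists[OF x] B(3)])
  fix y assume y: "y \<in> carrier (tensor K V W)"
  show "sweedler M B (x \<oplus>\<^bsub>tensor K V W\<^esub> y) = sweedler M B x \<oplus>\<^bsub>M\<^esub> sweedler M B y"
    unfolding add_tensor using sweedler_class[OF assms, of "x @ y"] tensor_lists[OF x] tensor_lists[OF y]
    by (simp add: sweedler_append[OF M _ _ B(3)] del: in_lists_conv_set)
next
  note B = bilinear_mapD[OF assms]
  fix a x assume a: "a \<in> carrier K" and x: "x \<in> carrier (tensor K V W)"
  let ?f = "map (\<lambda>(v, w). (a \<odot>\<^bsub>V\<^esub> v, w))"
  have l: "?f x \<in> lists (carrier V \<times> carrier W)" using tensor_lists[OF x] by induction (auto simp: a)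
  have "sweedler M B (?f x) = a \<odot>\<^bsub>M\<^esub> sweedler M B x"
    using tensor_lists[OF x]
  proof induction
    case (Cons z zs)
    obtain v w where z: "z = (v, w)" "v \<in> carrier V" "w \<in> carrier W" using Cons by auto
    then show ?case
      using Cons.IH a sweedler_list_closed[OF M Cons.hyps(2) B(3)] linear_mapD(3)[OF B(2)] B(3)
      by (simp add: sweedler_simps M.smult_r_distr)
  qed (use a in \<open>simp add: sweedler_simps\<close>)
  then show "sweedler M B (a \<odot>\<^bsub>tensor K V W\<^esub> x) = a \<odot>\<^bsub>M\<^esub> sweedler M B x"
    unfolding smult_tensor using sweedler_class[OF assms l] by simp
qed

lemma sweedler_pure:
  assumes "bilinear_map K V W M B" "v \<in> carrier V" "w \<in> carrier W"
  shows "sweedler M B (pure K V W v w) = B v w"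
  using sweedler_class[OF assms(1), of "[(v, w)]"] assms bilinear_mapD(3)[OF assms]
  by (simp add: pure_def sweedler_simps)

text \<open>The uniqueness half of the universal property. Identities on tensor products are reduced
  by it to pure tensors, where \<open>sweedler_pure\<close> computes.\<close>

lemma tensor_ext:
  assumes "linear_map K (tensor K V W) M f" "linear_map K (tensor K V W) M g"
    and "\<And>v w. \<lbrakk>v \<in> carrier V; w \<in> carrier W\<rbrakk> \<Longrightarrow> f (pure K V W v w) = g (pure K V W v w)"
    and "x \<in> carrier (tensor K V W)"
  shows "f x = g x"
  using assms(4)
proof (induction rule: tensor_induct)
  case zero
  then show ?case using linear_map_zero[OF tensor_module M assms(1)] linear_map_zero[OF tensor_module M assms(2)] by simp
next
  case (add v w y)
  then show ?case using linear_mapD[OF assms(1)] linear_mapD[OF assms(2)] assms(3) by (simp add: pure_closed)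
qed

lemma sweedler_closed:
  assumes "x \<in> carrier (tensor K V W)" "\<And>v w. \<lbrakk>v \<in> carrier V; w \<in> carrier W\<rbrakk> \<Longrightarrow> B v w \<in> carrier M"
  shows "sweedler M B x \<in> carrier M"
  using sweedler_list_closed[OF M tensor_lists[OF assms(1)] assms(2)] .

lemma sweedler_cong:
  assumes "x \<in> carrier (tensor K V W)" "\<And>v w. \<lbrakk>v \<in> carrier V; w \<in> carrier W\<rbrakk> \<Longrightarrow> B v w = B' v w"
  shows "sweedler M B x = sweedler M B' x"
  using tensor_lists[OF assms(1)] by induction (auto simp: sweedler_simps assms(2))

text \<open>For a fixed representative \<open>x\<close> this is a finite sum of maps that are linear
  in \<open>u\<close>. It provides the linearity in outer arguments when bilinear maps are lifted
  repeatedly.\<close>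

lemma sweedler_param_linear:
  assumes "module K U" "x \<in> carrier (tensor K V W)"
    "\<And>v w. \<lbrakk>v \<in> carrier V; w \<in> carrier W\<rbrakk> \<Longrightarrow> linear_map K U M (\<lambda>u. B u v w)"
  shows "linear_map K U M (\<lambda>u. sweedler M (B u) x)"
  using tensor_lists[OF assms(2)]
  by induction (auto simp: sweedler_simps M assms(1,3) intro!: linear_map_const_zero linear_map_sum)

end

lemma linear_map_sweedler:
  assumes "module K M" "module K N" "linear_map K M N f" "x \<in> carrier (tensor K V W)"
    "\<And>v w. \<lbrakk>v \<in> carrier V; w \<in> carrier W\<rbrakk> \<Longrightarrow> B v w \<in> carrier M"
  shows "f (sweedler M B x) = sweedler N (\<lambda>v w. f (B v w)) x"
  using tensor_lists[OF assms(4)]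
proof induction
  case Nil
  then show ?case using linear_map_zero[OF assms(1-3)] by (simp add: sweedler_simps)
next
  case (Cons z zs)
  then show ?case
    using sweedler_list_closed[OF assms(1) Cons.hyps(2) assms(5)] linear_mapD(2)[OF assms(3)] assms(5)
    by (auto simp: sweedler_simps)
qed

end

subsection \<open>Transport along injections\<close>

context
  fixes i :: "'x \<Rightarrow> 'y" and M :: "('k, 'x) module" and K :: "'k ring"
  assumes i: "inj i" and M: "module K M"
begin

interpretation M: module K M by (rule M)

lemma copy_module_simps:
  "carrier (copy_module i M) = i ` carrier M" "\<zero>\<^bsub>copy_module i M\<^esub> = i \<zero>\<^bsub>M\<^esub>"
  "i x \<oplus>\<^bsub>copy_module i M\<^esub> i y = i (x \<oplus>\<^bsub>M\<^esub> y)" "a \<odot>\<^bsub>copy_module i M\<^esub> i x = i (a \<odot>\<^bsub>M\<^esub> x)"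
  by (simp_all add: copy_module_def inv_f_f[OF i])

lemma copy_module: "module K (copy_module i M)"
proof (rule moduleI)
  show "abelian_group (copy_module i M)"
  proof (rule abelian_groupI)
    fix x assume "x \<in> carrier (copy_module i M)"
    then obtain y where "x = i y" "y \<in> carrier M" by (auto simp: copy_module_simps)
    then show "\<exists>z\<in>carrier (copy_module i M). z \<oplus>\<^bsub>copy_module i M\<^esub> x = \<zero>\<^bsub>copy_module i M\<^esub>"
      by (auto simp: copy_module_simps M.l_neg intro!: bexI[of _ "\<ominus>\<^bsub>M\<^esub> y"])
  qed (auto simp: copy_module_simps M.a_ac)
qed (auto simp: copy_module_simps M.is_cring M.smult_l_distr M.smult_r_distr M.smult_assoc1)

lemma copy_module_linear: "linear_map K M (copy_module i M) i"
  by (rule linear_mapI) (auto simp: copy_module_simps)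

lemma copy_module_inv_linear: "(\<And>x. j (i x) = x) \<Longrightarrow> linear_map K (copy_module i M) M j"
  by (rule linear_mapI) (auto simp: copy_module_simps)

end

lemma inj_univ: "inj Scal" "inj Coef" "inj Tens"
  by (simp_all add: inj_def)

subsection \<open>Tensor products in the universe\<close>

context
  fixes K :: "'k ring" and V W :: "('k, 'h, 'b) uspace"
  assumes V: "module K V" and W: "module K W"
begin

lemma tensor\<^sub>u_module: "module K (tensor\<^sub>u K V W)"
  unfolding tensor\<^sub>u_def by (rule copy_module[OF inj_univ(3) tensor_module[OF V W]])

lemma Tens_linear: "linear_map K (tensor K V W) (tensor\<^sub>u K V W) Tens"
  unfolding tensor\<^sub>u_def by (rule copy_module_linear[OF inj_univ(3) tensor_module[OF V W]])

lemma unTens_linear: "linear_map K (tensor\<^sub>u K V W) (tensor K V W) unTens"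
  unfolding tensor\<^sub>u_def by (rule copy_module_inv_linear[OF inj_univ(3) tensor_module[OF V W]]) simp

lemma carrier_tensor\<^sub>u: "carrier (tensor\<^sub>u K V W) = Tens ` carrier (tensor K V W)"
  unfolding tensor\<^sub>u_def by (rule copy_module_simps[OF inj_univ(3) tensor_module[OF V W]])

lemma pure\<^sub>u_bilinear: "bilinear_map K V W (tensor\<^sub>u K V W) (pure\<^sub>u K V W)"
  unfolding pure\<^sub>u_def
  by (intro bilinear_mapI linear_map_comp[OF _ Tens_linear] bilinear_mapD[OF pure_bilinear[OF V W]])

lemma pure\<^sub>u_closed: "\<lbrakk>v \<in> carrier V; w \<in> carrier W\<rbrakk> \<Longrightarrow> pure\<^sub>u K V W v w \<in> carrier (tensor\<^sub>u K V W)"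
  by (rule bilinear_mapD[OF pure\<^sub>u_bilinear])

context
  fixes M :: "('k, 'z) module"
  assumes M: "module K M"
begin

lemma sweedler\<^sub>u_linear:
  "bilinear_map K V W M B \<Longrightarrow> linear_map K (tensor\<^sub>u K V W) M (sweedler\<^sub>u M B)"
  unfolding sweedler\<^sub>u_def by (intro linear_map_comp[OF unTens_linear] sweedler_linear[OF V W M])

lemma sweedler\<^sub>u_pure\<^sub>u:
  "\<lbrakk>bilinear_map K V W M B; v \<in> carrier V; w \<in> carrier W\<rbrakk> \<Longrightarrow> sweedler\<^sub>u M B (pure\<^sub>u K V W v w) = B v w"
  by (simp add: sweedler\<^sub>u_def pure\<^sub>u_def sweedler_pure[OF V W M])

lemma tensor\<^sub>u_ext:
  assumes "linear_map K (tensor\<^sub>u K V W) M f" "linear_map K (tensor\<^sub>u K V W) M g"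
    and "\<And>v w. \<lbrakk>v \<in> carrier V; w \<in> carrier W\<rbrakk> \<Longrightarrow> f (pure\<^sub>u K V W v w) = g (pure\<^sub>u K V W v w)"
    and "x \<in> carrier (tensor\<^sub>u K V W)"
  shows "f x = g x"
proof -
  obtain y where y: "x = Tens y" "y \<in> carrier (tensor K V W)"
    using assms(4) by (auto simp: carrier_tensor\<^sub>u)
  have "f (Tens y) = g (Tens y)"
    by (rule tensor_ext[OF V W M linear_map_comp[OF Tens_linear assms(1)] linear_map_comp[OF Tens_linear assms(2)] _ y(2)])
      (use assms(3) in \<open>simp add: pure\<^sub>u_def\<close>)
  then show ?thesis using y by simp
qed

lemma sweedler\<^sub>u_param_linear:
  assumes "module K U" "x \<in> carrier (tensor\<^sub>u K V W)"
    "\<And>v w. \<lbrakk>v \<in> carrier V; w \<in> carrier W\<rbrakk> \<Longrightarrow> linear_map K U M (\<lambda>u. B u v w)"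
  shows "linear_map K U M (\<lambda>u. sweedler\<^sub>u M (B u) x)"
  using assms(2) sweedler_param_linear[OF V W M assms(1) _ assms(3)]
  by (auto simp: carrier_tensor\<^sub>u sweedler\<^sub>u_def)

end

lemma linear_map_sweedler\<^sub>u:
  assumes "module K M" "module K N" "linear_map K M N f" "x \<in> carrier (tensor\<^sub>u K V W)"
    "\<And>v w. \<lbrakk>v \<in> carrier V; w \<in> carrier W\<rbrakk> \<Longrightarrow> B v w \<in> carrier M"
  shows "f (sweedler\<^sub>u M B x) = sweedler\<^sub>u N (\<lambda>v w. f (B v w)) x"
  using assms(4) linear_map_sweedler[OF V W assms(1-3) _ assms(5)]
  by (auto simp: carrier_tensor\<^sub>u sweedler\<^sub>u_def)

end

subsection \<open>Linearity in one of several arguments\<close>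

text \<open>Introduction rules that follow the shape of an expression linear in one of its
  arguments. As \<open>bilinear_mapI\<close> is among them, \<open>intro lin\<close> reduces
  bilinearity of a nested expression to side conditions on modules and carriers.\<close>

named_theorems lin

lemmas [lin] = linear_map_id bilinear_mapI

lemma lin_pure [lin]:
  "\<lbrakk>module K V; module K W; linear_map K U V f; w \<in> carrier W\<rbrakk> \<Longrightarrow> linear_map K U (tensor K V W) (\<lambda>u. pure K V W (f u) w)"
  "\<lbrakk>module K V; module K W; linear_map K U W g; v \<in> carrier V\<rbrakk> \<Longrightarrow> linear_map K U (tensor K V W) (\<lambda>u. pure K V W v (g u))"
  by (rule linear_map_comp[OF _ bilinear_mapD(2)[OF pure_bilinear]]; assumption)
    (rule linear_map_comp[OF _ bilinear_mapD(1)[OF pure_bilinear]]; assumption)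

lemma lin_pure\<^sub>u [lin]:
  "\<lbrakk>module K V; module K W; linear_map K U V f; w \<in> carrier W\<rbrakk> \<Longrightarrow> linear_map K U (tensor\<^sub>u K V W) (\<lambda>u. pure\<^sub>u K V W (f u) w)"
  "\<lbrakk>module K V; module K W; linear_map K U W g; v \<in> carrier V\<rbrakk> \<Longrightarrow> linear_map K U (tensor\<^sub>u K V W) (\<lambda>u. pure\<^sub>u K V W v (g u))"
  by (rule linear_map_comp[OF _ bilinear_mapD(2)[OF pure\<^sub>u_bilinear]]; assumption)
    (rule linear_map_comp[OF _ bilinear_mapD(1)[OF pure\<^sub>u_bilinear]]; assumption)

text \<open>The common source of three constructions: the multiplication of a tensor product of
  algebras, the action on a tensor product of modules, and the coaction on a tensor product of
  Yetter-Drinfeld modules. Each is linear in four arguments taken from two tensor products.\<close>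

lemma sweedler2_bilinear:
  assumes "module K P" "module K Q" "module K V" "module K W" "module K M"
    and "\<And>p q. \<lbrakk>p \<in> carrier P; q \<in> carrier Q\<rbrakk> \<Longrightarrow> bilinear_map K V W M (B p q)"
    and "\<And>v w. \<lbrakk>v \<in> carrier V; w \<in> carrier W\<rbrakk> \<Longrightarrow> bilinear_map K P Q M (\<lambda>p q. B p q v w)"
  shows "bilinear_map K (tensor K P Q) (tensor K V W) M (\<lambda>t x. sweedler M (\<lambda>p q. sweedler M (B p q) x) t)"
    "\<lbrakk>p \<in> carrier P; q \<in> carrier Q; v \<in> carrier V; w \<in> carrier W\<rbrakk> \<Longrightarrow>
      sweedler M (\<lambda>p q. sweedler M (B p q) (pure K V W v w)) (pure K P Q p q) = B p q v w"
proof -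
  have b: "bilinear_map K P Q M (\<lambda>p q. sweedler M (B p q) x)" if x: "x \<in> carrier (tensor K V W)" for x
  proof (rule bilinear_mapI)
    fix p assume "p \<in> carrier P"
    then show "linear_map K Q M (\<lambda>q. sweedler M (B p q) x)"
      using assms(7) by (intro sweedler_param_linear[OF assms(3,4,5,2) x] bilinear_mapD(1)) auto
  next
    fix q assume "q \<in> carrier Q"
    then show "linear_map K P M (\<lambda>p. sweedler M (B p q) x)"
      using assms(7) by (intro sweedler_param_linear[OF assms(3,4,5,1) x]) (auto dest: bilinear_mapD(2))
  qed
  show "bilinear_map K (tensor K P Q) (tensor K V W) M (\<lambda>t x. sweedler M (\<lambda>p q. sweedler M (B p q) x) t)"
    by (intro bilinear_mapI sweedler_param_linear[OF assms(1,2,5) tensor_module[OF assms(3,4)]]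
        sweedler_linear[OF assms(3,4,5) assms(6)] sweedler_linear[OF assms(1,2,5) b])
  assume pq: "p \<in> carrier P" "q \<in> carrier Q" and vw: "v \<in> carrier V" "w \<in> carrier W"
  then show "sweedler M (\<lambda>p q. sweedler M (B p q) (pure K V W v w)) (pure K P Q p q) = B p q v w"
    using sweedler_pure[OF assms(1,2,5) b pq] sweedler_pure[OF assms(3,4,5) assms(6)[OF pq]]
    by (simp add: pure_closed[OF assms(3,4)])
qed

lemma sweedler2\<^sub>u_bilinear:
  fixes V W :: "('k, 'h, 'b) uspace"
  assumes "module K P" "module K Q" "module K V" "module K W" "module K M"
    and "\<And>p q. \<lbrakk>p \<in> carrier P; q \<in> carrier Q\<rbrakk> \<Longrightarrow> bilinear_map K V W M (B p q)"
    and "\<And>v w. \<lbrakk>v \<in> carrier V; w \<in> carrier W\<rbrakk> \<Longrightarrow> bilinear_map K P Q M (\<lambda>p q. B p q v w)"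
  shows "bilinear_map K (tensor K P Q) (tensor\<^sub>u K V W) M (\<lambda>t x. sweedler M (\<lambda>p q. sweedler\<^sub>u M (B p q) x) t)"
    "\<lbrakk>p \<in> carrier P; q \<in> carrier Q; v \<in> carrier V; w \<in> carrier W\<rbrakk> \<Longrightarrow>
      sweedler M (\<lambda>p q. sweedler\<^sub>u M (B p q) (pure\<^sub>u K V W v w)) (pure K P Q p q) = B p q v w"
proof -
  note b = sweedler2_bilinear[where B = B, OF assms]
  show "bilinear_map K (tensor K P Q) (tensor\<^sub>u K V W) M (\<lambda>t x. sweedler M (\<lambda>p q. sweedler\<^sub>u M (B p q) x) t)"
    unfolding sweedler\<^sub>u_def
    by (intro bilinear_mapI linear_map_comp[OF unTens_linear[OF assms(3,4)]] bilinear_mapD(1)[OF b(1)])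
      (use bilinear_mapD(2)[OF b(1)] linear_mapD(1)[OF unTens_linear[OF assms(3,4)]] in blast)+
  show "\<lbrakk>p \<in> carrier P; q \<in> carrier Q; v \<in> carrier V; w \<in> carrier W\<rbrakk> \<Longrightarrow>
      sweedler M (\<lambda>p q. sweedler\<^sub>u M (B p q) (pure\<^sub>u K V W v w)) (pure K P Q p q) = B p q v w"
    using b(2) by (simp add: sweedler\<^sub>u_def pure\<^sub>u_def)
qed

lemma tensor_mult:
  assumes "unital_algebra K A" "unital_algebra K B"
  shows "bilinear_map K (tensor K A B) (tensor K A B) (tensor K A B) (mult (tensor K A B))"
    "\<lbrakk>a \<in> carrier A; b \<in> carrier B; a' \<in> carrier A; b' \<in> carrier B\<rbrakk> \<Longrightarrow>
      pure K A B a b \<otimes>\<^bsub>tensor K A B\<^esub> pure K A B a' b' = pure K A B (a \<otimes>\<^bsub>A\<^esub> a') (b \<otimes>\<^bsub>B\<^esub> b')"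
proof -
  interpret A: unital_algebra K A by fact
  interpret B: unital_algebra K B by fact
  note m = A.module_axioms B.module_axioms
  note p = bilinear_mapD[OF pure_bilinear[OF m]]
  have r: "linear_map K A A (\<lambda>a'. a \<otimes>\<^bsub>A\<^esub> a')" "linear_map K A A (\<lambda>a'. a' \<otimes>\<^bsub>A\<^esub> a)" if "a \<in> carrier A" for a
    using that by (auto intro!: linear_mapI simp: A.smult_mult_left A.smult_mult_right A.A.r_distr A.A.l_distr)
  have s: "linear_map K B B (\<lambda>a'. a \<otimes>\<^bsub>B\<^esub> a')" "linear_map K B B (\<lambda>a'. a' \<otimes>\<^bsub>B\<^esub> a)" if "a \<in> carrier B" for a
    using that by (auto intro!: linear_mapI simp: B.smult_mult_left B.smult_mult_right B.A.r_distr B.A.l_distr)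
  note b = sweedler2_bilinear[where P = A and Q = B and V = A and W = B and M = "tensor K A B"
      and B = "\<lambda>a b a' b'. pure K A B (a \<otimes>\<^bsub>A\<^esub> a') (b \<otimes>\<^bsub>B\<^esub> b')", OF m m tensor_module[OF m]]
  have 1: "bilinear_map K A B (tensor K A B) (\<lambda>a' b'. pure K A B (a \<otimes>\<^bsub>A\<^esub> a') (b \<otimes>\<^bsub>B\<^esub> b'))"
    "bilinear_map K A B (tensor K A B) (\<lambda>a' b'. pure K A B (a' \<otimes>\<^bsub>A\<^esub> a) (b' \<otimes>\<^bsub>B\<^esub> b))"
    if "a \<in> carrier A" "b \<in> carrier B" for a b
    using that by (auto intro!: bilinear_mapI lin_pure m r s)
  have eq: "mult (tensor K A B) = (\<lambda>t x. sweedler (tensor K A B) (\<lambda>p q. sweedler (tensor K A B)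
     (\<lambda>a' b'. pure K A B (p \<otimes>\<^bsub>A\<^esub> a') (q \<otimes>\<^bsub>B\<^esub> b')) x) t)"
    by (intro ext) (rule mult_tensor[OF m])
  show "bilinear_map K (tensor K A B) (tensor K A B) (tensor K A B) (mult (tensor K A B))"
    unfolding eq by (rule b(1)) (use 1 in auto)
  show "\<lbrakk>a \<in> carrier A; b \<in> carrier B; a' \<in> carrier A; b' \<in> carrier B\<rbrakk> \<Longrightarrow>
      pure K A B a b \<otimes>\<^bsub>tensor K A B\<^esub> pure K A B a' b' = pure K A B (a \<otimes>\<^bsub>A\<^esub> a') (b \<otimes>\<^bsub>B\<^esub> b')"
    unfolding eq by (rule b(2)) (use 1 in auto)
qed

lemma ground_module: "field K \<Longrightarrow> module K (ground_module K)"
proof -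
  assume "field K"
  then interpret field K .
  show ?thesis
  proof (rule moduleI)
    show "abelian_group (ground_module K)"
    proof (rule abelian_groupI)
      fix x assume "x \<in> carrier (ground_module K)"
      then show "\<exists>y\<in>carrier (ground_module K). y \<oplus>\<^bsub>ground_module K\<^esub> x = \<zero>\<^bsub>ground_module K\<^esub>"
        by (intro bexI[of _ "\<ominus>\<^bsub>K\<^esub> x"]) (simp_all add: ground_module_def l_neg)
    qed (simp_all add: ground_module_def a_ac)
  qed (simp_all add: ground_module_def is_cring l_distr r_distr m_assoc)
qed

text \<open>The extension principle for both arguments at once, applied to equations in which a
  tensor of coefficients acts on a tensor of vectors.\<close>

lemma bilinear_ext:
  fixes V W :: "('k, 'h, 'b) uspace"
  assumes m: "module K P" "module K Q" "module K V" "module K W" "module K M"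
    and F: "bilinear_map K (tensor K P Q) (tensor\<^sub>u K V W) M F" and G: "bilinear_map K (tensor K P Q) (tensor\<^sub>u K V W) M G"
    and eq: "\<And>p q v w. \<lbrakk>p \<in> carrier P; q \<in> carrier Q; v \<in> carrier V; w \<in> carrier W\<rbrakk> \<Longrightarrow>
      F (pure K P Q p q) (pure\<^sub>u K V W v w) = G (pure K P Q p q) (pure\<^sub>u K V W v w)"
    and tx: "t \<in> carrier (tensor K P Q)" "x \<in> carrier (tensor\<^sub>u K V W)"
  shows "F t x = G t x"
proof (rule tensor_ext[OF m(1,2,5) bilinear_mapD(2)[OF F tx(2)] bilinear_mapD(2)[OF G tx(2)] _ tx(1)])
  fix p q assume pq: "p \<in> carrier P" "q \<in> carrier Q"
  note p = pure_closed[OF m(1,2) pq]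
  show "F (pure K P Q p q) x = G (pure K P Q p q) x"
    by (rule tensor\<^sub>u_ext[OF m(3,4,5) bilinear_mapD(1)[OF F p] bilinear_mapD(1)[OF G p] _ tx(2)]) (rule eq[OF pq])
qed

lemma tensor\<^sub>u_ext3:
  fixes U V W :: "('k, 'h, 'b) uspace"
  assumes m: "module K U" "module K V" "module K W" "module K M"
    and f: "linear_map K (tensor\<^sub>u K (tensor\<^sub>u K U V) W) M f" and g: "linear_map K (tensor\<^sub>u K (tensor\<^sub>u K U V) W) M g"
    and eq: "\<And>u v w. \<lbrakk>u \<in> carrier U; v \<in> carrier V; w \<in> carrier W\<rbrakk> \<Longrightarrow>
      f (pure\<^sub>u K (tensor\<^sub>u K U V) W (pure\<^sub>u K U V u v) w) = g (pure\<^sub>u K (tensor\<^sub>u K U V) W (pure\<^sub>u K U V u v) w)"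
    and x: "x \<in> carrier (tensor\<^sub>u K (tensor\<^sub>u K U V) W)"
  shows "f x = g x"
proof -
  note UV = tensor\<^sub>u_module[OF m(1,2)]
  note p = bilinear_mapD(2)[OF pure\<^sub>u_bilinear[OF UV m(3)]]
  show ?thesis
  proof (rule tensor\<^sub>u_ext[OF UV m(3,4) f g _ x])
    fix y w assume y: "y \<in> carrier (tensor\<^sub>u K U V)" and w: "w \<in> carrier W"
    show "f (pure\<^sub>u K (tensor\<^sub>u K U V) W y w) = g (pure\<^sub>u K (tensor\<^sub>u K U V) W y w)"
      by (rule tensor\<^sub>u_ext[OF m(1,2,4) linear_map_comp[OF p[OF w] f] linear_map_comp[OF p[OF w] g] _ y]) (rule eq[OF _ _ w])
  qed
qed

lemma tensor\<^sub>u_ext3':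
  fixes U V W :: "('k, 'h, 'b) uspace"
  assumes m: "module K U" "module K V" "module K W" "module K M"
    and f: "linear_map K (tensor\<^sub>u K U (tensor\<^sub>u K V W)) M f" and g: "linear_map K (tensor\<^sub>u K U (tensor\<^sub>u K V W)) M g"
    and eq: "\<And>u v w. \<lbrakk>u \<in> carrier U; v \<in> carrier V; w \<in> carrier W\<rbrakk> \<Longrightarrow>
      f (pure\<^sub>u K U (tensor\<^sub>u K V W) u (pure\<^sub>u K V W v w)) = g (pure\<^sub>u K U (tensor\<^sub>u K V W) u (pure\<^sub>u K V W v w))"
    and x: "x \<in> carrier (tensor\<^sub>u K U (tensor\<^sub>u K V W))"
  shows "f x = g x"
proof -
  note VW = tensor\<^sub>u_module[OF m(2,3)]
  note p = bilinear_mapD(1)[OF pure\<^sub>u_bilinear[OF m(1) VW]]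
  show ?thesis
  proof (rule tensor\<^sub>u_ext[OF m(1) VW m(4) f g _ x])
    fix u y assume y: "y \<in> carrier (tensor\<^sub>u K V W)" and u: "u \<in> carrier U"
    show "f (pure\<^sub>u K U (tensor\<^sub>u K V W) u y) = g (pure\<^sub>u K U (tensor\<^sub>u K V W) u y)"
      by (rule tensor\<^sub>u_ext[OF m(2,3,4) linear_map_comp[OF p[OF u] f] linear_map_comp[OF p[OF u] g] _ y]) (rule eq[OF u])
  qed
qed

lemma tensor\<^sub>u_ext4:
  fixes U V W X :: "('k, 'h, 'b) uspace"
  assumes m: "module K U" "module K V" "module K W" "module K X" "module K M"
    and f: "linear_map K (tensor\<^sub>u K (tensor\<^sub>u K (tensor\<^sub>u K U V) W) X) M f"
    and g: "linear_map K (tensor\<^sub>u K (tensor\<^sub>u K (tensor\<^sub>u K U V) W) X) M g"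
    and eq: "\<And>u v w x. \<lbrakk>u \<in> carrier U; v \<in> carrier V; w \<in> carrier W; x \<in> carrier X\<rbrakk> \<Longrightarrow>
      f (pure\<^sub>u K (tensor\<^sub>u K (tensor\<^sub>u K U V) W) X (pure\<^sub>u K (tensor\<^sub>u K U V) W (pure\<^sub>u K U V u v) w) x) =
      g (pure\<^sub>u K (tensor\<^sub>u K (tensor\<^sub>u K U V) W) X (pure\<^sub>u K (tensor\<^sub>u K U V) W (pure\<^sub>u K U V u v) w) x)"
    and x: "y \<in> carrier (tensor\<^sub>u K (tensor\<^sub>u K (tensor\<^sub>u K U V) W) X)"
  shows "f y = g y"
proof (rule tensor\<^sub>u_ext3[OF tensor\<^sub>u_module[OF m(1,2)] m(3-5) f g _ x])
  note UV = tensor\<^sub>u_module[OF m(1,2)]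
  note UVW = tensor\<^sub>u_module[OF UV m(3)]
  fix y w x assume y: "y \<in> carrier (tensor\<^sub>u K U V)" and w: "w \<in> carrier W" and x: "x \<in> carrier X"
  note p = linear_map_comp[OF bilinear_mapD(2)[OF pure\<^sub>u_bilinear[OF UV m(3)] w] bilinear_mapD(2)[OF pure\<^sub>u_bilinear[OF UVW m(4)] x]]
  show "f (pure\<^sub>u K (tensor\<^sub>u K (tensor\<^sub>u K U V) W) X (pure\<^sub>u K (tensor\<^sub>u K U V) W y w) x) =
      g (pure\<^sub>u K (tensor\<^sub>u K (tensor\<^sub>u K U V) W) X (pure\<^sub>u K (tensor\<^sub>u K U V) W y w) x)"
    by (rule tensor\<^sub>u_ext[OF m(1,2,5) linear_map_comp[OF p f] linear_map_comp[OF p g] _ y]) (rule eq[OF _ _ w x])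
qed

section \<open>Representations and Yetter-Drinfeld modules\<close>

context T_coalgebra
begin

abbreviation elts :: "('p, 'k, 'h, 'u) representation \<Rightarrow> 'u set" where
  "elts V \<equiv> carrier (space V)"

abbreviation coeffs :: "'p \<Rightarrow> 'h set" where
  "coeffs \<mu> \<equiv> carrier (alg H \<mu>)"

abbreviation tensor\<^sub>H :: "'p \<Rightarrow> 'p \<Rightarrow> ('k, ('h \<times> 'h) list) module" where
  "tensor\<^sub>H \<mu> \<nu> \<equiv> tensor K (alg H \<mu>) (alg H \<nu>)"

abbreviation pure\<^sub>H :: "'p \<Rightarrow> 'p \<Rightarrow> 'h \<Rightarrow> 'h \<Rightarrow> ('h \<times> 'h) list" where
  "pure\<^sub>H \<mu> \<nu> \<equiv> pure K (alg H \<mu>) (alg H \<nu>)"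

abbreviation tensor\<^sub>r :: "('p, 'k, 'h, 'b) rep \<Rightarrow> ('p, 'k, 'h, 'b) rep \<Rightarrow> ('k, 'h, 'b) uspace" where
  "tensor\<^sub>r V W \<equiv> tensor\<^sub>u K (space V) (space W)"

abbreviation pure\<^sub>r :: "('p, 'k, 'h, 'b) rep \<Rightarrow> ('p, 'k, 'h, 'b) rep \<Rightarrow>
    ('k, 'h, 'b) univ \<Rightarrow> ('k, 'h, 'b) univ \<Rightarrow> ('k, 'h, 'b) univ" where
  "pure\<^sub>r V W \<equiv> pure\<^sub>u K (space V) (space W)"

abbreviation tensor\<^sub>c :: "('p, 'k, 'h, 'b) rep \<Rightarrow> 'p \<Rightarrow> ('k, (('k, 'h, 'b) univ \<times> 'h) list) module" where
  "tensor\<^sub>c V \<mu> \<equiv> tensor K (space V) (alg H \<mu>)"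

abbreviation pure\<^sub>c :: "('p, 'k, 'h, 'b) rep \<Rightarrow> 'p \<Rightarrow> ('k, 'h, 'b) univ \<Rightarrow> 'h \<Rightarrow> (('k, 'h, 'b) univ \<times> 'h) list" where
  "pure\<^sub>c V \<mu> \<equiv> pure K (space V) (alg H \<mu>)"

abbreviation coef_space :: "'p \<Rightarrow> ('k, 'h, 'b) uspace" where
  "coef_space \<mu> \<equiv> copy_module Coef (alg H \<mu>)"

section \<open>Conjugation in the group and the structure maps of the T-coalgebra\<close>

lemma conjg_closed [simp]: "\<lbrakk>\<beta> \<in> carrier \<pi>; \<alpha> \<in> carrier \<pi>\<rbrakk> \<Longrightarrow> conjg \<pi> \<beta> \<alpha> \<in> carrier \<pi>"
  by (simp add: conjg_def)

lemma conjg_inv [simp]: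
  "\<lbrakk>\<beta> \<in> carrier \<pi>; \<alpha> \<in> carrier \<pi>\<rbrakk> \<Longrightarrow> conjg \<pi> (inv \<beta>) (conjg \<pi> \<beta> \<alpha>) = \<alpha>"
  "\<lbrakk>\<beta> \<in> carrier \<pi>; \<alpha> \<in> carrier \<pi>\<rbrakk> \<Longrightarrow> conjg \<pi> \<beta> (conjg \<pi> (inv \<beta>) \<alpha>) = \<alpha>"
  by (simp_all add: conjg_def P.m_assoc) (simp_all add: P.m_assoc[symmetric])

lemma conjg_mult: "\<lbrakk>\<beta> \<in> carrier \<pi>; \<gamma> \<in> carrier \<pi>; \<alpha> \<in> carrier \<pi>\<rbrakk> \<Longrightarrow>
    conjg \<pi> (\<beta> \<otimes> \<gamma>) \<alpha> = conjg \<pi> \<beta> (conjg \<pi> \<gamma> \<alpha>)"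
  by (simp add: conjg_def P.m_assoc P.inv_mult_group)

lemma conjg_distrib: "\<lbrakk>\<beta> \<in> carrier \<pi>; \<alpha> \<in> carrier \<pi>; \<alpha>' \<in> carrier \<pi>\<rbrakk> \<Longrightarrow>
    conjg \<pi> \<beta> (\<alpha> \<otimes> \<alpha>') = conjg \<pi> \<beta> \<alpha> \<otimes> conjg \<pi> \<beta> \<alpha>'"
  by (simp add: conjg_def P.m_assoc P.inv_solve_left)

lemma conjg_one [simp]: "\<alpha> \<in> carrier \<pi> \<Longrightarrow> conjg \<pi> \<one> \<alpha> = \<alpha>" "\<beta> \<in> carrier \<pi> \<Longrightarrow> conjg \<pi> \<beta> \<one> = \<one>"
  by (simp_all add: conjg_def)

lemma conjg_mult_right: "\<lbrakk>\<beta> \<in> carrier \<pi>; \<alpha> \<in> carrier \<pi>\<rbrakk> \<Longrightarrow> conjg \<pi> \<beta> \<alpha> \<otimes> \<beta> = \<beta> \<otimes> \<alpha>"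
  by (simp add: conjg_def P.m_assoc)

lemma alg_module [simp, intro]: "\<alpha> \<in> carrier \<pi> \<Longrightarrow> module K (alg H \<alpha>)"
  using alg unital_algebra.axioms(1) by blast

lemma alg_ring: "\<alpha> \<in> carrier \<pi> \<Longrightarrow> ring (alg H \<alpha>)"
  using alg unital_algebra.axioms(2) by blast

lemma alg_closed [simp, intro]:
  assumes "\<alpha> \<in> carrier \<pi>"
  shows "\<lbrakk>x \<in> coeffs \<alpha>; y \<in> coeffs \<alpha>\<rbrakk> \<Longrightarrow> x \<otimes>\<^bsub>alg H \<alpha>\<^esub> y \<in> coeffs \<alpha>"
    "\<lbrakk>x \<in> coeffs \<alpha>; y \<in> coeffs \<alpha>\<rbrakk> \<Longrightarrow> x \<oplus>\<^bsub>alg H \<alpha>\<^esub> y \<in> coeffs \<alpha>"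
    "\<lbrakk>a \<in> carrier K; y \<in> coeffs \<alpha>\<rbrakk> \<Longrightarrow> a \<odot>\<^bsub>alg H \<alpha>\<^esub> y \<in> coeffs \<alpha>"
    "\<one>\<^bsub>alg H \<alpha>\<^esub> \<in> coeffs \<alpha>"
proof -
  interpret unital_algebra K "alg H \<alpha>" using alg assms .
  show "\<lbrakk>x \<in> coeffs \<alpha>; y \<in> coeffs \<alpha>\<rbrakk> \<Longrightarrow> x \<otimes>\<^bsub>alg H \<alpha>\<^esub> y \<in> coeffs \<alpha>"
    "\<lbrakk>x \<in> coeffs \<alpha>; y \<in> coeffs \<alpha>\<rbrakk> \<Longrightarrow> x \<oplus>\<^bsub>alg H \<alpha>\<^esub> y \<in> coeffs \<alpha>"
    "\<lbrakk>a \<in> carrier K; y \<in> coeffs \<alpha>\<rbrakk> \<Longrightarrow> a \<odot>\<^bsub>alg H \<alpha>\<^esub> y \<in> coeffs \<alpha>"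
    "\<one>\<^bsub>alg H \<alpha>\<^esub> \<in> coeffs \<alpha>"
    by auto
qed

lemma alg_mult_assoc: "\<lbrakk>\<alpha> \<in> carrier \<pi>; x \<in> coeffs \<alpha>; y \<in> coeffs \<alpha>; z \<in> coeffs \<alpha>\<rbrakk> \<Longrightarrow>
    (x \<otimes>\<^bsub>alg H \<alpha>\<^esub> y) \<otimes>\<^bsub>alg H \<alpha>\<^esub> z = x \<otimes>\<^bsub>alg H \<alpha>\<^esub> (y \<otimes>\<^bsub>alg H \<alpha>\<^esub> z)"
  using ring.ring_simprules(11)[OF alg_ring] by simp

lemma alg_mult_one [simp]:
  "\<lbrakk>\<alpha> \<in> carrier \<pi>; x \<in> coeffs \<alpha>\<rbrakk> \<Longrightarrow> x \<otimes>\<^bsub>alg H \<alpha>\<^esub> \<one>\<^bsub>alg H \<alpha>\<^esub> = x"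
  "\<lbrakk>\<alpha> \<in> carrier \<pi>; x \<in> coeffs \<alpha>\<rbrakk> \<Longrightarrow> \<one>\<^bsub>alg H \<alpha>\<^esub> \<otimes>\<^bsub>alg H \<alpha>\<^esub> x = x"
  using ring.is_monoid[OF alg_ring] monoid.r_one monoid.l_one by metis+

lemma mult_linear:
  assumes "\<alpha> \<in> carrier \<pi>" "a \<in> coeffs \<alpha>"
  shows "linear_map K (alg H \<alpha>) (alg H \<alpha>) (\<lambda>x. a \<otimes>\<^bsub>alg H \<alpha>\<^esub> x)" "linear_map K (alg H \<alpha>) (alg H \<alpha>) (\<lambda>x. x \<otimes>\<^bsub>alg H \<alpha>\<^esub> a)"
proof -
  interpret A: unital_algebra K "alg H \<alpha>" using alg assms(1) .
  show "linear_map K (alg H \<alpha>) (alg H \<alpha>) (\<lambda>x. a \<otimes>\<^bsub>alg H \<alpha>\<^esub> x)" "linear_map K (alg H \<alpha>) (alg H \<alpha>) (\<lambda>x. x \<otimes>\<^bsub>alg H \<alpha>\<^esub> a)"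
    using assms(2) by (auto intro!: linear_mapI simp: A.smult_mult_left A.smult_mult_right A.A.r_distr A.A.l_distr)
qed

lemma lin_mult [lin]:
  "\<lbrakk>\<alpha> \<in> carrier \<pi>; linear_map K U (alg H \<alpha>) f; a \<in> coeffs \<alpha>\<rbrakk> \<Longrightarrow>
    linear_map K U (alg H \<alpha>) (\<lambda>u. f u \<otimes>\<^bsub>alg H \<alpha>\<^esub> a)"
  "\<lbrakk>\<alpha> \<in> carrier \<pi>; linear_map K U (alg H \<alpha>) f; a \<in> coeffs \<alpha>\<rbrakk> \<Longrightarrow>
    linear_map K U (alg H \<alpha>) (\<lambda>u. a \<otimes>\<^bsub>alg H \<alpha>\<^esub> f u)"
  by (rule linear_map_comp[OF _ mult_linear(2)]; assumption) (rule linear_map_comp[OF _ mult_linear(1)]; assumption)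

lemma comult_linear:
  "\<lbrakk>\<alpha> \<in> carrier \<pi>; \<beta> \<in> carrier \<pi>\<rbrakk> \<Longrightarrow>
    linear_map K (alg H (\<alpha> \<otimes> \<beta>)) (tensor\<^sub>H \<alpha> \<beta>) (comult H \<alpha> \<beta>)"
  using comult by (simp add: algebra_morphism_def)

lemma comult_closed [simp, intro]:
  "\<lbrakk>\<alpha> \<in> carrier \<pi>; \<beta> \<in> carrier \<pi>; h \<in> coeffs (\<alpha> \<otimes> \<beta>)\<rbrakk> \<Longrightarrow>
    comult H \<alpha> \<beta> h \<in> carrier (tensor\<^sub>H \<alpha> \<beta>)"
  using linear_mapD(1)[OF comult_linear] by blast

lemma comult_mult:
  "\<lbrakk>\<alpha> \<in> carrier \<pi>; \<beta> \<in> carrier \<pi>; h \<in> coeffs (\<alpha> \<otimes> \<beta>); h' \<in> coeffs (\<alpha> \<otimes> \<beta>)\<rbrakk> \<Longrightarrow>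
    comult H \<alpha> \<beta> (h \<otimes>\<^bsub>alg H (\<alpha> \<otimes> \<beta>)\<^esub> h') = comult H \<alpha> \<beta> h \<otimes>\<^bsub>tensor K (alg H \<alpha>) (alg H \<beta>)\<^esub> comult H \<alpha> \<beta> h'"
  "\<lbrakk>\<alpha> \<in> carrier \<pi>; \<beta> \<in> carrier \<pi>\<rbrakk> \<Longrightarrow> comult H \<alpha> \<beta> \<one>\<^bsub>alg H (\<alpha> \<otimes> \<beta>)\<^esub> = pure\<^sub>H \<alpha> \<beta> \<one>\<^bsub>alg H \<alpha>\<^esub> \<one>\<^bsub>alg H \<beta>\<^esub>"
  using comult[of \<alpha> \<beta>] one_tensor[of K "alg H \<alpha>" "alg H \<beta>"] by (auto simp: algebra_morphism_def ring_hom_def)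

lemma counit_linear: "linear_map K (alg H \<one>) (ground_module K) (counit H)"
  using counit by (simp add: algebra_morphism_def)

lemma counit_closed [simp, intro]: "h \<in> carrier (alg H \<one>) \<Longrightarrow> counit H h \<in> carrier K"
  using linear_mapD(1)[OF counit_linear] by (simp add: ground_module_def)

lemma counit_simps:
  "\<lbrakk>h \<in> carrier (alg H \<one>); h' \<in> carrier (alg H \<one>)\<rbrakk> \<Longrightarrow> counit H (h \<otimes>\<^bsub>alg H \<one>\<^esub> h') = counit H h \<otimes>\<^bsub>K\<^esub> counit H h'"
  "\<lbrakk>h \<in> carrier (alg H \<one>); h' \<in> carrier (alg H \<one>)\<rbrakk> \<Longrightarrow> counit H (h \<oplus>\<^bsub>alg H \<one>\<^esub> h') = counit H h \<oplus>\<^bsub>K\<^esub> counit H h'"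
  "counit H \<one>\<^bsub>alg H \<one>\<^esub> = \<one>\<^bsub>K\<^esub>"
  "\<lbrakk>a \<in> carrier K; h \<in> carrier (alg H \<one>)\<rbrakk> \<Longrightarrow> counit H (a \<odot>\<^bsub>alg H \<one>\<^esub> h) = a \<otimes>\<^bsub>K\<^esub> counit H h"
  using counit by (auto simp: algebra_morphism_def ring_hom_def ground_module_def linear_map_def)

lemma twist_linear:
  "\<lbrakk>\<alpha> \<in> carrier \<pi>; \<beta> \<in> carrier \<pi>\<rbrakk> \<Longrightarrow> linear_map K (alg H \<alpha>) (alg H (conjg \<pi> \<beta> \<alpha>)) (twist H \<beta> \<alpha>)"
  using twist by (simp add: algebra_morphism_def)

lemma twist_closed [simp]:
  "\<lbrakk>\<alpha> \<in> carrier \<pi>; \<beta> \<in> carrier \<pi>; h \<in> coeffs \<alpha>\<rbrakk> \<Longrightarrow> twist H \<beta> \<alpha> h \<in> coeffs (conjg \<pi> \<beta> \<alpha>)"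
  using linear_mapD(1)[OF twist_linear] by blast

lemma twist_hom:
  "\<lbrakk>\<alpha> \<in> carrier \<pi>; \<beta> \<in> carrier \<pi>; h \<in> coeffs \<alpha>; h' \<in> coeffs \<alpha>\<rbrakk> \<Longrightarrow>
    twist H \<beta> \<alpha> (h \<otimes>\<^bsub>alg H \<alpha>\<^esub> h') = twist H \<beta> \<alpha> h \<otimes>\<^bsub>alg H (conjg \<pi> \<beta> \<alpha>)\<^esub> twist H \<beta> \<alpha> h'"
  "\<lbrakk>\<alpha> \<in> carrier \<pi>; \<beta> \<in> carrier \<pi>\<rbrakk> \<Longrightarrow> twist H \<beta> \<alpha> \<one>\<^bsub>alg H \<alpha>\<^esub> = \<one>\<^bsub>alg H (conjg \<pi> \<beta> \<alpha>)\<^esub>"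
  using twist[of \<alpha> \<beta>] by (auto simp: algebra_morphism_def ring_hom_def)

text \<open>Multiplicativity makes the twist by the unit of the group idempotent; being injective,
  it is the identity.\<close>

lemma twist_one [simp]:
  assumes "\<alpha> \<in> carrier \<pi>" "h \<in> coeffs \<alpha>"
  shows "twist H \<one> \<alpha> h = h"
proof -
  have "twist H \<one> \<alpha> (twist H \<one> \<alpha> h) = twist H \<one> \<alpha> h"
    using twist_mult[of \<alpha> \<one> \<one> h] assms by simp
  then show ?thesis
    using twist_bij[of \<alpha> \<one>] assms twist_closed[of \<alpha> \<one> h] by (auto simp: bij_betw_def inj_on_def)
qed

lemma twist_inv [simp]:
  assumes "\<alpha> \<in> carrier \<pi>" "\<beta> \<in> carrier \<pi>"
  shows "h \<in> coeffs \<alpha> \<Longrightarrow> twist H (inv \<beta>) (conjg \<pi> \<beta> \<alpha>) (twist H \<beta> \<alpha> h) = h"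
    "h \<in> coeffs \<alpha> \<Longrightarrow> twist H \<beta> (conjg \<pi> (inv \<beta>) \<alpha>) (twist H (inv \<beta>) \<alpha> h) = h"
  using assms by (simp_all add: twist_mult)

subsection \<open>Representations\<close>

lemma repD:
  assumes "is_rep U"
  shows "deg U \<in> carrier \<pi>" "module K (space U)"
    "h \<in> coeffs (deg U) \<Longrightarrow> linear_map K (space U) (space U) (act U h)"
    "u \<in> elts U \<Longrightarrow> act U \<one>\<^bsub>alg H (deg U)\<^esub> u = u"
    "\<lbrakk>h \<in> coeffs (deg U); h' \<in> coeffs (deg U); u \<in> elts U\<rbrakk> \<Longrightarrow>
      act U (h \<otimes>\<^bsub>alg H (deg U)\<^esub> h') u = act U h (act U h' u)"
    "u \<in> elts U \<Longrightarrow> linear_map K (alg H (deg U)) (space U) (\<lambda>h. act U h u)"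
    "\<lbrakk>h \<in> coeffs (deg U); u \<in> elts U\<rbrakk> \<Longrightarrow> act U h u \<in> elts U"
    "act U \<in> extensional (coeffs (deg U))"
    "h \<in> coeffs (deg U) \<Longrightarrow> act U h \<in> extensional (elts U)"
  using assms by (auto simp: is_rep_def linear_map_def)

declare repD(1,2) [simp]

lemma lin_act [lin]:
  "\<lbrakk>is_rep U; linear_map K X (space U) f; h \<in> coeffs (deg U)\<rbrakk> \<Longrightarrow> linear_map K X (space U) (\<lambda>x. act U h (f x))"
  "\<lbrakk>is_rep U; linear_map K X (alg H (deg U)) g; u \<in> elts U\<rbrakk> \<Longrightarrow> linear_map K X (space U) (\<lambda>x. act U (g x) u)"
  by (rule linear_map_comp[OF _ repD(3)]; assumption) (rule linear_map_comp[OF _ repD(6)]; assumption)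

lemma repI:
  assumes "deg U \<in> carrier \<pi>" "module K (space U)" "act U \<in> extensional (coeffs (deg U))"
    "\<And>h. h \<in> coeffs (deg U) \<Longrightarrow> act U h \<in> extensional (elts U)"
    "bilinear_map K (alg H (deg U)) (space U) (space U) (act U)"
    "\<And>u. u \<in> elts U \<Longrightarrow> act U \<one>\<^bsub>alg H (deg U)\<^esub> u = u"
    "\<And>h h' u. \<lbrakk>h \<in> coeffs (deg U); h' \<in> coeffs (deg U); u \<in> elts U\<rbrakk> \<Longrightarrow>
      act U (h \<otimes>\<^bsub>alg H (deg U)\<^esub> h') u = act U h (act U h' u)"
  shows "is_rep U"
proof -
  note b = linear_mapD[OF bilinear_mapD(2)[OF assms(5)]]
  show ?thesis
    unfolding is_rep_def
    by (intro conjI ballI; (rule assms b bilinear_mapD(1)[OF assms(5)]; assumption)?)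
qed

section \<open>Tensor products, unit and conjugates of representations\<close>

text \<open>The action of the tensor product of two algebras on the tensor product of two modules,
  before it is restricted along the comultiplication. With an arbitrary \<open>t\<close> in place of
  \<open>comult H \<alpha> \<beta> h\<close>, arguments on pure tensors become possible.\<close>

definition tens_act :: "('p, 'k, 'h, 'b) rep \<Rightarrow> ('p, 'k, 'h, 'b) rep \<Rightarrow> ('h \<times> 'h) list \<Rightarrow>
    ('k, 'h, 'b) univ \<Rightarrow> ('k, 'h, 'b) univ" where
  "tens_act U V t x = sweedler (tensor\<^sub>r U V) (\<lambda>h' h''. sweedler\<^sub>u (tensor\<^sub>r U V) (\<lambda>u v.
      pure\<^sub>r U V (act U h' u) (act V h'' v)) x) t"

lemma tens_act:
  assumes "is_rep U" "is_rep V"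
  shows "bilinear_map K (tensor\<^sub>H (deg U) (deg V)) (tensor\<^sub>r U V)
      (tensor\<^sub>r U V) (tens_act U V)"
    "\<lbrakk>p \<in> coeffs (deg U); q \<in> coeffs (deg V); u \<in> elts U; v \<in> elts V\<rbrakk> \<Longrightarrow>
      tens_act U V (pure\<^sub>H (deg U) (deg V) p q) (pure\<^sub>r U V u v) =
      pure\<^sub>r U V (act U p u) (act V q v)"
proof -
  let ?S = "tensor\<^sub>r U V"
  have m: "module K (alg H (deg U))" "module K (alg H (deg V))" "module K (space U)" "module K (space V)"
    "module K ?S" using assms by (auto simp: tensor\<^sub>u_module)
  let ?B = "\<lambda>p q u v. pure\<^sub>r U V (act U p u) (act V q v)"
  have 1: "bilinear_map K (space U) (space V) ?S (?B p q)"
    if "p \<in> coeffs (deg U)" "q \<in> coeffs (deg V)" for p q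
    by (intro lin) (use that assms in \<open>simp_all add: repD\<close>)
  have 2: "bilinear_map K (alg H (deg U)) (alg H (deg V)) ?S (\<lambda>p q. ?B p q u v)"
    if "u \<in> elts U" "v \<in> elts V" for u v
    by (intro lin) (use that assms in \<open>simp_all add: repD\<close>)
  note b = sweedler2\<^sub>u_bilinear[where B = ?B, OF m 1 2]
  show "bilinear_map K (tensor\<^sub>H (deg U) (deg V)) ?S ?S (tens_act U V)"
    unfolding tens_act_def by (rule b(1))
  show "\<lbrakk>p \<in> coeffs (deg U); q \<in> coeffs (deg V); u \<in> elts U; v \<in> elts V\<rbrakk> \<Longrightarrow>
      tens_act U V (pure\<^sub>H (deg U) (deg V) p q) (pure\<^sub>r U V u v) = ?B p q u v"
    unfolding tens_act_def by (rule b(2))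
qed

lemma lin_tens_act [lin]:
  "\<lbrakk>is_rep U; is_rep V; linear_map K X (tensor\<^sub>r U V) f; t \<in> carrier (tensor\<^sub>H (deg U) (deg V))\<rbrakk> \<Longrightarrow>
    linear_map K X (tensor\<^sub>r U V) (\<lambda>x. tens_act U V t (f x))"
  "\<lbrakk>is_rep U; is_rep V; linear_map K X (tensor\<^sub>H (deg U) (deg V)) g; y \<in> carrier (tensor\<^sub>r U V)\<rbrakk> \<Longrightarrow>
    linear_map K X (tensor\<^sub>r U V) (\<lambda>x. tens_act U V (g x) y)"
  by (rule linear_map_comp[OF _ bilinear_mapD(1)[OF tens_act(1)]]; assumption)
     (rule linear_map_comp[OF _ bilinear_mapD(2)[OF tens_act(1)]]; assumption)

lemma lin_comult [lin]:
  "\<lbrakk>\<alpha> \<in> carrier \<pi>; \<beta> \<in> carrier \<pi>; linear_map K X (alg H (\<alpha> \<otimes> \<beta>)) f\<rbrakk> \<Longrightarrow>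
    linear_map K X (tensor\<^sub>H \<alpha> \<beta>) (\<lambda>x. comult H \<alpha> \<beta> (f x))"
  by (rule linear_map_comp[OF _ comult_linear])

lemma rep_tensor_simps [simp]:
  "deg (rep_tensor U V) = deg U \<otimes> deg V" "space (rep_tensor U V) = tensor\<^sub>r U V"
  by (simp_all add: rep_tensor_def Let_def)

lemma act_rep_tensor:
  "\<lbrakk>h \<in> coeffs (deg U \<otimes> deg V); x \<in> carrier (tensor\<^sub>r U V)\<rbrakk> \<Longrightarrow>
    act (rep_tensor U V) h x = tens_act U V (comult H (deg U) (deg V) h) x"
  by (simp add: rep_tensor_def tens_act_def Let_def)

text \<open>All of \<open>t\<close>, \<open>s\<close> and \<open>x\<close> are reduced to pure
  tensors, where the claim is the multiplicativity of the two actions separately.\<close>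

lemma tens_act_mult:
  assumes U: "is_rep U" and V: "is_rep V" and t: "t \<in> carrier (tensor\<^sub>H (deg U) (deg V))"
    and s: "s \<in> carrier (tensor\<^sub>H (deg U) (deg V))" and x: "x \<in> carrier (tensor\<^sub>r U V)"
  shows "tens_act U V (t \<otimes>\<^bsub>tensor K (alg H (deg U)) (alg H (deg V))\<^esub> s) x = tens_act U V t (tens_act U V s x)"
proof -
  let ?P = "alg H (deg U)" and ?Q = "alg H (deg V)" let ?T = "tensor K ?P ?Q" and ?S = "tensor\<^sub>r U V"
  have m: "module K ?P" "module K ?Q" "module K (space U)" "module K (space V)" using U V by auto
  have S: "module K ?S" by (rule tensor\<^sub>u_module[OF m(3,4)])
  note a = tens_act[OF U V]
  have mu: "unital_algebra K ?P" "unital_algebra K ?Q" using alg U V by auto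
  note mult = tensor_mult[OF mu]
  note mc = bilinear_mapD(3)[OF mult(1)] and ac = bilinear_mapD(3)[OF a(1)]
  note pc = pure_closed[OF m(1,2)] pure\<^sub>u_closed[OF m(3,4)]
  show ?thesis
  proof (rule tensor_ext[OF m(1,2) S _ _ _ t])
    show "linear_map K ?T ?S (\<lambda>t. tens_act U V (t \<otimes>\<^bsub>?T\<^esub> s) x)"
      by (rule linear_map_comp[OF bilinear_mapD(2)[OF mult(1) s] bilinear_mapD(2)[OF a(1) x]])
    show "linear_map K ?T ?S (\<lambda>t. tens_act U V t (tens_act U V s x))"
      by (rule bilinear_mapD(2)[OF a(1) ac[OF s x]])
    fix p q assume pq: "p \<in> carrier ?P" "q \<in> carrier ?Q"
    show "tens_act U V (pure K ?P ?Q p q \<otimes>\<^bsub>?T\<^esub> s) x = tens_act U V (pure K ?P ?Q p q) (tens_act U V s x)"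
    proof (rule tensor_ext[OF m(1,2) S _ _ _ s])
      show "linear_map K ?T ?S (\<lambda>s. tens_act U V (pure K ?P ?Q p q \<otimes>\<^bsub>?T\<^esub> s) x)"
        by (rule linear_map_comp[OF bilinear_mapD(1)[OF mult(1) pc(1)[OF pq]] bilinear_mapD(2)[OF a(1) x]])
      show "linear_map K ?T ?S (\<lambda>s. tens_act U V (pure K ?P ?Q p q) (tens_act U V s x))"
        by (rule linear_map_comp[OF bilinear_mapD(2)[OF a(1) x] bilinear_mapD(1)[OF a(1) pc(1)[OF pq]]])
      fix p' q' assume pq': "p' \<in> carrier ?P" "q' \<in> carrier ?Q"
      show "tens_act U V (pure K ?P ?Q p q \<otimes>\<^bsub>?T\<^esub> pure K ?P ?Q p' q') x = tens_act U V (pure K ?P ?Q p q) (tens_act U V (pure K ?P ?Q p' q') x)"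
      proof (rule tensor\<^sub>u_ext[OF m(3,4) S _ _ _ x])
        show "linear_map K ?S ?S (tens_act U V (pure K ?P ?Q p q \<otimes>\<^bsub>?T\<^esub> pure K ?P ?Q p' q'))"
          by (rule bilinear_mapD(1)[OF a(1) mc[OF pc(1)[OF pq] pc(1)[OF pq']]])
        show "linear_map K ?S ?S (\<lambda>x. tens_act U V (pure K ?P ?Q p q) (tens_act U V (pure K ?P ?Q p' q') x))"
          by (rule linear_map_comp[OF bilinear_mapD(1)[OF a(1) pc(1)[OF pq']] bilinear_mapD(1)[OF a(1) pc(1)[OF pq]]])
        fix u v assume uv: "u \<in> elts U" "v \<in> elts V"
        show "tens_act U V (pure K ?P ?Q p q \<otimes>\<^bsub>?T\<^esub> pure K ?P ?Q p' q') (pure\<^sub>r U V u v) =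
          tens_act U V (pure K ?P ?Q p q) (tens_act U V (pure K ?P ?Q p' q') (pure\<^sub>r U V u v))"
          using pq pq' uv U V by (simp add: mult(2) a(2) repD)
      qed
    qed
  qed
qed

text \<open>A module over the tensor product of the two algebras, restricted along the algebra
  morphism \<open>comult\<close>.\<close>

lemma rep_tensor_closed:
  assumes U: "is_rep U" and V: "is_rep V"
  shows "is_rep (rep_tensor U V)"
proof (rule repI)
  let ?P = "alg H (deg U)" and ?Q = "alg H (deg V)" let ?T = "tensor K ?P ?Q" and ?S = "tensor\<^sub>r U V"
  let ?A = "alg H (deg U \<otimes> deg V)"
  have m: "module K ?P" "module K ?Q" "module K (space U)" "module K (space V)" and d: "deg U \<in> carrier \<pi>" "deg V \<in> carrier \<pi>"
    using U V by auto
  have S: "module K ?S" by (rule tensor\<^sub>u_module[OF m(3,4)])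
  note a = tens_act[OF U V]
  show "module K (space (rep_tensor U V))" "deg (rep_tensor U V) \<in> carrier \<pi>" using S d by simp_all
  show "act (rep_tensor U V) \<in> extensional (coeffs (deg (rep_tensor U V)))"
    by (simp add: rep_tensor_def Let_def)
  show "act (rep_tensor U V) h \<in> extensional (elts (rep_tensor U V))" if "h \<in> coeffs (deg (rep_tensor U V))" for h
    using that by (simp add: rep_tensor_def Let_def)
  show "bilinear_map K (alg H (deg (rep_tensor U V))) (space (rep_tensor U V)) (space (rep_tensor U V)) (act (rep_tensor U V))"
    unfolding rep_tensor_simps
  proof (rule bilinear_mapI)
    fix h assume h: "h \<in> carrier ?A"
    show "linear_map K ?S ?S (act (rep_tensor U V) h)"
      by (rule linear_map_cong[OF bilinear_mapD(1)[OF a(1) comult_closed[OF d h]] S]) (simp add: act_rep_tensor h)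
  next
    fix x assume x: "x \<in> carrier ?S"
    have "module K ?A" using d by simp
    then show "linear_map K ?A ?S (\<lambda>h. act (rep_tensor U V) h x)"
      by (rule linear_map_cong[OF linear_map_comp[OF comult_linear[OF d] bilinear_mapD(2)[OF a(1) x]]]) (simp add: act_rep_tensor x)
  qed
  fix x assume "x \<in> elts (rep_tensor U V)"
  then have x: "x \<in> carrier ?S" by simp
  show "act (rep_tensor U V) \<one>\<^bsub>alg H (deg (rep_tensor U V))\<^esub> x = x"
  proof -
    have "tens_act U V (pure K ?P ?Q \<one>\<^bsub>?P\<^esub> \<one>\<^bsub>?Q\<^esub>) x = x"
      by (rule tensor\<^sub>u_ext[OF m(3,4) S bilinear_mapD(1)[OF a(1)] linear_map_id _ x])
        (use U V d in \<open>auto simp: a(2) repD pure_closed\<close>)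
    then show ?thesis using x d by (simp add: act_rep_tensor comult_mult)
  qed
  fix h h' assume "h \<in> coeffs (deg (rep_tensor U V))" "h' \<in> coeffs (deg (rep_tensor U V))"
  then have h: "h \<in> carrier ?A" "h' \<in> carrier ?A" by simp_all
  show "act (rep_tensor U V) (h \<otimes>\<^bsub>alg H (deg (rep_tensor U V))\<^esub> h') x = act (rep_tensor U V) h (act (rep_tensor U V) h' x)"
    using h x d bilinear_mapD(3)[OF a(1) comult_closed[OF d h(2)] x]
    by (simp add: act_rep_tensor comult_mult tens_act_mult[OF U V])
qed

lemma rep_unit_simps [simp]:
  "deg rep_unit = \<one>" "space rep_unit = copy_module Scal (ground_module K)"
  "\<lbrakk>h \<in> carrier (alg H \<one>); a \<in> carrier K\<rbrakk> \<Longrightarrow> act rep_unit h (Scal a) = Scal (counit H h \<otimes>\<^bsub>K\<^esub> a)"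
  by (simp_all add: rep_unit_def)

lemma scal_simps:
  "carrier (copy_module Scal (ground_module K)) = Scal ` carrier K"
  "module K (copy_module Scal (ground_module K))"
  "Scal a \<oplus>\<^bsub>copy_module Scal (ground_module K)\<^esub> Scal b = Scal (a \<oplus>\<^bsub>K\<^esub> b)"
  "a \<odot>\<^bsub>copy_module Scal (ground_module K)\<^esub> Scal b = Scal (a \<otimes>\<^bsub>K\<^esub> b)"
  using copy_module_simps[OF inj_univ(1) ground_module[OF K.field_axioms]]
    copy_module[OF inj_univ(1) ground_module[OF K.field_axioms]]
  by (auto simp: ground_module_def)

lemma rep_unit_closed: "is_rep rep_unit"
proof (rule repI)
  show "bilinear_map K (alg H (deg rep_unit)) (space rep_unit) (space rep_unit) (act rep_unit)"
    by (intro bilinear_mapI linear_mapI)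
      (auto simp: scal_simps counit_simps K.l_distr K.r_distr K.m_assoc K.m_lcomm)
  show "act rep_unit \<in> extensional (coeffs (deg rep_unit))"
    by (simp add: rep_unit_def)
  show "act rep_unit h \<in> extensional (elts rep_unit)" if "h \<in> coeffs (deg rep_unit)" for h
    using that by (simp add: rep_unit_def scal_simps(1))
  fix u assume "u \<in> elts rep_unit"
  then obtain a where a: "u = Scal a" "a \<in> carrier K" by (auto simp: scal_simps(1))
  show "act rep_unit \<one>\<^bsub>alg H (deg rep_unit)\<^esub> u = u" using a by (simp add: counit_simps)
  fix h h' assume "h \<in> coeffs (deg rep_unit)" "h' \<in> coeffs (deg rep_unit)"
  then show "act rep_unit (h \<otimes>\<^bsub>alg H (deg rep_unit)\<^esub> h') u = act rep_unit h (act rep_unit h' u)"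
    using a by (simp add: counit_simps K.m_assoc)
qed (simp_all add: scal_simps)

lemma rep_conj_simps [simp]:
  "deg (rep_conj \<beta> U) = conjg \<pi> \<beta> (deg U)" "space (rep_conj \<beta> U) = space U"
  "h \<in> coeffs (conjg \<pi> \<beta> (deg U)) \<Longrightarrow> act (rep_conj \<beta> U) h = act U (twist H (inv \<beta>) (conjg \<pi> \<beta> (deg U)) h)"
  by (simp_all add: rep_conj_def)

lemma twist_conj_closed:
  "\<lbrakk>is_rep U; \<beta> \<in> carrier \<pi>; h \<in> coeffs (conjg \<pi> \<beta> (deg U))\<rbrakk> \<Longrightarrow>
    twist H (inv \<beta>) (conjg \<pi> \<beta> (deg U)) h \<in> coeffs (deg U)"
  using twist_closed[of "conjg \<pi> \<beta> (deg U)" "inv \<beta>" h] by simp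

lemma lin_twist:
  "\<lbrakk>\<alpha> \<in> carrier \<pi>; \<beta> \<in> carrier \<pi>; linear_map K X (alg H \<alpha>) f; \<gamma> = conjg \<pi> \<beta> \<alpha>\<rbrakk> \<Longrightarrow> linear_map K X (alg H \<gamma>) (\<lambda>x. twist H \<beta> \<alpha> (f x))"
  using linear_map_comp[OF _ twist_linear] by blast

text \<open>Restriction along an algebra morphism, the twist by the inverse of
  \<open>\<beta>\<close>.\<close>

lemma rep_conj_closed:
  assumes U: "is_rep U" and b: "\<beta> \<in> carrier \<pi>"
  shows "is_rep (rep_conj \<beta> U)"
proof (rule repI)
  note d = repD(1)[OF U]
  let ?c = "conjg \<pi> \<beta> (deg U)"
  note t = twist_conj_closed[OF U b]
  have l: "linear_map K (alg H ?c) (alg H (deg U)) (twist H (inv \<beta>) ?c)"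
    using twist_linear[of ?c "inv \<beta>"] d b by simp
  show "bilinear_map K (alg H (deg (rep_conj \<beta> U))) (space (rep_conj \<beta> U)) (space (rep_conj \<beta> U)) (act (rep_conj \<beta> U))"
    unfolding rep_conj_simps
  proof (rule bilinear_mapI)
    fix h assume "h \<in> coeffs ?c"
    then show "linear_map K (space U) (space U) (act (rep_conj \<beta> U) h)" by (simp add: repD(3)[OF U t])
  next
    fix u assume u: "u \<in> elts U"
    show "linear_map K (alg H ?c) (space U) (\<lambda>h. act (rep_conj \<beta> U) h u)"
      by (rule linear_map_cong[OF linear_map_comp[OF l repD(6)[OF U u]]]) (use d b in simp_all)
  qed
  show "act (rep_conj \<beta> U) h \<in> extensional (elts (rep_conj \<beta> U))" if "h \<in> coeffs (deg (rep_conj \<beta> U))" for h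
    using repD(9)[OF U t[of h]] that by simp
  show "act (rep_conj \<beta> U) \<in> extensional (coeffs (deg (rep_conj \<beta> U)))"
    by (simp add: rep_conj_def)
  show "deg (rep_conj \<beta> U) \<in> carrier \<pi>" "module K (space (rep_conj \<beta> U))" using d b U by simp_all
  fix u assume u: "u \<in> elts (rep_conj \<beta> U)"
  then show "act (rep_conj \<beta> U) \<one>\<^bsub>alg H (deg (rep_conj \<beta> U))\<^esub> u = u"
    using twist_hom(2)[of ?c "inv \<beta>"] d b by (simp add: repD(4)[OF U])
  fix h h' assume h: "h \<in> coeffs (deg (rep_conj \<beta> U))" "h' \<in> coeffs (deg (rep_conj \<beta> U))"
  then have "twist H (inv \<beta>) ?c (h \<otimes>\<^bsub>alg H ?c\<^esub> h') = twist H (inv \<beta>) ?c h \<otimes>\<^bsub>alg H (deg U)\<^esub> twist H (inv \<beta>) ?c h'"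
    using twist_hom(1)[of ?c "inv \<beta>" h h'] d b by simp
  then show "act (rep_conj \<beta> U) (h \<otimes>\<^bsub>alg H (deg (rep_conj \<beta> U))\<^esub> h') u = act (rep_conj \<beta> U) h (act (rep_conj \<beta> U) h' u)"
    using h u t[of h] t[of h'] d b by (simp add: repD(5)[OF U])
qed

section \<open>Tensor products of maps and the constraints of \<open>Rep\<close>\<close>

lemma map_tensor:
  fixes U V U' V' :: "('k, 'h, 'b) uspace"
  assumes m: "module K U" "module K V" "module K U'" "module K V'"
    and f: "linear_map K U U' f" and g: "linear_map K V V' g"
  shows "linear_map K (tensor\<^sub>u K U V) (tensor\<^sub>u K U' V') (map_tensor U V U' V' f g)"
    "map_tensor U V U' V' f g \<in> extensional (carrier (tensor\<^sub>u K U V))"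
    "\<lbrakk>u \<in> carrier U; v \<in> carrier V\<rbrakk> \<Longrightarrow> map_tensor U V U' V' f g (pure\<^sub>u K U V u v) = pure\<^sub>u K U' V' (f u) (g v)"
proof -
  have b: "bilinear_map K U V (tensor\<^sub>u K U' V') (\<lambda>u v. pure\<^sub>u K U' V' (f u) (g v))"
    by (intro lin m f g) (simp_all add: linear_mapD[OF f] linear_mapD[OF g])
  note S = tensor\<^sub>u_module[OF m(3,4)] and R = tensor\<^sub>u_module[OF m(1,2)]
  show "linear_map K (tensor\<^sub>u K U V) (tensor\<^sub>u K U' V') (map_tensor U V U' V' f g)"
    by (rule linear_map_cong[OF sweedler\<^sub>u_linear[OF m(1,2) S b] R]) (simp add: map_tensor_def)
  show "map_tensor U V U' V' f g \<in> extensional (carrier (tensor\<^sub>u K U V))" by (simp add: map_tensor_def)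
  show "\<lbrakk>u \<in> carrier U; v \<in> carrier V\<rbrakk> \<Longrightarrow> map_tensor U V U' V' f g (pure\<^sub>u K U V u v) = pure\<^sub>u K U' V' (f u) (g v)"
    by (simp add: map_tensor_def pure\<^sub>u_closed[OF m(1,2)] sweedler\<^sub>u_pure\<^sub>u[OF m(1,2) S b])
qed

lemma assoc_map:
  fixes U V W :: "('k, 'h, 'b) uspace"
  assumes m: "module K U" "module K V" "module K W"
  shows "linear_map K (tensor\<^sub>u K (tensor\<^sub>u K U V) W) (tensor\<^sub>u K U (tensor\<^sub>u K V W)) (assoc_map U V W)"
    "assoc_map U V W \<in> extensional (carrier (tensor\<^sub>u K (tensor\<^sub>u K U V) W))"
    "\<lbrakk>u \<in> carrier U; v \<in> carrier V; w \<in> carrier W\<rbrakk> \<Longrightarrow>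
      assoc_map U V W (pure\<^sub>u K (tensor\<^sub>u K U V) W (pure\<^sub>u K U V u v) w) = pure\<^sub>u K U (tensor\<^sub>u K V W) u (pure\<^sub>u K V W v w)"
proof -
  note UV = tensor\<^sub>u_module[OF m(1,2)] and VW = tensor\<^sub>u_module[OF m(2,3)]
  note S = tensor\<^sub>u_module[OF m(1) VW] and R = tensor\<^sub>u_module[OF UV m(3)]
  let ?S = "tensor\<^sub>u K U (tensor\<^sub>u K V W)"
  have b: "bilinear_map K U V ?S (\<lambda>u v. pure\<^sub>u K U (tensor\<^sub>u K V W) u (pure\<^sub>u K V W v w))" if "w \<in> carrier W" for w
    by (intro lin m VW) (simp_all add: that pure\<^sub>u_closed m)
  have c: "linear_map K W ?S (\<lambda>w. pure\<^sub>u K U (tensor\<^sub>u K V W) u (pure\<^sub>u K V W v w))" if "u \<in> carrier U" "v \<in> carrier V" for u v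
    by (intro lin m VW) (simp_all add: that pure\<^sub>u_closed m)
  have d: "bilinear_map K (tensor\<^sub>u K U V) W ?S (\<lambda>y w. sweedler\<^sub>u ?S (\<lambda>u v. pure\<^sub>u K U (tensor\<^sub>u K V W) u (pure\<^sub>u K V W v w)) y)"
    by (intro bilinear_mapI sweedler\<^sub>u_linear[OF m(1,2) S b] sweedler\<^sub>u_param_linear[OF m(1,2) S m(3)] c)
  show "linear_map K (tensor\<^sub>u K (tensor\<^sub>u K U V) W) ?S (assoc_map U V W)"
    by (rule linear_map_cong[OF sweedler\<^sub>u_linear[OF UV m(3) S d] R]) (simp add: assoc_map_def Let_def)
  show "assoc_map U V W \<in> extensional (carrier (tensor\<^sub>u K (tensor\<^sub>u K U V) W))" by (simp add: assoc_map_def Let_def)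
  show "\<lbrakk>u \<in> carrier U; v \<in> carrier V; w \<in> carrier W\<rbrakk> \<Longrightarrow>
      assoc_map U V W (pure\<^sub>u K (tensor\<^sub>u K U V) W (pure\<^sub>u K U V u v) w) = pure\<^sub>u K U (tensor\<^sub>u K V W) u (pure\<^sub>u K V W v w)"
    by (simp add: assoc_map_def Let_def pure\<^sub>u_closed[OF UV m(3)] pure\<^sub>u_closed[OF m(1,2)] sweedler\<^sub>u_pure\<^sub>u[OF UV m(3) S d] sweedler\<^sub>u_pure\<^sub>u[OF m(1,2) S b])
qed

text \<open>The inverse is the lift of the opposite rebracketing; both composites are identities
  because they are so on pure tensors. Its values on pure tensors are exported, its construction
  stays hidden.\<close>

lemma assoc_map_inverse:
  fixes U V W :: "('k, 'h, 'b) uspace"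
  assumes m: "module K U" "module K V" "module K W"
  obtains g where "linear_map K (tensor\<^sub>u K U (tensor\<^sub>u K V W)) (tensor\<^sub>u K (tensor\<^sub>u K U V) W) g"
    "\<And>u v w. \<lbrakk>u \<in> carrier U; v \<in> carrier V; w \<in> carrier W\<rbrakk> \<Longrightarrow>
      g (pure\<^sub>u K U (tensor\<^sub>u K V W) u (pure\<^sub>u K V W v w)) = pure\<^sub>u K (tensor\<^sub>u K U V) W (pure\<^sub>u K U V u v) w"
    "\<And>x. x \<in> carrier (tensor\<^sub>u K (tensor\<^sub>u K U V) W) \<Longrightarrow> g (assoc_map U V W x) = x"
    "\<And>x. x \<in> carrier (tensor\<^sub>u K U (tensor\<^sub>u K V W)) \<Longrightarrow> assoc_map U V W (g x) = x"
proof -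
  note UV = tensor\<^sub>u_module[OF m(1,2)] and VW = tensor\<^sub>u_module[OF m(2,3)]
  note S = tensor\<^sub>u_module[OF m(1) VW] and R = tensor\<^sub>u_module[OF UV m(3)]
  let ?R = "tensor\<^sub>u K (tensor\<^sub>u K U V) W"
  have b: "bilinear_map K V W ?R (\<lambda>v w. pure\<^sub>u K (tensor\<^sub>u K U V) W (pure\<^sub>u K U V u v) w)" if "u \<in> carrier U" for u
    by (intro lin m UV) (simp_all add: that pure\<^sub>u_closed m)
  have c: "linear_map K U ?R (\<lambda>u. pure\<^sub>u K (tensor\<^sub>u K U V) W (pure\<^sub>u K U V u v) w)" if "w \<in> carrier W" "v \<in> carrier V" for v w
    by (intro lin m UV) (simp_all add: that pure\<^sub>u_closed m)
  have d: "bilinear_map K U (tensor\<^sub>u K V W) ?R (\<lambda>u y. sweedler\<^sub>u ?R (\<lambda>v w. pure\<^sub>u K (tensor\<^sub>u K U V) W (pure\<^sub>u K U V u v) w) y)"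
    by (intro bilinear_mapI sweedler\<^sub>u_linear[OF m(2,3) R b] sweedler\<^sub>u_param_linear[OF m(2,3) R m(1)] c)
  define g where "g = sweedler\<^sub>u ?R (\<lambda>u y. sweedler\<^sub>u ?R (\<lambda>v w. pure\<^sub>u K (tensor\<^sub>u K U V) W (pure\<^sub>u K U V u v) w) y)"
  have l: "linear_map K (tensor\<^sub>u K U (tensor\<^sub>u K V W)) ?R g" unfolding g_def by (rule sweedler\<^sub>u_linear[OF m(1) VW R d])
  have p: "g (pure\<^sub>u K U (tensor\<^sub>u K V W) u (pure\<^sub>u K V W v w)) = pure\<^sub>u K (tensor\<^sub>u K U V) W (pure\<^sub>u K U V u v) w"
    if "u \<in> carrier U" "v \<in> carrier V" "w \<in> carrier W" for u v w
    unfolding g_def using that by (simp add: pure\<^sub>u_closed[OF m(2,3)] sweedler\<^sub>u_pure\<^sub>u[OF m(1) VW R d] sweedler\<^sub>u_pure\<^sub>u[OF m(2,3) R b])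
  show thesis
  proof (rule that[OF l p])
    show "g (assoc_map U V W x) = x" if "x \<in> carrier ?R" for x
      by (rule tensor\<^sub>u_ext3[OF m R linear_map_comp[OF assoc_map(1)[OF m] l] linear_map_id _ that])
        (simp add: assoc_map(3)[OF m] p)
    show "assoc_map U V W (g x) = x" if "x \<in> carrier (tensor\<^sub>u K U (tensor\<^sub>u K V W))" for x
      by (rule tensor\<^sub>u_ext3'[OF m S linear_map_comp[OF l assoc_map(1)[OF m]] linear_map_id _ that])
        (simp add: assoc_map(3)[OF m] p)
  qed
qed

abbreviation "Sc \<equiv> copy_module Scal (ground_module K)"

lemma unScal_linear: "linear_map K Sc (ground_module K) unScal"
  by (rule copy_module_inv_linear[OF inj_univ(1) ground_module[OF K.field_axioms]]) simp

lemma lunit_map: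
  fixes U :: "('k, 'h, 'b) uspace"
  assumes m: "module K U"
  shows "linear_map K (tensor\<^sub>u K Sc U) U (lunit_map U)"
    "lunit_map U \<in> extensional (carrier (tensor\<^sub>u K Sc U))"
    "\<lbrakk>a \<in> carrier K; u \<in> carrier U\<rbrakk> \<Longrightarrow> lunit_map U (pure\<^sub>u K Sc U (Scal a) u) = a \<odot>\<^bsub>U\<^esub> u"
proof -
  have b: "bilinear_map K Sc U U (\<lambda>a u. unScal a \<odot>\<^bsub>U\<^esub> u)"
    by (intro bilinear_mapI linear_map_smult_left[OF m unScal_linear] linear_map_smult_right[OF m m linear_map_id])
      (auto simp: scal_simps)
  note R = tensor\<^sub>u_module[OF scal_simps(2) m]
  show "linear_map K (tensor\<^sub>u K Sc U) U (lunit_map U)"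
    by (rule linear_map_cong[OF sweedler\<^sub>u_linear[OF scal_simps(2) m m b] R]) (simp add: lunit_map_def)
  show "lunit_map U \<in> extensional (carrier (tensor\<^sub>u K Sc U))" by (simp add: lunit_map_def)
  show "\<lbrakk>a \<in> carrier K; u \<in> carrier U\<rbrakk> \<Longrightarrow> lunit_map U (pure\<^sub>u K Sc U (Scal a) u) = a \<odot>\<^bsub>U\<^esub> u"
    by (simp add: lunit_map_def pure\<^sub>u_closed[OF scal_simps(2) m] sweedler\<^sub>u_pure\<^sub>u[OF scal_simps(2) m m b] scal_simps(1))
qed

lemma runit_map:
  fixes U :: "('k, 'h, 'b) uspace"
  assumes m: "module K U"
  shows "linear_map K (tensor\<^sub>u K U Sc) U (runit_map U)"
    "runit_map U \<in> extensional (carrier (tensor\<^sub>u K U Sc))"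
    "\<lbrakk>a \<in> carrier K; u \<in> carrier U\<rbrakk> \<Longrightarrow> runit_map U (pure\<^sub>u K U Sc u (Scal a)) = a \<odot>\<^bsub>U\<^esub> u"
proof -
  have b: "bilinear_map K U Sc U (\<lambda>u a. unScal a \<odot>\<^bsub>U\<^esub> u)"
    by (intro bilinear_mapI linear_map_smult_left[OF m unScal_linear] linear_map_smult_right[OF m m linear_map_id])
      (auto simp: scal_simps)
  note R = tensor\<^sub>u_module[OF m scal_simps(2)]
  show "linear_map K (tensor\<^sub>u K U Sc) U (runit_map U)"
    by (rule linear_map_cong[OF sweedler\<^sub>u_linear[OF m scal_simps(2) m b] R]) (simp add: runit_map_def)
  show "runit_map U \<in> extensional (carrier (tensor\<^sub>u K U Sc))" by (simp add: runit_map_def)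
  show "\<lbrakk>a \<in> carrier K; u \<in> carrier U\<rbrakk> \<Longrightarrow> runit_map U (pure\<^sub>u K U Sc u (Scal a)) = a \<odot>\<^bsub>U\<^esub> u"
    by (simp add: runit_map_def pure\<^sub>u_closed[OF m scal_simps(2)] sweedler\<^sub>u_pure\<^sub>u[OF m scal_simps(2) m b] scal_simps(1))
qed

text \<open>Moving the scalar across the tensor sign writes every pure tensor as one whose scalar
  factor is \<open>\<one>\<close>.\<close>

lemma unit_map_inverse:
  fixes U :: "('k, 'h, 'b) uspace"
  assumes m: "module K U"
  shows "x \<in> carrier (tensor\<^sub>u K Sc U) \<Longrightarrow> pure\<^sub>u K Sc U (Scal \<one>\<^bsub>K\<^esub>) (lunit_map U x) = x"
    "u \<in> carrier U \<Longrightarrow> lunit_map U (pure\<^sub>u K Sc U (Scal \<one>\<^bsub>K\<^esub>) u) = u"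
    "x \<in> carrier (tensor\<^sub>u K U Sc) \<Longrightarrow> pure\<^sub>u K U Sc (runit_map U x) (Scal \<one>\<^bsub>K\<^esub>) = x"
    "u \<in> carrier U \<Longrightarrow> runit_map U (pure\<^sub>u K U Sc u (Scal \<one>\<^bsub>K\<^esub>)) = u"
proof -
  interpret U: module K U by fact
  note L = pure\<^sub>u_bilinear[OF scal_simps(2) m] and R = pure\<^sub>u_bilinear[OF m scal_simps(2)]
  have one: "Scal \<one>\<^bsub>K\<^esub> \<in> carrier Sc" by (simp add: scal_simps(1))
  show "u \<in> carrier U \<Longrightarrow> lunit_map U (pure\<^sub>u K Sc U (Scal \<one>\<^bsub>K\<^esub>) u) = u"
    "u \<in> carrier U \<Longrightarrow> runit_map U (pure\<^sub>u K U Sc u (Scal \<one>\<^bsub>K\<^esub>)) = u"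
    by (simp_all add: lunit_map(3)[OF m] runit_map(3)[OF m])
  show "pure\<^sub>u K Sc U (Scal \<one>\<^bsub>K\<^esub>) (lunit_map U x) = x" if "x \<in> carrier (tensor\<^sub>u K Sc U)"
  proof (rule tensor\<^sub>u_ext[OF scal_simps(2) m tensor\<^sub>u_module[OF scal_simps(2) m] linear_map_comp[OF lunit_map(1)[OF m] bilinear_mapD(1)[OF L one]] linear_map_id _ that])
    fix k :: "('k, 'h, 'b) univ" and u assume "k \<in> carrier Sc" and u: "u \<in> carrier U"
    then obtain a where a: "k = Scal a" "a \<in> carrier K" by (auto simp: scal_simps(1))
    have "pure\<^sub>u K Sc U (Scal \<one>\<^bsub>K\<^esub>) (a \<odot>\<^bsub>U\<^esub> u) = a \<odot>\<^bsub>tensor\<^sub>u K Sc U\<^esub> pure\<^sub>u K Sc U (Scal \<one>\<^bsub>K\<^esub>) u"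
      by (rule linear_mapD(3)[OF bilinear_mapD(1)[OF L one] a(2) u])
    also have "\<dots> = pure\<^sub>u K Sc U (a \<odot>\<^bsub>Sc\<^esub> Scal \<one>\<^bsub>K\<^esub>) u"
      by (rule linear_mapD(3)[OF bilinear_mapD(2)[OF L u] a(2) one, symmetric])
    finally show "pure\<^sub>u K Sc U (Scal \<one>\<^bsub>K\<^esub>) (lunit_map U (pure\<^sub>u K Sc U k u)) = pure\<^sub>u K Sc U k u"
      using a u by (simp add: lunit_map(3)[OF m] scal_simps)
  qed
  show "pure\<^sub>u K U Sc (runit_map U x) (Scal \<one>\<^bsub>K\<^esub>) = x" if "x \<in> carrier (tensor\<^sub>u K U Sc)"
  proof (rule tensor\<^sub>u_ext[OF m scal_simps(2) tensor\<^sub>u_module[OF m scal_simps(2)] linear_map_comp[OF runit_map(1)[OF m] bilinear_mapD(2)[OF R one]] linear_map_id _ that])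
    fix k :: "('k, 'h, 'b) univ" and u assume "k \<in> carrier Sc" and u: "u \<in> carrier U"
    then obtain a where a: "k = Scal a" "a \<in> carrier K" by (auto simp: scal_simps(1))
    have "pure\<^sub>u K U Sc (a \<odot>\<^bsub>U\<^esub> u) (Scal \<one>\<^bsub>K\<^esub>) = a \<odot>\<^bsub>tensor\<^sub>u K U Sc\<^esub> pure\<^sub>u K U Sc u (Scal \<one>\<^bsub>K\<^esub>)"
      by (rule linear_mapD(3)[OF bilinear_mapD(2)[OF R one] a(2) u])
    also have "\<dots> = pure\<^sub>u K U Sc u (a \<odot>\<^bsub>Sc\<^esub> Scal \<one>\<^bsub>K\<^esub>)"
      by (rule linear_mapD(3)[OF bilinear_mapD(1)[OF R u] a(2) one, symmetric])
    finally show "pure\<^sub>u K U Sc (runit_map U (pure\<^sub>u K U Sc u k)) (Scal \<one>\<^bsub>K\<^esub>) = pure\<^sub>u K U Sc u k"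
      using a u by (simp add: runit_map(3)[OF m] scal_simps)
  qed
qed

lemma rep_mapI:
  assumes "deg U = deg V" "f \<in> extensional (elts U)" "linear_map K (space U) (space V) f"
    "\<And>h u. \<lbrakk>h \<in> coeffs (deg U); u \<in> elts U\<rbrakk> \<Longrightarrow> f (act U h u) = act V h (f u)"
  shows "is_rep_map U V f"
  using assms by (auto simp: is_rep_map_def)

lemma rep_mapD:
  assumes "is_rep_map U V f"
  shows "deg U = deg V" "f \<in> extensional (elts U)" "linear_map K (space U) (space V) f"
    "\<lbrakk>h \<in> coeffs (deg U); u \<in> elts U\<rbrakk> \<Longrightarrow> f (act U h u) = act V h (f u)"
    "u \<in> elts U \<Longrightarrow> f u \<in> elts V"
  using assms linear_mapD(1) by (auto simp: is_rep_map_def)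

lemma rep_map_tensor:
  assumes r: "is_rep U" "is_rep V" "is_rep U'" "is_rep V'" and f: "is_rep_map U U' f" and g: "is_rep_map V V' g"
  shows "is_rep_map (rep_tensor U V) (rep_tensor U' V') (map_tensor (space U) (space V) (space U') (space V') f g)"
proof (rule rep_mapI)
  note m = repD(2)[OF r(1)] repD(2)[OF r(2)] repD(2)[OF r(3)] repD(2)[OF r(4)]
  note M = map_tensor[OF m rep_mapD(3)[OF f] rep_mapD(3)[OF g]]
  have d: "deg U' = deg U" "deg V' = deg V" using rep_mapD(1)[OF f] rep_mapD(1)[OF g] by simp_all
  let ?f = "map_tensor (space U) (space V) (space U') (space V') f g"
  show "deg (rep_tensor U V) = deg (rep_tensor U' V')" using d by simp
  show "?f \<in> extensional (elts (rep_tensor U V))" using M(2) by simp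
  show "linear_map K (space (rep_tensor U V)) (space (rep_tensor U' V')) ?f" using M(1) by simp
  fix h x assume "h \<in> coeffs (deg (rep_tensor U V))" "x \<in> elts (rep_tensor U V)"
  then have h: "h \<in> coeffs (deg U \<otimes> deg V)" and x: "x \<in> carrier (tensor\<^sub>r U V)" by simp_all
  note a = tens_act[OF r(1,2)] and a' = tens_act[OF r(3,4), unfolded d]
  have "?f (tens_act U V t x) = tens_act U' V' t (?f x)" if t: "t \<in> carrier (tensor\<^sub>H (deg U) (deg V))" for t
  proof (rule bilinear_ext[OF _ _ m(1,2) tensor\<^sub>u_module[OF m(3,4)] _ _ _ t x])
    show "bilinear_map K (tensor\<^sub>H (deg U) (deg V)) (tensor\<^sub>r U V) (tensor\<^sub>r U' V')
      (\<lambda>t x. ?f (tens_act U V t x))"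
      by (intro bilinear_mapI linear_map_comp[OF _ M(1)] bilinear_mapD[OF a(1)])
    show "bilinear_map K (tensor\<^sub>H (deg U) (deg V)) (tensor\<^sub>r U V) (tensor\<^sub>r U' V')
      (\<lambda>t x. tens_act U' V' t (?f x))"
      by (intro bilinear_mapI linear_map_comp[OF M(1)] bilinear_mapD[OF a'(1)] linear_mapD(1)[OF M(1)])
    fix p q u v assume "p \<in> coeffs (deg U)" "q \<in> coeffs (deg V)" "u \<in> elts U" "v \<in> elts V"
    then show "?f (tens_act U V (pure\<^sub>H (deg U) (deg V) p q) (pure\<^sub>r U V u v)) =
      tens_act U' V' (pure\<^sub>H (deg U) (deg V) p q) (?f (pure\<^sub>r U V u v))"
      by (simp add: a(2) a'(2) M(3) repD r rep_mapD(4,5)[OF f] rep_mapD(4,5)[OF g])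
  qed (use r in auto)
  from this[of "comult H (deg U) (deg V) h"]
  show "?f (act (rep_tensor U V) h x) = act (rep_tensor U' V') h (?f x)"
    using h x r linear_mapD(1)[OF M(1) x] by (simp add: act_rep_tensor d)
qed

text \<open>For an arbitrary \<open>t\<close>, acting by \<open>t\<close> and then applying the unit
  map amounts to acting by the image \<open>?s t\<close> of \<open>t\<close> under the counit in the
  first leg. For \<open>t\<close> the coproduct of \<open>h\<close> this image is \<open>h\<close>
  by the counit axiom.\<close>

lemma rep_map_lunit:
  fixes U :: "('p, 'k, 'h, 'b) rep"
  assumes r: "is_rep U"
  shows "is_rep_map (rep_tensor rep_unit U) U (lunit_map (space U))"
proof (rule rep_mapI)
  note m = repD(2)[OF r] and d = repD(1)[OF r]
  note L = lunit_map[OF m]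
  interpret U: module K "space U" by (rule m)
  show "deg (rep_tensor rep_unit U) = deg U" using d by simp
  show "lunit_map (space U) \<in> extensional (elts (rep_tensor rep_unit U))"
    "linear_map K (space (rep_tensor rep_unit U)) (space U) (lunit_map (space U))" using L by simp_all
  fix h x assume "h \<in> coeffs (deg (rep_tensor rep_unit U))" "x \<in> elts (rep_tensor rep_unit U)"
  then have h: "h \<in> coeffs (deg U)" and x: "x \<in> carrier (tensor\<^sub>u K Sc (space U))" using d by simp_all
  note a = tens_act[OF rep_unit_closed r, unfolded rep_unit_simps]
  have b: "bilinear_map K (alg H \<one>) (alg H (deg U)) (alg H (deg U)) (\<lambda>x y. counit H x \<odot>\<^bsub>alg H (deg U)\<^esub> y)"
    using d by (intro bilinear_mapI linear_map_smult_left[OF _ counit_linear] linear_map_smult_right[OF _ _ linear_map_id]) auto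
  let ?s = "sweedler (alg H (deg U)) (\<lambda>x y. counit H x \<odot>\<^bsub>alg H (deg U)\<^esub> y)"
  have s: "linear_map K (tensor K (alg H \<one>) (alg H (deg U))) (alg H (deg U)) ?s"
    using d by (intro sweedler_linear b) auto
  have "lunit_map (space U) (tens_act rep_unit U t x) = act U (?s t) (lunit_map (space U) x)"
    if t: "t \<in> carrier (tensor K (alg H \<one>) (alg H (deg U)))" for t
  proof (rule bilinear_ext[OF _ _ scal_simps(2) m m _ _ _ t x])
    show "bilinear_map K (tensor K (alg H \<one>) (alg H (deg U))) (tensor\<^sub>u K Sc (space U)) (space U)
      (\<lambda>t x. lunit_map (space U) (tens_act rep_unit U t x))"
      by (intro bilinear_mapI linear_map_comp[OF _ L(1)] bilinear_mapD[OF a(1)])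
    show "bilinear_map K (tensor K (alg H \<one>) (alg H (deg U))) (tensor\<^sub>u K Sc (space U)) (space U)
      (\<lambda>t x. act U (?s t) (lunit_map (space U) x))"
      by (intro bilinear_mapI linear_map_comp[OF L(1) repD(3)[OF r]] linear_map_comp[OF s repD(6)[OF r]] linear_mapD(1)[OF s] linear_mapD(1)[OF L(1)])
    fix p q u and k :: "('k, 'h, 'b) univ" assume k: "p \<in> carrier (alg H \<one>)" "q \<in> coeffs (deg U)" "k \<in> carrier Sc" "u \<in> elts U"
    then obtain c where "k = Scal c" "c \<in> carrier K" by (auto simp: scal_simps(1))
    then show "lunit_map (space U) (tens_act rep_unit U (pure K (alg H \<one>) (alg H (deg U)) p q) (pure\<^sub>u K Sc (space U) k u)) =
      act U (?s (pure K (alg H \<one>) (alg H (deg U)) p q)) (lunit_map (space U) (pure\<^sub>u K Sc (space U) k u))"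
      using k d by (simp add: a(2) L(3) repD r sweedler_pure[OF _ _ _ b] linear_mapD(3)[OF repD(6)[OF r]] linear_mapD(3)[OF repD(3)[OF r]]
          scal_simps(1) U.smult_assoc1[symmetric] K.m_comm)
  qed (use d in auto)
  from this[of "comult H \<one> (deg U) h"]
  show "lunit_map (space U) (act (rep_tensor rep_unit U) h x) = act U h (lunit_map (space U) x)"
    using h x d by (simp add: act_rep_tensor counit_left)
qed

text \<open>The same argument with the counit in the second leg.\<close>

lemma rep_map_runit:
  fixes U :: "('p, 'k, 'h, 'b) rep"
  assumes r: "is_rep U"
  shows "is_rep_map (rep_tensor U rep_unit) U (runit_map (space U))"
proof (rule rep_mapI)
  note m = repD(2)[OF r] and d = repD(1)[OF r]
  note L = runit_map[OF m]
  interpret U: module K "space U" by (rule m)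
  show "deg (rep_tensor U rep_unit) = deg U" using d by simp
  show "runit_map (space U) \<in> extensional (elts (rep_tensor U rep_unit))"
    "linear_map K (space (rep_tensor U rep_unit)) (space U) (runit_map (space U))" using L by simp_all
  fix h x assume "h \<in> coeffs (deg (rep_tensor U rep_unit))" "x \<in> elts (rep_tensor U rep_unit)"
  then have h: "h \<in> coeffs (deg U)" and x: "x \<in> carrier (tensor\<^sub>u K (space U) Sc)" using d by simp_all
  note a = tens_act[OF r rep_unit_closed, unfolded rep_unit_simps]
  have b: "bilinear_map K (alg H (deg U)) (alg H \<one>) (alg H (deg U)) (\<lambda>x y. counit H y \<odot>\<^bsub>alg H (deg U)\<^esub> x)"
    using d by (intro bilinear_mapI linear_map_smult_left[OF _ counit_linear] linear_map_smult_right[OF _ _ linear_map_id]) auto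
  let ?s = "sweedler (alg H (deg U)) (\<lambda>x y. counit H y \<odot>\<^bsub>alg H (deg U)\<^esub> x)"
  have s: "linear_map K (tensor K (alg H (deg U)) (alg H \<one>)) (alg H (deg U)) ?s"
    using d by (intro sweedler_linear b) auto
  have "runit_map (space U) (tens_act U rep_unit t x) = act U (?s t) (runit_map (space U) x)"
    if t: "t \<in> carrier (tensor K (alg H (deg U)) (alg H \<one>))" for t
  proof (rule bilinear_ext[OF _ _ m scal_simps(2) m _ _ _ t x])
    show "bilinear_map K (tensor K (alg H (deg U)) (alg H \<one>)) (tensor\<^sub>u K (space U) Sc) (space U)
      (\<lambda>t x. runit_map (space U) (tens_act U rep_unit t x))"
      by (intro bilinear_mapI linear_map_comp[OF _ L(1)] bilinear_mapD[OF a(1)])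
    show "bilinear_map K (tensor K (alg H (deg U)) (alg H \<one>)) (tensor\<^sub>u K (space U) Sc) (space U)
      (\<lambda>t x. act U (?s t) (runit_map (space U) x))"
      by (intro bilinear_mapI linear_map_comp[OF L(1) repD(3)[OF r]] linear_map_comp[OF s repD(6)[OF r]] linear_mapD(1)[OF s] linear_mapD(1)[OF L(1)])
    fix p q u and k :: "('k, 'h, 'b) univ" assume k: "p \<in> coeffs (deg U)" "q \<in> carrier (alg H \<one>)" "u \<in> elts U" "k \<in> carrier Sc"
    then obtain c where "k = Scal c" "c \<in> carrier K" by (auto simp: scal_simps(1))
    then show "runit_map (space U) (tens_act U rep_unit (pure K (alg H (deg U)) (alg H \<one>) p q) (pure\<^sub>u K (space U) Sc u k)) =
      act U (?s (pure K (alg H (deg U)) (alg H \<one>) p q)) (runit_map (space U) (pure\<^sub>u K (space U) Sc u k))"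
      using k d by (simp add: a(2) L(3) repD r sweedler_pure[OF _ _ _ b] linear_mapD(3)[OF repD(6)[OF r]] linear_mapD(3)[OF repD(3)[OF r]]
          scal_simps(1) U.smult_assoc1[symmetric] K.m_comm)
  qed (use d in auto)
  from this[of "comult H (deg U) \<one> h"]
  show "runit_map (space U) (act (rep_tensor U rep_unit) h x) = act U h (runit_map (space U) x)"
    using h x d by (simp add: act_rep_tensor counit_right)
qed

text \<open>For fixed \<open>u\<close>, \<open>v\<close>, \<open>w\<close> the two orders of acting
  and rebracketing are the images, under one linear map \<open>\<Phi>\<close>, of the two sides of
  coassociativity at \<open>h\<close>.\<close>

lemma rep_map_assoc:
  fixes U V W :: "('p, 'k, 'h, 'b) rep"
  assumes r: "is_rep U" "is_rep V" "is_rep W"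
  shows "is_rep_map (rep_tensor (rep_tensor U V) W) (rep_tensor U (rep_tensor V W)) (assoc_map (space U) (space V) (space W))"
proof (rule rep_mapI)
  let ?U = "space U" and ?V = "space V" and ?W = "space W"
  let ?A = "alg H (deg U)" and ?B = "alg H (deg V)" and ?C = "alg H (deg W)"
  let ?AB = "alg H (deg U \<otimes> deg V)" and ?BC = "alg H (deg V \<otimes> deg W)"
  note m [simp] = repD(2)[OF r(1)] repD(2)[OF r(2)] repD(2)[OF r(3)] and d [simp] = repD(1)[OF r(1)] repD(1)[OF r(2)] repD(1)[OF r(3)]
  note UV = rep_tensor_closed[OF r(1,2)] and VW = rep_tensor_closed[OF r(2,3)]
  note UV_W = rep_tensor_closed[OF UV r(3)] and U_VW = rep_tensor_closed[OF r(1) VW]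
  note M [simp] = repD(2)[OF UV, simplified] repD(2)[OF VW, simplified] repD(2)[OF UV_W, simplified] repD(2)[OF U_VW, simplified]
  note [simp] = pure\<^sub>u_closed pure_closed tensor_module
  note A = assoc_map[OF m]
  let ?f = "assoc_map ?U ?V ?W"
  let ?T = "tensor K ?A (tensor K ?B ?C)" and ?S = "tensor\<^sub>u K ?U (tensor\<^sub>u K ?V ?W)"
  show "deg (rep_tensor (rep_tensor U V) W) = deg (rep_tensor U (rep_tensor V W))" by (simp add: P.m_assoc)
  show "?f \<in> extensional (elts (rep_tensor (rep_tensor U V) W))" using A(2) by simp
  show "linear_map K (space (rep_tensor (rep_tensor U V) W)) (space (rep_tensor U (rep_tensor V W))) ?f" using A(1) by simp
  fix h x assume "h \<in> coeffs (deg (rep_tensor (rep_tensor U V) W))" and x: "x \<in> elts (rep_tensor (rep_tensor U V) W)"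
  then have h: "h \<in> coeffs (deg U \<otimes> deg V \<otimes> deg W)" by simp
  then have h': "h \<in> coeffs (deg U \<otimes> (deg V \<otimes> deg W))" by (simp add: P.m_assoc)
  show "?f (act (rep_tensor (rep_tensor U V) W) h x) = act (rep_tensor U (rep_tensor V W)) h (?f x)"
  proof (rule tensor\<^sub>u_ext3[OF m M(4) _ _ _ x[unfolded rep_tensor_simps]])
    show "linear_map K (tensor\<^sub>u K (tensor\<^sub>u K ?U ?V) ?W) ?S (\<lambda>x. ?f (act (rep_tensor (rep_tensor U V) W) h x))"
      using linear_map_comp[OF repD(3)[OF UV_W, of h, simplified] A(1)] h by simp
    show "linear_map K (tensor\<^sub>u K (tensor\<^sub>u K ?U ?V) ?W) ?S (\<lambda>x. act (rep_tensor U (rep_tensor V W)) h (?f x))"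
      using linear_map_comp[OF A(1) repD(3)[OF U_VW, of h, simplified]] h' by simp
    fix u v w assume u: "u \<in> carrier ?U" and v: "v \<in> carrier ?V" and w: "w \<in> carrier ?W"
    note [simp] = u v w
    note tc = bilinear_mapD(3)[OF tens_act(1)]
    \<comment> \<open>\<open>\<Phi>\<close> lets the three factors of an element of
      \<open>?T\<close> act on \<open>u\<close>, \<open>v\<close> and \<open>w\<close>. Below,
      \<open>R\<close> and \<open>L\<close> identify the two actions with \<open>\<Phi>\<close> of
      the two iterated coproducts, again for an arbitrary tensor in place of the outer
      coproduct.\<close>
    define \<Phi> where "\<Phi> = sweedler ?S (\<lambda>x s. pure\<^sub>u K ?U (tensor\<^sub>u K ?V ?W) (act U x u) (tens_act V W s (pure\<^sub>u K ?V ?W v w)))"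
    have b: "bilinear_map K ?A (tensor K ?B ?C) ?S (\<lambda>x s. pure\<^sub>u K ?U (tensor\<^sub>u K ?V ?W) (act U x u) (tens_act V W s (pure\<^sub>u K ?V ?W v w)))"
      by (intro lin) (simp_all add: r repD tc)
    have \<Phi>: "linear_map K ?T ?S \<Phi>" unfolding \<Phi>_def by (rule sweedler_linear[OF _ _ _ b]) simp_all
    have \<Phi>_pure: "\<Phi> (pure K ?A (tensor K ?B ?C) x (pure K ?B ?C y z)) =
        pure\<^sub>u K ?U (tensor\<^sub>u K ?V ?W) (act U x u) (pure\<^sub>u K ?V ?W (act V y v) (act W z w))"
      if "x \<in> carrier ?A" "y \<in> carrier ?B" "z \<in> carrier ?C" for x y z
      unfolding \<Phi>_def using that by (simp add: sweedler_pure[OF _ _ _ b] tens_act(2)[OF r(2,3)])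
    let ?uvw = "pure\<^sub>u K (tensor\<^sub>u K ?U ?V) ?W (pure\<^sub>u K ?U ?V u v) w"
    let ?uvw' = "pure\<^sub>u K ?U (tensor\<^sub>u K ?V ?W) u (pure\<^sub>u K ?V ?W v w)"
    note tR = tens_act[OF r(1) VW, simplified] and tL = tens_act[OF UV r(3), simplified]
    have R: "tens_act U (rep_tensor V W) t ?uvw' = \<Phi> (sweedler ?T (\<lambda>x y. pure K ?A (tensor K ?B ?C) x (comult H (deg V) (deg W) y)) t)"
      if t: "t \<in> carrier (tensor K ?A ?BC)" for t
    proof -
      have c: "bilinear_map K ?A ?BC ?T (\<lambda>x y. pure K ?A (tensor K ?B ?C) x (comult H (deg V) (deg W) y))"
        by (intro lin) simp_all
      show ?thesis
      proof (rule tensor_ext[OF _ _ _ _ linear_map_comp[OF sweedler_linear[OF _ _ _ c] \<Phi>] _ t])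
        show "linear_map K (tensor K ?A ?BC) ?S (\<lambda>t. tens_act U (rep_tensor V W) t ?uvw')"
          by (rule bilinear_mapD(2)[OF tR(1)]) simp
        fix p q assume pq: "p \<in> carrier ?A" "q \<in> carrier ?BC"
        then show "tens_act U (rep_tensor V W) (pure K ?A ?BC p q) ?uvw' =
           \<Phi> (sweedler ?T (\<lambda>x y. pure K ?A (tensor K ?B ?C) x (comult H (deg V) (deg W) y)) (pure K ?A ?BC p q))"
          by (simp add: sweedler_pure[OF _ _ _ c] tR(2) act_rep_tensor) (simp add: \<Phi>_def sweedler_pure[OF _ _ _ b])
      qed simp_all
    qed
    \<comment> \<open>The coproduct of the first leg is replaced by an arbitrary \<open>s\<close> as
      well.\<close>
    have L': "?f (pure\<^sub>u K (tensor\<^sub>u K ?U ?V) ?W (tens_act U V s (pure\<^sub>u K ?U ?V u v)) (act W z w)) =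
        \<Phi> (sweedler ?T (\<lambda>x y. pure K ?A (tensor K ?B ?C) x (pure K ?B ?C y z)) s)"
      if s: "s \<in> carrier (tensor K ?A ?B)" and z: "z \<in> carrier ?C" for s z
    proof -
      have c: "bilinear_map K ?A ?B ?T (\<lambda>x y. pure K ?A (tensor K ?B ?C) x (pure K ?B ?C y z))"
        by (intro lin) (simp_all add: z)
      show ?thesis
      proof (rule tensor_ext[OF _ _ _ linear_map_comp[OF _ A(1)] linear_map_comp[OF sweedler_linear[OF _ _ _ c] \<Phi>] _ s])
        show "linear_map K (tensor K ?A ?B) (tensor\<^sub>u K (tensor\<^sub>u K ?U ?V) ?W)
           (\<lambda>s. pure\<^sub>u K (tensor\<^sub>u K ?U ?V) ?W (tens_act U V s (pure\<^sub>u K ?U ?V u v)) (act W z w))"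
          by (intro lin) (simp_all add: r repD z)
        fix p q assume pq: "p \<in> carrier ?A" "q \<in> carrier ?B"
        then show "?f (pure\<^sub>u K (tensor\<^sub>u K ?U ?V) ?W (tens_act U V (pure K ?A ?B p q) (pure\<^sub>u K ?U ?V u v)) (act W z w)) =
           \<Phi> (sweedler ?T (\<lambda>x y. pure K ?A (tensor K ?B ?C) x (pure K ?B ?C y z)) (pure K ?A ?B p q))"
          by (simp add: sweedler_pure[OF _ _ _ c] tens_act(2)[OF r(1,2)] \<Phi>_pure z A(3) r repD)
      qed simp_all
    qed
    have L: "?f (tens_act (rep_tensor U V) W t ?uvw) =
        \<Phi> (sweedler ?T (\<lambda>p z. sweedler ?T (\<lambda>x y. pure K ?A (tensor K ?B ?C) x (pure K ?B ?C y z)) (comult H (deg U) (deg V) p)) t)"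
      if t: "t \<in> carrier (tensor K ?AB ?C)" for t
    proof -
      have c0: "bilinear_map K ?A ?B ?T (\<lambda>x y. pure K ?A (tensor K ?B ?C) x (pure K ?B ?C y z))" if "z \<in> carrier ?C" for z
        by (intro lin) (simp_all add: that)
      have c: "bilinear_map K ?AB ?C ?T (\<lambda>p z. sweedler ?T (\<lambda>x y. pure K ?A (tensor K ?B ?C) x (pure K ?B ?C y z)) (comult H (deg U) (deg V) p))"
      proof (rule bilinear_mapI)
        fix p assume p: "p \<in> carrier ?AB"
        show "linear_map K ?C ?T (\<lambda>z. sweedler ?T (\<lambda>x y. pure K ?A (tensor K ?B ?C) x (pure K ?B ?C y z)) (comult H (deg U) (deg V) p))"
          by (rule sweedler_param_linear[where V = ?A and W = ?B]) (use p in \<open>simp_all add: lin\<close>)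
      next
        fix z assume z: "z \<in> carrier ?C"
        show "linear_map K ?AB ?T (\<lambda>p. sweedler ?T (\<lambda>x y. pure K ?A (tensor K ?B ?C) x (pure K ?B ?C y z)) (comult H (deg U) (deg V) p))"
          by (rule linear_map_comp[OF comult_linear sweedler_linear[OF _ _ _ c0[OF z]]]) simp_all
      qed
      show ?thesis
      proof (rule tensor_ext[OF _ _ _ linear_map_comp[OF _ A(1)] linear_map_comp[OF sweedler_linear[OF _ _ _ c] \<Phi>] _ t])
        show "linear_map K (tensor K ?AB ?C) (tensor\<^sub>u K (tensor\<^sub>u K ?U ?V) ?W) (\<lambda>t. tens_act (rep_tensor U V) W t ?uvw)"
          by (rule bilinear_mapD(2)[OF tL(1)]) simp
        fix p q assume pq: "p \<in> carrier ?AB" "q \<in> carrier ?C"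
        then show "?f (tens_act (rep_tensor U V) W (pure K ?AB ?C p q) ?uvw) =
          \<Phi> (sweedler ?T (\<lambda>p z. sweedler ?T (\<lambda>x y. pure K ?A (tensor K ?B ?C) x (pure K ?B ?C y z)) (comult H (deg U) (deg V) p)) (pure K ?AB ?C p q))"
          by (simp add: sweedler_pure[OF _ _ _ c] tL(2) act_rep_tensor L')
      qed simp_all
    qed
    show "?f (act (rep_tensor (rep_tensor U V) W) h ?uvw) = act (rep_tensor U (rep_tensor V W)) h (?f ?uvw)"
      using L[of "comult H (deg U \<otimes> deg V) (deg W) h"] R[of "comult H (deg U) (deg V \<otimes> deg W) h"] h h'
        coassoc[of "deg U" "deg V" "deg W" h]
      by (simp add: act_rep_tensor A(3) Let_def)
  qed
qed

subsection \<open>The T-category of representations\<close>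

lemma Rep_simps [simp]:
  "Obj Rep = {U. is_rep U}"
  "Arr Rep = {Arrow U V f | U V f. is_rep U \<and> is_rep V \<and> is_rep_map U V f}"
  "Dom Rep = source" "Cod Rep = target"
  "Ident Rep U = Arrow U U (\<lambda>u\<in>carrier (space U). u)"
  "Comp Rep g f = Arrow (source f) (target g) (compose (elts (source f)) (body g) (body f))"
  "TenO Rep = rep_tensor"
  "TenA Rep f g = Arrow (rep_tensor (source f) (source g)) (rep_tensor (target f) (target g))
               (map_tensor (space (source f)) (space (source g)) (space (target f)) (space (target g))
                  (body f) (body g))"
  "Unit Rep = rep_unit"
  "Assoc Rep U V W = Arrow (rep_tensor (rep_tensor U V) W) (rep_tensor U (rep_tensor V W))
               (assoc_map (space U) (space V) (space W))"
  "LUnit Rep U = Arrow (rep_tensor rep_unit U) U (lunit_map (space U))"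
  "RUnit Rep U = Arrow (rep_tensor U rep_unit) U (runit_map (space U))"
  "Grade Rep = deg" "ConjO Rep = rep_conj"
  "ConjA Rep \<beta> f = Arrow (rep_conj \<beta> (source f)) (rep_conj \<beta> (target f)) (body f)"
  by (simp_all add: Rep_def)

lemma arrows_Rep: "f \<in> arrows Rep U V \<longleftrightarrow> (\<exists>g. f = Arrow U V g \<and> is_rep U \<and> is_rep V \<and> is_rep_map U V g)"
  by (auto simp: arrows_def)

lemma rep_map_id: "is_rep U \<Longrightarrow> is_rep_map U U (\<lambda>u\<in>carrier (space U). u)"
  by (rule rep_mapI) (auto simp: repD(7) intro: linear_map_cong[OF linear_map_id])

lemma rep_map_compose:
  assumes "is_rep U" "is_rep_map U V f" "is_rep_map V W g"
  shows "is_rep_map U W (compose (elts U) g f)"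
proof (rule rep_mapI)
  show "linear_map K (space U) (space W) (compose (elts U) g f)"
    by (rule linear_map_cong[OF linear_map_comp[OF rep_mapD(3)[OF assms(2)] rep_mapD(3)[OF assms(3)]] repD(2)[OF assms(1)]])
      (simp add: compose_eq)
  fix h u assume "h \<in> coeffs (deg U)" "u \<in> elts U"
  then show "compose (elts U) g f (act U h u) = act W h (compose (elts U) g f u)"
    using rep_mapD(1)[OF assms(2)]
    by (simp add: compose_eq repD(7)[OF assms(1)] rep_mapD(4,5)[OF assms(2)] rep_mapD(4)[OF assms(3)])
qed (use rep_mapD(1)[OF assms(2)] rep_mapD(1)[OF assms(3)] in simp_all)

lemma Rep_category: "category (Rep :: ('p, ('p, 'k, 'h, 'b) rep, ('p, 'k, 'h, 'b) rep_arrow) T_category)"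
proof
  fix f :: "('p, 'k, 'h, 'b) rep_arrow" and U V assume "f \<in> arrows Rep U V"
  then obtain g where f: "f = Arrow U V g" "is_rep U" "is_rep V" "is_rep_map U V g" by (auto simp: arrows_Rep)
  have "compose (elts U) g (\<lambda>u\<in>carrier (space U). u) = g"
    "compose (elts U) (\<lambda>u\<in>carrier (space V). u) g = g"
    using rep_mapD(2)[OF f(4)] rep_mapD(5)[OF f(4)]
    by (intro extensionalityI[where A = "elts U"]; simp add: compose_eq)+
  then show "Comp Rep f (Ident Rep U) = f" "Comp Rep (Ident Rep V) f = f" using f by simp_all
next
  fix f g h :: "('p, 'k, 'h, 'b) rep_arrow" and U V W X
  assume "f \<in> arrows Rep U V" "g \<in> arrows Rep V W" "h \<in> arrows Rep W X"
  then obtain f' g' h' where e: "f = Arrow U V f'" "g = Arrow V W g'" "h = Arrow W X h'" "is_rep_map U V f'"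
    by (auto simp: arrows_Rep)
  have "f' \<in> elts U \<rightarrow> elts V" using rep_mapD(5)[OF e(4)] by blast
  then show "Comp Rep (Comp Rep h g) f = Comp Rep h (Comp Rep g f)"
    using e by (simp add: compose_assoc)
next
  fix f g :: "('p, 'k, 'h, 'b) rep_arrow" and U V W
  assume "f \<in> arrows Rep U V" "g \<in> arrows Rep V W"
  then show "Comp Rep g f \<in> arrows Rep U W"
    by (auto simp: arrows_Rep intro: rep_map_compose)
qed (auto simp: arrows_Rep rep_map_id)

text \<open>The inverse of a bijective morphism is a morphism: each identity for \<open>g\<close> is
  checked after applying the injective map \<open>f\<close>. Thus only a map inverse to
  \<open>f\<close> on the carriers has to be supplied.\<close>

lemma Rep_isoI:
  fixes U V :: "('p, 'k, 'h, 'b) rep"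
  assumes r: "is_rep U" "is_rep V" and f: "is_rep_map U V f"
    and g: "\<And>v. v \<in> elts V \<Longrightarrow> g v \<in> elts U" "\<And>v. v \<in> elts V \<Longrightarrow> f (g v) = v"
      "\<And>u. u \<in> elts U \<Longrightarrow> g (f u) = u"
  shows "Arrow U V f \<in> isos Rep U V" "inv_arrow Rep (Arrow U V f) = Arrow V U (restrict g (elts V))"
    "is_rep_map V U (restrict g (elts V))"
proof -
  interpret category "Rep :: ('p, ('p, 'k, 'h, 'b) rep, ('p, 'k, 'h, 'b) rep_arrow) T_category" by (rule Rep_category)
  interpret U: module K "space U" using r by simp
  interpret V: module K "space V" using r by simp
  note F = rep_mapD[OF f] linear_mapD[OF rep_mapD(3)[OF f]]
  have inj: "x = y" if "f x = f y" "x \<in> elts U" "y \<in> elts U" for x y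
    using that g(3) by metis
  show G: "is_rep_map V U (restrict g (elts V))"
  proof (intro rep_mapI linear_mapI)
    fix v v' assume "v \<in> elts V" "v' \<in> elts V"
    then show "restrict g (elts V) (v \<oplus>\<^bsub>space V\<^esub> v') = restrict g (elts V) v \<oplus>\<^bsub>space U\<^esub> restrict g (elts V) v'"
      by - (rule inj; simp add: g F(7))
  next
    fix a v assume "a \<in> carrier K" "v \<in> elts V"
    then show "restrict g (elts V) (a \<odot>\<^bsub>space V\<^esub> v) = a \<odot>\<^bsub>space U\<^esub> restrict g (elts V) v"
      by - (rule inj; simp add: g F(8))
  next
    fix h v assume "h \<in> coeffs (deg V)" "v \<in> elts V"
    then show "restrict g (elts V) (act V h v) = act U h (restrict g (elts V) v)"
      using F(1) by - (rule inj; simp add: g F(4) repD(7) r)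
  qed (simp_all add: F(1) g(1))
  have i: "inverse_arrows Rep (Arrow U V f) (Arrow V U (restrict g (elts V)))"
  proof -
    have "compose (elts U) (restrict g (elts V)) f = (\<lambda>u\<in>carrier (space U). u)"
      by (rule extensionalityI[where A = "elts U"]) (simp_all add: compose_eq F(5) g(3))
    moreover have "compose (elts V) f (restrict g (elts V)) = (\<lambda>u\<in>carrier (space V). u)"
      by (rule extensionalityI[where A = "elts V"]) (simp_all add: compose_eq g)
    ultimately show ?thesis using r f G by (simp add: inverse_arrows_def arrows_def)
  qed
  then show "inv_arrow Rep (Arrow U V f) = Arrow V U (restrict g (elts V))" by (rule inv_arrow_eq)
  show "Arrow U V f \<in> isos Rep U V" by (rule isosI[OF _ i]) (use r f in \<open>simp add: arrows_def\<close>)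
qed

text \<open>Conjugating both actions means twisting both legs of the coproduct by the inverse of
  \<open>\<beta>\<close>, and \<open>twist_comult\<close> moves the twist inside the
  comultiplication.\<close>

lemma tens_act_conj:
  fixes U V :: "('p, 'k, 'h, 'b) rep"
  assumes r: "is_rep U" "is_rep V" and b: "\<beta> \<in> carrier \<pi>"
    and h: "h \<in> coeffs (conjg \<pi> \<beta> (deg U \<otimes> deg V))" and x: "x \<in> carrier (tensor\<^sub>r U V)"
  shows "tens_act (rep_conj \<beta> U) (rep_conj \<beta> V) (comult H (conjg \<pi> \<beta> (deg U)) (conjg \<pi> \<beta> (deg V)) h) x =
    tens_act U V (comult H (deg U) (deg V) (twist H (inv \<beta>) (conjg \<pi> \<beta> (deg U \<otimes> deg V)) h)) x"
proof -
  let ?A = "alg H (deg U)" and ?B = "alg H (deg V)" and ?\<alpha> = "conjg \<pi> \<beta> (deg U)" and ?\<beta> = "conjg \<pi> \<beta> (deg V)"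
  let ?A' = "alg H ?\<alpha>" and ?B' = "alg H ?\<beta>"
  note m = repD(2)[OF r(1)] repD(2)[OF r(2)] and d = repD(1)[OF r(1)] repD(1)[OF r(2)]
  note S = tensor\<^sub>u_module[OF m]
  note a = tens_act[OF r] and a' = tens_act[OF rep_conj_closed[OF r(1) b] rep_conj_closed[OF r(2) b], unfolded rep_conj_simps]
  let ?t = "\<lambda>x y. pure K ?A ?B (twist H (inv \<beta>) ?\<alpha> x) (twist H (inv \<beta>) ?\<beta> y)"
  have tw: "bilinear_map K ?A' ?B' (tensor K ?A ?B) ?t"
    by (intro lin lin_twist) (use d b twist_conj_closed[OF r(1) b] twist_conj_closed[OF r(2) b] in simp_all)
  have l: "linear_map K (tensor K ?A' ?B') (tensor K ?A ?B) (sweedler (tensor K ?A ?B) ?t)"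
    by (rule sweedler_linear[OF _ _ tensor_module tw]) (use d b in simp_all)
  have "tens_act (rep_conj \<beta> U) (rep_conj \<beta> V) t x = tens_act U V (sweedler (tensor K ?A ?B) ?t t) x"
    if t: "t \<in> carrier (tensor K ?A' ?B')" for t
  proof (rule bilinear_ext[OF _ _ m S a'(1) _ _ t x])
    show "bilinear_map K (tensor K ?A' ?B') (tensor\<^sub>r U V) (tensor\<^sub>r U V)
       (\<lambda>t x. tens_act U V (sweedler (tensor K ?A ?B) ?t t) x)"
      by (intro bilinear_mapI linear_map_comp[OF l] bilinear_mapD[OF a(1)] linear_mapD(1)[OF l])
    fix p q u v assume "p \<in> carrier ?A'" "q \<in> carrier ?B'" "u \<in> elts U" "v \<in> elts V"
    then show "tens_act (rep_conj \<beta> U) (rep_conj \<beta> V) (pure K ?A' ?B' p q) (pure\<^sub>r U V u v) =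
       tens_act U V (sweedler (tensor K ?A ?B) ?t (pure K ?A' ?B' p q)) (pure\<^sub>r U V u v)"
      using d b by (simp add: a'(2) a(2) sweedler_pure[OF _ _ tensor_module tw] twist_conj_closed r)
  qed (use d b in simp_all)
  note * = this[of "comult H ?\<alpha> ?\<beta> h"]
  have "sweedler (tensor K ?A ?B) ?t (comult H ?\<alpha> ?\<beta> h) = comult H (deg U) (deg V) (twist H (inv \<beta>) (conjg \<pi> \<beta> (deg U \<otimes> deg V)) h)"
    using twist_comult[of ?\<alpha> ?\<beta> "inv \<beta>" h] d b h by (simp add: Let_def conjg_distrib)
  then show ?thesis using * h d b by (simp add: conjg_distrib)
qed

lemma rep_eqI:
  assumes "is_rep U" "is_rep V" "deg U = deg V" "space U = space V"
    "\<And>h u. \<lbrakk>h \<in> coeffs (deg U); u \<in> elts U\<rbrakk> \<Longrightarrow> act U h u = act V h u"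
  shows "U = V"
proof -
  have "act U = act V"
  proof (rule extensionalityI[OF repD(8)[OF assms(1)]])
    show "act V \<in> extensional (coeffs (deg U))" using repD(8)[OF assms(2)] assms(3) by simp
    fix h assume h: "h \<in> coeffs (deg U)"
    show "act U h = act V h"
      by (rule extensionalityI[OF repD(9)[OF assms(1) h]]) (use repD(9)[OF assms(2), of h] assms h in auto)
  qed
  then show ?thesis using assms by (intro representation.equality) simp_all
qed

text \<open>\<open>rep_conj\<close> keeps the underlying space, so both sides have the same space
  and degree and only the actions are compared, by \<open>tens_act_conj\<close>. This makes the
  conjugation functors strict.\<close>

lemma rep_conj_tensor:
  fixes U V :: "('p, 'k, 'h, 'b) rep"
  assumes r: "is_rep U" "is_rep V" and b: "\<beta> \<in> carrier \<pi>"
  shows "rep_conj \<beta> (rep_tensor U V) = rep_tensor (rep_conj \<beta> U) (rep_conj \<beta> V)"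
proof (rule rep_eqI)
  show "is_rep (rep_conj \<beta> (rep_tensor U V))" "is_rep (rep_tensor (rep_conj \<beta> U) (rep_conj \<beta> V))"
    using r b by (simp_all add: rep_conj_closed rep_tensor_closed)
  have d: "conjg \<pi> \<beta> (deg U) \<otimes> conjg \<pi> \<beta> (deg V) = conjg \<pi> \<beta> (deg U \<otimes> deg V)" using r b by (simp add: conjg_distrib)
  then show "deg (rep_conj \<beta> (rep_tensor U V)) = deg (rep_tensor (rep_conj \<beta> U) (rep_conj \<beta> V))" by simp
  fix h x assume h: "h \<in> coeffs (deg (rep_conj \<beta> (rep_tensor U V)))" and x: "x \<in> elts (rep_conj \<beta> (rep_tensor U V))"
  then have "twist H (inv \<beta>) (conjg \<pi> \<beta> (deg U \<otimes> deg V)) h \<in> coeffs (deg U \<otimes> deg V)"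
    using twist_conj_closed[OF rep_tensor_closed[OF r] b, of h] by simp
  then show "act (rep_conj \<beta> (rep_tensor U V)) h x = act (rep_tensor (rep_conj \<beta> U) (rep_conj \<beta> V)) h x"
    using h x by (simp add: act_rep_tensor d tens_act_conj[OF r b])
qed simp

lemma rep_conj_unit:
  assumes b: "\<beta> \<in> carrier \<pi>"
  shows "rep_conj \<beta> rep_unit = rep_unit"
proof (rule rep_eqI)
  show "is_rep (rep_conj \<beta> rep_unit)" "is_rep rep_unit" using b by (simp_all add: rep_conj_closed rep_unit_closed)
  fix h x assume "h \<in> coeffs (deg (rep_conj \<beta> rep_unit))" "x \<in> elts (rep_conj \<beta> rep_unit)"
  then show "act (rep_conj \<beta> rep_unit) h x = act rep_unit h x"
    using b twist_closed[of \<one> "inv \<beta>" h] by (auto simp: scal_simps(1) twist_counit)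
qed (use b in simp_all)

lemma rep_conj_one:
  assumes r: "is_rep U"
  shows "rep_conj \<one> U = U"
  by (rule rep_eqI) (use r in \<open>simp_all add: rep_conj_closed\<close>)

lemma rep_conj_mult:
  assumes r: "is_rep U" and b: "\<beta> \<in> carrier \<pi>" "\<gamma> \<in> carrier \<pi>"
  shows "rep_conj (\<beta> \<otimes> \<gamma>) U = rep_conj \<beta> (rep_conj \<gamma> U)"
proof (rule rep_eqI)
  show "is_rep (rep_conj (\<beta> \<otimes> \<gamma>) U)" "is_rep (rep_conj \<beta> (rep_conj \<gamma> U))"
    using r b by (simp_all add: rep_conj_closed)
  fix h u assume "h \<in> coeffs (deg (rep_conj (\<beta> \<otimes> \<gamma>) U))" "u \<in> elts (rep_conj (\<beta> \<otimes> \<gamma>) U)"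
  then have h: "h \<in> coeffs (conjg \<pi> \<beta> (conjg \<pi> \<gamma> (deg U)))" using r b by (simp add: conjg_mult)
  have c: "conjg \<pi> \<gamma> (deg U) = conjg \<pi> (inv \<beta>) (conjg \<pi> \<beta> (conjg \<pi> \<gamma> (deg U)))" using r b by simp
  have "twist H (inv \<gamma> \<otimes> inv \<beta>) (conjg \<pi> \<beta> (conjg \<pi> \<gamma> (deg U))) h =
    twist H (inv \<gamma>) (conjg \<pi> \<gamma> (deg U)) (twist H (inv \<beta>) (conjg \<pi> \<beta> (conjg \<pi> \<gamma> (deg U))) h)"
    using twist_mult[of "conjg \<pi> \<beta> (conjg \<pi> \<gamma> (deg U))" "inv \<gamma>" "inv \<beta>" h] r b h by simp
  then show "act (rep_conj (\<beta> \<otimes> \<gamma>) U) h u = act (rep_conj \<beta> (rep_conj \<gamma> U)) h u"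
    using r b h twist_closed[of "conjg \<pi> \<beta> (conjg \<pi> \<gamma> (deg U))" "inv \<beta>" h]
    by (simp add: conjg_mult P.inv_mult_group)
qed (use r b in \<open>simp_all add: conjg_mult\<close>)

lemma rep_map_conj:
  assumes "is_rep U" "is_rep V" "is_rep_map U V f" "\<beta> \<in> carrier \<pi>"
  shows "is_rep_map (rep_conj \<beta> U) (rep_conj \<beta> V) f"
  by (rule rep_mapI)
    (use assms rep_mapD(1-3)[OF assms(3)] rep_mapD(4)[OF assms(3) twist_conj_closed[OF assms(1,4)]] in simp_all)

text \<open>Provides the inverse associator as an arrow whose body has known values on pure tensors;
  this is how it enters the computations with half braidings.\<close>

lemma Rep_Assoc_iso:
  fixes U V W :: "('p, 'k, 'h, 'b) rep"
  assumes r: "is_rep U" "is_rep V" "is_rep W"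
  obtains g where "Assoc Rep U V W \<in> isos Rep (rep_tensor (rep_tensor U V) W) (rep_tensor U (rep_tensor V W))"
    "inv_arrow Rep (Assoc Rep U V W) = Arrow (rep_tensor U (rep_tensor V W)) (rep_tensor (rep_tensor U V) W) g"
    "is_rep_map (rep_tensor U (rep_tensor V W)) (rep_tensor (rep_tensor U V) W) g"
    "\<And>u v w. \<lbrakk>u \<in> elts U; v \<in> elts V; w \<in> elts W\<rbrakk> \<Longrightarrow>
      g (pure\<^sub>u K (space U) (tensor\<^sub>r V W) u (pure\<^sub>r V W v w)) =
      pure\<^sub>u K (tensor\<^sub>r U V) (space W) (pure\<^sub>r U V u v) w"
proof -
  note m = repD(2)[OF r(1)] repD(2)[OF r(2)] repD(2)[OF r(3)]
  obtain g where g: "linear_map K (tensor\<^sub>u K (space U) (tensor\<^sub>r V W)) (tensor\<^sub>u K (tensor\<^sub>r U V) (space W)) g"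
    "\<And>u v w. \<lbrakk>u \<in> elts U; v \<in> elts V; w \<in> elts W\<rbrakk> \<Longrightarrow>
      g (pure\<^sub>u K (space U) (tensor\<^sub>r V W) u (pure\<^sub>r V W v w)) =
      pure\<^sub>u K (tensor\<^sub>r U V) (space W) (pure\<^sub>r U V u v) w"
    "\<And>x. x \<in> carrier (tensor\<^sub>u K (tensor\<^sub>r U V) (space W)) \<Longrightarrow> g (assoc_map (space U) (space V) (space W) x) = x"
    "\<And>x. x \<in> carrier (tensor\<^sub>u K (space U) (tensor\<^sub>r V W)) \<Longrightarrow> assoc_map (space U) (space V) (space W) (g x) = x"
    using assoc_map_inverse[OF m] by blast
  note i = Rep_isoI[OF rep_tensor_closed[OF rep_tensor_closed[OF r(1,2)] r(3)] rep_tensor_closed[OF r(1) rep_tensor_closed[OF r(2,3)]]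
    rep_map_assoc[OF r], of g]
  note p = pure\<^sub>u_closed[OF m(1) tensor\<^sub>u_module[OF m(2,3)]] pure\<^sub>u_closed[OF m(2,3)]
  show thesis
  proof (rule that)
    let ?g = "restrict g (carrier (tensor\<^sub>u K (space U) (tensor\<^sub>r V W)))"
    show "Assoc Rep U V W \<in> isos Rep (rep_tensor (rep_tensor U V) W) (rep_tensor U (rep_tensor V W))"
      "inv_arrow Rep (Assoc Rep U V W) = Arrow (rep_tensor U (rep_tensor V W)) (rep_tensor (rep_tensor U V) W) ?g"
      "is_rep_map (rep_tensor U (rep_tensor V W)) (rep_tensor (rep_tensor U V) W) ?g"
      using i g(3,4) linear_mapD(1)[OF g(1)] by simp_all
    show "?g (pure\<^sub>u K (space U) (tensor\<^sub>r V W) u (pure\<^sub>r V W v w)) =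
      pure\<^sub>u K (tensor\<^sub>r U V) (space W) (pure\<^sub>r U V u v) w"
      if "u \<in> elts U" "v \<in> elts V" "w \<in> elts W" for u v w
      using g(2)[OF that] p(1)[OF that(1) p(2)[OF that(2,3)]] by simp
  qed
qed

text \<open>Bodies of arrows are extensional linear maps, so the tensor category axioms become
  identities that are tested on pure tensors of up to four factors. The axioms of conjugation rest
  on the strict equalities of representations above.\<close>

theorem Rep_T_category: "T_category \<pi> (Rep :: ('p, ('p, 'k, 'h, 'b) rep, ('p, 'k, 'h, 'b) rep_arrow) T_category)"
proof -
  let ?R = "Rep :: ('p, ('p, 'k, 'h, 'b) rep, ('p, 'k, 'h, 'b) rep_arrow) T_category"
  interpret category ?R by (rule Rep_category)
  have arr_eqI: "Arrow U V f = Arrow U V g"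
    if "f \<in> extensional A" "g \<in> extensional A" "\<And>x. x \<in> A \<Longrightarrow> f x = g x" for U V :: "('p, 'k, 'h, 'b) rep" and f g :: "('k, 'h, 'b) univ \<Rightarrow> ('k, 'h, 'b) univ" and A
    using extensionalityI[OF that] by simp
  show ?thesis
  proof
    fix f g :: "('p, 'k, 'h, 'b) rep_arrow" and U U' V V'
    assume "f \<in> arrows Rep U U'" "g \<in> arrows Rep V V'"
    then show "TenA Rep f g \<in> arrows Rep (TenO Rep U V) (TenO Rep U' V')"
      by (auto simp: arrows_Rep intro!: rep_tensor_closed rep_map_tensor)
  next
    fix U V :: "('p, 'k, 'h, 'b) rep" assume "U \<in> Obj Rep" "V \<in> Obj Rep"
    then have r: "is_rep U" "is_rep V" by simp_all
    note m = repD(2)[OF r(1)] repD(2)[OF r(2)]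
    note t = map_tensor[OF m m rep_mapD(3)[OF rep_map_id[OF r(1)]] rep_mapD(3)[OF rep_map_id[OF r(2)]]]
    have "map_tensor (space U) (space V) (space U) (space V) (\<lambda>u\<in>carrier (space U). u) (\<lambda>u\<in>carrier (space V). u) x = x"
      if "x \<in> carrier (tensor\<^sub>r U V)" for x
      by (rule tensor\<^sub>u_ext[OF m tensor\<^sub>u_module[OF m] t(1) linear_map_id _ that]) (simp add: t(3))
    then show "TenA Rep (Ident Rep U) (Ident Rep V) = Ident Rep (TenO Rep U V)"
      using t(2) by (simp, intro extensionalityI[where A = "carrier (tensor\<^sub>r U V)"]) simp_all
  next
    fix f f' g g' :: "('p, 'k, 'h, 'b) rep_arrow" and U U' U'' V V' V''
    assume "f \<in> arrows Rep U U'" "f' \<in> arrows Rep U' U''" "g \<in> arrows Rep V V'" "g' \<in> arrows Rep V' V''"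
    then obtain a a' b b' where e: "f = Arrow U U' a" "f' = Arrow U' U'' a'" "g = Arrow V V' b" "g' = Arrow V' V'' b'"
      and r: "is_rep U" "is_rep U'" "is_rep U''" "is_rep V" "is_rep V'" "is_rep V''"
      and M: "is_rep_map U U' a" "is_rep_map U' U'' a'" "is_rep_map V V' b" "is_rep_map V' V'' b'"
      by (auto simp: arrows_Rep)
    note m = r[THEN repD(2)]
    note t1 = map_tensor[OF m(1,4,2,5) M(1)[THEN rep_mapD(3)] M(3)[THEN rep_mapD(3)]]
    note t2 = map_tensor[OF m(2,5,3,6) M(2)[THEN rep_mapD(3)] M(4)[THEN rep_mapD(3)]]
    note t3 = map_tensor[OF m(1,4,3,6) rep_map_compose[OF r(1) M(1,2), THEN rep_mapD(3)] rep_map_compose[OF r(4) M(3,4), THEN rep_mapD(3)]]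
    have "map_tensor (space U) (space V) (space U'') (space V'') (compose (elts U) a' a) (compose (elts V) b' b) x =
      map_tensor (space U') (space V') (space U'') (space V'') a' b' (map_tensor (space U) (space V) (space U') (space V') a b x)"
      if "x \<in> carrier (tensor\<^sub>r U V)" for x
      by (rule tensor\<^sub>u_ext[OF m(1,4) tensor\<^sub>u_module[OF m(3,6)] t3(1) linear_map_comp[OF t1(1) t2(1)] _ that])
        (simp add: t1(3) t2(3) t3(3) compose_eq rep_mapD(5)[OF M(1)] rep_mapD(5)[OF M(3)])
    then show "TenA Rep (Comp Rep f' f) (Comp Rep g' g) = Comp Rep (TenA Rep f' g') (TenA Rep f g)"
      using t3(2) by (simp add: e, intro extensionalityI[where A = "carrier (tensor\<^sub>r U V)"]) (simp_all add: compose_eq)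
  next
    fix U V W :: "('p, 'k, 'h, 'b) rep" assume "U \<in> Obj Rep" "V \<in> Obj Rep" "W \<in> Obj Rep"
    then show "Assoc Rep U V W \<in> isos Rep (TenO Rep (TenO Rep U V) W) (TenO Rep U (TenO Rep V W))"
      using Rep_Assoc_iso[of U V W] by simp blast
  next
    fix f g h :: "('p, 'k, 'h, 'b) rep_arrow" and U U' V V' W W'
    assume "f \<in> arrows Rep U U'" "g \<in> arrows Rep V V'" "h \<in> arrows Rep W W'"
    then obtain a b c where e: "f = Arrow U U' a" "g = Arrow V V' b" "h = Arrow W W' c"
      and r: "is_rep U" "is_rep U'" "is_rep V" "is_rep V'" "is_rep W" "is_rep W'"
      and M: "is_rep_map U U' a" "is_rep_map V V' b" "is_rep_map W W' c"
      by (auto simp: arrows_Rep)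
    note m = r[THEN repD(2)] note M3 = M[THEN rep_mapD(3)]
    note mm = tensor\<^sub>u_module[OF m(3,5)] tensor\<^sub>u_module[OF m(4,6)] tensor\<^sub>u_module[OF m(1,3)] tensor\<^sub>u_module[OF m(2,4)]
    note s1 = map_tensor[OF m(3,5,4,6) M3(2,3)] note s2 = map_tensor[OF m(1) mm(1) m(2) mm(2) M3(1) s1(1)]
    note t1 = map_tensor[OF m(1,3,2,4) M3(1,2)] note t2 = map_tensor[OF mm(3) m(5) mm(4) m(6) t1(1) M3(3)]
    note A = assoc_map[OF m(1,3,5)] and A' = assoc_map[OF m(2,4,6)]
    have "map_tensor (space U) (tensor\<^sub>r V W) (space U') (tensor\<^sub>r V' W') a (map_tensor (space V) (space W) (space V') (space W') b c)
        (assoc_map (space U) (space V) (space W) x) =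
      assoc_map (space U') (space V') (space W') (map_tensor (tensor\<^sub>r U V) (space W) (tensor\<^sub>r U' V') (space W')
        (map_tensor (space U) (space V) (space U') (space V') a b) c x)" if "x \<in> carrier (tensor\<^sub>u K (tensor\<^sub>r U V) (space W))" for x
      by (rule tensor\<^sub>u_ext3[OF m(1,3,5) tensor\<^sub>u_module[OF m(2) mm(2)] linear_map_comp[OF A(1) s2(1)] linear_map_comp[OF t2(1) A'(1)] _ that])
        (simp add: A(3) A'(3) s1(3) s2(3) t1(3) t2(3) pure\<^sub>u_closed m rep_mapD(5)[OF M(1)] rep_mapD(5)[OF M(2)] rep_mapD(5)[OF M(3)])
    then show "Comp Rep (TenA Rep f (TenA Rep g h)) (Assoc Rep U V W) = Comp Rep (Assoc Rep U' V' W') (TenA Rep (TenA Rep f g) h)"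
      by (simp add: e, intro extensionalityI[where A = "carrier (tensor\<^sub>u K (tensor\<^sub>r U V) (space W))"]) (simp_all add: compose_eq)
  next
    fix U :: "('p, 'k, 'h, 'b) rep" assume "U \<in> Obj Rep"
    then have r: "is_rep U" by simp
    note m = repD(2)[OF r]
    have one: "Scal \<one>\<^bsub>K\<^esub> \<in> carrier Sc" by (simp add: scal_simps(1))
    show "LUnit Rep U \<in> isos Rep (TenO Rep (Unit Rep) U) U"
      using Rep_isoI(1)[OF rep_tensor_closed[OF rep_unit_closed r] r rep_map_lunit[OF r], of "pure\<^sub>u K Sc (space U) (Scal \<one>\<^bsub>K\<^esub>)"]
        unit_map_inverse[OF m] pure\<^sub>u_closed[OF scal_simps(2) m one] by simp
    show "RUnit Rep U \<in> isos Rep (TenO Rep U (Unit Rep)) U"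
      using Rep_isoI(1)[OF rep_tensor_closed[OF r rep_unit_closed] r rep_map_runit[OF r], of "\<lambda>u. pure\<^sub>u K (space U) Sc u (Scal \<one>\<^bsub>K\<^esub>)"]
        unit_map_inverse[OF m] pure\<^sub>u_closed[OF m scal_simps(2) _ one] by simp
  next
    fix f :: "('p, 'k, 'h, 'b) rep_arrow" and U V assume "f \<in> arrows Rep U V"
    then obtain a where e: "f = Arrow U V a" and r: "is_rep U" "is_rep V" and M: "is_rep_map U V a" by (auto simp: arrows_Rep)
    note m = r[THEN repD(2)]
    have id: "linear_map K Sc Sc (\<lambda>u\<in>carrier Sc. u)"
      by (rule linear_map_cong[OF linear_map_id scal_simps(2)]) simp
    note L = lunit_map[OF m(1)] lunit_map[OF m(2)] note R = runit_map[OF m(1)] runit_map[OF m(2)]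
    note t = map_tensor[OF scal_simps(2) m(1) scal_simps(2) m(2) id rep_mapD(3)[OF M]]
    note t' = map_tensor[OF m(1) scal_simps(2) m(2) scal_simps(2) rep_mapD(3)[OF M] id]
    have "a (lunit_map (space U) x) = lunit_map (space V) (map_tensor Sc (space U) Sc (space V) (\<lambda>u\<in>carrier Sc. u) a x)"
      if "x \<in> carrier (tensor\<^sub>u K Sc (space U))" for x
    proof (rule tensor\<^sub>u_ext[OF scal_simps(2) m linear_map_comp[OF L(1) rep_mapD(3)[OF M]] linear_map_comp[OF t(1) L(4)] _ that])
      fix k :: "('k, 'h, 'b) univ" and w assume k: "k \<in> carrier Sc" and w: "w \<in> elts U"
      then obtain c where c: "k = Scal c" "c \<in> carrier K" by (auto simp: scal_simps(1))
      have "map_tensor Sc (space U) Sc (space V) (\<lambda>u\<in>carrier Sc. u) a (pure\<^sub>u K Sc (space U) k w) = pure\<^sub>u K Sc (space V) k (a w)"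
        using t(3)[of k w] k w by simp
      then show "a (lunit_map (space U) (pure\<^sub>u K Sc (space U) k w)) = lunit_map (space V) (map_tensor Sc (space U) Sc (space V) (\<lambda>u\<in>carrier Sc. u) a (pure\<^sub>u K Sc (space U) k w))"
        using c w by (simp add: L(3) L(6) rep_mapD(5)[OF M] linear_mapD(3)[OF rep_mapD(3)[OF M]])
    qed
    then show "Comp Rep f (LUnit Rep U) = Comp Rep (LUnit Rep V) (TenA Rep (Ident Rep (Unit Rep)) f)"
      by (simp add: e, intro extensionalityI[where A = "carrier (tensor\<^sub>u K Sc (space U))"]) (simp_all add: compose_eq)
    have "a (runit_map (space U) x) = runit_map (space V) (map_tensor (space U) Sc (space V) Sc a (\<lambda>u\<in>carrier Sc. u) x)"
      if "x \<in> carrier (tensor\<^sub>u K (space U) Sc)" for x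
    proof (rule tensor\<^sub>u_ext[OF m(1) scal_simps(2) m(2) linear_map_comp[OF R(1) rep_mapD(3)[OF M]] linear_map_comp[OF t'(1) R(4)] _ that])
      fix k :: "('k, 'h, 'b) univ" and w assume k: "k \<in> carrier Sc" and w: "w \<in> elts U"
      then obtain c where c: "k = Scal c" "c \<in> carrier K" by (auto simp: scal_simps(1))
      have "map_tensor (space U) Sc (space V) Sc a (\<lambda>u\<in>carrier Sc. u) (pure\<^sub>u K (space U) Sc w k) = pure\<^sub>u K (space V) Sc (a w) k"
        using t'(3)[of w k] k w by simp
      then show "a (runit_map (space U) (pure\<^sub>u K (space U) Sc w k)) = runit_map (space V) (map_tensor (space U) Sc (space V) Sc a (\<lambda>u\<in>carrier Sc. u) (pure\<^sub>u K (space U) Sc w k))"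
        using c w by (simp add: R(3) R(6) rep_mapD(5)[OF M] linear_mapD(3)[OF rep_mapD(3)[OF M]])
    qed
    then show "Comp Rep f (RUnit Rep U) = Comp Rep (RUnit Rep V) (TenA Rep f (Ident Rep (Unit Rep)))"
      by (simp add: e, intro extensionalityI[where A = "carrier (tensor\<^sub>u K (space U) Sc)"]) (simp_all add: compose_eq)
  next
    fix U V W X :: "('p, 'k, 'h, 'b) rep" assume "U \<in> Obj Rep" "V \<in> Obj Rep" "W \<in> Obj Rep" "X \<in> Obj Rep"
    then have r: "is_rep U" "is_rep V" "is_rep W" "is_rep X" by simp_all
    note m = r[THEN repD(2)]
    note UV = tensor\<^sub>u_module[OF m(1,2)] and VW = tensor\<^sub>u_module[OF m(2,3)] and WX = tensor\<^sub>u_module[OF m(3,4)]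
    note VW_X = tensor\<^sub>u_module[OF VW m(4)] and V_WX = tensor\<^sub>u_module[OF m(2) WX]
      and U_VW = tensor\<^sub>u_module[OF m(1) VW] and UV_W = tensor\<^sub>u_module[OF UV m(3)]
    note a1 = assoc_map[OF UV m(3,4)] and a2 = assoc_map[OF m(1,2) WX] and b1 = assoc_map[OF m(1-3)] and b2 = assoc_map[OF m(1) VW m(4)]
      and b3 = assoc_map[OF m(2-4)]
    have idU: "linear_map K (space U) (space U) (\<lambda>u\<in>carrier (space U). u)" and idX: "linear_map K (space X) (space X) (\<lambda>u\<in>carrier (space X). u)"
      using rep_map_id[OF r(1)] rep_map_id[OF r(4)] rep_mapD(3) by blast+
    note t1 = map_tensor[OF UV_W m(4) U_VW m(4) b1(1) idX] and t2 = map_tensor[OF m(1) VW_X m(1) V_WX idU b3(1)]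
    let ?l = "\<lambda>x. assoc_map (space U) (space V) (tensor\<^sub>r W X) (assoc_map (tensor\<^sub>r U V) (space W) (space X) x)"
    let ?r = "\<lambda>x. map_tensor (space U) (tensor\<^sub>u K (tensor\<^sub>r V W) (space X)) (space U) (tensor\<^sub>u K (space V) (tensor\<^sub>r W X))
      (\<lambda>u\<in>carrier (space U). u) (assoc_map (space V) (space W) (space X)) (assoc_map (space U) (tensor\<^sub>r V W) (space X)
       (map_tensor (tensor\<^sub>u K (tensor\<^sub>r U V) (space W)) (space X) (tensor\<^sub>u K (space U) (tensor\<^sub>r V W)) (space X)
       (assoc_map (space U) (space V) (space W)) (\<lambda>u\<in>carrier (space X). u) x))"
    have "?l x = ?r x" if "x \<in> carrier (tensor\<^sub>u K (tensor\<^sub>u K (tensor\<^sub>r U V) (space W)) (space X))" for x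
      by (rule tensor\<^sub>u_ext4[OF m tensor\<^sub>u_module[OF m(1) V_WX] linear_map_comp[OF a1(1) a2(1)] linear_map_comp[OF linear_map_comp[OF t1(1) b2(1)] t2(1)] _ that])
        (simp add: a1(3) a2(3) b1(3) b2(3) b3(3) t1(3) t2(3) pure\<^sub>u_closed m UV VW WX VW_X UV_W)
    moreover have "map_tensor (tensor\<^sub>u K (tensor\<^sub>r U V) (space W)) (space X) (tensor\<^sub>u K (space U) (tensor\<^sub>r V W)) (space X)
       (assoc_map (space U) (space V) (space W)) (\<lambda>u\<in>carrier (space X). u) x \<in> carrier (tensor\<^sub>u K (tensor\<^sub>u K (space U) (tensor\<^sub>r V W)) (space X))"
      if "x \<in> carrier (tensor\<^sub>u K (tensor\<^sub>u K (tensor\<^sub>r U V) (space W)) (space X))" for x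
      by (rule linear_mapD(1)[OF t1(1) that])
    ultimately show "Comp Rep (Assoc Rep U V (TenO Rep W X)) (Assoc Rep (TenO Rep U V) W X) =
       Comp Rep (Comp Rep (TenA Rep (Ident Rep U) (Assoc Rep V W X)) (Assoc Rep U (TenO Rep V W) X)) (TenA Rep (Assoc Rep U V W) (Ident Rep X))"
      by (simp, intro extensionalityI[where A = "carrier (tensor\<^sub>u K (tensor\<^sub>u K (tensor\<^sub>r U V) (space W)) (space X))"]) (simp_all add: compose_eq)
  next
    fix U V :: "('p, 'k, 'h, 'b) rep" assume "U \<in> Obj Rep" "V \<in> Obj Rep"
    then have r: "is_rep U" "is_rep V" by simp_all
    note m = r[THEN repD(2)]
    note UI = tensor\<^sub>u_module[OF m(1) scal_simps(2)] and IV = tensor\<^sub>u_module[OF scal_simps(2) m(2)]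
    note idU = rep_mapD(3)[OF rep_map_id[OF r(1)]] and idV = rep_mapD(3)[OF rep_map_id[OF r(2)]]
    note L = lunit_map[OF m(2)] and R = runit_map[OF m(1)] and A = assoc_map[OF m(1) scal_simps(2) m(2)]
    note t1 = map_tensor[OF m(1) IV m(1,2) idU L(1)] and t2 = map_tensor[OF UI m(2) m(1,2) R(1) idV]
    note p = pure\<^sub>u_bilinear[OF m]
    \<comment> \<open>The triangle axiom amounts to passing a scalar from one tensor factor to the
      other.\<close>
    have sm: "pure\<^sub>r U V u (c \<odot>\<^bsub>space V\<^esub> v) = pure\<^sub>r U V (c \<odot>\<^bsub>space U\<^esub> u) v"
      "c \<odot>\<^bsub>space V\<^esub> v \<in> elts V" "c \<odot>\<^bsub>space U\<^esub> u \<in> elts U"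
      if "u \<in> elts U" "v \<in> elts V" "c \<in> carrier K" for u v c
      using linear_mapD(3)[OF bilinear_mapD(1)[OF p that(1)] that(3,2)] linear_mapD(3)[OF bilinear_mapD(2)[OF p that(2)] that(3,1)]
        module.smult_closed[OF m(1) that(3,1)] module.smult_closed[OF m(2) that(3,2)] by simp_all
    have "map_tensor (space U) (tensor\<^sub>u K Sc (space V)) (space U) (space V) (\<lambda>u\<in>carrier (space U). u) (lunit_map (space V)) (assoc_map (space U) Sc (space V) x) =
      map_tensor (tensor\<^sub>u K (space U) Sc) (space V) (space U) (space V) (runit_map (space U)) (\<lambda>u\<in>carrier (space V). u) x"
      if "x \<in> carrier (tensor\<^sub>u K (tensor\<^sub>u K (space U) Sc) (space V))" for x
      by (rule tensor\<^sub>u_ext3[OF m(1) scal_simps(2) m(2) tensor\<^sub>u_module[OF m] linear_map_comp[OF A(1) t1(1)] t2(1) _ that])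
        (auto simp: A(3) t1(3) t2(3) L(3) R(3) pure\<^sub>u_closed m scal_simps(1,2) UI IV sm)
    then show "Comp Rep (TenA Rep (Ident Rep U) (LUnit Rep V)) (Assoc Rep U (Unit Rep) V) = TenA Rep (RUnit Rep U) (Ident Rep V)"
      using t2(2) by (simp, intro extensionalityI[where A = "carrier (tensor\<^sub>u K (tensor\<^sub>u K (space U) Sc) (space V))"]) (simp_all add: compose_eq)
  next
    fix f :: "('p, 'k, 'h, 'b) rep_arrow" assume "f \<in> Arr Rep"
    then show "Grade Rep (Dom Rep f) = Grade Rep (Cod Rep f)" by (auto dest: rep_mapD(1))
  next
    fix \<beta> assume "\<beta> \<in> carrier \<pi>"
    then show "is_functor ?R ?R (ConjO Rep \<beta>) (ConjA Rep \<beta>)"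
      by (auto simp: is_functor_def arrows_Rep intro!: rep_conj_closed rep_map_conj)
  next
    fix \<beta> \<alpha> assume b: "\<beta> \<in> carrier \<pi>" "\<alpha> \<in> carrier \<pi>"
    show "ConjO Rep \<beta> ` component ?R \<alpha> = component ?R (conjg \<pi> \<beta> \<alpha>)"
    proof (intro subset_antisym subsetI)
      fix U assume "U \<in> ConjO Rep \<beta> ` component ?R \<alpha>"
      then show "U \<in> component ?R (conjg \<pi> \<beta> \<alpha>)" using b by (auto simp: component_def rep_conj_closed)
    next
      fix U assume U: "U \<in> component ?R (conjg \<pi> \<beta> \<alpha>)"
      then have "U = rep_conj \<beta> (rep_conj (inv \<beta>) U)"
        using b by (simp add: component_def rep_conj_mult[symmetric] rep_conj_one)
      moreover have "rep_conj (inv \<beta>) U \<in> component ?R \<alpha>" using U b by (simp add: component_def rep_conj_closed)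
      ultimately show "U \<in> ConjO Rep \<beta> ` component ?R \<alpha>" by auto
    qed
  qed (auto simp: rep_tensor_closed rep_unit_closed rep_conj_tensor rep_conj_unit rep_conj_one rep_conj_mult)
qed

section \<open>Coactions as maps between tensor products of representations\<close>

text \<open>Lets the algebra factor of an element \<open>t\<close> act on \<open>x\<close>. With
  \<open>t\<close> the coaction of \<open>v\<close> this is the value of \<open>e_map\<close> on a
  pure tensor; with \<open>t\<close> arbitrary it can be treated by linearity in
  \<open>t\<close>.\<close>

definition coact_ap :: "('p, 'k, 'h, 'b) rep \<Rightarrow> ('p, 'k, 'h, 'b) rep \<Rightarrow> (('k, 'h, 'b) univ \<times> 'h) list \<Rightarrow>
    ('k, 'h, 'b) univ \<Rightarrow> ('k, 'h, 'b) univ" where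
  "coact_ap V X t x = sweedler (tensor\<^sub>r V X) (\<lambda>u a. pure\<^sub>r V X u (act X a x)) t"

lemma coact_ap:
  assumes V: "module K (space V)" and X: "is_rep X"
  shows "bilinear_map K (tensor\<^sub>c V (deg X)) (space X) (tensor\<^sub>r V X) (coact_ap V X)"
    "\<lbrakk>u \<in> elts V; a \<in> coeffs (deg X); x \<in> elts X\<rbrakk> \<Longrightarrow>
      coact_ap V X (pure\<^sub>c V (deg X) u a) x = pure\<^sub>r V X u (act X a x)"
proof -
  note m = V repD(2)[OF X] and A = alg_module[OF repD(1)[OF X]]
  have b: "bilinear_map K (space V) (alg H (deg X)) (tensor\<^sub>r V X) (\<lambda>u a. pure\<^sub>r V X u (act X a x))"
    if "x \<in> elts X" for x
    by (intro lin) (simp_all add: that m X repD(7)[OF X])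
  have l: "linear_map K (space X) (tensor\<^sub>r V X) (\<lambda>x. pure\<^sub>r V X u (act X a x))"
    if "u \<in> elts V" "a \<in> coeffs (deg X)" for u a
    by (intro lin) (simp_all add: that m X)
  show "bilinear_map K (tensor\<^sub>c V (deg X)) (space X) (tensor\<^sub>r V X) (coact_ap V X)"
    unfolding coact_ap_def
    by (intro bilinear_mapI sweedler_param_linear[OF V A tensor\<^sub>u_module[OF m] m(2)] sweedler_linear[OF V A tensor\<^sub>u_module[OF m] b] l)
  show "\<lbrakk>u \<in> elts V; a \<in> coeffs (deg X); x \<in> elts X\<rbrakk> \<Longrightarrow>
      coact_ap V X (pure\<^sub>c V (deg X) u a) x = pure\<^sub>r V X u (act X a x)"
    unfolding coact_ap_def by (rule sweedler_pure[OF V A tensor\<^sub>u_module[OF m] b])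
qed

definition e_map :: "('p, 'k, 'h, 'b) rep \<Rightarrow> ('p, 'k, 'h, 'b) coaction \<Rightarrow> ('p, 'k, 'h, 'b) rep \<Rightarrow>
    ('k, 'h, 'b) univ \<Rightarrow> ('k, 'h, 'b) univ" where
  "e_map V \<Delta> X = (\<lambda>t\<in>carrier (tensor\<^sub>r X V). sweedler\<^sub>u (tensor\<^sub>r V X)
     (\<lambda>x v. coact_ap V X (\<Delta> (deg X) v) x) t)"

text \<open>Only linearity is demanded, because a half braiding yields its coaction before any axiom
  of a Yetter-Drinfeld module is known; the axioms are then read off from
  \<open>e_map\<close>.\<close>

definition pre_coaction :: "('p, 'k, 'h, 'b) rep \<Rightarrow> ('p, 'k, 'h, 'b) coaction \<Rightarrow> bool" where
  "pre_coaction V \<Delta> \<longleftrightarrow> is_rep V \<and>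
     (\<forall>\<mu>\<in>carrier \<pi>. linear_map K (space V) (tensor\<^sub>c V \<mu>) (\<Delta> \<mu>))"

lemma pre_coactionD:
  assumes "pre_coaction V \<Delta>"
  shows "is_rep V" "\<mu> \<in> carrier \<pi> \<Longrightarrow> linear_map K (space V) (tensor\<^sub>c V \<mu>) (\<Delta> \<mu>)"
    "\<mu> \<in> carrier \<pi> \<Longrightarrow> v \<in> elts V \<Longrightarrow> \<Delta> \<mu> v \<in> carrier (tensor\<^sub>c V \<mu>)"
  using assms by (auto simp: pre_coaction_def dest: linear_mapD(1))

lemma e_map:
  assumes D: "pre_coaction V \<Delta>" and X: "is_rep X"
  shows "linear_map K (tensor\<^sub>r X V) (tensor\<^sub>r V X) (e_map V \<Delta> X)"
    "e_map V \<Delta> X \<in> extensional (carrier (tensor\<^sub>r X V))"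
    "\<lbrakk>x \<in> elts X; v \<in> elts V\<rbrakk> \<Longrightarrow>
      e_map V \<Delta> X (pure\<^sub>r X V x v) = coact_ap V X (\<Delta> (deg X) v) x"
proof -
  note V = pre_coactionD(1)[OF D] note m = repD(2)[OF V] repD(2)[OF X] note d = repD(1)[OF X]
  have b: "bilinear_map K (space X) (space V) (tensor\<^sub>r V X) (\<lambda>x v. coact_ap V X (\<Delta> (deg X) v) x)"
    by (intro bilinear_mapI bilinear_mapD[OF coact_ap(1)[OF m(1) X]] pre_coactionD(3)[OF D d]
        linear_map_comp[OF pre_coactionD(2)[OF D d]])
  note S = tensor\<^sub>u_module[OF m]
  show "linear_map K (tensor\<^sub>r X V) (tensor\<^sub>r V X) (e_map V \<Delta> X)"
    by (rule linear_map_cong[OF sweedler\<^sub>u_linear[OF m(2,1) S b] tensor\<^sub>u_module[OF m(2,1)]]) (simp add: e_map_def)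
  show "e_map V \<Delta> X \<in> extensional (carrier (tensor\<^sub>r X V))" by (simp add: e_map_def)
  show "\<lbrakk>x \<in> elts X; v \<in> elts V\<rbrakk> \<Longrightarrow>
      e_map V \<Delta> X (pure\<^sub>r X V x v) = coact_ap V X (\<Delta> (deg X) v) x"
    by (simp add: e_map_def pure\<^sub>u_closed[OF m(2,1)] sweedler\<^sub>u_pure\<^sub>u[OF m(2,1) S b])
qed

text \<open>The sides of compatibility and of coassociativity get names, since each side by itself
  is matched with a value of a map built from \<open>e_map\<close>.\<close>

definition yd_lhs where
  "yd_lhs V \<Delta> \<mu> h v = sweedler (tensor\<^sub>c V \<mu>) (\<lambda>h' h''. sweedler (tensor\<^sub>c V \<mu>) (\<lambda>u x.
            pure\<^sub>c V \<mu> (act V h' u) (h'' \<otimes>\<^bsub>alg H \<mu>\<^esub> x)) (\<Delta> \<mu> v))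
          (comult H (deg V) \<mu> h)"

definition yd_rhs where
  "yd_rhs V \<Delta> \<mu> h v = sweedler (tensor\<^sub>c V \<mu>) (\<lambda>h' h''. sweedler (tensor\<^sub>c V \<mu>) (\<lambda>u x.
            pure\<^sub>c V \<mu> u
              (x \<otimes>\<^bsub>alg H \<mu>\<^esub> twist H (inv (deg V)) (conjg \<pi> (deg V) \<mu>) h')) (\<Delta> \<mu> (act V h'' v)))
          (comult H (conjg \<pi> (deg V) \<mu>) (deg V) h)"

definition coassoc_lhs where
  "coassoc_lhs V \<Delta> \<mu> \<nu> v = sweedler (tensor K (space V) (tensor\<^sub>H \<mu> \<nu>))
     (\<lambda>u z. pure K (space V) (tensor\<^sub>H \<mu> \<nu>) u (comult H \<mu> \<nu> z)) (\<Delta> (\<mu> \<otimes> \<nu>) v)"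

definition coassoc_rhs where
  "coassoc_rhs V \<Delta> \<mu> \<nu> v = sweedler (tensor K (space V) (tensor\<^sub>H \<mu> \<nu>)) (\<lambda>w y.
      sweedler (tensor K (space V) (tensor\<^sub>H \<mu> \<nu>)) (\<lambda>u x.
            pure K (space V) (tensor\<^sub>H \<mu> \<nu>) u (pure\<^sub>H \<mu> \<nu> x y)) (\<Delta> \<mu> w)) (\<Delta> \<nu> v)"

lemma is_yd_iff:
  "is_yd (V, \<Delta>) \<longleftrightarrow> pre_coaction V \<Delta> \<and> \<Delta> \<in> extensional (carrier \<pi>) \<and>
     (\<forall>\<mu>\<in>carrier \<pi>. \<Delta> \<mu> \<in> extensional (elts V)) \<and>
     (\<forall>\<mu>\<in>carrier \<pi>. \<forall>\<nu>\<in>carrier \<pi>. \<forall>v\<in>carrier (space V). coassoc_lhs V \<Delta> \<mu> \<nu> v = coassoc_rhs V \<Delta> \<mu> \<nu> v) \<and>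
     (\<forall>v\<in>carrier (space V). sweedler (space V) (\<lambda>u x. counit H x \<odot>\<^bsub>space V\<^esub> u) (\<Delta> \<one> v) = v) \<and>
     (\<forall>\<mu>\<in>carrier \<pi>. \<forall>h\<in>carrier (alg H (deg V \<otimes> \<mu>)). \<forall>v\<in>carrier (space V). yd_lhs V \<Delta> \<mu> h v = yd_rhs V \<Delta> \<mu> h v)"
  unfolding is_yd_def pre_coaction_def coassoc_lhs_def coassoc_rhs_def yd_lhs_def yd_rhs_def Let_def prod.case by blast

text \<open>The map induced by \<open>B\<close> is pushed through the nested sums. This brings
  coassociativity into the form in which it meets the actions on two representations, the antipode
  and the counit.\<close>

lemma coassoc_lift:
  assumes D: "pre_coaction V \<Delta>" and M: "module K M" and \<mu>: "\<mu> \<in> carrier \<pi>" and \<nu>: "\<nu> \<in> carrier \<pi>"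
    and B: "bilinear_map K (space V) (tensor\<^sub>H \<mu> \<nu>) M B" and v: "v \<in> elts V"
  defines "\<Phi> \<equiv> sweedler M B"
  shows "\<Phi> (coassoc_lhs V \<Delta> \<mu> \<nu> v) = sweedler M (\<lambda>u z. B u (comult H \<mu> \<nu> z)) (\<Delta> (\<mu> \<otimes> \<nu>) v)"
    "\<Phi> (coassoc_rhs V \<Delta> \<mu> \<nu> v) = sweedler M (\<lambda>w y. sweedler M (\<lambda>u x. B u (pure\<^sub>H \<mu> \<nu> x y)) (\<Delta> \<mu> w)) (\<Delta> \<nu> v)"
    "coassoc_lhs V \<Delta> \<mu> \<nu> v \<in> carrier (tensor K (space V) (tensor\<^sub>H \<mu> \<nu>))"
    "coassoc_rhs V \<Delta> \<mu> \<nu> v \<in> carrier (tensor K (space V) (tensor\<^sub>H \<mu> \<nu>))"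
proof -
  note V = repD(2)[OF pre_coactionD(1)[OF D]] and A = alg_module[OF \<mu>] alg_module[OF \<nu>]
  have \<mu>\<nu>: "\<mu> \<otimes> \<nu> \<in> carrier \<pi>" using \<mu> \<nu> by simp
  note A' = alg_module[OF \<mu>\<nu>]
  let ?P = "tensor\<^sub>H \<mu> \<nu>" note P = tensor_module[OF A]
  note T = tensor_module[OF V P]
  note d = pre_coactionD(3)[OF D]
  have \<Phi>: "linear_map K (tensor K (space V) ?P) M \<Phi>" unfolding \<Phi>_def by (rule sweedler_linear[OF V P M B])
  have \<Phi>_pure: "\<Phi> (pure K (space V) ?P u p) = B u p" if "u \<in> elts V" "p \<in> carrier ?P" for u p
    unfolding \<Phi>_def by (rule sweedler_pure[OF V P M B that])
  note p = pure_closed[OF V P] and q = pure_closed[OF A]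
  show "\<Phi> (coassoc_lhs V \<Delta> \<mu> \<nu> v) = sweedler M (\<lambda>u z. B u (comult H \<mu> \<nu> z)) (\<Delta> (\<mu> \<otimes> \<nu>) v)"
    unfolding coassoc_lhs_def
    by (subst linear_map_sweedler[OF V A' T M \<Phi> d[OF \<mu>\<nu> v]])
      (use \<mu> \<nu> in \<open>auto intro!: sweedler_cong[OF V A' M d[OF \<mu>\<nu> v]] simp: \<Phi>_pure p\<close>)
  have c: "sweedler (tensor K (space V) ?P) (\<lambda>u x. pure K (space V) ?P u (pure\<^sub>H \<mu> \<nu> x y)) (\<Delta> \<mu> w) \<in> carrier (tensor K (space V) ?P)"
    if "w \<in> elts V" "y \<in> coeffs \<nu>" for w y
    by (rule sweedler_closed[OF V A(1) T d[OF \<mu> that(1)]]) (use that in \<open>simp add: p q\<close>)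
  show "coassoc_lhs V \<Delta> \<mu> \<nu> v \<in> carrier (tensor K (space V) ?P)"
    unfolding coassoc_lhs_def by (rule sweedler_closed[OF V A' T d[OF \<mu>\<nu> v]]) (use \<mu> \<nu> in \<open>simp add: p\<close>)
  show "coassoc_rhs V \<Delta> \<mu> \<nu> v \<in> carrier (tensor K (space V) ?P)"
    unfolding coassoc_rhs_def by (rule sweedler_closed[OF V A(2) T d[OF \<nu> v] c])
  have i: "\<Phi> (sweedler (tensor K (space V) ?P) (\<lambda>u x. pure K (space V) ?P u (pure\<^sub>H \<mu> \<nu> x y)) (\<Delta> \<mu> w)) =
      sweedler M (\<lambda>u x. B u (pure\<^sub>H \<mu> \<nu> x y)) (\<Delta> \<mu> w)" if w: "w \<in> elts V" and y: "y \<in> coeffs \<nu>" for w y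
    by (subst linear_map_sweedler[OF V A(1) T M \<Phi> d[OF \<mu> w]])
      (use y in \<open>auto intro!: sweedler_cong[OF V A(1) M d[OF \<mu> w]] simp: \<Phi>_pure p q\<close>)
  show "\<Phi> (coassoc_rhs V \<Delta> \<mu> \<nu> v) = sweedler M (\<lambda>w y. sweedler M (\<lambda>u x. B u (pure\<^sub>H \<mu> \<nu> x y)) (\<Delta> \<mu> w)) (\<Delta> \<nu> v)"
    unfolding coassoc_rhs_def
    by (subst linear_map_sweedler[OF V A(2) T M \<Phi> d[OF \<nu> v] c])
      (auto intro!: sweedler_cong[OF V A(2) M d[OF \<nu> v]] simp: i)
qed

text \<open>Acting before \<open>e_map\<close> produces the right hand side of the Yetter-Drinfeld
  condition, acting after it the left hand side, both applied to \<open>x\<close>. So linearity of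
  \<open>e_map\<close> over the algebras is the part of the condition visible to \<open>X\<close>,
  and the regular representation sees all of it.\<close>

lemma e_map_act:
  fixes V X :: "('p, 'k, 'h, 'b) rep"
  assumes D: "pre_coaction V \<Delta>" and X: "is_rep X" and h: "h \<in> coeffs (deg V \<otimes> deg X)"
    and x: "x \<in> elts X" and v: "v \<in> elts V"
  shows "e_map V \<Delta> X (act (rep_tensor (rep_conj (deg V) X) V) h (pure\<^sub>r X V x v)) =
      coact_ap V X (yd_rhs V \<Delta> (deg X) h v) x"
    "act (rep_tensor V X) h (e_map V \<Delta> X (pure\<^sub>r X V x v)) = coact_ap V X (yd_lhs V \<Delta> (deg X) h v) x"
    "yd_lhs V \<Delta> (deg X) h v \<in> carrier (tensor\<^sub>c V (deg X))"
    "yd_rhs V \<Delta> (deg X) h v \<in> carrier (tensor\<^sub>c V (deg X))"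
proof -
  note V = pre_coactionD(1)[OF D] note m = repD(2)[OF V] repD(2)[OF X] note d = repD(1)[OF V] repD(1)[OF X]
  let ?\<mu> = "deg X" and ?\<alpha> = "deg V" let ?c = "conjg \<pi> ?\<alpha> ?\<mu>"
  let ?T = "tensor\<^sub>c V ?\<mu>" and ?S = "tensor\<^sub>r V X"
  note X' = rep_conj_closed[OF X d(1)]
  note A = alg_module[OF d(1)] alg_module[OF d(2)] have A': "module K (alg H ?c)" using d by simp
  note T = tensor_module[OF m(1) A(2)] and S = tensor\<^sub>u_module[OF m]
  note e = e_map[OF D X] and ap = coact_ap[OF m(1) X]
  note \<Delta> = pre_coactionD(2)[OF D d(2)] pre_coactionD(3)[OF D d(2)]
  note p = pure_closed[OF m(1) A(2)] note pT = pure\<^sub>u_closed[OF m(2,1)]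
  \<comment> \<open>\<open>h\<close> is comultiplied in two ways, with legs of degrees
    \<open>?c\<close>, \<open>?\<alpha>\<close> and with legs of degrees \<open>?\<alpha>\<close>,
    \<open>?\<mu>\<close>; the products of the degrees agree.\<close>
  have c: "?c \<otimes> ?\<alpha> = ?\<alpha> \<otimes> ?\<mu>" using d by (simp add: conjg_mult_right)
  have hc: "h \<in> coeffs (?c \<otimes> ?\<alpha>)" using h c by simp
  have tw: "twist H (inv ?\<alpha>) ?c y \<in> coeffs ?\<mu>" if "y \<in> coeffs ?c" for y
    using twist_conj_closed[OF X d(1) that] .
  have twl: "linear_map K (alg H ?c) (alg H ?\<mu>) (twist H (inv ?\<alpha>) ?c)"
    using twist_linear[of ?c "inv ?\<alpha>"] d by simp
  have br: "bilinear_map K (space V) (alg H ?\<mu>) ?T (\<lambda>u y. pure\<^sub>c V ?\<mu> u (y \<otimes>\<^bsub>alg H ?\<mu>\<^esub> z))" if "z \<in> coeffs ?\<mu>" for z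
    by (intro lin) (simp_all add: m A d that)
  have brl: "linear_map K (alg H ?\<mu>) ?T (\<lambda>z. sweedler ?T (\<lambda>u y. pure\<^sub>c V ?\<mu> u (y \<otimes>\<^bsub>alg H ?\<mu>\<^esub> z)) t)" if "t \<in> carrier ?T" for t
    by (rule sweedler_param_linear[OF m(1) A(2) T A(2) that]) (intro lin, simp_all add: m A d)
  let ?R = "\<lambda>h' h''. sweedler ?T (\<lambda>u y. pure\<^sub>c V ?\<mu> u (y \<otimes>\<^bsub>alg H ?\<mu>\<^esub> twist H (inv ?\<alpha>) ?c h')) (\<Delta> ?\<mu> (act V h'' v))"
  have bR: "bilinear_map K (alg H ?c) (alg H ?\<alpha>) ?T ?R"
  proof (rule bilinear_mapI)
    fix h' assume h': "h' \<in> coeffs ?c"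
    show "linear_map K (alg H ?\<alpha>) ?T (?R h')"
      by (rule linear_map_comp[OF linear_map_comp[OF repD(6)[OF V v] \<Delta>(1)] sweedler_linear[OF m(1) A(2) T br[OF tw[OF h']]]])
  next
    fix h'' assume "h'' \<in> coeffs ?\<alpha>"
    then show "linear_map K (alg H ?c) ?T (\<lambda>h'. ?R h' h'')"
      using linear_map_comp[OF twl brl[OF \<Delta>(2)[OF repD(7)[OF V _ v]]]] by simp
  qed
  have lR: "linear_map K (tensor\<^sub>H ?c ?\<alpha>) ?T (sweedler ?T ?R)" by (rule sweedler_linear[OF A' A(1) T bR])
  show "yd_rhs V \<Delta> ?\<mu> h v \<in> carrier ?T" unfolding yd_rhs_def by (rule linear_mapD(1)[OF lR]) (use d hc in simp)
  note ta = tens_act[OF X' V, unfolded rep_conj_simps]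
  \<comment> \<open>The twisted coefficient \<open>h'\<close> acts on \<open>x\<close> before the
    coefficient of the coaction does, so it becomes the right factor of the product in
    \<open>yd_rhs\<close>.\<close>
  have R: "e_map V \<Delta> X (tens_act (rep_conj ?\<alpha> X) V t (pure\<^sub>r X V x v)) = coact_ap V X (sweedler ?T ?R t) x"
    if t: "t \<in> carrier (tensor\<^sub>H ?c ?\<alpha>)" for t
  proof (rule tensor_ext[OF A' A(1) S linear_map_comp[OF bilinear_mapD(2)[OF ta(1) pT[OF x v]] e(1)] linear_map_comp[OF lR bilinear_mapD(2)[OF ap(1) x]] _ t])
    fix h' h'' assume h': "h' \<in> coeffs ?c" and h'': "h'' \<in> coeffs ?\<alpha>"
    have "coact_ap V X s (act X (twist H (inv ?\<alpha>) ?c h') x) = coact_ap V X (sweedler ?T (\<lambda>u y. pure\<^sub>c V ?\<mu> u (y \<otimes>\<^bsub>alg H ?\<mu>\<^esub> twist H (inv ?\<alpha>) ?c h')) s) x"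
      if s: "s \<in> carrier ?T" for s
      by (rule tensor_ext[OF m(1) A(2) S bilinear_mapD(2)[OF ap(1)] linear_map_comp[OF sweedler_linear[OF m(1) A(2) T br[OF tw[OF h']]] bilinear_mapD(2)[OF ap(1) x]] _ s])
        (simp_all add: repD(7)[OF X] tw h' x sweedler_pure[OF m(1) A(2) T br[OF tw[OF h']]] ap(2) d repD(5)[OF X])
    then show "e_map V \<Delta> X (tens_act (rep_conj ?\<alpha> X) V (pure\<^sub>H ?c ?\<alpha> h' h'') (pure\<^sub>r X V x v)) =
       coact_ap V X (sweedler ?T ?R (pure\<^sub>H ?c ?\<alpha> h' h'')) x"
      using h' h'' x v by (simp add: ta(2) e(3) repD(7)[OF X] repD(7)[OF V] tw sweedler_pure[OF A' A(1) T bR] \<Delta>(2))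
  qed
  show "e_map V \<Delta> X (act (rep_tensor (rep_conj ?\<alpha> X) V) h (pure\<^sub>r X V x v)) = coact_ap V X (yd_rhs V \<Delta> ?\<mu> h v) x"
    using R[of "comult H ?c ?\<alpha> h"] hc d pT[OF x v] by (simp add: act_rep_tensor yd_rhs_def)
  have bl: "bilinear_map K (space V) (alg H ?\<mu>) ?T (\<lambda>u y. pure\<^sub>c V ?\<mu> (act V h' u) (h'' \<otimes>\<^bsub>alg H ?\<mu>\<^esub> y))"
    if "h' \<in> coeffs ?\<alpha>" "h'' \<in> coeffs ?\<mu>" for h' h''
    by (intro lin) (simp_all add: m A d that V repD(7)[OF V])
  let ?L = "\<lambda>h' h''. sweedler ?T (\<lambda>u y. pure\<^sub>c V ?\<mu> (act V h' u) (h'' \<otimes>\<^bsub>alg H ?\<mu>\<^esub> y)) (\<Delta> ?\<mu> v)"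
  have bL: "bilinear_map K (alg H ?\<alpha>) (alg H ?\<mu>) ?T ?L"
  proof (rule bilinear_mapI)
    fix h' assume h': "h' \<in> coeffs ?\<alpha>"
    show "linear_map K (alg H ?\<mu>) ?T (?L h')"
      by (rule sweedler_param_linear[OF m(1) A(2) T A(2) \<Delta>(2)[OF v]]) (intro lin, simp_all add: m A d h' repD(7)[OF V])
  next
    fix h'' assume h'': "h'' \<in> coeffs ?\<mu>"
    show "linear_map K (alg H ?\<alpha>) ?T (\<lambda>h'. ?L h' h'')"
      by (rule sweedler_param_linear[OF m(1) A(2) T A(1) \<Delta>(2)[OF v]]) (intro lin, simp_all add: m A d h'' V)
  qed
  have lL: "linear_map K (tensor\<^sub>H ?\<alpha> ?\<mu>) ?T (sweedler ?T ?L)" by (rule sweedler_linear[OF A T bL])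
  show "yd_lhs V \<Delta> ?\<mu> h v \<in> carrier ?T" unfolding yd_lhs_def by (rule linear_mapD(1)[OF lL]) (use d h in simp)
  note tb = tens_act[OF V X]
  \<comment> \<open>Here the new coefficient \<open>h''\<close> acts last and becomes the left
    factor, as in \<open>yd_lhs\<close>.\<close>
  have L: "tens_act V X t (coact_ap V X (\<Delta> ?\<mu> v) x) = coact_ap V X (sweedler ?T ?L t) x"
    if t: "t \<in> carrier (tensor\<^sub>H ?\<alpha> ?\<mu>)" for t
  proof (rule tensor_ext[OF A S bilinear_mapD(2)[OF tb(1) bilinear_mapD(3)[OF ap(1) \<Delta>(2)[OF v] x]] linear_map_comp[OF lL bilinear_mapD(2)[OF ap(1) x]] _ t])
    fix h' h'' assume h': "h' \<in> coeffs ?\<alpha>" and h'': "h'' \<in> coeffs ?\<mu>"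
    have "tens_act V X (pure\<^sub>H ?\<alpha> ?\<mu> h' h'') (coact_ap V X s x) =
       coact_ap V X (sweedler ?T (\<lambda>u y. pure\<^sub>c V ?\<mu> (act V h' u) (h'' \<otimes>\<^bsub>alg H ?\<mu>\<^esub> y)) s) x"
      if s: "s \<in> carrier ?T" for s
      by (rule tensor_ext[OF m(1) A(2) S linear_map_comp[OF bilinear_mapD(2)[OF ap(1) x] bilinear_mapD(1)[OF tb(1) pure_closed[OF A h' h'']]]
            linear_map_comp[OF sweedler_linear[OF m(1) A(2) T bl[OF h' h'']] bilinear_mapD(2)[OF ap(1) x]] _ s])
        (simp add: sweedler_pure[OF m(1) A(2) T bl[OF h' h'']] ap(2) tb(2) h' h'' x d repD(5,7)[OF X] repD(7)[OF V])
    then show "tens_act V X (pure\<^sub>H ?\<alpha> ?\<mu> h' h'') (coact_ap V X (\<Delta> ?\<mu> v) x) = coact_ap V X (sweedler ?T ?L (pure\<^sub>H ?\<alpha> ?\<mu> h' h'')) x"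
      using h' h'' by (simp add: sweedler_pure[OF A T bL] \<Delta>(2) v)
  qed
  show "act (rep_tensor V X) h (e_map V \<Delta> X (pure\<^sub>r X V x v)) = coact_ap V X (yd_lhs V \<Delta> ?\<mu> h v) x"
    using L[of "comult H ?\<alpha> ?\<mu> h"] h d x v bilinear_mapD(3)[OF ap(1) \<Delta>(2)[OF v] x] by (simp add: act_rep_tensor yd_lhs_def e(3))
qed

text \<open>The analogue of \<open>coact_ap\<close> for two coefficients at a time, acting on the
  pure tensor of \<open>x\<close> and \<open>y\<close>.\<close>

definition coact_ap2 where
  "coact_ap2 V X Y x y = sweedler (tensor\<^sub>u K (space V) (tensor\<^sub>r X Y))
     (\<lambda>u p. pure\<^sub>u K (space V) (tensor\<^sub>r X Y) u (tens_act X Y p (pure\<^sub>r X Y x y)))"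

text \<open>One side of coassociativity gives \<open>e_map\<close> at the tensor product of
  \<open>X\<close> and \<open>Y\<close>. The other gives an iterated sum, which
  \<open>e_map_TenO_rhs\<close> recognizes as a composite of \<open>e_map\<close> at
  \<open>Y\<close> and at \<open>X\<close>.\<close>

lemma coact_ap2:
  fixes V X Y :: "('p, 'k, 'h, 'b) rep"
  assumes D: "pre_coaction V \<Delta>" and X: "is_rep X" and Y: "is_rep Y" and x: "x \<in> elts X" and y: "y \<in> elts Y"
  shows "bilinear_map K (space V) (tensor\<^sub>H (deg X) (deg Y)) (tensor\<^sub>u K (space V) (tensor\<^sub>r X Y))
     (\<lambda>u p. pure\<^sub>u K (space V) (tensor\<^sub>r X Y) u (tens_act X Y p (pure\<^sub>r X Y x y)))"
    "v \<in> elts V \<Longrightarrow> coact_ap2 V X Y x y (coassoc_lhs V \<Delta> (deg X) (deg Y) v) =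
      e_map V \<Delta> (rep_tensor X Y) (pure\<^sub>u K (tensor\<^sub>r X Y) (space V) (pure\<^sub>r X Y x y) v)"
    "v \<in> elts V \<Longrightarrow> coact_ap2 V X Y x y (coassoc_rhs V \<Delta> (deg X) (deg Y) v) =
      sweedler (tensor\<^sub>u K (space V) (tensor\<^sub>r X Y)) (\<lambda>w b. sweedler (tensor\<^sub>u K (space V) (tensor\<^sub>r X Y))
        (\<lambda>u a. pure\<^sub>u K (space V) (tensor\<^sub>r X Y) u (pure\<^sub>r X Y (act X a x) (act Y b y))) (\<Delta> (deg X) w)) (\<Delta> (deg Y) v)"
proof -
  note V = pre_coactionD(1)[OF D] note m = repD(2)[OF V] repD(2)[OF X] repD(2)[OF Y] note d = repD(1)[OF X] repD(1)[OF Y]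
  note A = alg_module[OF d(1)] alg_module[OF d(2)]
  note XY = tensor\<^sub>u_module[OF m(2,3)] note S = tensor\<^sub>u_module[OF m(1) XY]
  note \<Delta> = pre_coactionD(3)[OF D] note p = pure\<^sub>u_closed[OF m(2,3) x y]
  note rXY = rep_tensor_closed[OF X Y]
  note ta = tens_act[OF X Y]
  show b: "bilinear_map K (space V) (tensor\<^sub>H (deg X) (deg Y)) (tensor\<^sub>u K (space V) (tensor\<^sub>r X Y))
     (\<lambda>u p. pure\<^sub>u K (space V) (tensor\<^sub>r X Y) u (tens_act X Y p (pure\<^sub>r X Y x y)))"
    by (intro lin) (simp_all add: m X Y XY p bilinear_mapD(3)[OF ta(1)])
  assume v: "v \<in> elts V"
  have dd: "deg X \<otimes> deg Y \<in> carrier \<pi>" using d by simp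
  show "coact_ap2 V X Y x y (coassoc_lhs V \<Delta> (deg X) (deg Y) v) =
      e_map V \<Delta> (rep_tensor X Y) (pure\<^sub>u K (tensor\<^sub>r X Y) (space V) (pure\<^sub>r X Y x y) v)"
    unfolding coact_ap2_def coassoc_lift(1)[OF D S d b v]
    using e_map(3)[OF D rXY, of "pure\<^sub>r X Y x y" v] p v
    by (simp add: coact_ap_def) (rule sweedler_cong[OF m(1) alg_module[OF dd] S \<Delta>[OF dd v]], simp add: act_rep_tensor)
  show "coact_ap2 V X Y x y (coassoc_rhs V \<Delta> (deg X) (deg Y) v) =
      sweedler (tensor\<^sub>u K (space V) (tensor\<^sub>r X Y)) (\<lambda>w b. sweedler (tensor\<^sub>u K (space V) (tensor\<^sub>r X Y))
        (\<lambda>u a. pure\<^sub>u K (space V) (tensor\<^sub>r X Y) u (pure\<^sub>r X Y (act X a x) (act Y b y))) (\<Delta> (deg X) w)) (\<Delta> (deg Y) v)"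
    unfolding coact_ap2_def coassoc_lift(2)[OF D S d b v]
    by (intro sweedler_cong[OF m(1) A(2) S \<Delta>[OF d(2) v]] sweedler_cong[OF m(1) A(1) S \<Delta>[OF d(1)]]) (simp_all add: ta(2) x y)
qed

lemma act_Rep [simp]:
  "actO Rep V X = rep_conj (deg V) X" "actA Rep V f = Arrow (rep_conj (deg V) (source f)) (rep_conj (deg V) (target f)) (body f)"
  by (simp_all add: actO_def actA_def)

lemma is_rep_map_E:
  fixes V X :: "('p, 'k, 'h, 'b) rep"
  assumes D: "pre_coaction V \<Delta>" and X: "is_rep X"
    and c: "\<And>h v. \<lbrakk>h \<in> coeffs (deg V \<otimes> deg X); v \<in> elts V\<rbrakk> \<Longrightarrow> yd_lhs V \<Delta> (deg X) h v = yd_rhs V \<Delta> (deg X) h v"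
  shows "is_rep_map (rep_tensor (rep_conj (deg V) X) V) (rep_tensor V X) (e_map V \<Delta> X)"
proof (rule rep_mapI)
  note V = pre_coactionD(1)[OF D] note m = repD(2)[OF V] repD(2)[OF X] note d = repD(1)[OF V] repD(1)[OF X]
  note X' = rep_conj_closed[OF X d(1)]
  note e = e_map[OF D X]
  show dd: "deg (rep_tensor (rep_conj (deg V) X) V) = deg (rep_tensor V X)" using d by (simp add: conjg_mult_right)
  show "e_map V \<Delta> X \<in> extensional (elts (rep_tensor (rep_conj (deg V) X) V))"
    "linear_map K (space (rep_tensor (rep_conj (deg V) X) V)) (space (rep_tensor V X)) (e_map V \<Delta> X)" using e by simp_all
  fix h t assume h: "h \<in> coeffs (deg (rep_tensor (rep_conj (deg V) X) V))" and "t \<in> elts (rep_tensor (rep_conj (deg V) X) V)"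
  then have t: "t \<in> carrier (tensor\<^sub>r X V)" by simp
  have h': "h \<in> coeffs (deg V \<otimes> deg X)" using h dd by simp
  note l1 = repD(3)[OF rep_tensor_closed[OF X' V] h, simplified] and l2 = repD(3)[OF rep_tensor_closed[OF V X], simplified, OF h']
  show "e_map V \<Delta> X (act (rep_tensor (rep_conj (deg V) X) V) h t) = act (rep_tensor V X) h (e_map V \<Delta> X t)"
    by (rule tensor\<^sub>u_ext[OF m(2,1) tensor\<^sub>u_module[OF m] linear_map_comp[OF l1 e(1)] linear_map_comp[OF e(1) l2] _ t])
      (simp add: e_map_act[OF D X h'] c[OF h'])
qed

text \<open>On a pure tensor the composite applies the coaction of degree \<open>deg Y\<close> to
  \<open>v\<close> and then the coaction of degree \<open>deg X\<close> to the resulting vector of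
  \<open>V\<close>; this is the order of the iterated coaction in
  \<open>coassoc_rhs\<close>.\<close>

lemma e_map_TenO_rhs:
  fixes V X Y :: "('p, 'k, 'h, 'b) rep"
  assumes D: "pre_coaction V \<Delta>" and X: "is_rep X" and Y: "is_rep Y"
    and x: "x \<in> elts X" and y: "y \<in> elts Y" and v: "v \<in> elts V"
  defines "E \<equiv> \<lambda>X. Arrow (rep_tensor (rep_conj (deg V) X) V) (rep_tensor V X) (e_map V \<Delta> X)"
  shows "body (Comp Rep (Assoc Rep V X Y) (Comp Rep (TenA Rep (E X) (Ident Rep Y)) (Comp Rep
      (inv_arrow Rep (Assoc Rep (rep_conj (deg V) X) V Y)) (Comp Rep (TenA Rep (Ident Rep (rep_conj (deg V) X)) (E Y))
      (Assoc Rep (rep_conj (deg V) X) (rep_conj (deg V) Y) V)))))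
      (pure\<^sub>u K (tensor\<^sub>r X Y) (space V) (pure\<^sub>r X Y x y) v) =
    coact_ap2 V X Y x y (coassoc_rhs V \<Delta> (deg X) (deg Y) v)"
proof -
  note V = pre_coactionD(1)[OF D] note m = repD(2)[OF V] repD(2)[OF X] repD(2)[OF Y] note d = repD(1)[OF V] repD(1)[OF X] repD(1)[OF Y]
  note X' = rep_conj_closed[OF X d(1)]
  note A = alg_module[OF d(2)] alg_module[OF d(3)]
  note e = e_map[OF D X] and e' = e_map[OF D Y] and ap = coact_ap[OF m(1) X] and ap' = coact_ap[OF m(1) Y]
  note \<Delta> = pre_coactionD(2,3)[OF D]
  obtain g where g: "inv_arrow Rep (Assoc Rep (rep_conj (deg V) X) V Y) = Arrow (rep_tensor (rep_conj (deg V) X) (rep_tensor V Y)) (rep_tensor (rep_tensor (rep_conj (deg V) X) V) Y) g"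
    "is_rep_map (rep_tensor (rep_conj (deg V) X) (rep_tensor V Y)) (rep_tensor (rep_tensor (rep_conj (deg V) X) V) Y) g"
    "\<And>u v w. \<lbrakk>u \<in> elts X; v \<in> elts V; w \<in> elts Y\<rbrakk> \<Longrightarrow>
      g (pure\<^sub>u K (space X) (tensor\<^sub>r V Y) u (pure\<^sub>r V Y v w)) =
      pure\<^sub>u K (tensor\<^sub>r X V) (space Y) (pure\<^sub>r X V u v) w"
    using Rep_Assoc_iso[OF X' V Y] by (metis rep_conj_simps(2))
  note gl = rep_mapD(3)[OF g(2), simplified]
  have idX: "linear_map K (space X) (space X) (\<lambda>u\<in>carrier (space X). u)" and idY: "linear_map K (space Y) (space Y) (\<lambda>u\<in>carrier (space Y). u)"
    using rep_mapD(3)[OF rep_map_id[OF X]] rep_mapD(3)[OF rep_map_id[OF Y]] .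
  note VX = tensor\<^sub>u_module[OF m(1,2)] and XV = tensor\<^sub>u_module[OF m(2,1)] and VY = tensor\<^sub>u_module[OF m(1,3)] and YV = tensor\<^sub>u_module[OF m(3,1)] and XY = tensor\<^sub>u_module[OF m(2,3)]
  note a1 = assoc_map[OF m(2,3,1)] and a2 = assoc_map[OF m]
  note t1 = map_tensor[OF m(2) YV m(2) VY idX e'(1)] and t2 = map_tensor[OF XV m(3) VX m(3) e(1) idY]
  let ?S = "tensor\<^sub>u K (space V) (tensor\<^sub>r X Y)" note S = tensor\<^sub>u_module[OF m(1) XY]
  let ?xyv = "pure\<^sub>u K (tensor\<^sub>r X Y) (space V) (pure\<^sub>r X Y x y) v"
  let ?t2 = "map_tensor (tensor\<^sub>r X V) (space Y) (tensor\<^sub>r V X) (space Y) (e_map V \<Delta> X) (\<lambda>u\<in>carrier (space Y). u)"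
  let ?t1 = "map_tensor (space X) (tensor\<^sub>r Y V) (space X) (tensor\<^sub>r V Y) (\<lambda>u\<in>carrier (space X). u) (e_map V \<Delta> Y)"
  have p: "?xyv \<in> carrier (tensor\<^sub>u K (tensor\<^sub>r X Y) (space V))"
    by (simp add: pure\<^sub>u_closed m XY x y v)
  have L: "body (Comp Rep (Assoc Rep V X Y) (Comp Rep (TenA Rep (E X) (Ident Rep Y)) (Comp Rep
      (inv_arrow Rep (Assoc Rep (rep_conj (deg V) X) V Y)) (Comp Rep (TenA Rep (Ident Rep (rep_conj (deg V) X)) (E Y))
      (Assoc Rep (rep_conj (deg V) X) (rep_conj (deg V) Y) V))))) ?xyv =
     assoc_map (space V) (space X) (space Y) (?t2 (g (?t1 (assoc_map (space X) (space Y) (space V) ?xyv))))"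
    unfolding g(1) E_def using p by (simp add: compose_eq)
  also have "?t1 (assoc_map (space X) (space Y) (space V) ?xyv) = pure\<^sub>u K (space X) (tensor\<^sub>r V Y) x (coact_ap V Y (\<Delta> (deg Y) v) y)"
    using x y v by (simp add: a1(3) t1(3) pure\<^sub>u_closed m e'(3))
  also have "assoc_map (space V) (space X) (space Y) (?t2 (g (pure\<^sub>u K (space X) (tensor\<^sub>r V Y) x (coact_ap V Y (\<Delta> (deg Y) v) y)))) =
    sweedler ?S (\<lambda>w b. sweedler ?S
        (\<lambda>u a. pure\<^sub>u K (space V) (tensor\<^sub>r X Y) u (pure\<^sub>r X Y (act X a x) (act Y b y))) (\<Delta> (deg X) w)) (\<Delta> (deg Y) v)"
  proof -
    have b2: "bilinear_map K (space V) (alg H (deg X)) ?S (\<lambda>u a. pure\<^sub>u K (space V) (tensor\<^sub>r X Y) u (pure\<^sub>r X Y (act X a x) (act Y b y)))"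
      if "b \<in> coeffs (deg Y)" for b
      by (intro lin) (simp_all add: that m X XY pure\<^sub>u_closed repD(7)[OF X] repD(7)[OF Y] x y)
    have b2': "linear_map K (alg H (deg Y)) ?S (\<lambda>b. pure\<^sub>u K (space V) (tensor\<^sub>r X Y) u (pure\<^sub>r X Y (act X a x) (act Y b y)))"
      if "u \<in> elts V" "a \<in> coeffs (deg X)" for u a
      by (intro lin) (simp_all add: that m Y XY pure\<^sub>u_closed repD(7)[OF X] repD(7)[OF Y] x y)
    let ?B = "\<lambda>w b. sweedler ?S (\<lambda>u a. pure\<^sub>u K (space V) (tensor\<^sub>r X Y) u (pure\<^sub>r X Y (act X a x) (act Y b y))) (\<Delta> (deg X) w)"
    have b3: "bilinear_map K (space V) (alg H (deg Y)) ?S ?B"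
      by (intro bilinear_mapI sweedler_param_linear[OF m(1) A(1) S A(2)] linear_map_comp[OF \<Delta>(1)[OF d(2)] sweedler_linear[OF m(1) A(1) S b2]] b2' \<Delta>(2)[OF d(2)])
    \<comment> \<open>Values of the coaction need not be pure tensors, so they are replaced by
      arbitrary elements: here the value that acts on \<open>X\<close>, afterwards the one that acts
      on \<open>Y\<close>.\<close>
    have inner: "assoc_map (space V) (space X) (space Y) (pure\<^sub>u K (tensor\<^sub>r V X) (space Y) (coact_ap V X s x) z) =
        sweedler ?S (\<lambda>u a. pure\<^sub>u K (space V) (tensor\<^sub>r X Y) u (pure\<^sub>r X Y (act X a x) z)) s"
      if s: "s \<in> carrier (tensor\<^sub>c V (deg X))" and z: "z \<in> elts Y" for s z
    proof -
      have b: "bilinear_map K (space V) (alg H (deg X)) ?S (\<lambda>u a. pure\<^sub>u K (space V) (tensor\<^sub>r X Y) u (pure\<^sub>r X Y (act X a x) z))"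
        by (intro lin) (simp_all add: z m X XY pure\<^sub>u_closed repD(7)[OF X] repD(7)[OF Y] x y)
      show ?thesis
        by (rule tensor_ext[OF m(1) A(1) S linear_map_comp[OF linear_map_comp[OF bilinear_mapD(2)[OF ap(1) x] bilinear_mapD(2)[OF pure\<^sub>u_bilinear[OF VX m(3)] z]] a2(1)]
              sweedler_linear[OF m(1) A(1) S b] _ s])
          (simp add: ap(2) x z sweedler_pure[OF m(1) A(1) S b] a2(3) repD(7)[OF X])
    qed
    have "assoc_map (space V) (space X) (space Y) (?t2 (g (pure\<^sub>u K (space X) (tensor\<^sub>r V Y) x (coact_ap V Y s y)))) = sweedler ?S ?B s"
      if s: "s \<in> carrier (tensor\<^sub>c V (deg Y))" for s
    proof (rule tensor_ext[OF m(1) A(2) S linear_map_comp[OF linear_map_comp[OF linear_map_comp[OF linear_map_comp[OF bilinear_mapD(2)[OF ap'(1) y] bilinear_mapD(1)[OF pure\<^sub>u_bilinear[OF m(2) VY] x]] gl] t2(1)] a2(1)]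
              sweedler_linear[OF m(1) A(2) S b3] _ s])
      fix w b assume wb: "w \<in> elts V" "b \<in> coeffs (deg Y)"
      then show "assoc_map (space V) (space X) (space Y) (?t2 (g (pure\<^sub>u K (space X) (tensor\<^sub>r V Y) x (coact_ap V Y (pure\<^sub>c V (deg Y) w b) y)))) = sweedler ?S ?B (pure\<^sub>c V (deg Y) w b)"
        by (simp add: ap'(2) x y g(3) repD(7)[OF Y] t2(3) pure\<^sub>u_closed m e(3) sweedler_pure[OF m(1) A(2) S b3] inner \<Delta>(2)[OF d(2)])
    qed
    then show ?thesis using \<Delta>(2)[OF d(3) v] .
  qed
  also have "\<dots> = coact_ap2 V X Y x y (coassoc_rhs V \<Delta> (deg X) (deg Y) v)"
    by (rule coact_ap2(3)[OF D X Y x y v, symmetric])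
  finally show ?thesis .
qed

subsection \<open>From Yetter-Drinfeld modules to half braidings\<close>

text \<open>The braiding formula involves only the representation underlying its second argument, so
  it extends from Yetter-Drinfeld modules to all representations \<open>X\<close>;
  \<open>undefined\<close> fills the slot of the coaction.\<close>

definition c_map :: "('p, 'k, 'h, 'b) rep \<Rightarrow> ('p, 'k, 'h, 'b) coaction \<Rightarrow> ('p, 'k, 'h, 'b) rep \<Rightarrow>
    ('k, 'h, 'b) univ \<Rightarrow> ('k, 'h, 'b) univ" where
  "c_map V \<Delta> X = yd_braid_map (V, \<Delta>) (X, undefined)"

definition br_ap where
  "br_ap V X t x = sweedler (tensor\<^sub>r X V) (\<lambda>v' a.
           pure\<^sub>r X V (act X (antipode H (inv (deg X)) a) x) v') t"

lemma antipode_linear':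
  "\<beta> \<in> carrier \<pi> \<Longrightarrow> linear_map K (alg H (inv \<beta>)) (alg H \<beta>) (antipode H (inv \<beta>))"
  using antipode[of "inv \<beta>"] by simp

lemma c_map:
  fixes V X :: "('p, 'k, 'h, 'b) rep"
  assumes D: "pre_coaction V \<Delta>" and X: "is_rep X"
  shows "linear_map K (tensor\<^sub>r V X) (tensor\<^sub>r X V) (c_map V \<Delta> X)"
    "c_map V \<Delta> X \<in> extensional (carrier (tensor\<^sub>r V X))"
    "\<lbrakk>x \<in> elts X; v \<in> elts V\<rbrakk> \<Longrightarrow>
      c_map V \<Delta> X (pure\<^sub>r V X v x) = br_ap V X (\<Delta> (inv (deg X)) v) x"
    "bilinear_map K (tensor\<^sub>c V (inv (deg X))) (space X) (tensor\<^sub>r X V) (br_ap V X)"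
    "\<lbrakk>u \<in> elts V; a \<in> coeffs (inv (deg X)); x \<in> elts X\<rbrakk> \<Longrightarrow>
      br_ap V X (pure\<^sub>c V (inv (deg X)) u a) x = pure\<^sub>r X V (act X (antipode H (inv (deg X)) a) x) u"
proof -
  note V = pre_coactionD(1)[OF D] note m = repD(2)[OF V] repD(2)[OF X] and d = repD(1)[OF X]
  have d': "inv (deg X) \<in> carrier \<pi>" using d by simp
  note A = alg_module[OF d']
  note S = tensor\<^sub>u_module[OF m(2,1)]
  note s = antipode_linear'[OF d]
  have b: "bilinear_map K (space V) (alg H (inv (deg X))) (tensor\<^sub>r X V) (\<lambda>v' a.
           pure\<^sub>r X V (act X (antipode H (inv (deg X)) a) x) v')" if x: "x \<in> elts X" for x
    by (intro lin linear_map_comp[OF s repD(6)[OF X x]]) (simp_all add: m x repD(7)[OF X] linear_mapD(1)[OF s])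
  have l: "linear_map K (space X) (tensor\<^sub>r X V) (\<lambda>x. pure\<^sub>r X V (act X (antipode H (inv (deg X)) a) x) v')"
    if "v' \<in> elts V" "a \<in> coeffs (inv (deg X))" for v' a
    by (intro lin) (simp_all add: that m X linear_mapD(1)[OF s])
  show B: "bilinear_map K (tensor\<^sub>c V (inv (deg X))) (space X) (tensor\<^sub>r X V) (br_ap V X)"
    unfolding br_ap_def
    by (intro bilinear_mapI sweedler_param_linear[OF m(1) A S m(2)] sweedler_linear[OF m(1) A S b] l)
  show "\<lbrakk>u \<in> elts V; a \<in> coeffs (inv (deg X)); x \<in> elts X\<rbrakk> \<Longrightarrow>
      br_ap V X (pure\<^sub>c V (inv (deg X)) u a) x = pure\<^sub>r X V (act X (antipode H (inv (deg X)) a) x) u"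
    unfolding br_ap_def by (rule sweedler_pure[OF m(1) A S b])
  have c: "c_map V \<Delta> X = (\<lambda>t\<in>carrier (tensor\<^sub>r V X). sweedler\<^sub>u (tensor\<^sub>r X V) (\<lambda>v x. br_ap V X (\<Delta> (inv (deg X)) v) x) t)"
    by (simp add: c_map_def yd_braid_map_def br_ap_def Let_def)
  have bb: "bilinear_map K (space V) (space X) (tensor\<^sub>r X V) (\<lambda>v x. br_ap V X (\<Delta> (inv (deg X)) v) x)"
    by (intro bilinear_mapI bilinear_mapD[OF B] pre_coactionD(3)[OF D d'] linear_map_comp[OF pre_coactionD(2)[OF D d']])
  show "linear_map K (tensor\<^sub>r V X) (tensor\<^sub>r X V) (c_map V \<Delta> X)"
    by (rule linear_map_cong[OF sweedler\<^sub>u_linear[OF m S bb] tensor\<^sub>u_module[OF m]]) (simp add: c)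
  show "c_map V \<Delta> X \<in> extensional (carrier (tensor\<^sub>r V X))" by (simp add: c)
  show "\<lbrakk>x \<in> elts X; v \<in> elts V\<rbrakk> \<Longrightarrow>
      c_map V \<Delta> X (pure\<^sub>r V X v x) = br_ap V X (\<Delta> (inv (deg X)) v) x"
    by (simp add: c pure\<^sub>u_closed[OF m] sweedler\<^sub>u_pure\<^sub>u[OF m S bb])
qed

text \<open>The antipode axioms are identities in the algebra of degree \<open>deg X\<close>;
  letting both sides act on \<open>x\<close> gives them the form in which they meet the
  coaction.\<close>

lemma antipode_lift:
  fixes X :: "('p, 'k, 'h, 'b) rep"
  assumes X: "is_rep X" and x: "x \<in> elts X"
  shows "bilinear_map K (alg H (deg X)) (alg H (inv (deg X))) (space X) (\<lambda>a b. act X a (act X (antipode H (inv (deg X)) b) x))"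
    "bilinear_map K (alg H (inv (deg X))) (alg H (deg X)) (space X) (\<lambda>b a. act X (antipode H (inv (deg X)) b) (act X a x))"
    "z \<in> carrier (alg H \<one>) \<Longrightarrow> sweedler (space X) (\<lambda>a b. act X a (act X (antipode H (inv (deg X)) b) x)) (comult H (deg X) (inv (deg X)) z) = counit H z \<odot>\<^bsub>space X\<^esub> x"
    "z \<in> carrier (alg H \<one>) \<Longrightarrow> sweedler (space X) (\<lambda>b a. act X (antipode H (inv (deg X)) b) (act X a x)) (comult H (inv (deg X)) (deg X) z) = counit H z \<odot>\<^bsub>space X\<^esub> x"
proof -
  note m = repD(2)[OF X] and d = repD(1)[OF X]
  have d': "inv (deg X) \<in> carrier \<pi>" using d by simp
  note A = alg_module[OF d] alg_module[OF d']
  note s = antipode_linear'[OF d] note sc = linear_mapD(1)[OF s] and xc = repD(7)[OF X]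
  show "bilinear_map K (alg H (deg X)) (alg H (inv (deg X))) (space X) (\<lambda>a b. act X a (act X (antipode H (inv (deg X)) b) x))"
    by (intro bilinear_mapI repD(6)[OF X] linear_map_comp[OF linear_map_comp[OF s repD(6)[OF X x]] repD(3)[OF X]]) (simp_all add: xc sc x)
  show "bilinear_map K (alg H (inv (deg X))) (alg H (deg X)) (space X) (\<lambda>b a. act X (antipode H (inv (deg X)) b) (act X a x))"
    by (intro bilinear_mapI linear_map_comp[OF s repD(6)[OF X]] linear_map_comp[OF repD(6)[OF X x] repD(3)[OF X]]) (simp_all add: xc sc x)
  have e: "act X (counit H z \<odot>\<^bsub>alg H (deg X)\<^esub> \<one>\<^bsub>alg H (deg X)\<^esub>) x = counit H z \<odot>\<^bsub>space X\<^esub> x" if "z \<in> carrier (alg H \<one>)"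
    using that d x linear_mapD(3)[OF repD(6)[OF X x]] by (simp add: repD(4)[OF X x])
  show "sweedler (space X) (\<lambda>a b. act X a (act X (antipode H (inv (deg X)) b) x)) (comult H (deg X) (inv (deg X)) z) = counit H z \<odot>\<^bsub>space X\<^esub> x" if z: "z \<in> carrier (alg H \<one>)"
  proof -
    have c: "comult H (deg X) (inv (deg X)) z \<in> carrier (tensor\<^sub>H (deg X) (inv (deg X)))" using d z by simp
    have "act X (sweedler (alg H (deg X)) (\<lambda>x y. x \<otimes>\<^bsub>alg H (deg X)\<^esub> antipode H (inv (deg X)) y) (comult H (deg X) (inv (deg X)) z)) x =
      sweedler (space X) (\<lambda>a b. act X (a \<otimes>\<^bsub>alg H (deg X)\<^esub> antipode H (inv (deg X)) b) x) (comult H (deg X) (inv (deg X)) z)"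
      by (rule linear_map_sweedler[OF A(1,2) A(1) m repD(6)[OF X x] c]) (use d sc in simp)
    also have "\<dots> = sweedler (space X) (\<lambda>a b. act X a (act X (antipode H (inv (deg X)) b) x)) (comult H (deg X) (inv (deg X)) z)"
      by (rule sweedler_cong[OF A(1,2) m c]) (simp add: repD(5)[OF X] sc x)
    finally show ?thesis using antipode_right[OF d z] e[OF z] by simp
  qed
  show "sweedler (space X) (\<lambda>b a. act X (antipode H (inv (deg X)) b) (act X a x)) (comult H (inv (deg X)) (deg X) z) = counit H z \<odot>\<^bsub>space X\<^esub> x" if z: "z \<in> carrier (alg H \<one>)"
  proof -
    have c: "comult H (inv (deg X)) (deg X) z \<in> carrier (tensor\<^sub>H (inv (deg X)) (deg X))" using d z by simp
    have "act X (sweedler (alg H (deg X)) (\<lambda>x y. antipode H (inv (deg X)) x \<otimes>\<^bsub>alg H (deg X)\<^esub> y) (comult H (inv (deg X)) (deg X) z)) x =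
      sweedler (space X) (\<lambda>a b. act X (antipode H (inv (deg X)) a \<otimes>\<^bsub>alg H (deg X)\<^esub> b) x) (comult H (inv (deg X)) (deg X) z)"
      by (rule linear_map_sweedler[OF A(2,1) A(1) m repD(6)[OF X x] c]) (use d sc in simp)
    also have "\<dots> = sweedler (space X) (\<lambda>b a. act X (antipode H (inv (deg X)) b) (act X a x)) (comult H (inv (deg X)) (deg X) z)"
      by (rule sweedler_cong[OF A(2,1) m c]) (simp add: repD(5)[OF X] sc x)
    finally show ?thesis using antipode_left[OF d z] e[OF z] by simp
  qed
qed

text \<open>Either composite applies the coaction twice, in mutually inverse degrees.
  Coassociativity replaces this by one coaction of degree \<open>\<one>\<close> followed by a
  coproduct, the antipode reduces the coproduct to a counit, and the counit axiom of the coaction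
  removes it.\<close>

lemma e_c_inverse:
  fixes V X :: "('p, 'k, 'h, 'b) rep"
  assumes Y: "is_yd (V, \<Delta>)" and X: "is_rep X"
  shows "t \<in> carrier (tensor\<^sub>r V X) \<Longrightarrow> e_map V \<Delta> X (c_map V \<Delta> X t) = t"
    "t \<in> carrier (tensor\<^sub>r X V) \<Longrightarrow> c_map V \<Delta> X (e_map V \<Delta> X t) = t"
proof -
  note y = Y[unfolded is_yd_iff]
  have D: "pre_coaction V \<Delta>" and ca: "\<And>\<mu> \<nu> v. \<lbrakk>\<mu> \<in> carrier \<pi>; \<nu> \<in> carrier \<pi>; v \<in> elts V\<rbrakk> \<Longrightarrow> coassoc_lhs V \<Delta> \<mu> \<nu> v = coassoc_rhs V \<Delta> \<mu> \<nu> v"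
    and cu: "\<And>v. v \<in> elts V \<Longrightarrow> sweedler (space V) (\<lambda>u x. counit H x \<odot>\<^bsub>space V\<^esub> u) (\<Delta> \<one> v) = v"
    using y by blast+
  note V = pre_coactionD(1)[OF D] note m = repD(2)[OF V] repD(2)[OF X] and d = repD(1)[OF X]
  have d': "inv (deg X) \<in> carrier \<pi>" using d by simp
  note A = alg_module[OF d] alg_module[OF d']
  note \<Delta> = pre_coactionD(2,3)[OF D]
  note e = e_map[OF D X] and c = c_map[OF D X] and ap = coact_ap[OF m(1) X]
  note S = tensor\<^sub>u_module[OF m] and S' = tensor\<^sub>u_module[OF m(2,1)]
  note s = antipode_linear'[OF d] note sc = linear_mapD(1)[OF s] and xc = repD(7)[OF X]
  have A1: "module K (alg H \<one>)" by simp
  note pb = pure\<^sub>u_bilinear[OF m] and pb' = pure\<^sub>u_bilinear[OF m(2,1)]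
  {
    fix v x assume v: "v \<in> elts V" and x: "x \<in> elts X"
    note al = antipode_lift[OF X x]
    \<comment> \<open>The scalar is moved from \<open>x\<close> to \<open>u\<close>, where the
      counit axiom applies.\<close>
    have unit1: "sweedler (tensor\<^sub>r V X) (\<lambda>u z. pure\<^sub>r V X u (counit H z \<odot>\<^bsub>space X\<^esub> x)) (\<Delta> \<one> v) = pure\<^sub>r V X v x"
    proof -
      have "sweedler (tensor\<^sub>r V X) (\<lambda>u z. pure\<^sub>r V X u (counit H z \<odot>\<^bsub>space X\<^esub> x)) (\<Delta> \<one> v) =
        sweedler (tensor\<^sub>r V X) (\<lambda>u z. pure\<^sub>r V X (counit H z \<odot>\<^bsub>space V\<^esub> u) x) (\<Delta> \<one> v)"
        by (rule sweedler_cong[OF m(1) A1 S \<Delta>(2)[OF P.one_closed v]])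
          (simp add: linear_mapD(3)[OF bilinear_mapD(1)[OF pb]] linear_mapD(3)[OF bilinear_mapD(2)[OF pb]] x)
      also have "\<dots> = pure\<^sub>r V X (sweedler (space V) (\<lambda>u x. counit H x \<odot>\<^bsub>space V\<^esub> u) (\<Delta> \<one> v)) x"
        by (rule linear_map_sweedler[OF m(1) A1 m(1) S bilinear_mapD(2)[OF pb x] \<Delta>(2)[OF P.one_closed v], symmetric]) (simp add: module.smult_closed[OF m(1)])
      finally show ?thesis using cu[OF v] by simp
    qed
    have unit2: "sweedler (tensor\<^sub>r X V) (\<lambda>u z. pure\<^sub>r X V (counit H z \<odot>\<^bsub>space X\<^esub> x) u) (\<Delta> \<one> v) = pure\<^sub>r X V x v"
    proof -
      have "sweedler (tensor\<^sub>r X V) (\<lambda>u z. pure\<^sub>r X V (counit H z \<odot>\<^bsub>space X\<^esub> x) u) (\<Delta> \<one> v) =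
        sweedler (tensor\<^sub>r X V) (\<lambda>u z. pure\<^sub>r X V x (counit H z \<odot>\<^bsub>space V\<^esub> u)) (\<Delta> \<one> v)"
        by (rule sweedler_cong[OF m(1) A1 S' \<Delta>(2)[OF P.one_closed v]])
          (simp add: linear_mapD(3)[OF bilinear_mapD(1)[OF pb']] linear_mapD(3)[OF bilinear_mapD(2)[OF pb']] x)
      also have "\<dots> = pure\<^sub>r X V x (sweedler (space V) (\<lambda>u x. counit H x \<odot>\<^bsub>space V\<^esub> u) (\<Delta> \<one> v))"
        by (rule linear_map_sweedler[OF m(1) A1 m(1) S' bilinear_mapD(1)[OF pb' x] \<Delta>(2)[OF P.one_closed v], symmetric]) (simp add: module.smult_closed[OF m(1)])
      finally show ?thesis using cu[OF v] by simp
    qed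
    let ?P = "tensor\<^sub>H (deg X) (inv (deg X))" and ?Q = "tensor\<^sub>H (inv (deg X)) (deg X)"
    let ?a = "sweedler (space X) (\<lambda>a b. act X a (act X (antipode H (inv (deg X)) b) x))"
      and ?b = "sweedler (space X) (\<lambda>b a. act X (antipode H (inv (deg X)) b) (act X a x))"
    note la = sweedler_linear[OF A m(2) al(1)] and lb = sweedler_linear[OF A(2,1) m(2) al(2)]
    \<comment> \<open>The bilinear map through which coassociativity is evaluated: both coefficients
      act on \<open>x\<close>, the one of inverse degree through the antipode.\<close>
    have B: "bilinear_map K (space V) ?P (tensor\<^sub>r V X) (\<lambda>u p. pure\<^sub>r V X u (?a p))"
      by (intro bilinear_mapI linear_map_comp[OF la] bilinear_mapD[OF pb] linear_mapD(1)[OF la])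
    have B': "bilinear_map K (space V) ?Q (tensor\<^sub>r X V) (\<lambda>u p. pure\<^sub>r X V (?b p) u)"
      by (intro bilinear_mapI linear_map_comp[OF lb] bilinear_mapD[OF pb'] linear_mapD(1)[OF lb])
    have 1: "e_map V \<Delta> X (br_ap V X t x) = sweedler (tensor\<^sub>r V X) (\<lambda>w b. coact_ap V X (\<Delta> (deg X) w) (act X (antipode H (inv (deg X)) b) x)) t"
      if t: "t \<in> carrier (tensor\<^sub>c V (inv (deg X)))" for t
    proof -
      have b: "bilinear_map K (space V) (alg H (inv (deg X))) (tensor\<^sub>r V X) (\<lambda>w b. coact_ap V X (\<Delta> (deg X) w) (act X (antipode H (inv (deg X)) b) x))"
        by (intro bilinear_mapI linear_map_comp[OF linear_map_comp[OF s repD(6)[OF X x]] bilinear_mapD(1)[OF ap(1)]] linear_map_comp[OF \<Delta>(1)[OF d] bilinear_mapD(2)[OF ap(1)]] \<Delta>(2)[OF d])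
          (simp_all add: xc sc x)
      show ?thesis
        by (rule tensor_ext[OF m(1) A(2) S linear_map_comp[OF bilinear_mapD(2)[OF c(4) x] e(1)] sweedler_linear[OF m(1) A(2) S b] _ t])
          (simp add: sweedler_pure[OF m(1) A(2) S b] c(5) x e(3) xc sc)
    qed
    have "e_map V \<Delta> X (c_map V \<Delta> X (pure\<^sub>r V X v x)) =
       sweedler (tensor\<^sub>r V X) (\<lambda>w b. sweedler (tensor\<^sub>r V X) (\<lambda>u a. pure\<^sub>r V X u (?a (pure\<^sub>H (deg X) (inv (deg X)) a b))) (\<Delta> (deg X) w)) (\<Delta> (inv (deg X)) v)"
      unfolding c(3)[OF x v] 1[OF \<Delta>(2)[OF d' v]] coact_ap_def
      by (intro sweedler_cong[OF m(1) A(2) S \<Delta>(2)[OF d' v]] sweedler_cong[OF m(1) A(1) S \<Delta>(2)[OF d]]) (simp_all add: sweedler_pure[OF A m(2) al(1)])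
    \<comment> \<open>Coassociativity. The product of the two degrees is \<open>\<one>\<close>, so
      the coproduct that appears is the one in the antipode axiom.\<close>
    also have "\<dots> = sweedler (tensor\<^sub>r V X) (\<lambda>u z. pure\<^sub>r V X u (?a (comult H (deg X) (inv (deg X)) z))) (\<Delta> (deg X \<otimes> inv (deg X)) v)"
      using coassoc_lift(1,2)[OF D S d d' B v] ca[OF d d' v] by simp
    also have "\<dots> = sweedler (tensor\<^sub>r V X) (\<lambda>u z. pure\<^sub>r V X u (counit H z \<odot>\<^bsub>space X\<^esub> x)) (\<Delta> \<one> v)"
      using d by (simp, intro sweedler_cong[OF m(1) A1 S \<Delta>(2)[OF P.one_closed v]]) (simp add: al(3))
    finally have E: "e_map V \<Delta> X (c_map V \<Delta> X (pure\<^sub>r V X v x)) = pure\<^sub>r V X v x"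
      unfolding unit1 .
    have 2: "c_map V \<Delta> X (coact_ap V X t x) = sweedler (tensor\<^sub>r X V) (\<lambda>w a. br_ap V X (\<Delta> (inv (deg X)) w) (act X a x)) t"
      if t: "t \<in> carrier (tensor\<^sub>c V (deg X))" for t
    proof -
      have b: "bilinear_map K (space V) (alg H (deg X)) (tensor\<^sub>r X V) (\<lambda>w a. br_ap V X (\<Delta> (inv (deg X)) w) (act X a x))"
        by (intro bilinear_mapI linear_map_comp[OF repD(6)[OF X x] bilinear_mapD(1)[OF c(4)]] linear_map_comp[OF \<Delta>(1)[OF d'] bilinear_mapD(2)[OF c(4)]] \<Delta>(2)[OF d'])
          (simp_all add: xc x)
      show ?thesis
        by (rule tensor_ext[OF m(1) A(1) S' linear_map_comp[OF bilinear_mapD(2)[OF ap(1) x] c(1)] sweedler_linear[OF m(1) A(1) S' b] _ t])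
          (simp add: sweedler_pure[OF m(1) A(1) S' b] ap(2) x c(3) xc)
    qed
    have "c_map V \<Delta> X (e_map V \<Delta> X (pure\<^sub>r X V x v)) =
       sweedler (tensor\<^sub>r X V) (\<lambda>w a. sweedler (tensor\<^sub>r X V) (\<lambda>u b. pure\<^sub>r X V (?b (pure\<^sub>H (inv (deg X)) (deg X) b a)) u) (\<Delta> (inv (deg X)) w)) (\<Delta> (deg X) v)"
      unfolding e(3)[OF x v] 2[OF \<Delta>(2)[OF d v]] br_ap_def
      by (intro sweedler_cong[OF m(1) A(1) S' \<Delta>(2)[OF d v]] sweedler_cong[OF m(1) A(2) S' \<Delta>(2)[OF d']]) (simp_all add: sweedler_pure[OF A(2,1) m(2) al(2)])
    also have "\<dots> = sweedler (tensor\<^sub>r X V) (\<lambda>u z. pure\<^sub>r X V (?b (comult H (inv (deg X)) (deg X) z)) u) (\<Delta> (inv (deg X) \<otimes> deg X) v)"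
      using coassoc_lift(1,2)[OF D S' d' d B' v] ca[OF d' d v] by simp
    also have "\<dots> = sweedler (tensor\<^sub>r X V) (\<lambda>u z. pure\<^sub>r X V (counit H z \<odot>\<^bsub>space X\<^esub> x) u) (\<Delta> \<one> v)"
      using d by (simp, intro sweedler_cong[OF m(1) A1 S' \<Delta>(2)[OF P.one_closed v]]) (simp add: al(4))
    finally have C: "c_map V \<Delta> X (e_map V \<Delta> X (pure\<^sub>r X V x v)) = pure\<^sub>r X V x v"
      unfolding unit2 .
    note E C
  }
  note EC = this
  show "e_map V \<Delta> X (c_map V \<Delta> X t) = t" if "t \<in> carrier (tensor\<^sub>r V X)"
    by (rule tensor\<^sub>u_ext[OF m S linear_map_comp[OF c(1) e(1)] linear_map_id _ that]) (rule EC(1))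
  show "c_map V \<Delta> X (e_map V \<Delta> X t) = t" if "t \<in> carrier (tensor\<^sub>r X V)"
    by (rule tensor\<^sub>u_ext[OF m(2,1) S' linear_map_comp[OF e(1) c(1)] linear_map_id _ that]) (rule EC(2))
qed

interpretation R: T_category \<pi> "Rep :: ('p, ('p, 'k, 'h, 'b) rep, ('p, 'k, 'h, 'b) rep_arrow) T_category"
  by (rule Rep_T_category)

lemma Rep_arrow_eqI:
  assumes "f \<in> arrows Rep U V" "g \<in> arrows Rep U V" "\<And>x. x \<in> elts U \<Longrightarrow> body f x = body g x"
  shows "f = g"
proof -
  obtain a b where e: "f = Arrow U V a" "g = Arrow U V b" "is_rep_map U V a" "is_rep_map U V b"
    using assms(1,2) by (auto simp: arrows_Rep)
  then have "a = b"
    using extensionalityI[OF rep_mapD(2)[OF e(3)] rep_mapD(2)[OF e(4)]] assms(3) by simp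
  then show ?thesis using e by simp
qed

lemma arrows_RepI: "\<lbrakk>is_rep U; is_rep V; is_rep_map U V f\<rbrakk> \<Longrightarrow> Arrow U V f \<in> arrows Rep U V"
  by (simp add: arrows_def)

definition to_center :: "('p, 'k, 'h, 'b) yd \<Rightarrow> ('p, 'k, 'h, 'b) rep \<times> (('p, 'k, 'h, 'b) rep \<Rightarrow> ('p, 'k, 'h, 'b) rep_arrow)" where
  "to_center A = (fst A, \<lambda>X\<in>{X. is_rep X}. Arrow (rep_tensor (fst A) X) (rep_tensor (rep_conj (deg (fst A)) X) (fst A))
     (c_map (fst A) (snd A) X))"

lemma ydD:
  assumes "is_yd (V, \<Delta>)"
  shows "pre_coaction V \<Delta>" "\<Delta> \<in> extensional (carrier \<pi>)" "\<mu> \<in> carrier \<pi> \<Longrightarrow> \<Delta> \<mu> \<in> extensional (elts V)"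
    "\<lbrakk>\<mu> \<in> carrier \<pi>; \<nu> \<in> carrier \<pi>; v \<in> elts V\<rbrakk> \<Longrightarrow> coassoc_lhs V \<Delta> \<mu> \<nu> v = coassoc_rhs V \<Delta> \<mu> \<nu> v"
    "v \<in> elts V \<Longrightarrow> sweedler (space V) (\<lambda>u x. counit H x \<odot>\<^bsub>space V\<^esub> u) (\<Delta> \<one> v) = v"
    "\<lbrakk>\<mu> \<in> carrier \<pi>; h \<in> coeffs (deg V \<otimes> \<mu>); v \<in> elts V\<rbrakk> \<Longrightarrow> yd_lhs V \<Delta> \<mu> h v = yd_rhs V \<Delta> \<mu> h v"
    "is_rep V"
  using assms pre_coactionD(1) unfolding is_yd_iff by blast+

text \<open>Linearity over the algebras is computed only for \<open>e_map\<close>;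
  \<open>c_map\<close>, whose formula contains the antipode, inherits it as the inverse map.\<close>

lemma yd_c_iso:
  fixes V X :: "('p, 'k, 'h, 'b) rep"
  assumes Y: "is_yd (V, \<Delta>)" and X: "is_rep X"
  shows "Arrow (rep_tensor V X) (rep_tensor (rep_conj (deg V) X) V) (c_map V \<Delta> X) \<in> isos Rep (rep_tensor V X) (rep_tensor (rep_conj (deg V) X) V)"
    "inv_arrow Rep (Arrow (rep_tensor V X) (rep_tensor (rep_conj (deg V) X) V) (c_map V \<Delta> X)) =
       Arrow (rep_tensor (rep_conj (deg V) X) V) (rep_tensor V X) (e_map V \<Delta> X)"
    "is_rep_map (rep_tensor (rep_conj (deg V) X) V) (rep_tensor V X) (e_map V \<Delta> X)"
    "is_rep_map (rep_tensor V X) (rep_tensor (rep_conj (deg V) X) V) (c_map V \<Delta> X)"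
proof -
  note D = ydD(1)[OF Y] and V = ydD(7)[OF Y]
  note X' = rep_conj_closed[OF X repD(1)[OF V]]
  note r = rep_tensor_closed[OF X' V] rep_tensor_closed[OF V X]
  show e: "is_rep_map (rep_tensor (rep_conj (deg V) X) V) (rep_tensor V X) (e_map V \<Delta> X)"
    by (rule is_rep_map_E[OF D X ydD(6)[OF Y repD(1)[OF X]]])
  have c: "restrict (c_map V \<Delta> X) (elts (rep_tensor V X)) = c_map V \<Delta> X"
    using c_map(2)[OF D X] by (simp add: extensional_restrict)
  note i = Rep_isoI[where g = "c_map V \<Delta> X", OF r e, unfolded c]
  have pre: "\<And>v. v \<in> elts (rep_tensor V X) \<Longrightarrow> c_map V \<Delta> X v \<in> elts (rep_tensor (rep_conj (deg V) X) V)"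
    "\<And>v. v \<in> elts (rep_tensor V X) \<Longrightarrow> e_map V \<Delta> X (c_map V \<Delta> X v) = v"
    "\<And>u. u \<in> elts (rep_tensor (rep_conj (deg V) X) V) \<Longrightarrow> c_map V \<Delta> X (e_map V \<Delta> X u) = u"
    using linear_mapD(1)[OF c_map(1)[OF D X]] e_c_inverse[OF Y X] by simp_all
  have i1: "Arrow (rep_tensor (rep_conj (deg V) X) V) (rep_tensor V X) (e_map V \<Delta> X) \<in> isos Rep (rep_tensor (rep_conj (deg V) X) V) (rep_tensor V X)"
    by (rule i(1)) (fact pre)+
  have i2: "inv_arrow Rep (Arrow (rep_tensor (rep_conj (deg V) X) V) (rep_tensor V X) (e_map V \<Delta> X)) = Arrow (rep_tensor V X) (rep_tensor (rep_conj (deg V) X) V) (c_map V \<Delta> X)"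
    by (rule i(2)) (fact pre)+
  show "is_rep_map (rep_tensor V X) (rep_tensor (rep_conj (deg V) X) V) (c_map V \<Delta> X)" by (rule i(3)) (fact pre)+
  show "Arrow (rep_tensor V X) (rep_tensor (rep_conj (deg V) X) V) (c_map V \<Delta> X) \<in> isos Rep (rep_tensor V X) (rep_tensor (rep_conj (deg V) X) V)"
    using R.inv_isos[OF i1] unfolding i2 .
  show "inv_arrow Rep (Arrow (rep_tensor V X) (rep_tensor (rep_conj (deg V) X) V) (c_map V \<Delta> X)) =
       Arrow (rep_tensor (rep_conj (deg V) X) V) (rep_tensor V X) (e_map V \<Delta> X)"
    using R.inv_inv_arrow[OF i1] unfolding i2 .
qed

text \<open>Arrows out of a threefold tensor product are determined by their values on pure tensors,
  where the two sides are known from \<open>coact_ap2\<close> and \<open>e_map_TenO_rhs\<close>. The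
  equivalence is applied in both directions, from coactions to half braidings and back.\<close>

lemma e_map_TenO_iff:
  fixes V X Y :: "('p, 'k, 'h, 'b) rep"
  assumes D: "pre_coaction V \<Delta>" and X: "is_rep X" and Y: "is_rep Y"
    and e: "\<And>X. is_rep X \<Longrightarrow> is_rep_map (rep_tensor (rep_conj (deg V) X) V) (rep_tensor V X) (e_map V \<Delta> X)"
  defines "E \<equiv> \<lambda>X. Arrow (rep_tensor (rep_conj (deg V) X) V) (rep_tensor V X) (e_map V \<Delta> X)"
  shows "E (rep_tensor X Y) = Comp Rep (Assoc Rep V X Y) (Comp Rep (TenA Rep (E X) (Ident Rep Y)) (Comp Rep
      (inv_arrow Rep (Assoc Rep (rep_conj (deg V) X) V Y)) (Comp Rep (TenA Rep (Ident Rep (rep_conj (deg V) X)) (E Y))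
      (Assoc Rep (rep_conj (deg V) X) (rep_conj (deg V) Y) V)))) \<longleftrightarrow>
    (\<forall>x\<in>carrier (space X). \<forall>y\<in>carrier (space Y). \<forall>v\<in>carrier (space V).
      coact_ap2 V X Y x y (coassoc_lhs V \<Delta> (deg X) (deg Y) v) = coact_ap2 V X Y x y (coassoc_rhs V \<Delta> (deg X) (deg Y) v))"
    (is "_ = ?r \<longleftrightarrow> _")
proof -
  note V = pre_coactionD(1)[OF D] note d = repD(1)[OF V]
  note X' = rep_conj_closed[OF X d] and Y' = rep_conj_closed[OF Y d]
  note m = repD(2)[OF V] repD(2)[OF X] repD(2)[OF Y]
  note XY = rep_tensor_closed[OF X Y]
  let ?S = "rep_tensor (rep_tensor (rep_conj (deg V) X) (rep_conj (deg V) Y)) V" let ?T = "rep_tensor V (rep_tensor X Y)"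
  have EA: "E X \<in> arrows Rep (rep_tensor (rep_conj (deg V) X) V) (rep_tensor V X)" if X: "is_rep X" for X
    unfolding E_def by (rule arrows_RepI) (simp_all add: rep_tensor_closed rep_conj_closed X V d e)
  have "TenO Rep (TenO Rep (rep_conj (deg V) X) (rep_conj (deg V) Y)) V = ?S" by simp
  have o: "V \<in> Obj Rep" "X \<in> Obj Rep" "Y \<in> Obj Rep" "rep_conj (deg V) X \<in> Obj Rep" "rep_conj (deg V) Y \<in> Obj Rep"
    using V X Y X' Y' by simp_all
  have r: "?r \<in> arrows Rep ?S ?T"
  proof -
    note a1 = R.isos_arrows[OF R.Assoc_iso[OF o(4,5,1)]] and a2 = R.isos_arrows[OF R.inv_isos[OF R.Assoc_iso[OF o(4,1,3)]]]
      and a3 = R.isos_arrows[OF R.Assoc_iso[OF o(1-3)]]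
    note t1 = R.TenA_closed[OF R.Ident_closed[OF o(4)] EA[OF Y]] and t2 = R.TenA_closed[OF EA[OF X] R.Ident_closed[OF o(3)]]
    have "?r \<in> arrows Rep (TenO Rep (TenO Rep (rep_conj (deg V) X) (rep_conj (deg V) Y)) V) (TenO Rep V (TenO Rep X Y))"
      by (rule R.Comp_closed[OF R.Comp_closed[OF R.Comp_closed[OF R.Comp_closed[OF a1]]] a3])
        (use t1 t2 a2 in \<open>simp_all only: Rep_simps(7)\<close>)
    then show ?thesis by simp
  qed
  have l: "E (rep_tensor X Y) \<in> arrows Rep ?S ?T"
    using EA[OF XY] by (simp add: rep_conj_tensor[OF X Y d])
  obtain g where g: "?r = Arrow ?S ?T g" "is_rep_map ?S ?T g" using r by (auto simp: arrows_Rep)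
  note eXY = e_map[OF D XY, simplified]
  note gl = rep_mapD(3)[OF g(2), simplified]
  note b = e_map_TenO_rhs[OF D X Y, unfolded g(1)[unfolded E_def] arrow.sel]
  note lhs = coact_ap2(2)[OF D X Y]
  show ?thesis
  proof
    assume eq: "E (rep_tensor X Y) = ?r"
    then have "e_map V \<Delta> (rep_tensor X Y) = g" unfolding g(1) by (simp add: E_def)
    then show "\<forall>x\<in>carrier (space X). \<forall>y\<in>carrier (space Y). \<forall>v\<in>carrier (space V).
      coact_ap2 V X Y x y (coassoc_lhs V \<Delta> (deg X) (deg Y) v) = coact_ap2 V X Y x y (coassoc_rhs V \<Delta> (deg X) (deg Y) v)"
      using b lhs by simp
  next
    assume a: "\<forall>x\<in>carrier (space X). \<forall>y\<in>carrier (space Y). \<forall>v\<in>carrier (space V).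
      coact_ap2 V X Y x y (coassoc_lhs V \<Delta> (deg X) (deg Y) v) = coact_ap2 V X Y x y (coassoc_rhs V \<Delta> (deg X) (deg Y) v)"
    show "E (rep_tensor X Y) = ?r"
    proof (rule Rep_arrow_eqI[OF l r])
      fix t assume "t \<in> elts ?S"
      then have t: "t \<in> carrier (tensor\<^sub>u K (tensor\<^sub>r X Y) (space V))" by simp
      have "e_map V \<Delta> (rep_tensor X Y) t = g t"
        by (rule tensor\<^sub>u_ext3[OF m(2,3,1) tensor\<^sub>u_module[OF m(1) tensor\<^sub>u_module[OF m(2,3)]] eXY(1) gl _ t]) (use a b lhs in simp)
      then show "body (E (rep_tensor X Y)) t = body ?r t" unfolding g(1) by (simp add: E_def)
    qed
  qed
qed

text \<open>By \<open>half_braiding_inverse_iff\<close> it suffices to treat \<open>e_map\<close>: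
  multiplicativity is coassociativity by \<open>e_map_TenO_iff\<close>, and naturality holds because
  morphisms of representations commute with the action of the coefficients.\<close>

lemma to_center_closed:
  fixes A :: "('p, 'k, 'h, 'b) yd"
  assumes "is_yd A"
  shows "to_center A \<in> R.center_obj"
proof -
  obtain V \<Delta> where A: "A = (V, \<Delta>)" by (cases A)
  note Y = assms[unfolded A] note D = ydD(1)[OF Y] and V = ydD(7)[OF Y] note d = repD(1)[OF V]
  let ?c = "\<lambda>X\<in>{X. is_rep X}. Arrow (rep_tensor V X) (rep_tensor (rep_conj (deg V) X) V) (c_map V \<Delta> X)"
  let ?E = "\<lambda>X. Arrow (rep_tensor (rep_conj (deg V) X) V) (rep_tensor V X) (e_map V \<Delta> X)"
  note e = yd_c_iso(3)[OF Y]
  have inv: "inv_arrow Rep (?c X) = ?E X" if "is_rep X" for X using yd_c_iso(2)[OF Y that] that by simp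
  have "R.half_braiding V ?c"
  proof (subst R.half_braiding_inverse_iff)
    show "V \<in> Obj Rep" "?c \<in> extensional (Obj Rep)" using V by simp_all
    show "?c X \<in> isos Rep (TenO Rep V X) (TenO Rep (actO Rep V X) V)" if "X \<in> Obj Rep" for X
      using yd_c_iso(1)[OF Y] that by simp
    show "(\<forall>f\<in>Arr Rep. Comp Rep (inv_arrow Rep (?c (Cod Rep f))) (TenA Rep (actA Rep V f) (Ident Rep V)) =
         Comp Rep (TenA Rep (Ident Rep V) f) (inv_arrow Rep (?c (Dom Rep f)))) \<and>
     (\<forall>X\<in>Obj Rep. \<forall>Y\<in>Obj Rep. inv_arrow Rep (?c (TenO Rep X Y)) =
        Comp Rep (Assoc Rep V X Y) (Comp Rep (TenA Rep (inv_arrow Rep (?c X)) (Ident Rep Y)) (Comp Rep (inv_arrow Rep (Assoc Rep (actO Rep V X) V Y))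
          (Comp Rep (TenA Rep (Ident Rep (actO Rep V X)) (inv_arrow Rep (?c Y))) (Assoc Rep (actO Rep V X) (actO Rep V Y) V)))))"
    proof (intro conjI ballI)
      fix X Y :: "('p, 'k, 'h, 'b) rep" assume "X \<in> Obj Rep" "Y \<in> Obj Rep"
      then have X: "is_rep X" and Y': "is_rep Y" by simp_all
      show "inv_arrow Rep (?c (TenO Rep X Y)) =
        Comp Rep (Assoc Rep V X Y) (Comp Rep (TenA Rep (inv_arrow Rep (?c X)) (Ident Rep Y)) (Comp Rep (inv_arrow Rep (Assoc Rep (actO Rep V X) V Y))
          (Comp Rep (TenA Rep (Ident Rep (actO Rep V X)) (inv_arrow Rep (?c Y))) (Assoc Rep (actO Rep V X) (actO Rep V Y) V))))"
        unfolding act_Rep Rep_simps(7) inv[OF X] inv[OF Y'] inv[OF rep_tensor_closed[OF X Y']]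
        by (rule e_map_TenO_iff[OF D X Y' e, THEN iffD2]) (simp_all add: ydD(4)[OF Y] repD(1) X Y')
    next
      fix f assume "f \<in> Arr (Rep :: ('p, ('p, 'k, 'h, 'b) rep, ('p, 'k, 'h, 'b) rep_arrow) T_category)"
      then obtain X Z a where f: "f = Arrow X Z a" and r: "is_rep X" "is_rep Z" and a: "is_rep_map X Z a" by auto
      note m = repD(2)[OF V] repD(2)[OF r(1)] repD(2)[OF r(2)]
      have idV: "linear_map K (space V) (space V) (\<lambda>u\<in>carrier (space V). u)" by (rule rep_mapD(3)[OF rep_map_id[OF V]])
      note eX = e_map[OF D r(1)] and eZ = e_map[OF D r(2)]
      note t1 = map_tensor[OF m(2,1,3,1) rep_mapD(3)[OF a] idV] and t2 = map_tensor[OF m(1,2,1,3) idV rep_mapD(3)[OF a]]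
      note ap = coact_ap[OF m(1) r(1)] and ap' = coact_ap[OF m(1) r(2)]
      have dd: "deg Z = deg X" using rep_mapD(1)[OF a] by simp
      note dX = repD(1)[OF r(1)]
      \<comment> \<open>Naturality for an arbitrary element \<open>s\<close> in place of the
        coaction of \<open>v\<close>.\<close>
      have c: "coact_ap V Z s (a x) = map_tensor (space V) (space X) (space V) (space Z) (\<lambda>u\<in>carrier (space V). u) a (coact_ap V X s x)"
        if s: "s \<in> carrier (tensor\<^sub>c V (deg X))" and x: "x \<in> elts X" for s x
        by (rule tensor_ext[OF m(1) alg_module[OF dX] tensor\<^sub>u_module[OF m(1,3)] bilinear_mapD(2)[OF ap'(1)[unfolded dd] rep_mapD(5)[OF a x]]
              linear_map_comp[OF bilinear_mapD(2)[OF ap(1) x] t2(1)] _ s])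
          (simp add: ap(2) ap'(2)[unfolded dd] x rep_mapD(5)[OF a] t2(3) rep_mapD(4)[OF a] repD(7)[OF r(1)])
      have "e_map V \<Delta> Z (map_tensor (space X) (space V) (space Z) (space V) a (\<lambda>u\<in>carrier (space V). u) t) =
         map_tensor (space V) (space X) (space V) (space Z) (\<lambda>u\<in>carrier (space V). u) a (e_map V \<Delta> X t)"
        if t: "t \<in> carrier (tensor\<^sub>r X V)" for t
        by (rule tensor\<^sub>u_ext[OF m(2,1) tensor\<^sub>u_module[OF m(1,3)] linear_map_comp[OF t1(1) eZ(1)] linear_map_comp[OF eX(1) t2(1)] _ t])
          (simp add: t1(3) eZ(3) eX(3) rep_mapD(5)[OF a] dd c pre_coactionD(3)[OF D dX])
      then have "compose (carrier (tensor\<^sub>r X V)) (e_map V \<Delta> Z) (map_tensor (space X) (space V) (space Z) (space V) a (\<lambda>u\<in>carrier (space V). u)) =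
         compose (carrier (tensor\<^sub>r X V)) (map_tensor (space V) (space X) (space V) (space Z) (\<lambda>u\<in>carrier (space V). u) a) (e_map V \<Delta> X)"
        by (intro extensionalityI[where A = "carrier (tensor\<^sub>r X V)"]) (simp_all add: compose_eq)
      then show "Comp Rep (inv_arrow Rep (?c (Cod Rep f))) (TenA Rep (actA Rep V f) (Ident Rep V)) =
         Comp Rep (TenA Rep (Ident Rep V) f) (inv_arrow Rep (?c (Dom Rep f)))"
        unfolding f Rep_simps(3,4) arrow.sel inv[OF r(1)] inv[OF r(2)] by simp
    qed
  qed
  then show ?thesis using V by (simp add: R.center_obj_def to_center_def A)
qed

subsection \<open>From half braidings to Yetter-Drinfeld modules\<close>

abbreviation "unCoef \<equiv> inv_into UNIV Coef"

lemma unCoef [simp]: "unCoef (Coef h) = h"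
  by (rule inv_f_f[OF inj_univ(2)])

text \<open>The left regular representation, carried by a copy of the algebra inside the universe;
  it is an object of \<open>Rep\<close> because the universe contains the coefficients through
  \<open>Coef\<close>.\<close>

definition reg :: "'p \<Rightarrow> ('p, 'k, 'h, 'b) rep" where
  "reg \<mu> = \<lparr>deg = \<mu>, space = coef_space \<mu>,
     act = (\<lambda>h\<in>carrier (alg H \<mu>). \<lambda>x\<in>Coef ` coeffs \<mu>. Coef (h \<otimes>\<^bsub>alg H \<mu>\<^esub> unCoef x))\<rparr>"

lemma reg_simps [simp]:
  "deg (reg \<mu>) = \<mu>" "space (reg \<mu>) = coef_space \<mu>"
  "\<lbrakk>h \<in> coeffs \<mu>; a \<in> coeffs \<mu>\<rbrakk> \<Longrightarrow> act (reg \<mu>) h (Coef a) = Coef (h \<otimes>\<^bsub>alg H \<mu>\<^esub> a)"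
  by (simp_all add: reg_def)

lemma Coef_linear:
  assumes "\<mu> \<in> carrier \<pi>"
  shows "linear_map K (alg H \<mu>) (coef_space \<mu>) Coef" "linear_map K (coef_space \<mu>) (alg H \<mu>) unCoef"
    "module K (coef_space \<mu>)" "carrier (coef_space \<mu>) = Coef ` coeffs \<mu>"
  using copy_module_linear[OF inj_univ(2) alg_module[OF assms]] copy_module_inv_linear[OF inj_univ(2) alg_module[OF assms] unCoef]
    copy_module[OF inj_univ(2) alg_module[OF assms]] copy_module_simps(1)[OF inj_univ(2) alg_module[OF assms]] .

lemma reg_rep:
  assumes \<mu>: "\<mu> \<in> carrier \<pi>"
  shows "is_rep (reg \<mu>)"
proof (rule repI)
  note C = Coef_linear[OF \<mu>]
  show "bilinear_map K (alg H (deg (reg \<mu>))) (space (reg \<mu>)) (space (reg \<mu>)) (act (reg \<mu>))"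
  proof (rule bilinear_mapI)
    fix h assume h: "h \<in> coeffs (deg (reg \<mu>))"
    show "linear_map K (space (reg \<mu>)) (space (reg \<mu>)) (act (reg \<mu>) h)"
      unfolding reg_simps
      by (rule linear_map_cong[OF linear_map_comp[OF linear_map_comp[OF C(2) mult_linear(1)[OF \<mu>, of h]] C(1)] C(3)])
        (use h in \<open>auto simp: C(4)\<close>)
  next
    fix x assume "x \<in> elts (reg \<mu>)"
    then obtain a where a: "x = Coef a" "a \<in> coeffs \<mu>" by (auto simp: C(4))
    show "linear_map K (alg H (deg (reg \<mu>))) (space (reg \<mu>)) (\<lambda>h. act (reg \<mu>) h x)"
      unfolding reg_simps
      by (rule linear_map_cong[OF linear_map_comp[OF mult_linear(2)[OF \<mu> a(2)] C(1)]]) (use a \<mu> in auto)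
  qed
  show "act (reg \<mu>) \<in> extensional (coeffs (deg (reg \<mu>)))" by (simp add: reg_def)
  show "act (reg \<mu>) h \<in> extensional (elts (reg \<mu>))" if "h \<in> coeffs (deg (reg \<mu>))" for h
    using that by (simp add: reg_def C(4))
  fix x assume "x \<in> elts (reg \<mu>)"
  then obtain a where a: "x = Coef a" "a \<in> coeffs \<mu>" by (auto simp: C(4))
  show "act (reg \<mu>) \<one>\<^bsub>alg H (deg (reg \<mu>))\<^esub> x = x" using a \<mu> by simp
  fix h h' assume "h \<in> coeffs (deg (reg \<mu>))" "h' \<in> coeffs (deg (reg \<mu>))"
  then show "act (reg \<mu>) (h \<otimes>\<^bsub>alg H (deg (reg \<mu>))\<^esub> h') x = act (reg \<mu>) h (act (reg \<mu>) h' x)"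
    using a \<mu> by (simp add: alg_mult_assoc)
qed (use \<mu> Coef_linear in simp_all)

definition orb :: "('p, 'k, 'h, 'b) rep \<Rightarrow> ('k, 'h, 'b) univ \<Rightarrow> ('k, 'h, 'b) univ \<Rightarrow> ('k, 'h, 'b) univ" where
  "orb X x = (\<lambda>y\<in>Coef ` coeffs (deg X). act X (unCoef y) x)"

text \<open>The regular representation is free on the unit. These morphisms carry the unit to
  arbitrary elements of arbitrary representations, so a natural family is controlled by its values
  at the unit.\<close>

lemma orb:
  fixes X :: "('p, 'k, 'h, 'b) rep"
  assumes X: "is_rep X" and x: "x \<in> elts X"
  shows "is_rep_map (reg (deg X)) X (orb X x)" "a \<in> coeffs (deg X) \<Longrightarrow> orb X x (Coef a) = act X a x"
proof -
  note d = repD(1)[OF X] note C = Coef_linear[OF d]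
  show "a \<in> coeffs (deg X) \<Longrightarrow> orb X x (Coef a) = act X a x" for a by (simp add: orb_def)
  show "is_rep_map (reg (deg X)) X (orb X x)"
  proof (rule rep_mapI)
    show "orb X x \<in> extensional (elts (reg (deg X)))" by (simp add: orb_def C(4))
    show "linear_map K (space (reg (deg X))) (space X) (orb X x)"
      unfolding reg_simps by (rule linear_map_cong[OF linear_map_comp[OF C(2) repD(6)[OF X x]] C(3)]) (simp add: orb_def C(4))
    fix h and y :: "('k, 'h, 'b) univ" assume "h \<in> coeffs (deg (reg (deg X)))" "y \<in> elts (reg (deg X))"
    then show "orb X x (act (reg (deg X)) h y) = act X h (orb X x y)"
      using d x by (auto simp: orb_def repD(5)[OF X] C(4))
  qed simp
qed

text \<open>Removes the constructor \<open>Coef\<close> from the second tensor factor: arrows of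
  \<open>Rep\<close> take values in the tensor product with the copied algebra, coactions in the
  tensor product with the algebra itself.\<close>

definition coef_ten :: "('p, 'k, 'h, 'b) rep \<Rightarrow> 'p \<Rightarrow> ('k, 'h, 'b) univ \<Rightarrow> (('k, 'h, 'b) univ \<times> 'h) list" where
  "coef_ten V \<mu> = sweedler\<^sub>u (tensor\<^sub>c V \<mu>) (\<lambda>u y. pure\<^sub>c V \<mu> u (unCoef y))"

text \<open>The last claim is the injectivity behind the correspondence: an element of the tensor
  product of \<open>V\<close> with the algebra is recovered from its action on the unit of the
  regular representation.\<close>

lemma coef_ten:
  fixes V :: "('p, 'k, 'h, 'b) rep"
  assumes V: "is_rep V" and \<mu>: "\<mu> \<in> carrier \<pi>"
  shows "linear_map K (tensor\<^sub>u K (space V) (coef_space \<mu>)) (tensor\<^sub>c V \<mu>) (coef_ten V \<mu>)"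
    "\<lbrakk>u \<in> elts V; a \<in> coeffs \<mu>\<rbrakk> \<Longrightarrow>
      coef_ten V \<mu> (pure\<^sub>u K (space V) (coef_space \<mu>) u (Coef a)) = pure\<^sub>c V \<mu> u a"
    "t \<in> carrier (tensor\<^sub>c V \<mu>) \<Longrightarrow> coef_ten V \<mu> (coact_ap V (reg \<mu>) t (Coef \<one>\<^bsub>alg H \<mu>\<^esub>)) = t"
proof -
  note C = Coef_linear[OF \<mu>] and m = repD(2)[OF V] and A = alg_module[OF \<mu>]
  note T = tensor_module[OF m A]
  have b: "bilinear_map K (space V) (coef_space \<mu>) (tensor\<^sub>c V \<mu>) (\<lambda>u y. pure\<^sub>c V \<mu> u (unCoef y))"
    by (intro lin C(2)) (use m A in \<open>auto simp: C(4)\<close>)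
  show l: "linear_map K (tensor\<^sub>u K (space V) (coef_space \<mu>)) (tensor\<^sub>c V \<mu>) (coef_ten V \<mu>)"
    unfolding coef_ten_def by (rule sweedler\<^sub>u_linear[OF m C(3) T b])
  have p: "coef_ten V \<mu> (pure\<^sub>u K (space V) (coef_space \<mu>) u (Coef a)) = pure\<^sub>c V \<mu> u a"
    if "u \<in> elts V" "a \<in> coeffs \<mu>" for u a
    unfolding coef_ten_def using that by (subst sweedler\<^sub>u_pure\<^sub>u[OF m C(3) T b]) (auto simp: C(4))
  then show "\<lbrakk>u \<in> elts V; a \<in> coeffs \<mu>\<rbrakk> \<Longrightarrow>
      coef_ten V \<mu> (pure\<^sub>u K (space V) (coef_space \<mu>) u (Coef a)) = pure\<^sub>c V \<mu> u a" .
  note ap = coact_ap[OF m reg_rep[OF \<mu>], unfolded reg_simps]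
  have one: "Coef \<one>\<^bsub>alg H \<mu>\<^esub> \<in> carrier (coef_space \<mu>)" using \<mu> by (simp add: C(4))
  show "coef_ten V \<mu> (coact_ap V (reg \<mu>) t (Coef \<one>\<^bsub>alg H \<mu>\<^esub>)) = t" if t: "t \<in> carrier (tensor\<^sub>c V \<mu>)"
    by (rule tensor_ext[OF m A T linear_map_comp[OF bilinear_mapD(2)[OF ap(1) one] l] linear_map_id _ t])
      (simp add: one \<mu> ap(2) p)
qed

definition from_center :: "('p, 'k, 'h, 'b) rep \<times> (('p, 'k, 'h, 'b) rep \<Rightarrow> ('p, 'k, 'h, 'b) rep_arrow) \<Rightarrow> ('p, 'k, 'h, 'b) yd" where
  "from_center Z = (fst Z, \<lambda>\<mu>\<in>carrier \<pi>. \<lambda>v\<in>carrier (space (fst Z)).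
     coef_ten (fst Z) \<mu> (body (inv_arrow Rep (snd Z (reg \<mu>)))
       (pure\<^sub>u K (coef_space \<mu>) (space (fst Z)) (Coef \<one>\<^bsub>alg H \<mu>\<^esub>) v)))"

lemma center_inv_arrow:
  fixes V X :: "('p, 'k, 'h, 'b) rep"
  assumes Z: "(V, c) \<in> R.center_obj" and X: "is_rep X"
  obtains e where "inv_arrow Rep (c X) = Arrow (rep_tensor (rep_conj (deg V) X) V) (rep_tensor V X) e"
    "is_rep_map (rep_tensor (rep_conj (deg V) X) V) (rep_tensor V X) e"
proof -
  have "c X \<in> isos Rep (TenO Rep V X) (TenO Rep (actO Rep V X) V)"
    using Z X by (auto simp: R.center_obj_def R.half_braiding_def)
  then have "inv_arrow Rep (c X) \<in> arrows Rep (TenO Rep (actO Rep V X) V) (TenO Rep V X)"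
    by (rule R.isos_arrows[OF R.inv_isos])
  then show thesis using that by (auto simp: arrows_Rep)
qed

lemma center_inverse:
  fixes V X Y :: "('p, 'k, 'h, 'b) rep"
  assumes Z: "(V, c) \<in> R.center_obj"
  shows "f \<in> Arr Rep \<Longrightarrow> Comp Rep (inv_arrow Rep (c (Cod Rep f))) (TenA Rep (actA Rep V f) (Ident Rep V)) =
         Comp Rep (TenA Rep (Ident Rep V) f) (inv_arrow Rep (c (Dom Rep f)))"
    "\<lbrakk>is_rep X; is_rep Y\<rbrakk> \<Longrightarrow> inv_arrow Rep (c (TenO Rep X Y)) =
        Comp Rep (Assoc Rep V X Y) (Comp Rep (TenA Rep (inv_arrow Rep (c X)) (Ident Rep Y)) (Comp Rep (inv_arrow Rep (Assoc Rep (actO Rep V X) V Y))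
          (Comp Rep (TenA Rep (Ident Rep (actO Rep V X)) (inv_arrow Rep (c Y))) (Assoc Rep (actO Rep V X) (actO Rep V Y) V))))"
proof -
  have V: "V \<in> Obj Rep" and hb: "R.half_braiding V c" using Z by (auto simp: R.center_obj_def)
  have ext: "c \<in> extensional (Obj Rep)"
    using hb unfolding R.half_braiding_def by (elim conjE)
  have "\<forall>X\<in>Obj Rep. c X \<in> isos Rep (TenO Rep V X) (TenO Rep (actO Rep V X) V)"
    using hb unfolding R.half_braiding_def by (elim conjE)
  then have iso: "c X \<in> isos Rep (TenO Rep V X) (TenO Rep (actO Rep V X) V)" if "X \<in> Obj Rep" for X using that by blast
  note i = R.half_braiding_inverse_iff[OF V ext iso, THEN iffD1, OF _ hb]
  show "f \<in> Arr Rep \<Longrightarrow> Comp Rep (inv_arrow Rep (c (Cod Rep f))) (TenA Rep (actA Rep V f) (Ident Rep V)) =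
         Comp Rep (TenA Rep (Ident Rep V) f) (inv_arrow Rep (c (Dom Rep f)))"
    by (rule conjunct1[OF i, rule_format])
  show "inv_arrow Rep (c (TenO Rep X Y)) =
        Comp Rep (Assoc Rep V X Y) (Comp Rep (TenA Rep (inv_arrow Rep (c X)) (Ident Rep Y)) (Comp Rep (inv_arrow Rep (Assoc Rep (actO Rep V X) V Y))
          (Comp Rep (TenA Rep (Ident Rep (actO Rep V X)) (inv_arrow Rep (c Y))) (Assoc Rep (actO Rep V X) (actO Rep V Y) V))))"
    if X: "is_rep X" and Y: "is_rep Y"
    by (rule conjunct2[OF i, rule_format]) (use X Y in simp_all)
qed

text \<open>Naturality with respect to \<open>orb X x\<close> reduces the inverse half braiding on
  the pure tensor of \<open>x\<close> and \<open>v\<close> to its value on the unit of the regular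
  representation and \<open>v\<close>, which is the coaction by definition.\<close>

lemma from_center_e_map:
  fixes V X :: "('p, 'k, 'h, 'b) rep"
  assumes Z: "(V, c) \<in> R.center_obj"
  shows "pre_coaction V (snd (from_center (V, c)))"
    "is_rep X \<Longrightarrow> inv_arrow Rep (c X) = Arrow (rep_tensor (rep_conj (deg V) X) V) (rep_tensor V X) (e_map V (snd (from_center (V, c))) X)"
proof -
  let ?\<Delta> = "snd (from_center (V, c))"
  have V: "is_rep V" and hb: "R.half_braiding V c" using Z by (auto simp: R.center_obj_def)
  note m = repD(2)[OF V] and d = repD(1)[OF V]
  {
    fix \<mu> assume \<mu>: "\<mu> \<in> carrier \<pi>"
    note C = Coef_linear[OF \<mu>]
    have one: "Coef \<one>\<^bsub>alg H \<mu>\<^esub> \<in> carrier (coef_space \<mu>)" using \<mu> by (simp add: C(4))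
    obtain e where e: "inv_arrow Rep (c (reg \<mu>)) = Arrow (rep_tensor (rep_conj (deg V) (reg \<mu>)) V) (rep_tensor V (reg \<mu>)) e"
      "is_rep_map (rep_tensor (rep_conj (deg V) (reg \<mu>)) V) (rep_tensor V (reg \<mu>)) e"
      using center_inv_arrow[OF Z reg_rep[OF \<mu>]] .
    have "linear_map K (space V) (tensor\<^sub>c V \<mu>) (\<lambda>v. coef_ten V \<mu> (e (pure\<^sub>u K (coef_space \<mu>) (space V) (Coef \<one>\<^bsub>alg H \<mu>\<^esub>) v)))"
      by (rule linear_map_comp[OF linear_map_comp[OF bilinear_mapD(1)[OF pure\<^sub>u_bilinear[OF C(3) m] one] rep_mapD(3)[OF e(2), simplified]] coef_ten(1)[OF V \<mu>]])
    then have "linear_map K (space V) (tensor\<^sub>c V \<mu>) (?\<Delta> \<mu>)"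
      by (rule linear_map_cong[OF _ m]) (simp add: from_center_def \<mu> e(1))
  }
  then show D: "pre_coaction V ?\<Delta>" using V by (simp add: pre_coaction_def)
  assume X: "is_rep X"
  note mX = repD(2)[OF X] and dX = repD(1)[OF X]
  note C = Coef_linear[OF dX]
  have one: "Coef \<one>\<^bsub>alg H (deg X)\<^esub> \<in> carrier (coef_space (deg X))" using dX by (simp add: C(4))
  obtain e where e: "inv_arrow Rep (c X) = Arrow (rep_tensor (rep_conj (deg V) X) V) (rep_tensor V X) e"
    "is_rep_map (rep_tensor (rep_conj (deg V) X) V) (rep_tensor V X) e" using center_inv_arrow[OF Z X] .
  obtain e' where e': "inv_arrow Rep (c (reg (deg X))) = Arrow (rep_tensor (rep_conj (deg V) (reg (deg X))) V) (rep_tensor V (reg (deg X))) e'"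
    "is_rep_map (rep_tensor (rep_conj (deg V) (reg (deg X))) V) (rep_tensor V (reg (deg X))) e'" using center_inv_arrow[OF Z reg_rep[OF dX]] .
  have nat: "Comp Rep (inv_arrow Rep (c (Cod Rep f))) (TenA Rep (actA Rep V f) (Ident Rep V)) =
         Comp Rep (TenA Rep (Ident Rep V) f) (inv_arrow Rep (c (Dom Rep f)))" if "f \<in> Arr Rep" for f
    using center_inverse(1)[OF Z that] .
  note idV = rep_mapD(3)[OF rep_map_id[OF V]]
  have key: "e (pure\<^sub>r X V x v) = coact_ap V X (?\<Delta> (deg X) v) x"
    if x: "x \<in> elts X" and v: "v \<in> elts V" for x v
  proof -
    note o = orb[OF X x] note ol = rep_mapD(3)[OF o(1), simplified]
    note t1 = map_tensor[OF C(3) m mX m ol idV] and t2 = map_tensor[OF m C(3) m mX idV ol]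
    let ?y = "pure\<^sub>u K (coef_space (deg X)) (space V) (Coef \<one>\<^bsub>alg H (deg X)\<^esub>) v"
    have y: "?y \<in> carrier (tensor\<^sub>u K (coef_space (deg X)) (space V))" by (rule pure\<^sub>u_closed[OF C(3) m one v])
    have "Arrow (reg (deg X)) X (orb X x) \<in> Arr Rep" using o(1) X reg_rep[OF dX] by simp
    from nat[OF this] have "compose (carrier (tensor\<^sub>u K (coef_space (deg X)) (space V))) e (map_tensor (coef_space (deg X)) (space V) (space X) (space V) (orb X x) (\<lambda>u\<in>carrier (space V). u)) =
      compose (carrier (tensor\<^sub>u K (coef_space (deg X)) (space V))) (map_tensor (space V) (coef_space (deg X)) (space V) (space X) (\<lambda>u\<in>carrier (space V). u) (orb X x)) e'"
      by (simp add: e(1) e'(1))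
    from fun_cong[OF this, of ?y] have "e (pure\<^sub>r X V x v) = map_tensor (space V) (coef_space (deg X)) (space V) (space X) (\<lambda>u\<in>carrier (space V). u) (orb X x) (e' ?y)"
      using y dX by (simp add: compose_eq t1(3) one v o(2) repD(4)[OF X x])
    \<comment> \<open>Applying \<open>orb X x\<close> to the second tensor factor means letting that
      factor, as a coefficient, act on \<open>x\<close>.\<close>
    also have "\<dots> = coact_ap V X (coef_ten V (deg X) (e' ?y)) x"
    proof -
      have ey: "e' ?y \<in> carrier (tensor\<^sub>u K (space V) (coef_space (deg X)))" using rep_mapD(5)[OF e'(2)] y by simp
      note ap = coact_ap[OF m X]
      show ?thesis
      proof (rule tensor\<^sub>u_ext[OF m C(3) tensor\<^sub>u_module[OF m mX] t2(1) linear_map_comp[OF coef_ten(1)[OF V dX] bilinear_mapD(2)[OF ap(1) x]] _ ey])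
        fix u and z :: "('k, 'h, 'b) univ" assume u: "u \<in> elts V" and z: "z \<in> carrier (coef_space (deg X))"
        then obtain a where "z = Coef a" "a \<in> coeffs (deg X)" by (auto simp: C(4))
        then show "map_tensor (space V) (coef_space (deg X)) (space V) (space X) (\<lambda>u\<in>carrier (space V). u) (orb X x) (pure\<^sub>u K (space V) (coef_space (deg X)) u z) =
           coact_ap V X (coef_ten V (deg X) (pure\<^sub>u K (space V) (coef_space (deg X)) u z)) x"
          using u z x by (simp add: t2(3) o(2) coef_ten(2)[OF V dX] ap(2))
      qed
    qed
    also have "coef_ten V (deg X) (e' ?y) = ?\<Delta> (deg X) v" by (simp add: from_center_def dX v e'(1))
    finally show ?thesis .
  qed
  have "e = e_map V ?\<Delta> X"
  proof (rule extensionalityI)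
    show "e \<in> extensional (carrier (tensor\<^sub>r X V))" using rep_mapD(2)[OF e(2)] by simp
    show "e_map V ?\<Delta> X \<in> extensional (carrier (tensor\<^sub>r X V))" by (rule e_map(2)[OF D X])
    show "e t = e_map V ?\<Delta> X t" if "t \<in> carrier (tensor\<^sub>r X V)" for t
      by (rule tensor\<^sub>u_ext[OF mX m tensor\<^sub>u_module[OF m mX] rep_mapD(3)[OF e(2), simplified] e_map(1)[OF D X] _ that]) (simp add: key e_map(3)[OF D X])
  qed
  then show "inv_arrow Rep (c X) = Arrow (rep_tensor (rep_conj (deg V) X) V) (rep_tensor V X) (e_map V ?\<Delta> X)" using e(1) by simp
qed

text \<open>The version of \<open>coef_ten\<close> for two coefficients: \<open>?Q\<close> undoes
  the action on the pair of units, so an equation evaluated at two regular representations becomes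
  an equation of coefficients.\<close>

lemma coact_ap2_reg_inj:
  fixes V :: "('p, 'k, 'h, 'b) rep"
  assumes D: "pre_coaction V \<Delta>" and \<mu>: "\<mu> \<in> carrier \<pi>" and \<nu>: "\<nu> \<in> carrier \<pi>"
    and s: "s \<in> carrier (tensor K (space V) (tensor\<^sub>H \<mu> \<nu>))"
    and t: "t \<in> carrier (tensor K (space V) (tensor\<^sub>H \<mu> \<nu>))"
    and eq: "coact_ap2 V (reg \<mu>) (reg \<nu>) (Coef \<one>\<^bsub>alg H \<mu>\<^esub>) (Coef \<one>\<^bsub>alg H \<nu>\<^esub>) s =
      coact_ap2 V (reg \<mu>) (reg \<nu>) (Coef \<one>\<^bsub>alg H \<mu>\<^esub>) (Coef \<one>\<^bsub>alg H \<nu>\<^esub>) t"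
  shows "s = t"
proof -
  note V = pre_coactionD(1)[OF D] note m = repD(2)[OF V]
  note C = Coef_linear[OF \<mu>] and C' = Coef_linear[OF \<nu>] note A = alg_module[OF \<mu>] alg_module[OF \<nu>]
  let ?M = "coef_space \<mu> :: ('k, 'h, 'b) uspace" and ?N = "coef_space \<nu> :: ('k, 'h, 'b) uspace"
  let ?P = "tensor\<^sub>H \<mu> \<nu>" let ?T = "tensor K (space V) ?P"
  have MN: "module K (tensor\<^sub>u K ?M ?N)" by (rule tensor\<^sub>u_module[OF C(3) C'(3)])
  note P = tensor_module[OF A] note T = tensor_module[OF m P]
  have one: "Coef \<one>\<^bsub>alg H \<mu>\<^esub> \<in> elts (reg \<mu>)" "Coef \<one>\<^bsub>alg H \<nu>\<^esub> \<in> elts (reg \<nu>)" using \<mu> \<nu> by (auto simp: C(4) C'(4))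
  note ta = tens_act[OF reg_rep[OF \<mu>] reg_rep[OF \<nu>], unfolded reg_simps]
  have q: "bilinear_map K ?M ?N ?P (\<lambda>y z. pure\<^sub>H \<mu> \<nu> (unCoef y) (unCoef z))"
    by (intro lin C(2) C'(2)) (use A in \<open>auto simp: C(4) C'(4)\<close>)
  define q where "q = sweedler\<^sub>u ?P (\<lambda>(y :: ('k, 'h, 'b) univ) (z :: ('k, 'h, 'b) univ). pure\<^sub>H \<mu> \<nu> (unCoef y) (unCoef z))"
  have ql: "linear_map K (tensor\<^sub>u K ?M ?N) ?P q" unfolding q_def by (rule sweedler\<^sub>u_linear[OF C(3) C'(3) P q])
  have qp: "q (pure\<^sub>u K ?M ?N (Coef a) (Coef b)) = pure\<^sub>H \<mu> \<nu> a b" if "a \<in> coeffs \<mu>" "b \<in> coeffs \<nu>" for a b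
    unfolding q_def using that by (subst sweedler\<^sub>u_pure\<^sub>u[OF C(3) C'(3) P q]) (auto simp: C(4) C'(4))
  have qt: "q (tens_act (reg \<mu>) (reg \<nu>) p (pure\<^sub>u K ?M ?N (Coef \<one>\<^bsub>alg H \<mu>\<^esub>) (Coef \<one>\<^bsub>alg H \<nu>\<^esub>))) = p" if p: "p \<in> carrier ?P" for p
    by (rule tensor_ext[OF A P linear_map_comp[OF bilinear_mapD(2)[OF ta(1) pure\<^sub>u_closed[OF C(3) C'(3) one[unfolded reg_simps]]] ql] linear_map_id _ p])
      (simp add: ta(2) one[unfolded reg_simps] \<mu> \<nu> qp)
  have Q: "bilinear_map K (space V) (tensor\<^sub>u K ?M ?N) ?T (\<lambda>u w. pure K (space V) ?P u (q w))"
    by (intro lin ql) (simp_all add: m P linear_mapD(1)[OF ql])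
  let ?Q = "sweedler\<^sub>u ?T (\<lambda>u w. pure K (space V) ?P u (q w))"
  note Ql = sweedler\<^sub>u_linear[OF m MN T Q]
  note c = coact_ap2(1)[OF D reg_rep[OF \<mu>] reg_rep[OF \<nu>] one, unfolded reg_simps]
  have c2: "coact_ap2 V (reg \<mu>) (reg \<nu>) (Coef \<one>\<^bsub>alg H \<mu>\<^esub>) (Coef \<one>\<^bsub>alg H \<nu>\<^esub>) =
    sweedler (tensor\<^sub>u K (space V) (tensor\<^sub>u K ?M ?N)) (\<lambda>u p. pure\<^sub>u K (space V) (tensor\<^sub>u K ?M ?N) u (tens_act (reg \<mu>) (reg \<nu>) p (pure\<^sub>u K ?M ?N (Coef \<one>\<^bsub>alg H \<mu>\<^esub>) (Coef \<one>\<^bsub>alg H \<nu>\<^esub>))))"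
    by (simp add: coact_ap2_def)
  note S = tensor\<^sub>u_module[OF m MN]
  have "?Q (coact_ap2 V (reg \<mu>) (reg \<nu>) (Coef \<one>\<^bsub>alg H \<mu>\<^esub>) (Coef \<one>\<^bsub>alg H \<nu>\<^esub>) r) = r" if r: "r \<in> carrier ?T" for r
    unfolding c2
    by (rule tensor_ext[OF m P T linear_map_comp[OF sweedler_linear[OF m P S c] Ql] linear_map_id _ r])
      (simp add: sweedler_pure[OF m P S c] sweedler\<^sub>u_pure\<^sub>u[OF m MN T Q] qt bilinear_mapD(3)[OF ta(1)] pure\<^sub>u_closed[OF C(3) C'(3)] one[unfolded reg_simps])
  note Q_inv = this
  show ?thesis
    by (rule HOL.trans[OF Q_inv[OF s, symmetric] HOL.trans[OF arg_cong[where f = ?Q, OF eq] Q_inv[OF t]]])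
qed

text \<open>
  The axioms of a half braiding do not mention the unit object, so the counit axiom of the associated
  coaction has to be derived: this idempotent is injective as the half braiding at the unit object is invertible.
\<close>

lemma counit_coaction_idem:
  fixes V :: "('p, 'k, 'h, 'b) rep"
  assumes D: "pre_coaction V \<Delta>" and v: "v \<in> elts V" and ca: "coassoc_lhs V \<Delta> \<one> \<one> v = coassoc_rhs V \<Delta> \<one> \<one> v"
  defines "T \<equiv> \<lambda>v. sweedler (space V) (\<lambda>u x. counit H x \<odot>\<^bsub>space V\<^esub> u) (\<Delta> \<one> v)"
  shows "linear_map K (space V) (space V) T" "T (T v) = T v"
proof -
  note V = pre_coactionD(1)[OF D] note m = repD(2)[OF V]
  interpret V: module K "space V" by (rule m)
  have A: "module K (alg H \<one>)" by simp
  have o: "\<one> \<in> carrier \<pi>" by simp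
  note \<Delta> = pre_coactionD(2,3)[OF D o]
  note G = ground_module[OF K.field_axioms]
  have b: "bilinear_map K (space V) (alg H \<one>) (space V) (\<lambda>u x. counit H x \<odot>\<^bsub>space V\<^esub> u)"
    by (intro bilinear_mapI linear_map_smult_left[OF m counit_linear] linear_map_smult_right[OF m m linear_map_id]) simp_all
  show Tl: "linear_map K (space V) (space V) T" unfolding T_def by (rule linear_map_comp[OF \<Delta>(1) sweedler_linear[OF m A m b]])
  have e: "bilinear_map K (alg H \<one>) (alg H \<one>) (ground_module K) (\<lambda>x y. counit H x \<otimes>\<^bsub>K\<^esub> counit H y)"
    by (intro bilinear_mapI linear_mapI) (simp_all add: ground_module_def counit_simps K.r_distr K.l_distr K.m_ac)
  \<comment> \<open>\<open>?e\<close> is the counit on both legs. Applied to coassociativity in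
    degree \<open>\<one>\<close> it gives \<open>T v\<close> on one side, by \<open>ecm\<close>, and
    \<open>T (T v)\<close> on the other.\<close>
  let ?e = "sweedler (ground_module K) (\<lambda>x y. counit H x \<otimes>\<^bsub>K\<^esub> counit H y)"
  note el = sweedler_linear[OF A A G e]
  have ec: "?e p \<in> carrier K" if "p \<in> carrier (tensor K (alg H \<one>) (alg H \<one>))" for p
    using linear_mapD(1)[OF el that] by (simp add: ground_module_def)
  have B: "bilinear_map K (space V) (tensor K (alg H \<one>) (alg H \<one>)) (space V) (\<lambda>u p. ?e p \<odot>\<^bsub>space V\<^esub> u)"
    by (intro bilinear_mapI linear_map_smult_left[OF m el] linear_map_smult_right[OF m m linear_map_id] ec)
  have ecm: "?e (comult H \<one> \<one> z) = counit H z" if z: "z \<in> carrier (alg H \<one>)" for z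
  proof -
    have c: "comult H \<one> \<one> z \<in> carrier (tensor K (alg H \<one>) (alg H \<one>))" using comult_closed[of \<one> \<one> z] z by simp
    have "counit H (sweedler (alg H \<one>) (\<lambda>x y. counit H x \<odot>\<^bsub>alg H \<one>\<^esub> y) (comult H \<one> \<one> z)) = sweedler (ground_module K) (\<lambda>x y. counit H (counit H x \<odot>\<^bsub>alg H \<one>\<^esub> y)) (comult H \<one> \<one> z)"
      by (rule linear_map_sweedler[OF A A A G counit_linear c]) simp
    also have "\<dots> = ?e (comult H \<one> \<one> z)" by (rule sweedler_cong[OF A A G c]) (simp add: counit_simps)
    finally show ?thesis using counit_left[OF o z] by simp
  qed
  have "T v = sweedler (space V) (\<lambda>u z. ?e (comult H \<one> \<one> z) \<odot>\<^bsub>space V\<^esub> u) (\<Delta> \<one> v)"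
    unfolding T_def by (rule sweedler_cong[OF m A m \<Delta>(2)[OF v]]) (simp add: ecm)
  also have "\<dots> = sweedler (space V) (\<lambda>w y. sweedler (space V) (\<lambda>u x. ?e (pure K (alg H \<one>) (alg H \<one>) x y) \<odot>\<^bsub>space V\<^esub> u) (\<Delta> \<one> w)) (\<Delta> \<one> v)"
  proof -
    have "\<one> \<otimes> \<one> = \<one>" by simp
    then show ?thesis
      using HOL.trans[OF coassoc_lift(1)[OF D m o o B v, symmetric] HOL.trans[OF arg_cong[where f = "sweedler (space V) (\<lambda>u p. ?e p \<odot>\<^bsub>space V\<^esub> u)", OF ca] coassoc_lift(2)[OF D m o o B v]]]
      by (simp only:)
  qed
  also have "\<dots> = sweedler (space V) (\<lambda>w y. T (counit H y \<odot>\<^bsub>space V\<^esub> w)) (\<Delta> \<one> v)"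
  proof (rule sweedler_cong[OF m A m \<Delta>(2)[OF v]])
    fix w y assume w: "w \<in> elts V" and y: "y \<in> carrier (alg H \<one>)"
    have "T (counit H y \<odot>\<^bsub>space V\<^esub> w) = counit H y \<odot>\<^bsub>space V\<^esub> T w" using linear_mapD(3)[OF Tl] w y by simp
    also have "\<dots> = sweedler (space V) (\<lambda>u x. counit H y \<odot>\<^bsub>space V\<^esub> (counit H x \<odot>\<^bsub>space V\<^esub> u)) (\<Delta> \<one> w)"
      unfolding T_def by (rule linear_map_sweedler[OF m A m m linear_map_smult_right[OF m m linear_map_id counit_closed[OF y]] \<Delta>(2)[OF w]]) simp
    also have "\<dots> = sweedler (space V) (\<lambda>u x. ?e (pure K (alg H \<one>) (alg H \<one>) x y) \<odot>\<^bsub>space V\<^esub> u) (\<Delta> \<one> w)"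
      by (rule sweedler_cong[OF m A m \<Delta>(2)[OF w]]) (use y in \<open>simp add: sweedler_pure[OF A A G e] V.smult_assoc1[symmetric] K.m_comm\<close>)
    finally show "sweedler (space V) (\<lambda>u x. ?e (pure K (alg H \<one>) (alg H \<one>) x y) \<odot>\<^bsub>space V\<^esub> u) (\<Delta> \<one> w) = T (counit H y \<odot>\<^bsub>space V\<^esub> w)" ..
  qed
  also have "\<dots> = T (sweedler (space V) (\<lambda>w y. counit H y \<odot>\<^bsub>space V\<^esub> w) (\<Delta> \<one> v))"
    by (rule linear_map_sweedler[OF m A m m Tl \<Delta>(2)[OF v], symmetric]) simp
  also have "sweedler (space V) (\<lambda>w y. counit H y \<odot>\<^bsub>space V\<^esub> w) (\<Delta> \<one> v) = T v" by (simp add: T_def)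
  finally show "T (T v) = T v" ..
qed

text \<open>Evaluated at regular representations, multiplicativity of the half braiding becomes
  coassociativity, and linearity of its values becomes the compatibility of action and coaction. For
  the counit axiom the unit object and \<open>counit_coaction_idem\<close> are used.\<close>

lemma from_center_yd:
  fixes Z :: "('p, 'k, 'h, 'b) rep \<times> (('p, 'k, 'h, 'b) rep \<Rightarrow> ('p, 'k, 'h, 'b) rep_arrow)"
  assumes "Z \<in> R.center_obj"
  shows "is_yd (from_center Z)"
proof -
  obtain V c where Zeq: "Z = (V, c)" by (cases Z)
  note Z = assms[unfolded Zeq]
  let ?\<Delta> = "snd (from_center (V, c))"
  note D = from_center_e_map(1)[OF Z] and E = from_center_e_map(2)[OF Z]
  have V: "is_rep V" using Z by (auto simp: R.center_obj_def)
  note m = repD(2)[OF V]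
  note \<Delta> = pre_coactionD(2,3)[OF D]
  have fc: "from_center Z = (V, ?\<Delta>)" by (simp add: Zeq from_center_def)
  have er: "is_rep_map (rep_tensor (rep_conj (deg V) X) V) (rep_tensor V X) (e_map V ?\<Delta> X)" if X: "is_rep X" for X
    using center_inv_arrow[OF Z X] E[OF X] by auto
  have one: "Coef \<one>\<^bsub>alg H \<mu>\<^esub> \<in> carrier (coef_space \<mu>)" if "\<mu> \<in> carrier \<pi>" for \<mu>
    using that by (simp add: Coef_linear(4)[OF that])
  have ca: "coassoc_lhs V ?\<Delta> \<mu> \<nu> v = coassoc_rhs V ?\<Delta> \<mu> \<nu> v" if \<mu>: "\<mu> \<in> carrier \<pi>" and \<nu>: "\<nu> \<in> carrier \<pi>" and v: "v \<in> elts V" for \<mu> \<nu> v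
  proof -
    note X = reg_rep[OF \<mu>] and Y = reg_rep[OF \<nu>]
    have B: "bilinear_map K (space V) (tensor\<^sub>H \<mu> \<nu>) (tensor K (space V) (tensor\<^sub>H \<mu> \<nu>)) (pure K (space V) (tensor\<^sub>H \<mu> \<nu>))"
      using \<mu> \<nu> by (intro pure_bilinear m tensor_module) simp_all
    have T: "module K (tensor K (space V) (tensor\<^sub>H \<mu> \<nu>))" using \<mu> \<nu> by (simp add: tensor_module m)
    let ?X = "reg \<mu> :: ('p, 'k, 'h, 'b) rep" and ?Y = "reg \<nu> :: ('p, 'k, 'h, 'b) rep"
    have "\<forall>x\<in>carrier (space ?X). \<forall>y\<in>carrier (space ?Y). \<forall>v\<in>carrier (space V).
      coact_ap2 V ?X ?Y x y (coassoc_lhs V ?\<Delta> (deg ?X) (deg ?Y) v) = coact_ap2 V ?X ?Y x y (coassoc_rhs V ?\<Delta> (deg ?X) (deg ?Y) v)"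
      by (rule e_map_TenO_iff[OF D X Y, THEN iffD1])
        (erule er, rule center_inverse(2)[OF Z X Y, unfolded act_Rep E[OF X] E[OF Y] Rep_simps(7) E[OF rep_tensor_closed[OF X Y]]])
    then show ?thesis
      by (intro coact_ap2_reg_inj[OF D \<mu> \<nu> coassoc_lift(3,4)[OF D T \<mu> \<nu> B v]]) (simp add: one \<mu> \<nu> v)
  qed
  have yc: "yd_lhs V ?\<Delta> \<mu> h v = yd_rhs V ?\<Delta> \<mu> h v" if \<mu>: "\<mu> \<in> carrier \<pi>" and h: "h \<in> coeffs (deg V \<otimes> \<mu>)" and v: "v \<in> elts V" for \<mu> h v
  proof -
    note X = reg_rep[OF \<mu>]
    let ?x = "Coef \<one>\<^bsub>alg H \<mu>\<^esub>"
    have x: "?x \<in> elts (reg \<mu>)" using one[OF \<mu>] by simp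
    note ea = e_map_act[OF D X _ x v, unfolded reg_simps, OF h]
    have "pure\<^sub>u K (coef_space \<mu>) (space V) ?x v \<in> carrier (tensor\<^sub>u K (coef_space \<mu>) (space V))"
      by (rule pure\<^sub>u_closed[OF Coef_linear(3)[OF \<mu>] m one[OF \<mu>] v])
    then have "coact_ap V (reg \<mu>) (yd_rhs V ?\<Delta> \<mu> h v) ?x = coact_ap V (reg \<mu>) (yd_lhs V ?\<Delta> \<mu> h v) ?x"
      using rep_mapD(4)[OF er[OF X], of h "pure\<^sub>u K (coef_space \<mu>) (space V) ?x v"] ea(1,2) h \<mu> V
      by (simp add: conjg_mult_right)
    then show ?thesis using coef_ten(3)[OF V \<mu> ea(3)] coef_ten(3)[OF V \<mu> ea(4)] by simp
  qed
  have cu: "sweedler (space V) (\<lambda>u x. counit H x \<odot>\<^bsub>space V\<^esub> u) (?\<Delta> \<one> v) = v" if v: "v \<in> elts V" for v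
  proof -
    \<comment> \<open>At the unit object \<open>e_map\<close> sends the pure tensor of
      \<open>?k\<close> and \<open>w\<close> to that of \<open>T w\<close> and \<open>?k\<close>. So
      invertibility there makes the idempotent \<open>T\<close> injective, hence the
      identity.\<close>
    define T where "T = (\<lambda>v. sweedler (space V) (\<lambda>u x. counit H x \<odot>\<^bsub>space V\<^esub> u) (?\<Delta> \<one> v))"
    note T = counit_coaction_idem[OF D v ca[OF P.one_closed P.one_closed v], folded T_def]
    note Tv = linear_mapD(1)[OF T(1) v]
    have TT: "T (T v) = T v" using T(2) by (simp add: T_def)
    let ?I = "rep_unit :: ('p, 'k, 'h, 'b) rep" and ?k = "Scal \<one>\<^bsub>K\<^esub> :: ('k, 'h, 'b) univ"
    have k: "?k \<in> carrier Sc" by (simp add: scal_simps(1))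
    note ap = coact_ap[OF m rep_unit_closed, unfolded rep_unit_simps]
    have A: "module K (alg H \<one>)" by simp
    have b: "bilinear_map K (space V) (alg H \<one>) (space V) (\<lambda>u x. counit H x \<odot>\<^bsub>space V\<^esub> u)"
      by (intro bilinear_mapI linear_map_smult_left[OF m counit_linear] linear_map_smult_right[OF m m linear_map_id]) simp_all
    note pb = pure\<^sub>u_bilinear[OF m scal_simps(2)]
    have "coact_ap V ?I t ?k = pure\<^sub>u K (space V) Sc (sweedler (space V) (\<lambda>u x. counit H x \<odot>\<^bsub>space V\<^esub> u) t) ?k"
      if t: "t \<in> carrier (tensor K (space V) (alg H \<one>))" for t
    proof (rule tensor_ext[OF m A tensor\<^sub>u_module[OF m scal_simps(2)] bilinear_mapD(2)[OF ap(1) k] linear_map_comp[OF sweedler_linear[OF m A m b] bilinear_mapD(2)[OF pb k]] _ t])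
      fix u a assume u: "u \<in> elts V" and a: "a \<in> carrier (alg H \<one>)"
      have "pure\<^sub>u K (space V) Sc u (Scal (counit H a)) = pure\<^sub>u K (space V) Sc u (counit H a \<odot>\<^bsub>Sc\<^esub> ?k)" using a by (simp add: scal_simps(4))
      also have "\<dots> = pure\<^sub>u K (space V) Sc (counit H a \<odot>\<^bsub>space V\<^esub> u) ?k"
        using linear_mapD(3)[OF bilinear_mapD(1)[OF pb u] _ k] linear_mapD(3)[OF bilinear_mapD(2)[OF pb k] _ u] a by simp
      finally show "coact_ap V ?I (pure K (space V) (alg H \<one>) u a) ?k = pure\<^sub>u K (space V) Sc (sweedler (space V) (\<lambda>u x. counit H x \<odot>\<^bsub>space V\<^esub> u) (pure K (space V) (alg H \<one>) u a)) ?k"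
        using u a by (simp add: ap(2) k sweedler_pure[OF m A m b])
    qed
    then have eT: "e_map V ?\<Delta> ?I (pure\<^sub>u K Sc (space V) ?k w) = pure\<^sub>u K (space V) Sc (T w) ?k" if "w \<in> elts V" for w
      using e_map(3)[OF D rep_unit_closed, of ?k w] that k \<Delta>(2)[of \<one> w] by (simp add: T_def)
    have "c ?I \<in> isos Rep (TenO Rep V ?I) (TenO Rep (actO Rep V ?I) V)"
      using Z rep_unit_closed by (auto simp: R.center_obj_def R.half_braiding_def)
    from R.isosD(9)[OF this] have C: "compose (carrier (tensor\<^sub>u K Sc (space V))) (body (c ?I)) (e_map V ?\<Delta> ?I) = (\<lambda>u\<in>carrier (tensor\<^sub>u K Sc (space V)). u)"
      using arg_cong[where f = source, OF E[OF rep_unit_closed]] arg_cong[where f = body, OF E[OF rep_unit_closed]] by simp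
    have ce: "body (c ?I) (e_map V ?\<Delta> ?I t) = t" if "t \<in> carrier (tensor\<^sub>u K Sc (space V))" for t
      using fun_cong[OF C, of t] that by (simp add: compose_eq)
    have "pure\<^sub>u K Sc (space V) ?k (T v) = pure\<^sub>u K Sc (space V) ?k v"
      using ce[of "pure\<^sub>u K Sc (space V) ?k (T v)"] ce[of "pure\<^sub>u K Sc (space V) ?k v"] eT[OF Tv] eT[OF v] TT
        pure\<^sub>u_closed[OF scal_simps(2) m k v] pure\<^sub>u_closed[OF scal_simps(2) m k Tv] by simp
    then have "T v = v" using unit_map_inverse(2)[OF m Tv] unit_map_inverse(2)[OF m v] by simp
    then show ?thesis by (simp add: T_def)
  qed
  have x: "?\<Delta> \<in> extensional (carrier \<pi>)" "\<And>\<mu>. \<mu> \<in> carrier \<pi> \<Longrightarrow> ?\<Delta> \<mu> \<in> extensional (elts V)"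
    by (simp_all add: from_center_def)
  show ?thesis unfolding fc is_yd_iff
    by (intro conjI ballI D x ca cu yc)
qed

text \<open>Two half braidings agree if their inverses do, and both inverses are given by
  \<open>e_map\<close> for the same coaction.\<close>

lemma to_center_from_center:
  fixes Z :: "('p, 'k, 'h, 'b) rep \<times> (('p, 'k, 'h, 'b) rep \<Rightarrow> ('p, 'k, 'h, 'b) rep_arrow)"
  assumes "Z \<in> R.center_obj"
  shows "to_center (from_center Z) = Z"
proof -
  obtain V c where Zeq: "Z = (V, c)" by (cases Z)
  note Z = assms[unfolded Zeq]
  have fc: "from_center Z = (V, snd (from_center (V, c)))" by (simp add: Zeq from_center_def)
  note Y = from_center_yd[OF assms, unfolded fc]
  show ?thesis
  proof (rule R.center_obj_eqI[OF to_center_closed[OF from_center_yd[OF assms]] assms])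
    show "fst (to_center (from_center Z)) = fst Z" by (simp add: to_center_def from_center_def Zeq)
    fix X :: "('p, 'k, 'h, 'b) rep" assume "X \<in> Obj Rep"
    then have X: "is_rep X" by simp
    have i: "c X \<in> isos Rep (TenO Rep V X) (TenO Rep (actO Rep V X) V)"
      using Z X by (auto simp: R.center_obj_def R.half_braiding_def)
    have "inv_arrow Rep (snd (to_center (from_center Z)) X) = inv_arrow Rep (c X)"
      using yd_c_iso(2)[OF Y X] from_center_e_map(2)[OF Z X] X unfolding fc by (simp add: to_center_def)
    then show "snd (to_center (from_center Z)) X = snd Z X"
      using R.inv_inv_arrow[OF i] R.inv_inv_arrow[OF yd_c_iso(1)[OF Y X]] X unfolding fc by (simp add: to_center_def Zeq)
  qed
qed

lemma from_center_coaction: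
  fixes V :: "('p, 'k, 'h, 'b) rep"
  assumes Z: "(V, c) \<in> R.center_obj" and \<mu>: "\<mu> \<in> carrier \<pi>" and v: "v \<in> elts V"
  shows "snd (from_center (V, c)) \<mu> v = coef_ten V \<mu> (body (inv_arrow Rep (c (reg \<mu>)))
       (pure\<^sub>u K (coef_space \<mu>) (space V) (Coef \<one>\<^bsub>alg H \<mu>\<^esub>) v))"
  using assms by (simp add: from_center_def)

lemma yd_eqI:
  assumes "is_yd (V, \<Delta>)" "\<Delta>' \<in> extensional (carrier \<pi>)" "\<And>\<mu>. \<mu> \<in> carrier \<pi> \<Longrightarrow> \<Delta>' \<mu> \<in> extensional (elts V)"
    "\<And>\<mu> v. \<mu> \<in> carrier \<pi> \<Longrightarrow> v \<in> elts V \<Longrightarrow> \<Delta> \<mu> v = \<Delta>' \<mu> v"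
  shows "\<Delta> = \<Delta>'"
proof (rule extensionalityI[OF ydD(2)[OF assms(1)] assms(2)])
  fix \<mu> assume "\<mu> \<in> carrier \<pi>"
  then show "\<Delta> \<mu> = \<Delta>' \<mu>"
    by (intro extensionalityI[OF ydD(3)[OF assms(1)] assms(3)] assms(4))
qed

text \<open>The inverse half braiding is \<open>e_map\<close>, whose value at the unit of a regular
  representation is the coaction acting on that unit; \<open>coef_ten\<close> recovers the
  coaction.\<close>

lemma from_center_to_center:
  fixes A :: "('p, 'k, 'h, 'b) yd"
  assumes "is_yd A"
  shows "from_center (to_center A) = A"
proof -
  obtain V \<Delta> where A: "A = (V, \<Delta>)" by (cases A)
  note Y = assms[unfolded A] note D = ydD(1)[OF Y] and V = ydD(7)[OF Y]
  obtain c where tc: "to_center A = (V, c)" by (simp add: A to_center_def)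
  note Z = to_center_closed[OF assms, unfolded tc]
  obtain \<Delta>' where fc: "from_center (V, c) = (V, \<Delta>')" by (simp add: from_center_def)
  have "\<Delta>' = \<Delta>"
  proof (rule yd_eqI[OF from_center_yd[OF Z, unfolded fc] ydD(2,3)[OF Y]])
    fix \<mu> v assume \<mu>: "\<mu> \<in> carrier \<pi>" and v: "v \<in> elts V"
    note X = reg_rep[OF \<mu>]
    have one: "Coef \<one>\<^bsub>alg H \<mu>\<^esub> \<in> elts (reg \<mu>)" using \<mu> by (simp add: Coef_linear(4)[OF \<mu>])
    have c: "c (reg \<mu>) = snd (to_center A) (reg \<mu>)" by (simp add: tc)
    have "inv_arrow Rep (c (reg \<mu>)) = Arrow (rep_tensor (rep_conj (deg V) (reg \<mu>)) V) (rep_tensor V (reg \<mu>)) (e_map V \<Delta> (reg \<mu>))"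
      unfolding c using yd_c_iso(2)[OF Y X] by (simp add: to_center_def A X)
    then show "\<Delta>' \<mu> v = \<Delta> \<mu> v"
      using e_map(3)[OF D X one v] coef_ten(3)[OF V \<mu> pre_coactionD(3)[OF D \<mu> v]]
        from_center_coaction[OF Z \<mu> v] fc by simp
  qed
  then show ?thesis using tc fc A by simp
qed

text \<open>A half braiding is determined by its values on the regular representations.\<close>

lemma to_center_eqI:
  fixes V :: "('p, 'k, 'h, 'b) rep"
  assumes Z: "(V, c) \<in> R.center_obj" and x: "\<Delta> \<in> extensional (carrier \<pi>)"
    "\<And>\<mu>. \<mu> \<in> carrier \<pi> \<Longrightarrow> \<Delta> \<mu> \<in> extensional (elts V)"
    and \<Delta>: "\<And>\<mu>. \<mu> \<in> carrier \<pi> \<Longrightarrow> linear_map K (space V) (tensor\<^sub>c V \<mu>) (\<Delta> \<mu>)"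
    and e: "\<And>\<mu> v. \<lbrakk>\<mu> \<in> carrier \<pi>; v \<in> elts V\<rbrakk> \<Longrightarrow> body (inv_arrow Rep (c (reg \<mu>)))
       (pure\<^sub>u K (coef_space \<mu>) (space V) (Coef \<one>\<^bsub>alg H \<mu>\<^esub>) v) = coact_ap V (reg \<mu>) (\<Delta> \<mu> v) (Coef \<one>\<^bsub>alg H \<mu>\<^esub>)"
  shows "is_yd (V, \<Delta>)" "to_center (V, \<Delta>) = (V, c)"
proof -
  have V: "is_rep V" using Z by (auto simp: R.center_obj_def)
  obtain \<Delta>' where fc: "from_center (V, c) = (V, \<Delta>')" by (simp add: from_center_def)
  have "\<Delta>' = \<Delta>"
  proof (rule yd_eqI[OF from_center_yd[OF Z, unfolded fc] x])
    fix \<mu> v assume \<mu>: "\<mu> \<in> carrier \<pi>" and v: "v \<in> elts V"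
    show "\<Delta>' \<mu> v = \<Delta> \<mu> v"
      using from_center_coaction[OF Z \<mu> v] coef_ten(3)[OF V \<mu> linear_mapD(1)[OF \<Delta>[OF \<mu>] v]] fc e[OF \<mu> v] by simp
  qed
  then show "is_yd (V, \<Delta>)" "to_center (V, \<Delta>) = (V, c)"
    using from_center_yd[OF Z] to_center_from_center[OF Z] fc by simp_all
qed

section \<open>Unit, conjugation and tensor product under the correspondence\<close>

lemma yd_c_iso_reg:
  fixes A :: "('p, 'k, 'h, 'b) yd"
  assumes A: "is_yd A" and X: "is_rep X"
  shows "inv_arrow Rep (snd (to_center A) X) = Arrow (rep_tensor (rep_conj (deg (fst A)) X) (fst A)) (rep_tensor (fst A) X) (e_map (fst A) (snd A) X)"
  using yd_c_iso(2)[of "fst A" "snd A" X] A X by (simp add: to_center_def)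

text \<open>The inverse half braiding of the unit is the right unit constraint followed by the
  inverse of the left one. It sends the pure tensor of the unit of the algebra and a scalar to the
  same tensor with the factors exchanged, which is the coaction of \<open>yd_unit\<close>.\<close>

lemma to_center_unit:
  shows "is_yd (yd_unit :: ('p, 'k, 'h, 'b) yd)" "to_center (yd_unit :: ('p, 'k, 'h, 'b) yd) = R.center_Unit"
proof -
  let ?I = "rep_unit :: ('p, 'k, 'h, 'b) rep"
  obtain c where cu: "R.center_Unit = (?I, c)" by (simp add: R.center_Unit_def)
  have Z: "(?I, c) \<in> R.center_obj" unfolding cu[symmetric] by (rule R.center_Unit_closed)
  define \<Delta> where "\<Delta> = snd (yd_unit :: ('p, 'k, 'h, 'b) yd)"
  have yu: "yd_unit = (?I, \<Delta>)" by (simp add: yd_unit_def \<Delta>_def)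
  have D: "\<Delta> \<mu> = (\<lambda>x\<in>carrier Sc. pure K Sc (alg H \<mu>) x \<one>\<^bsub>alg H \<mu>\<^esub>)" if "\<mu> \<in> carrier \<pi>" for \<mu>
    using that by (simp add: \<Delta>_def yd_unit_def)
  have l: "linear_map K (space ?I) (tensor\<^sub>c ?I \<mu>) (\<Delta> \<mu>)" if \<mu>: "\<mu> \<in> carrier \<pi>" for \<mu>
    by (rule linear_map_cong[OF bilinear_mapD(2)[OF pure_bilinear[OF _ alg_module[OF \<mu>]] alg_closed(4)[OF \<mu>]]]) (simp_all add: D \<mu> scal_simps(2))
  have e: "body (inv_arrow Rep (c (reg \<mu>))) (pure\<^sub>u K (coef_space \<mu>) (space ?I) (Coef \<one>\<^bsub>alg H \<mu>\<^esub>) v) =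
      coact_ap ?I (reg \<mu>) (\<Delta> \<mu> v) (Coef \<one>\<^bsub>alg H \<mu>\<^esub>)" if \<mu>: "\<mu> \<in> carrier \<pi>" and v: "v \<in> elts ?I" for \<mu> v
  proof -
    have X: "is_rep (reg \<mu> :: ('p, 'k, 'h, 'b) rep)" by (rule reg_rep[OF \<mu>])
    note C = Coef_linear[OF \<mu>]
    let ?M = "coef_space \<mu> :: ('k, 'h, 'b) uspace" and ?x = "Coef \<one>\<^bsub>alg H \<mu>\<^esub> :: ('k, 'h, 'b) univ"
    have one: "?x \<in> carrier ?M" using \<mu> by (simp add: C(4))
    obtain k where k: "v = Scal k" "k \<in> carrier K" using v by (auto simp: scal_simps(1))
    have Xo: "(reg \<mu> :: ('p, 'k, 'h, 'b) rep) \<in> Obj Rep" using X by simp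
    note lu = R.LUnit_iso[OF Xo] and ru = R.RUnit_iso[OF Xo]
    note L = rep_map_lunit[OF X] and Rr = rep_map_runit[OF X]
    have gc: "pure\<^sub>u K Sc ?M (Scal \<one>\<^bsub>K\<^esub>) y \<in> elts (rep_tensor rep_unit (reg \<mu>))" if "y \<in> elts (reg \<mu>)" for y :: "('k, 'h, 'b) univ"
      using that by (simp add: pure\<^sub>u_closed scal_simps C(3))
    have il: "inv_arrow Rep (LUnit Rep (reg \<mu>)) = Arrow (reg \<mu>) (rep_tensor rep_unit (reg \<mu>)) (restrict (pure\<^sub>u K Sc ?M (Scal \<one>\<^bsub>K\<^esub>)) (carrier ?M))"
      using Rep_isoI(2)[OF rep_tensor_closed[OF rep_unit_closed X] X L, of "pure\<^sub>u K Sc ?M (Scal \<one>\<^bsub>K\<^esub>)", OF gc]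
      by (simp add: unit_map_inverse(1,2)[OF C(3)])
    have "inv_arrow Rep (c (reg \<mu>)) = Comp Rep (inv_arrow Rep (LUnit Rep (reg \<mu>))) (RUnit Rep (reg \<mu>))"
      using R.snd_center_Unit[OF Xo] R.inv_comp[OF lu R.inv_isos[OF ru]] R.inv_inv_arrow[OF ru] by (simp only: cu prod.sel)
    moreover have "pure\<^sub>u K ?M Sc ?x v \<in> carrier (tensor\<^sub>u K ?M Sc)" by (rule pure\<^sub>u_closed[OF C(3) scal_simps(2) one]) (use v in simp)
    ultimately have "body (inv_arrow Rep (c (reg \<mu>))) (pure\<^sub>u K ?M Sc ?x v) = restrict (pure\<^sub>u K Sc ?M (Scal \<one>\<^bsub>K\<^esub>)) (carrier ?M) (runit_map ?M (pure\<^sub>u K ?M Sc ?x v))"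
      by (simp add: il[simplified] compose_eq)
    also have "\<dots> = pure\<^sub>u K Sc ?M (Scal \<one>\<^bsub>K\<^esub>) (k \<odot>\<^bsub>?M\<^esub> ?x)" using one k by (simp add: runit_map(3)[OF C(3)] module.smult_closed[OF C(3)])
    also have "\<dots> = k \<odot>\<^bsub>tensor\<^sub>u K Sc ?M\<^esub> pure\<^sub>u K Sc ?M (Scal \<one>\<^bsub>K\<^esub>) ?x"
      by (rule linear_mapD(3)[OF bilinear_mapD(1)[OF pure\<^sub>u_bilinear[OF scal_simps(2) C(3)]] k(2) one]) (simp add: scal_simps(1))
    also have "\<dots> = pure\<^sub>u K Sc ?M (k \<odot>\<^bsub>Sc\<^esub> Scal \<one>\<^bsub>K\<^esub>) ?x"
      by (rule linear_mapD(3)[OF bilinear_mapD(2)[OF pure\<^sub>u_bilinear[OF scal_simps(2) C(3)] one] k(2), symmetric]) (simp add: scal_simps(1))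
    also have "\<dots> = coact_ap ?I (reg \<mu>) (\<Delta> \<mu> v) ?x"
      using coact_ap(2)[OF _ X, of ?I v "\<one>\<^bsub>alg H \<mu>\<^esub>" ?x] v one k \<mu> by (simp add: scal_simps D)
    finally show ?thesis by simp
  qed
  note T = to_center_eqI[of ?I c \<Delta>, OF Z _ _ l e]
  have x: "\<Delta> \<in> extensional (carrier \<pi>)" "\<And>\<mu>. \<mu> \<in> carrier \<pi> \<Longrightarrow> \<Delta> \<mu> \<in> extensional (elts ?I)"
    by (simp_all add: D) (simp add: \<Delta>_def yd_unit_def)
  show "is_yd (yd_unit :: ('p, 'k, 'h, 'b) yd)" unfolding yu by (rule T(1)[OF x])
  show "to_center (yd_unit :: ('p, 'k, 'h, 'b) yd) = R.center_Unit" unfolding yu by (subst cu, rule T(2)[OF x])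
qed

text \<open>The half braiding of the conjugate at a regular representation is that of
  \<open>A\<close> at its conjugate by the inverse of \<open>\<beta>\<close>, where coefficients act
  through the twist by \<open>\<beta>\<close>. This is the origin of the twist in
  \<open>yd_conj\<close>.\<close>

lemma to_center_conj:
  fixes A :: "('p, 'k, 'h, 'b) yd"
  assumes A: "is_yd A" and b: "\<beta> \<in> carrier \<pi>"
  shows "is_yd (yd_conj \<beta> A)" "to_center (yd_conj \<beta> A) = R.center_ConjO \<beta> (to_center A)"
proof -
  obtain V \<Delta> where Aeq: "A = (V, \<Delta>)" by (cases A)
  note Y = A[unfolded Aeq] note D = ydD(1)[OF Y] and V = ydD(7)[OF Y] note d = repD(1)[OF V] note m = repD(2)[OF V]
  have fA: "fst (to_center A) = V" by (simp add: to_center_def Aeq)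
  define c where "c = snd (R.center_ConjO \<beta> (to_center A))"
  have ce: "R.center_ConjO \<beta> (to_center A) = (rep_conj \<beta> V, c)" by (rule prod_eqI) (simp_all add: c_def fA)
  note Z = R.center_ConjO_closed[OF b to_center_closed[OF A], unfolded ce]
  let ?T = "\<lambda>\<mu>. tensor\<^sub>c V \<mu>"
  let ?G = "\<lambda>\<mu>. sweedler (?T \<mu>) (\<lambda>u x. pure\<^sub>c V \<mu> u (twist H \<beta> (conjg \<pi> (inv \<beta>) \<mu>) x))"
  define \<Delta>' where "\<Delta>' = snd (yd_conj \<beta> A)"
  have yc: "yd_conj \<beta> A = (rep_conj \<beta> V, \<Delta>')" by (simp add: yd_conj_def \<Delta>'_def Aeq)
  have D': "\<Delta>' \<mu> = (\<lambda>v\<in>carrier (space V). ?G \<mu> (\<Delta> (conjg \<pi> (inv \<beta>) \<mu>) v))" if "\<mu> \<in> carrier \<pi>" for \<mu>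
    using that by (simp add: \<Delta>'_def yd_conj_def Aeq)
  note \<Delta> = pre_coactionD(2,3)[OF D]
  have cl: "conjg \<pi> (inv \<beta>) \<mu> \<in> carrier \<pi>" if "\<mu> \<in> carrier \<pi>" for \<mu> using that b by simp
  have bG: "bilinear_map K (space V) (alg H (conjg \<pi> (inv \<beta>) \<mu>)) (?T \<mu>) (\<lambda>u x. pure\<^sub>c V \<mu> u (twist H \<beta> (conjg \<pi> (inv \<beta>) \<mu>) x))"
    if \<mu>: "\<mu> \<in> carrier \<pi>" for \<mu>
    using twist_linear[OF cl[OF \<mu>] b] twist_closed[OF cl[OF \<mu>] b] \<mu> b by (intro lin) (simp_all add: m)
  note G = sweedler_linear[OF m alg_module[OF cl] tensor_module[OF m alg_module] bG]
  have l: "linear_map K (space (rep_conj \<beta> V)) (tensor\<^sub>c (rep_conj \<beta> V) \<mu>) (\<Delta>' \<mu>)" if \<mu>: "\<mu> \<in> carrier \<pi>" for \<mu>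
    using linear_map_cong[OF linear_map_comp[OF \<Delta>(1)[OF cl[OF \<mu>]] G[OF \<mu> \<mu> \<mu>]] m, of "\<Delta>' \<mu>"] by (simp add: D' \<mu>)
  have e: "body (inv_arrow Rep (c (reg \<mu>))) (pure\<^sub>u K (coef_space \<mu>) (space (rep_conj \<beta> V)) (Coef \<one>\<^bsub>alg H \<mu>\<^esub>) v) =
      coact_ap (rep_conj \<beta> V) (reg \<mu>) (\<Delta>' \<mu> v) (Coef \<one>\<^bsub>alg H \<mu>\<^esub>)" if \<mu>: "\<mu> \<in> carrier \<pi>" and v: "v \<in> elts (rep_conj \<beta> V)" for \<mu> v
  proof -
    have v: "v \<in> elts V" using v by simp
    have X: "is_rep (reg \<mu> :: ('p, 'k, 'h, 'b) rep)" by (rule reg_rep[OF \<mu>])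
    note C = Coef_linear[OF \<mu>]
    let ?M = "coef_space \<mu> :: ('k, 'h, 'b) uspace" and ?x = "Coef \<one>\<^bsub>alg H \<mu>\<^esub> :: ('k, 'h, 'b) univ"
    let ?X = "rep_conj (inv \<beta>) (reg \<mu>) :: ('p, 'k, 'h, 'b) rep" and ?\<nu> = "conjg \<pi> (inv \<beta>) \<mu>"
    have one: "?x \<in> carrier ?M" using \<mu> by (simp add: C(4))
    have X': "is_rep ?X" using rep_conj_closed[OF X, of "inv \<beta>"] b by simp
    have i: "snd (to_center A) ?X \<in> isos Rep (rep_tensor V ?X) (rep_tensor (rep_conj (deg V) ?X) V)"
      using yd_c_iso(1)[OF Y X'] X' by (simp add: to_center_def Aeq)
    have "inv_arrow Rep (c (reg \<mu>)) = ConjA Rep \<beta> (inv_arrow Rep (snd (to_center A) ?X))"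
      using R.ConjA_isos(2)[OF b i] R.snd_center_ConjO[of "reg \<mu>" \<beta> "to_center A"] X by (simp add: c_def)
    then have "body (inv_arrow Rep (c (reg \<mu>))) (pure\<^sub>u K ?M (space V) ?x v) = coact_ap V ?X (\<Delta> ?\<nu> v) ?x"
      using e_map(3)[OF D X', of ?x v] one v by (simp add: yd_c_iso_reg[OF A X', unfolded Aeq prod.sel] Aeq)
    also have "\<dots> = coact_ap (rep_conj \<beta> V) (reg \<mu>) (?G \<mu> (\<Delta> ?\<nu> v)) ?x"
    proof -
      note ap = coact_ap[OF m X', unfolded rep_conj_simps reg_simps]
      have m': "module K (space (rep_conj \<beta> V))" using m by simp
      note ap' = coact_ap[OF m' X, unfolded rep_conj_simps reg_simps]
      have tw: "twist H \<beta> ?\<nu> a \<in> coeffs \<mu>" if "a \<in> coeffs ?\<nu>" for a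
        using twist_closed[OF cl[OF \<mu>] b that] b \<mu> by simp
      show ?thesis
      proof (rule tensor_ext[OF m alg_module[OF cl[OF \<mu>]] tensor\<^sub>u_module[OF m C(3)] bilinear_mapD(2)[OF ap(1) one]
          linear_map_comp[OF G[OF \<mu> \<mu> \<mu>] bilinear_mapD(2)[OF ap'(1) one]] _ \<Delta>(2)[OF cl[OF \<mu>] v]])
        fix u a assume u: "u \<in> elts V" and a: "a \<in> coeffs ?\<nu>"
        then show "coact_ap V ?X (pure\<^sub>c V ?\<nu> u a) ?x = coact_ap (rep_conj \<beta> V) (reg \<mu>) (?G \<mu> (pure\<^sub>c V ?\<nu> u a)) ?x"
          using b \<mu> by (simp add: ap(2) ap'(2) one sweedler_pure[OF m alg_module[OF cl[OF \<mu>]] tensor_module[OF m alg_module[OF \<mu>]] bG[OF \<mu>]] tw)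
      qed
    qed
    finally show ?thesis using v by (simp add: D' \<mu>)
  qed
  have x: "\<Delta>' \<in> extensional (carrier \<pi>)" "\<And>\<mu>. \<mu> \<in> carrier \<pi> \<Longrightarrow> \<Delta>' \<mu> \<in> extensional (elts (rep_conj \<beta> V))"
    by (simp_all add: D') (simp add: \<Delta>'_def yd_conj_def Aeq)
  show "is_yd (yd_conj \<beta> A)" "to_center (yd_conj \<beta> A) = R.center_ConjO \<beta> (to_center A)"
    unfolding yc ce using to_center_eqI[OF Z x l e] by simp_all
qed

text \<open>\<open>to_center_eqI\<close> gives both claims from one evaluation at the regular
  representations. In the inverse half braiding of the tensor product the coefficient of
  \<open>v\<close> acts first, through a twist since the half braiding of \<open>A\<close> is taken
  at a conjugate; the coefficient of \<open>w\<close> acts afterwards and therefore stands on the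
  left in the product.\<close>

lemma to_center_tensor:
  fixes A B :: "('p, 'k, 'h, 'b) yd"
  assumes A: "is_yd A" and B: "is_yd B"
  shows "is_yd (yd_tensor A B)" "to_center (yd_tensor A B) = R.center_TenO (to_center A) (to_center B)"
proof -
  obtain V \<Delta> where Aeq: "A = (V, \<Delta>)" by (cases A)
  obtain W \<Delta>' where Beq: "B = (W, \<Delta>')" by (cases B)
  note Y = A[unfolded Aeq] note D = ydD(1)[OF Y] and V = ydD(7)[OF Y]
  note Y' = B[unfolded Beq] note D' = ydD(1)[OF Y'] and W = ydD(7)[OF Y']
  note d = repD(1)[OF V] repD(1)[OF W] note m = repD(2)[OF V] repD(2)[OF W]
  note VW = tensor\<^sub>u_module[OF m]
  have fAB: "fst (to_center A) = V" "fst (to_center B) = W" by (simp_all add: to_center_def Aeq Beq)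
  define c where "c = snd (R.center_TenO (to_center A) (to_center B))"
  have ce: "R.center_TenO (to_center A) (to_center B) = (rep_tensor V W, c)" by (rule prod_eqI) (simp_all add: c_def fAB)
  note Z = R.center_TenO_closed[OF to_center_closed[OF A] to_center_closed[OF B], unfolded ce]
  let ?S = "\<lambda>\<mu>. tensor K (tensor\<^sub>r V W) (alg H \<mu>)" and ?\<nu> = "conjg \<pi> (deg W)"
  let ?p = "\<lambda>\<mu> v a w b. pure K (tensor\<^sub>r V W) (alg H \<mu>) (pure\<^sub>r V W v w)
              (b \<otimes>\<^bsub>alg H \<mu>\<^esub> twist H (inv (deg W)) (?\<nu> \<mu>) a)"
  let ?G = "\<lambda>\<mu> s t. sweedler (?S \<mu>) (\<lambda>v' a. sweedler (?S \<mu>) (\<lambda>w' b. ?p \<mu> v' a w' b) t) s"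
  define \<Delta>'' where "\<Delta>'' = snd (yd_tensor A B)"
  have yc: "yd_tensor A B = (rep_tensor V W, \<Delta>'')" by (simp add: yd_tensor_def \<Delta>''_def Aeq Beq Let_def)
  have D'': "\<Delta>'' \<mu> = (\<lambda>x\<in>carrier (tensor\<^sub>r V W). sweedler\<^sub>u (?S \<mu>) (\<lambda>v w. ?G \<mu> (\<Delta> (?\<nu> \<mu>) v) (\<Delta>' \<mu> w)) x)" if "\<mu> \<in> carrier \<pi>" for \<mu>
    using that by (simp add: \<Delta>''_def yd_tensor_def Aeq Beq Let_def)
  note \<Delta> = pre_coactionD(2,3)[OF D] and \<Delta>' = pre_coactionD(2,3)[OF D']
  have cl: "?\<nu> \<mu> \<in> carrier \<pi>" if "\<mu> \<in> carrier \<pi>" for \<mu> using that d by simp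
  have tw: "linear_map K (alg H (?\<nu> \<mu>)) (alg H \<mu>) (twist H (inv (deg W)) (?\<nu> \<mu>))" if "\<mu> \<in> carrier \<pi>" for \<mu>
    using twist_linear[OF cl[OF that], of "inv (deg W)"] d that by simp
  note twc = linear_mapD(1)[OF tw]
  {
    fix \<mu> assume \<mu>: "\<mu> \<in> carrier \<pi>"
    note A1 = alg_module[OF \<mu>] and A2 = alg_module[OF cl[OF \<mu>]] and S = tensor_module[OF VW alg_module[OF \<mu>]]
    have b1: "bilinear_map K (space W) (alg H \<mu>) (?S \<mu>) (?p \<mu> v a)" if "v \<in> elts V" "a \<in> coeffs (?\<nu> \<mu>)" for v a
      using twc[OF \<mu>] that \<mu> by (intro lin) (simp_all add: m VW pure\<^sub>u_closed)
    have b2: "bilinear_map K (space V) (alg H (?\<nu> \<mu>)) (?S \<mu>) (\<lambda>v a. ?p \<mu> v a w b)" if "w \<in> elts W" "b \<in> coeffs \<mu>" for w b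
      using twc[OF \<mu>] tw[OF \<mu>] that \<mu> by (intro lin) (simp_all add: m VW pure\<^sub>u_closed)
    note sweedler2_bilinear[OF m(1) A2 m(2) A1 S b1 b2]
  }
  note G = this
  have bG: "bilinear_map K (space V) (space W) (?S \<mu>) (\<lambda>v w. ?G \<mu> (\<Delta> (?\<nu> \<mu>) v) (\<Delta>' \<mu> w))" if \<mu>: "\<mu> \<in> carrier \<pi>" for \<mu>
    by (intro bilinear_mapI linear_map_comp[OF \<Delta>'(1)[OF \<mu>] bilinear_mapD(1)[OF G(1)[OF \<mu>] \<Delta>(2)[OF cl[OF \<mu>]]]]
      linear_map_comp[OF \<Delta>(1)[OF cl[OF \<mu>]] bilinear_mapD(2)[OF G(1)[OF \<mu>] \<Delta>'(2)[OF \<mu>]]])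
  note SM = tensor_module[OF VW alg_module]
  have l: "linear_map K (space (rep_tensor V W)) (tensor\<^sub>c (rep_tensor V W) \<mu>) (\<Delta>'' \<mu>)" if \<mu>: "\<mu> \<in> carrier \<pi>" for \<mu>
    using linear_map_cong[OF sweedler\<^sub>u_linear[OF m SM[OF \<mu>] bG[OF \<mu>]] VW, of "\<Delta>'' \<mu>"] by (simp add: D'' \<mu>)
  have e: "body (inv_arrow Rep (c (reg \<mu>))) (pure\<^sub>u K (coef_space \<mu>) (space (rep_tensor V W)) (Coef \<one>\<^bsub>alg H \<mu>\<^esub>) y) =
      coact_ap (rep_tensor V W) (reg \<mu>) (\<Delta>'' \<mu> y) (Coef \<one>\<^bsub>alg H \<mu>\<^esub>)" if \<mu>: "\<mu> \<in> carrier \<pi>" and y: "y \<in> elts (rep_tensor V W)" for \<mu> y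
  proof -
    have X: "is_rep (reg \<mu> :: ('p, 'k, 'h, 'b) rep)" by (rule reg_rep[OF \<mu>])
    note C = Coef_linear[OF \<mu>]
    let ?M = "coef_space \<mu> :: ('k, 'h, 'b) uspace" and ?x = "Coef \<one>\<^bsub>alg H \<mu>\<^esub> :: ('k, 'h, 'b) univ"
    let ?X = "reg \<mu> :: ('p, 'k, 'h, 'b) rep" let ?X' = "rep_conj (deg W) ?X" let ?X'' = "rep_conj (deg V) ?X'"
    have one: "?x \<in> carrier ?M" using \<mu> by (simp add: C(4))
    note X' = rep_conj_closed[OF X d(2)] note X'' = rep_conj_closed[OF X' d(1)]
    note e = e_map[OF D X', simplified] and e' = e_map[OF D' X, simplified]
    note ap = coact_ap[OF m(1) X', simplified] and ap' = coact_ap[OF m(2) X, simplified]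
    have mt: "module K (space (rep_tensor V W))" using VW by simp
    note ap'' = coact_ap[OF mt X, simplified]
    obtain g1 where g1: "inv_arrow Rep (Assoc Rep ?X'' V W) = Arrow (rep_tensor ?X'' (rep_tensor V W)) (rep_tensor (rep_tensor ?X'' V) W) g1"
      "is_rep_map (rep_tensor ?X'' (rep_tensor V W)) (rep_tensor (rep_tensor ?X'' V) W) g1"
      "\<And>u v w. \<lbrakk>u \<in> carrier ?M; v \<in> elts V; w \<in> elts W\<rbrakk> \<Longrightarrow>
        g1 (pure\<^sub>u K ?M (tensor\<^sub>r V W) u (pure\<^sub>r V W v w)) =
        pure\<^sub>u K (tensor\<^sub>u K ?M (space V)) (space W) (pure\<^sub>u K ?M (space V) u v) w"
      using Rep_Assoc_iso[OF X'' V W] by (metis rep_conj_simps(2) reg_simps(2))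
    obtain g2 where g2: "inv_arrow Rep (Assoc Rep V W ?X) = Arrow (rep_tensor V (rep_tensor W ?X)) (rep_tensor (rep_tensor V W) ?X) g2"
      "is_rep_map (rep_tensor V (rep_tensor W ?X)) (rep_tensor (rep_tensor V W) ?X) g2"
      "\<And>u v w. \<lbrakk>u \<in> elts V; v \<in> elts W; w \<in> carrier ?M\<rbrakk> \<Longrightarrow>
        g2 (pure\<^sub>u K (space V) (tensor\<^sub>u K (space W) ?M) u (pure\<^sub>u K (space W) ?M v w)) =
        pure\<^sub>u K (tensor\<^sub>r V W) ?M (pure\<^sub>r V W u v) w"
      using Rep_Assoc_iso[OF V W X] by (metis reg_simps(2))
    note g1l = rep_mapD(3)[OF g1(2), simplified] and g2l = rep_mapD(3)[OF g2(2), simplified]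
    note idV = rep_mapD(3)[OF rep_map_id[OF V]] and idW = rep_mapD(3)[OF rep_map_id[OF W]]
    note MV = tensor\<^sub>u_module[OF C(3) m(1)] and VM = tensor\<^sub>u_module[OF m(1) C(3)] and WM = tensor\<^sub>u_module[OF m(2) C(3)] and MW = tensor\<^sub>u_module[OF C(3) m(2)]
    note R' = tensor\<^sub>u_module[OF VW C(3)]
    note a = assoc_map[OF m(1) C(3) m(2)]
    note t1 = map_tensor[OF MV m(2) VM m(2) e(1) idW] and t2 = map_tensor[OF m(1) MW m(1) WM idV e'(1)]
    let ?t1 = "map_tensor (tensor\<^sub>u K ?M (space V)) (space W) (tensor\<^sub>u K (space V) ?M) (space W) (e_map V \<Delta> ?X') (\<lambda>u\<in>carrier (space W). u)"
    let ?t2 = "map_tensor (space V) (tensor\<^sub>u K ?M (space W)) (space V) (tensor\<^sub>u K (space W) ?M) (\<lambda>u\<in>carrier (space V). u) (e_map W \<Delta>' ?X)"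
    let ?a = "assoc_map (space V) ?M (space W)"
    let ?E = "\<lambda>z. g2 (?t2 (?a (?t1 (g1 z))))"
    note T = linear_map_comp[OF linear_map_comp[OF a(1) t2(1)] g2l]
    note El = linear_map_comp[OF linear_map_comp[OF g1l t1(1)] T]
    have iA: "inv_arrow Rep (snd (to_center A) ?X') = Arrow (rep_tensor ?X'' V) (rep_tensor V ?X') (e_map V \<Delta> ?X')"
      using yd_c_iso_reg[OF A X'] by (simp add: Aeq)
    have iB: "inv_arrow Rep (snd (to_center B) ?X) = Arrow (rep_tensor ?X' W) (rep_tensor W ?X) (e_map W \<Delta>' ?X)"
      using yd_c_iso_reg[OF B X] by (simp add: Beq)
    \<comment> \<open>\<open>?E\<close> is the composite from \<open>center_TenO_inverse\<close> on
      elements; \<open>g1\<close> and \<open>g2\<close> are bodies of inverse associators, known on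
      pure tensors.\<close>
    have body: "body (inv_arrow Rep (c (reg \<mu>))) z = ?E z" if z: "z \<in> carrier (tensor\<^sub>u K ?M (tensor\<^sub>r V W))" for z
      using R.center_TenO_inverse[OF to_center_closed[OF A] to_center_closed[OF B], of ?X] X z
      by (simp add: c_def fAB iA iB g1(1)[simplified] g2(1)[simplified] compose_eq)
    \<comment> \<open>The two coactions are reduced to pure tensors one after the other, first the
      one on \<open>V\<close>, then the one on \<open>W\<close>.\<close>
    have inner: "g2 (?t2 (?a (pure\<^sub>u K (tensor\<^sub>u K (space V) ?M) (space W) (coact_ap V ?X' s ?x) w))) =
        coact_ap (rep_tensor V W) ?X (?G \<mu> s (\<Delta>' \<mu> w)) ?x"
      if s: "s \<in> carrier (tensor\<^sub>c V (?\<nu> \<mu>))" and w: "w \<in> elts W" for s w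
    proof (rule tensor_ext[OF m(1) alg_module[OF cl[OF \<mu>]] R' linear_map_comp[OF linear_map_comp[OF bilinear_mapD(2)[OF ap(1) one] bilinear_mapD(2)[OF pure\<^sub>u_bilinear[OF VM m(2)] w]] T]
          linear_map_comp[OF bilinear_mapD(2)[OF G(1)[OF \<mu>] \<Delta>'(2)[OF \<mu> w]] bilinear_mapD(2)[OF ap''(1) one]] _ s])
      fix v' a' assume v': "v' \<in> elts V" and a': "a' \<in> coeffs (?\<nu> \<mu>)"
      note pv = pure_closed[OF m(1) alg_module[OF cl[OF \<mu>]] v' a']
      \<comment> \<open>The unit after the first coefficient has acted on it; the coefficient of
        \<open>w\<close> then acts on \<open>?y\<close>.\<close>
      let ?y = "Coef (twist H (inv (deg W)) (?\<nu> \<mu>) a') :: ('k, 'h, 'b) univ"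
      have y: "?y \<in> carrier ?M" using twc[OF \<mu> a'] by (simp add: C(4))
      have "g2 (?t2 (?a (pure\<^sub>u K (tensor\<^sub>u K (space V) ?M) (space W) (coact_ap V ?X' (pure\<^sub>c V (?\<nu> \<mu>) v' a') ?x) w))) =
        g2 (pure\<^sub>u K (space V) (tensor\<^sub>u K (space W) ?M) v' (coact_ap W ?X (\<Delta>' \<mu> w) ?y))"
        using \<mu> by (simp add: ap(2) v' a' one twc[OF \<mu>] a(3) y w t2(3) pure\<^sub>u_closed[OF C(3) m(2)] e'(3))
      also have "\<dots> = coact_ap (rep_tensor V W) ?X (?G \<mu> (pure\<^sub>c V (?\<nu> \<mu>) v' a') (\<Delta>' \<mu> w)) ?x"
      proof (rule tensor_ext[OF m(2) alg_module[OF \<mu>] R' linear_map_comp[OF linear_map_comp[OF bilinear_mapD(2)[OF ap'(1) y] bilinear_mapD(1)[OF pure\<^sub>u_bilinear[OF m(1) WM] v']] g2l]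
          linear_map_comp[OF bilinear_mapD(1)[OF G(1)[OF \<mu>] pv] bilinear_mapD(2)[OF ap''(1) one]] _ \<Delta>'(2)[OF \<mu> w]])
        fix w' b assume w': "w' \<in> elts W" and b: "b \<in> coeffs \<mu>"
        then show "g2 (pure\<^sub>u K (space V) (tensor\<^sub>u K (space W) ?M) v' (coact_ap W ?X (pure\<^sub>c W \<mu> w' b) ?y)) =
          coact_ap (rep_tensor V W) ?X (?G \<mu> (pure\<^sub>c V (?\<nu> \<mu>) v' a') (pure\<^sub>c W \<mu> w' b)) ?x"
          using \<mu> by (simp add: ap'(2) ap''(2) y one twc[OF \<mu> a'] v' a' G(2)[OF \<mu>] pure\<^sub>u_closed[OF m] g2(3) C(4))
      qed
      finally show "g2 (?t2 (?a (pure\<^sub>u K (tensor\<^sub>u K (space V) ?M) (space W) (coact_ap V ?X' (pure\<^sub>c V (?\<nu> \<mu>) v' a') ?x) w))) =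
        coact_ap (rep_tensor V W) ?X (?G \<mu> (pure\<^sub>c V (?\<nu> \<mu>) v' a') (\<Delta>' \<mu> w)) ?x" .
    qed
    have yy: "y \<in> carrier (tensor\<^sub>r V W)" using y by simp
    have "?E (pure\<^sub>u K ?M (tensor\<^sub>r V W) ?x y) = coact_ap (rep_tensor V W) ?X (\<Delta>'' \<mu> y) ?x"
    proof (rule tensor\<^sub>u_ext[OF m R' linear_map_comp[OF bilinear_mapD(1)[OF pure\<^sub>u_bilinear[OF C(3) VW] one] El]
          linear_map_comp[OF l[OF \<mu>, simplified] bilinear_mapD(2)[OF ap''(1) one]] _ yy])
      fix v w assume v: "v \<in> elts V" and w: "w \<in> elts W"
      have "?E (pure\<^sub>u K ?M (tensor\<^sub>r V W) ?x (pure\<^sub>r V W v w)) =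
        g2 (?t2 (?a (pure\<^sub>u K (tensor\<^sub>u K (space V) ?M) (space W) (coact_ap V ?X' (\<Delta> (?\<nu> \<mu>) v) ?x) w)))"
        using one v w by (simp add: g1(3) t1(3) pure\<^sub>u_closed[OF C(3) m(1)] e(3))
      also have "\<dots> = coact_ap (rep_tensor V W) ?X (?G \<mu> (\<Delta> (?\<nu> \<mu>) v) (\<Delta>' \<mu> w)) ?x" by (rule inner[OF \<Delta>(2)[OF cl[OF \<mu>] v] w])
      also have "?G \<mu> (\<Delta> (?\<nu> \<mu>) v) (\<Delta>' \<mu> w) = \<Delta>'' \<mu> (pure\<^sub>r V W v w)"
        by (simp add: D'' \<mu> pure\<^sub>u_closed[OF m v w] sweedler\<^sub>u_pure\<^sub>u[OF m SM[OF \<mu>] bG[OF \<mu>] v w])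
      finally show "?E (pure\<^sub>u K ?M (tensor\<^sub>r V W) ?x (pure\<^sub>r V W v w)) =
        coact_ap (rep_tensor V W) ?X (\<Delta>'' \<mu> (pure\<^sub>r V W v w)) ?x" .
    qed
    then show ?thesis using body[OF pure\<^sub>u_closed[OF C(3) VW one yy]] by simp
  qed
  have x: "\<Delta>'' \<in> extensional (carrier \<pi>)" "\<And>\<mu>. \<mu> \<in> carrier \<pi> \<Longrightarrow> \<Delta>'' \<mu> \<in> extensional (elts (rep_tensor V W))"
    by (simp_all add: D'') (simp add: \<Delta>''_def yd_tensor_def Aeq Beq Let_def)
  show "is_yd (yd_tensor A B)" "to_center (yd_tensor A B) = R.center_TenO (to_center A) (to_center B)"
    unfolding yc ce using to_center_eqI[OF Z x l e] by simp_all
qed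

section \<open>Morphisms and the isomorphism of categories\<close>

text \<open>Compatibility with the half braidings, read for the inverses and on pure tensors, says
  that the two sides of colinearity act equally on all elements of all representations. The regular
  representations turn this into equality of the two sides.\<close>

lemma to_center_arr_iff:
  fixes A B :: "('p, 'k, 'h, 'b) yd"
  assumes A: "is_yd A" and B: "is_yd B" and f: "is_rep_map (fst A) (fst B) f"
  shows "Arrow (to_center A) (to_center B) (Arrow (fst A) (fst B) f) \<in> R.center_arr \<longleftrightarrow> is_yd_map A B f"
proof -
  obtain V \<Delta> where Aeq: "A = (V, \<Delta>)" by (cases A)
  obtain W \<Delta>' where Beq: "B = (W, \<Delta>')" by (cases B)
  note Y = A[unfolded Aeq] note D = ydD(1)[OF Y] and V = ydD(7)[OF Y]
  note Y' = B[unfolded Beq] note D' = ydD(1)[OF Y'] and W = ydD(7)[OF Y']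
  note f = f[unfolded Aeq Beq prod.sel]
  note d = repD(1)[OF V] repD(1)[OF W] and m = repD(2)[OF V] repD(2)[OF W] and dW = rep_mapD(1)[OF f] and fl = rep_mapD(3)[OF f]
  note \<Delta> = pre_coactionD(2,3)[OF D] and \<Delta>' = pre_coactionD(2,3)[OF D']
  let ?F = "\<lambda>\<mu>. sweedler (tensor\<^sub>c W \<mu>) (\<lambda>u x. pure\<^sub>c W \<mu> (f u) x)"
  have Fb: "bilinear_map K (space V) (alg H \<mu>) (tensor\<^sub>c W \<mu>) (\<lambda>u x. pure\<^sub>c W \<mu> (f u) x)" if "\<mu> \<in> carrier \<pi>" for \<mu>
    using that by (intro lin fl) (simp_all add: m linear_mapD(1)[OF fl])
  note F = sweedler_linear[OF m(1) alg_module tensor_module[OF m(2) alg_module] Fb]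
  have Fp: "?F \<mu> (pure\<^sub>c V \<mu> u a) = pure\<^sub>c W \<mu> (f u) a"
    if "\<mu> \<in> carrier \<pi>" "u \<in> elts V" "a \<in> coeffs \<mu>" for \<mu> u a
    using sweedler_pure[OF m(1) alg_module tensor_module[OF m(2) alg_module] Fb] that by blast
  \<comment> \<open>The compatibility square at \<open>X\<close>, translated by
    \<open>square_inv\<close> into one for \<open>e_map\<close> and then evaluated on pure
    tensors.\<close>
  have sq: "Comp Rep (TenA Rep (Ident Rep (actO Rep V X)) (Arrow V W f)) (snd (to_center A) X) =
       Comp Rep (snd (to_center B) X) (TenA Rep (Arrow V W f) (Ident Rep X)) \<longleftrightarrow>
     (\<forall>x\<in>carrier (space X). \<forall>v\<in>carrier (space V). coact_ap W X (\<Delta>' (deg X) (f v)) x = coact_ap W X (?F (deg X) (\<Delta> (deg X) v)) x)"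
    (is "?l \<longleftrightarrow> ?r") if X: "is_rep X" for X
  proof -
    note dX = repD(1)[OF X] and mX = repD(2)[OF X]
    note X' = rep_conj_closed[OF X d(1)]
    note e = e_map[OF D X] and e' = e_map[OF D' X] and ap = coact_ap[OF m(1) X] and ap' = coact_ap[OF m(2) X]
    note idX = rep_mapD(3)[OF rep_map_id[OF X]]
    note t1 = map_tensor[OF mX m(1) mX m(2) idX fl] and t2 = map_tensor[OF m(1) mX m(2) mX fl idX]
    let ?t1 = "map_tensor (space X) (space V) (space X) (space W) (\<lambda>u\<in>carrier (space X). u) f"
    let ?t2 = "map_tensor (space V) (space X) (space W) (space X) f (\<lambda>u\<in>carrier (space X). u)"
    let ?q = "TenA Rep (Ident Rep (rep_conj (deg V) X)) (Arrow V W f)" and ?p = "TenA Rep (Arrow V W f) (Ident Rep X)"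
    have i: "snd (to_center A) X \<in> isos Rep (rep_tensor V X) (rep_tensor (rep_conj (deg V) X) V)"
      using yd_c_iso(1)[OF Y X] X by (simp add: to_center_def Aeq)
    have i': "snd (to_center B) X \<in> isos Rep (rep_tensor W X) (rep_tensor (rep_conj (deg V) X) W)"
      using yd_c_iso(1)[OF Y' X] X by (simp add: to_center_def Beq dW)
    have iA: "inv_arrow Rep (snd (to_center A) X) = Arrow (rep_tensor (rep_conj (deg V) X) V) (rep_tensor V X) (e_map V \<Delta> X)"
      using yd_c_iso_reg[OF A X] by (simp add: Aeq)
    have iB: "inv_arrow Rep (snd (to_center B) X) = Arrow (rep_tensor (rep_conj (deg V) X) W) (rep_tensor W X) (e_map W \<Delta>' X)"
      using yd_c_iso_reg[OF B X] by (simp add: Beq dW)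
    have q: "?q \<in> arrows Rep (rep_tensor (rep_conj (deg V) X) V) (rep_tensor (rep_conj (deg V) X) W)"
      using R.TenA_closed[OF R.Ident_closed[of "rep_conj (deg V) X"] arrows_RepI[OF V W f]] X' by simp
    have p: "?p \<in> arrows Rep (rep_tensor V X) (rep_tensor W X)"
      using R.TenA_closed[OF arrows_RepI[OF V W f] R.Ident_closed[of X]] X by simp
    have "?l \<longleftrightarrow> Comp Rep (inv_arrow Rep (snd (to_center B) X)) ?q = Comp Rep ?p (inv_arrow Rep (snd (to_center A) X))"
      using R.square_inv[OF i i' p q] by simp
    also have "\<dots> \<longleftrightarrow> compose (carrier (tensor\<^sub>r X V)) (e_map W \<Delta>' X) ?t1 =
       compose (carrier (tensor\<^sub>r X V)) ?t2 (e_map V \<Delta> X)"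
      by (simp add: iA iB)
    also have "\<dots> \<longleftrightarrow> (\<forall>z\<in>carrier (tensor\<^sub>r X V). e_map W \<Delta>' X (?t1 z) = ?t2 (e_map V \<Delta> X z))"
      by (auto simp: fun_eq_iff compose_def)
    also have "\<dots> \<longleftrightarrow> (\<forall>x\<in>carrier (space X). \<forall>v\<in>carrier (space V). coact_ap W X (\<Delta>' (deg X) (f v)) x = ?t2 (coact_ap V X (\<Delta> (deg X) v) x))"
      (is "?a \<longleftrightarrow> ?b")
    proof -
      have c: "e_map W \<Delta>' X (?t1 (pure\<^sub>r X V x v)) = coact_ap W X (\<Delta>' (deg X) (f v)) x"
        "?t2 (e_map V \<Delta> X (pure\<^sub>r X V x v)) = ?t2 (coact_ap V X (\<Delta> (deg X) v) x)"
        if "x \<in> elts X" "v \<in> elts V" for x v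
        using that by (simp_all add: t1(3) e'(3) e(3) linear_mapD(1)[OF fl])
      show ?thesis
      proof
        assume ?a
        then show ?b using c pure\<^sub>u_closed[OF mX m(1)] by metis
      next
        assume b: ?b
        show ?a
        proof
          fix z assume z: "z \<in> carrier (tensor\<^sub>r X V)"
          show "e_map W \<Delta>' X (?t1 z) = ?t2 (e_map V \<Delta> X z)"
            by (rule tensor\<^sub>u_ext[OF mX m(1) tensor\<^sub>u_module[OF m(2) mX] linear_map_comp[OF t1(1) e'(1)] linear_map_comp[OF e(1) t2(1)] _ z])
              (use b c in simp)
        qed
      qed
    qed
    also have "\<dots> \<longleftrightarrow> ?r"
    proof -
      have "?t2 (coact_ap V X s x) = coact_ap W X (?F (deg X) s) x" if s: "s \<in> carrier (tensor\<^sub>c V (deg X))" and x: "x \<in> elts X" for s x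
        by (rule tensor_ext[OF m(1) alg_module[OF dX] tensor\<^sub>u_module[OF m(2) mX] linear_map_comp[OF bilinear_mapD(2)[OF ap(1) x] t2(1)]
            linear_map_comp[OF F[OF dX dX dX] bilinear_mapD(2)[OF ap'(1) x]] _ s])
          (simp add: ap(2) x t2(3) repD(7)[OF X] Fp dX ap'(2) linear_mapD(1)[OF fl])
      then show ?thesis using \<Delta>(2)[OF dX] by simp
    qed
    finally show ?thesis .
  qed
  have "(Arrow (to_center A) (to_center B) (Arrow V W f) \<in> R.center_arr) \<longleftrightarrow>
     (\<forall>X. is_rep X \<longrightarrow> (\<forall>x\<in>carrier (space X). \<forall>v\<in>carrier (space V). coact_ap W X (\<Delta>' (deg X) (f v)) x = coact_ap W X (?F (deg X) (\<Delta> (deg X) v)) x))"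
    unfolding R.center_arr_iff using sq to_center_closed[OF A] to_center_closed[OF B] V W f
    by (simp add: to_center_def Aeq Beq)
  also have "\<dots> \<longleftrightarrow> (\<forall>\<mu>\<in>carrier \<pi>. \<forall>v\<in>carrier (space V). \<Delta>' \<mu> (f v) = ?F \<mu> (\<Delta> \<mu> v))" (is "?a \<longleftrightarrow> ?b")
  proof
    assume b: ?b
    show ?a using b by (auto simp: repD(1))
  next
    \<comment> \<open>Test at the unit of the regular representation of degree
      \<open>\<mu>\<close>.\<close>
    assume a: ?a
    show ?b
    proof (intro ballI)
      fix \<mu> v assume \<mu>: "\<mu> \<in> carrier \<pi>" and v: "v \<in> elts V"
      note one = alg_closed(4)[OF \<mu>]
      have "coact_ap W (reg \<mu>) (\<Delta>' \<mu> (f v)) (Coef \<one>\<^bsub>alg H \<mu>\<^esub>) = coact_ap W (reg \<mu>) (?F \<mu> (\<Delta> \<mu> v)) (Coef \<one>\<^bsub>alg H \<mu>\<^esub>)"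
        using a[rule_format, OF reg_rep[OF \<mu>], of "Coef \<one>\<^bsub>alg H \<mu>\<^esub>" v] v one by (simp add: Coef_linear(4)[OF \<mu>])
      from arg_cong[where f = "coef_ten W \<mu>", OF this] show "\<Delta>' \<mu> (f v) = ?F \<mu> (\<Delta> \<mu> v)"
        unfolding coef_ten(3)[OF W \<mu> \<Delta>'(2)[OF \<mu> linear_mapD(1)[OF fl v]]] coef_ten(3)[OF W \<mu> linear_mapD(1)[OF F[OF \<mu> \<mu> \<mu>] \<Delta>(2)[OF \<mu> v]]] .
    qed
  qed
  finally show ?thesis using f by (simp add: is_yd_map_def Aeq Beq)
qed

definition to_center_arrow :: "('p, 'k, 'h, 'b) yd_arrow \<Rightarrow>
    (('p, 'k, 'h, 'b) rep \<times> (('p, 'k, 'h, 'b) rep \<Rightarrow> ('p, 'k, 'h, 'b) rep_arrow), ('p, 'k, 'h, 'b) rep_arrow) arrow" where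
  "to_center_arrow f = Arrow (to_center (source f)) (to_center (target f)) (Arrow (fst (source f)) (fst (target f)) (body f))"

lemma to_center_arrow_simps [simp]:
  "source (to_center_arrow f) = to_center (source f)" "target (to_center_arrow f) = to_center (target f)"
  "body (to_center_arrow f) = Arrow (fst (source f)) (fst (target f)) (body f)"
  by (simp_all add: to_center_arrow_def)

lemma fst_to_center [simp]: "fst (to_center A) = fst A"
  by (simp add: to_center_def)

lemma fst_from_center [simp]: "fst (from_center Z) = fst Z"
  by (simp add: from_center_def)

lemma is_yd_rep: "is_yd A \<Longrightarrow> is_rep (fst A)"
  by (cases A) (simp add: ydD(7))

lemma fst_yd [simp]:
  "fst (yd_tensor A B) = rep_tensor (fst A) (fst B)" "fst yd_unit = rep_unit" "fst (yd_conj \<beta> A) = rep_conj \<beta> (fst A)"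
  by (simp_all add: yd_tensor_def yd_unit_def yd_conj_def Let_def case_prod_beta)

lemma YD_simps [simp]:
  "Obj YD = {V. is_yd V}"
  "Arr YD = {Arrow V W f | V W f. is_yd V \<and> is_yd W \<and> is_yd_map V W f}"
  "Dom YD = source" "Cod YD = target"
  "Ident YD A = Arrow A A (\<lambda>v\<in>carrier (space (fst A)). v)"
  "Comp YD g f = Arrow (source f) (target g) (compose (elts (fst (source f))) (body g) (body f))"
  "TenO YD = yd_tensor"
  "TenA YD f g = Arrow (yd_tensor (source f) (source g)) (yd_tensor (target f) (target g))
     (map_tensor (space (fst (source f))) (space (fst (source g))) (space (fst (target f))) (space (fst (target g))) (body f) (body g))"
  "Unit YD = yd_unit"
  "Assoc YD A B A' = Arrow (yd_tensor (yd_tensor A B) A') (yd_tensor A (yd_tensor B A'))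
     (assoc_map (space (fst A)) (space (fst B)) (space (fst A')))"
  "LUnit YD A = Arrow (yd_tensor yd_unit A) A (lunit_map (space (fst A)))"
  "RUnit YD A = Arrow (yd_tensor A yd_unit) A (runit_map (space (fst A)))"
  "Grade YD A = deg (fst A)" "ConjO YD = yd_conj"
  "ConjA YD \<beta> f = Arrow (yd_conj \<beta> (source f)) (yd_conj \<beta> (target f)) (body f)"
  "Braid YD A B = Arrow (yd_tensor A B) (yd_tensor (yd_conj (deg (fst A)) B) A) (yd_braid_map A B)"
  by (simp_all add: YD_def)

text \<open>\<open>c_map\<close> was defined by the braiding formula, so the half braiding of
  \<open>A\<close> at the representation underlying \<open>B\<close> is already the braiding of
  \<open>YD\<close>.\<close>

lemma Braid_to_center:
  fixes A B :: "('p, 'k, 'h, 'b) yd"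
  assumes "is_yd A" "is_yd B"
  shows "snd (to_center A) (fst B) = Arrow (rep_tensor (fst A) (fst B)) (rep_tensor (rep_conj (deg (fst A)) (fst B)) (fst A)) (yd_braid_map A B)"
  using is_yd_rep[OF assms(2)] by (simp add: to_center_def c_map_def yd_braid_map_def case_prod_beta)

text \<open>Arrows are reflected even when the body is not known in advance to be a morphism of
  representations; this is the assumption \<open>Arr_iff\<close> of the transport.\<close>

lemma to_center_arrow_iff:
  fixes f :: "('p, 'k, 'h, 'b) yd_arrow"
  assumes "is_yd (source f)" "is_yd (target f)"
  shows "to_center_arrow f \<in> R.center_arr \<longleftrightarrow> f \<in> Arr YD"
proof -
  obtain A B b where f: "f = Arrow A B b" by (cases f)
  have AB: "is_yd A" "is_yd B" using assms f by simp_all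
  have 1: "is_rep_map (fst A) (fst B) b" if "to_center_arrow f \<in> R.center_arr"
    using R.center_arr_cases(3)[OF that] f by simp
  have 2: "is_rep_map (fst A) (fst B) b" if "is_yd_map A B b" using that by (simp add: is_yd_map_def case_prod_beta)
  have 3: "f \<in> Arr YD \<longleftrightarrow> is_yd_map A B b" using AB f by (simp del: split_paired_Ex)
  have 4: "to_center_arrow f = Arrow (to_center A) (to_center B) (Arrow (fst A) (fst B) b)" by (simp add: f to_center_arrow_def)
  show ?thesis unfolding 3 using to_center_arr_iff[OF AB] 1 2 unfolding 4 by blast
qed

lemma to_center_bij: "bij_betw to_center {A :: ('p, 'k, 'h, 'b) yd. is_yd A} R.center_obj"
  by (rule bij_betw_byWitness[where f' = from_center])
    (auto simp: to_center_from_center from_center_to_center to_center_closed from_center_yd)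

text \<open>Source and target are recovered by \<open>from_center\<close>. An arrow of the center is
  the image of the arrow with the same underlying map between the recovered modules, which belongs
  to \<open>YD\<close> by \<open>to_center_arrow_iff\<close>.\<close>

lemma to_center_arrow_bij:
  "bij_betw to_center_arrow (Arr YD :: ('p, 'k, 'h, 'b) yd_arrow set) R.center_arr"
proof (rule bij_betwI')
  fix f g :: "('p, 'k, 'h, 'b) yd_arrow" assume "f \<in> Arr YD" "g \<in> Arr YD"
  then have "is_yd (source f)" "is_yd (target f)" "is_yd (source g)" "is_yd (target g)" by auto
  then show "to_center_arrow f = to_center_arrow g \<longleftrightarrow> f = g"
    using from_center_to_center unfolding to_center_arrow_def arrow.inject by (metis arrow.expand)
next
  fix f :: "('p, 'k, 'h, 'b) yd_arrow" assume "f \<in> Arr YD"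
  then show "to_center_arrow f \<in> R.center_arr" by (subst to_center_arrow_iff) auto
next
  fix h assume h: "h \<in> R.center_arr"
  note s = R.center_arr_cases(1,2)[OF h]
  obtain b where b: "body h = Arrow (fst (source h)) (fst (target h)) b"
    using R.center_arr_cases(3-5)[OF h] by auto
  let ?f = "Arrow (from_center (source h)) (from_center (target h)) b"
  have "to_center_arrow ?f = h"
    using b by (intro arrow.expand) (simp add: to_center_from_center[OF s(1)] to_center_from_center[OF s(2)])
  moreover have "?f \<in> Arr YD"
    using h to_center_arrow_iff[of ?f] from_center_yd[OF s(1)] from_center_yd[OF s(2)] calculation by simp
  ultimately show "\<exists>f\<in>Arr YD. h = to_center_arrow f" by metis
qed

text \<open>Constraints and tensor products of arrows of \<open>YD\<close> have the same bodies as
  in \<open>Rep\<close>. What remains are the equations of objects from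
  \<open>to_center_tensor\<close>, \<open>to_center_unit\<close> and \<open>to_center_conj\<close>,
  and the identification of the braiding.\<close>

lemma YD_transport:
  "structure_transport \<pi> R.center (YD :: ('p, ('p, 'k, 'h, 'b) yd, ('p, 'k, 'h, 'b) yd_arrow) braided_T_category) to_center to_center_arrow"
proof (rule structure_transport.intro[OF R.center_braided_T_category], unfold_locales, goal_cases)
  case 1 then show ?case using to_center_bij by simp
next
  case 2 then show ?case using to_center_arrow_bij by simp
next
  case (7 f) then show ?case using to_center_arrow_iff[of f] by simp
qed (auto simp del: split_paired_Ex simp: to_center_tensor to_center_unit to_center_conj to_center_arrow_def actO_def Braid_to_center repD(1) is_yd_rep)

end

theorem mainTheorem2:
  fixes \<pi> :: "'p monoid" and K :: "'k ring" and H :: "('p, 'k, 'h) T_coalgebra"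
  assumes "group \<pi>" and "field K" and "T_coalgebra \<pi> K H"
  shows "let RepH = T_coalgebra.Rep \<pi> K H ::
               ('p, ('p, 'k, 'h, 'b) rep, ('p, 'k, 'h, 'b) rep_arrow) T_category;
             Z = T_category.center \<pi> RepH;
             YDH = T_coalgebra.YD \<pi> K H ::
               ('p, ('p, 'k, 'h, 'b) yd, ('p, 'k, 'h, 'b) yd_arrow) braided_T_category
         in T_category \<pi> RepH \<and> braided_T_category \<pi> Z \<and> braided_T_category \<pi> YDH \<and>
            (\<exists>Fo Fa. category_isomorphism YDH Z Fo Fa \<and> transported_structure \<pi> YDH Z Fo Fa)"
proof -
  note R = T_coalgebra.Rep_T_category[OF assms(3)]
  note T = T_coalgebra.YD_transport[OF assms(3)]
  show ?thesis
    unfolding Let_def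
    using R T_category.center_braided_T_category[OF R] structure_transport.braided_T_category[OF T]
      structure_transport.category_isomorphism[OF T] structure_transport.transported_structure[OF T] by blast
qed

end
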